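(* Let $0<p,q\le\infty$ and let $\mu\in C^2(\mathbb{R}^n)$ be real-valued such that, for some $s>0$, $\epsilon>0$ and all $|\gamma|=2$: $\langle\xi\rangle^{-s}\partial^\gamma\mu\in W^{\infty,1}$ if $p\ge1$, and $\langle\xi\rangle^{-s}\partial^\gamma\mu\in W^{\infty,1}_{n(1/\dot p-1)+\epsilon}$ if $p<1$. Then $e^{i\mu(D)}:W^{p,q}_\delta\to W^{p,q}$ is bounded for every $\delta\ge sn|1/p-1/2|+n|1/p-1/q|$, with strict inequality required when $p\ne q$.
   Context: $\hat f(\xi)=\int f(x)e^{-2\pi i x\cdot\xi}dx$; $\langle x\rangle=(1+|x|^2)^{1/2}$. For a fixed nonzero Schwartz window $\phi$, $V_\phi f(x,\xi)=\int f(y)\overline{\phi(y-x)}e^{-2\pi i y\cdot\xi}dy$. Wiener amalgam space: $\|f\|_{W^{p,q}_s}=\big\|\,\|V_\phi f(x,\xi)\langle\xi\rangle^s\|_{L^q_\xi}\big\|_{L^p_x}$, $W^{p,q}=W^{p,q}_0$. $\dot p=\min\{1,p\}$. $e^{i\mu(D)}f=\mathcal F^{-1}(e^{i\mu}\hat f)$; boundedness means $\|e^{i\mu(D)}f\|_{W^{p,q}}\le C\|f\|_{W^{p,q}_\delta}$ for Schwartz $f$. *)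

theory Defs
  imports "HOL-Analysis.Analysis" "HOL-Probability.Essential_Supremum"
begin

definition jb :: "real^'n \<Rightarrow> real" where
  "jb x = sqrt (1 + (norm x)\<^sup>2)"

definition pd :: "'n::finite \<Rightarrow> (real^'n \<Rightarrow> 'b::real_normed_vector) \<Rightarrow> real^'n \<Rightarrow> 'b" where
  "pd i f x = vector_derivative (\<lambda>t. f (x + t *\<^sub>R axis i 1)) (at 0)"

definition has_pd :: "'n::finite \<Rightarrow> (real^'n \<Rightarrow> 'b::real_normed_vector) \<Rightarrow> bool" where
  "has_pd i f \<longleftrightarrow> (\<forall>x. (\<lambda>t. f (x + t *\<^sub>R axis i 1)) differentiable (at 0))"

primrec dpart :: "'n::finite list \<Rightarrow> (real^'n \<Rightarrow> 'b::real_normed_vector) \<Rightarrow> real^'n \<Rightarrow> 'b" where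
  "dpart [] f = f"
| "dpart (i # is) f = pd i (dpart is f)"

definition schwartz :: "(real^'n::finite \<Rightarrow> complex) \<Rightarrow> bool" where
  "schwartz f \<longleftrightarrow>
     (\<forall>is. continuous_on UNIV (dpart is f)) \<and>
     (\<forall>is i. has_pd i (dpart is f)) \<and>
     (\<forall>is (k::nat). bounded (range (\<lambda>x. (1 + norm x) ^ k *\<^sub>R dpart is f x)))"

definition C2 :: "(real^'n::finite \<Rightarrow> real) \<Rightarrow> bool" where
  "C2 \<mu> \<longleftrightarrow> continuous_on UNIV \<mu> \<and>
     (\<forall>i. has_pd i \<mu> \<and> continuous_on UNIV (pd i \<mu>)) \<and>
     (\<forall>i j. has_pd j (pd i \<mu>) \<and> continuous_on UNIV (pd j (pd i \<mu>)))"

definition fourier :: "(real^'n::finite \<Rightarrow> complex) \<Rightarrow> real^'n \<Rightarrow> complex" where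
  "fourier f \<xi> = (LINT x|lborel. f x * cis (- 2 * pi * (x \<bullet> \<xi>)))"

definition ifourier :: "(real^'n::finite \<Rightarrow> complex) \<Rightarrow> real^'n \<Rightarrow> complex" where
  "ifourier g x = (LINT \<xi>|lborel. g \<xi> * cis (2 * pi * (x \<bullet> \<xi>)))"

definition fmult :: "(real^'n::finite \<Rightarrow> real) \<Rightarrow> (real^'n \<Rightarrow> complex) \<Rightarrow> real^'n \<Rightarrow> complex" where
  "fmult \<mu> f = ifourier (\<lambda>\<xi>. cis (\<mu> \<xi>) * fourier f \<xi>)"

definition stft :: "(real^'n::finite \<Rightarrow> complex) \<Rightarrow> (real^'n \<Rightarrow> complex) \<Rightarrow> real^'n \<Rightarrow> real^'n \<Rightarrow> complex" where
  "stft \<phi> f x \<xi> = (LINT y|lborel. f y * cnj (\<phi> (y - x)) * cis (- 2 * pi * (y \<bullet> \<xi>)))"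

text \<open>Power on ennreal with a positive real exponent.\<close>
definition enn_pow :: "ennreal \<Rightarrow> real \<Rightarrow> ennreal" where
  "enn_pow a r = (if a = \<infinity> then \<infinity> else ennreal (enn2real a powr r))"

definition Lpnorm :: "ennreal \<Rightarrow> (real^'n::finite \<Rightarrow> ennreal) \<Rightarrow> ennreal" where
  "Lpnorm p h = (if p = \<infinity> then esssup lborel h
     else enn_pow (\<integral>\<^sup>+ x. enn_pow (h x) (enn2real p) \<partial>lborel) (1 / enn2real p))"

definition Wnorm :: "(real^'n::finite \<Rightarrow> complex) \<Rightarrow> ennreal \<Rightarrow> ennreal \<Rightarrow> real \<Rightarrow> (real^'n \<Rightarrow> complex) \<Rightarrow> ennreal" where
  "Wnorm \<phi> p q s f = Lpnorm p (\<lambda>x. Lpnorm q (\<lambda>\<xi>. ennreal (norm (stft \<phi> f x \<xi>) * jb \<xi> powr s)))"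

text \<open>Membership in W^{p,q}_s for a (not necessarily Schwartz) function: the STFT integrals
  exist and the amalgam quasi-norm is finite.\<close>
definition inW :: "(real^'n::finite \<Rightarrow> complex) \<Rightarrow> ennreal \<Rightarrow> ennreal \<Rightarrow> real \<Rightarrow> (real^'n \<Rightarrow> complex) \<Rightarrow> bool" where
  "inW \<phi> p q s g \<longleftrightarrow> (\<forall>x. integrable lborel (\<lambda>y. g y * cnj (\<phi> (y - x)))) \<and> Wnorm \<phi> p q s g < \<infinity>"

definition recip :: "ennreal \<Rightarrow> real" where
  "recip p = (if p = \<infinity> then 0 else 1 / enn2real p)"

end

theory Submission
  imports Defs "HOL-Probability.Probability"
begin

text \<open>Let \<open>u\<close> and \<open>\<Phi>\<close> be the Fourier transforms of \<open>f\<close> and of the window. Up to a unimodular factor,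
 \<open>V f (\<cdot>, \<xi>)\<close> is the slice \<open>F\<inverse>(u cnj \<Phi>(\<cdot> - \<xi>))\<close>, and the slices of \<open>e^(i\<mu>(D)) f\<close> are averages over \<open>\<xi>'\<close> of
 convolutions of slices of \<open>f\<close> with the kernels \<open>F\<inverse>(e^(i\<mu>) \<Phi>(\<cdot> - \<xi>') cnj \<Phi>(\<cdot> - \<xi>))\<close>, which decay rapidly in
 \<open>\<xi>' - \<xi>\<close>. The Hessian of \<open>\<mu>\<close> near \<open>\<xi>\<close> has size \<open>jb \<xi> powr s\<close>, so at scale \<open>jb \<xi> powr (- s / 2)\<close> the phase is
 affine up to a harmless factor, given by an exponential series. A unit cell consists of \<open>jb \<xi> powr (s n / 2)\<close>
 such pieces, each with a kernel of bounded mass within distance \<open>jb \<xi> powr s\<close> of \<open>- \<nabla>\<mu>(\<xi>) / 2\<pi>\<close>. Hence the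
 kernel has \<open>L\<^sup>1\<close> norm \<open>O(jb \<xi> powr (s n / 2))\<close> and a bounded symbol, and interpolation yields the growth
 \<open>s n |1/p - 1/2|\<close> for \<open>p \<ge> 1\<close>. For \<open>p < 1\<close>, slices vary slowly enough to be treated as constant at unit
 scale, and Hoelder's inequality over the region carrying the kernel replaces interpolation. Hoelder's
 inequality in \<open>\<xi>\<close> costs more than \<open>n |1/p - 1/q|\<close> derivatives and reduces \<open>q\<close> to \<open>p\<close> on one side of the
 estimate; on the other side slow variation gives the embedding between the amalgam spaces for free.\<close>

text \<open>Two derivatives of \<mu> are too few to make a kernel decay through integration by
  parts. The substitute for smoothness is the weighted norm \<open>NW\<close> of an inverse Fourier
  transform: it is submultiplicative and does not grow when a function is zoomed in on. So the
  Taylor remainder at scale \<open>h\<close> has norm at most \<open>h ^ 2\<close> times that of the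
  Hessian, and its exponential is controlled by the norm alone. Affine phases only translate
  kernels, which is why every kernel estimate carries a centre \<open>- vel \<xi>\<close> and a
  rate.

  For \<open>p \<ge> 1\<close> the growth arises as the \<open>\<bar>p - 2\<bar>\<close>-th power of
  a kernel mass of order \<open>s n / 2\<close>. For \<open>p < 1\<close> it arises as
  \<open>s n (1 - p) + p s n / 2\<close>: the first term is Hoelder's inequality over a region of
  volume of order \<open>s n\<close>, the second the mass. Both equal
  \<open>s n p \<bar>1 / p - 1 / 2\<bar>\<close>. Confining the kernel to that region takes a weight
  of order above \<open>n (1 / p - 1)\<close>, which is where the order in the hypothesis comes
  from.

  The integrations in \<open>x\<close> and \<xi> commute only for \<open>q = p\<close>. That case is
  therefore the base, and the strict inequality for \<delta> otherwise is the integrability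
  condition in Hoelder's inequality.\<close>

abbreviation (input) L1 :: "('a::euclidean_space => 'b::{banach,second_countable_topology}) => bool" where
 "L1 f \<equiv> integrable lborel f"

abbreviation (input) Bm :: "('a::topological_space => 'b::topological_space) set" where
 "Bm \<equiv> borel_measurable borel"

abbreviation (input) Bm2 :: "('a::topological_space \<times> 'b::topological_space => 'c::topological_space) set" where
 "Bm2 \<equiv> borel_measurable (borel \<Otimes>\<^sub>M borel)"

abbreviation (input) nni :: "('a::euclidean_space => ennreal) => ennreal" (binder "NNI " 10) where
 "nni f \<equiv> nn_integral lborel f"

abbreviation (input) cor :: "real => complex" where "cor \<equiv> of_real"

abbreviation (input) modulated :: "('a => real) => ('a => complex) => 'a => complex" where
 "modulated m u \<equiv> (\<lambda>x. cis (m x) * u x)"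

abbreviation (input) enorm :: "'a::real_normed_vector => ennreal" where
 "enorm z \<equiv> ennreal (norm z)"

section \<open>Polynomial weights\<close>

lemma nn_integral_lborel_affine:
 fixes f :: "'a::euclidean_space => ennreal"
 assumes [measurable]: "f \<in> Bm" and c: "c \<noteq> 0"
 shows "(NNI x. f x) = ennreal (\<bar>c\<bar> ^ DIM('a)) * (NNI x. f (t + c *\<^sub>R x))"
 by (subst lborel_affine[OF c, of t])
   (simp add: nn_integral_density nn_integral_distr nn_integral_cmult)

lemma nn_integral_lborel_translate:
 fixes f :: "'a::euclidean_space => ennreal"
 assumes [measurable]: "f \<in> Bm"
 shows "(NNI x. f (x + t)) = (NNI x. f x)"
  and "(NNI x. f (x - t)) = (NNI x. f x)"
  and "(NNI x. f (t - x)) = (NNI x. f x)"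
  and "(NNI x. f (- x)) = (NNI x. f x)"
proof -
 show "(NNI x. f (x + t)) = (NNI x. f x)"
  using nn_integral_lborel_affine[OF assms, of 1 t] by (simp add: add.commute)
 show "(NNI x. f (x - t)) = (NNI x. f x)"
  using nn_integral_lborel_affine[OF assms, of 1 "-t"] by simp
 show "(NNI x. f (t - x)) = (NNI x. f x)"
  using nn_integral_lborel_affine[OF assms, of "-1" t] by simp
 show "(NNI x. f (- x)) = (NNI x. f x)"
  using nn_integral_lborel_affine[OF assms, of "-1" 0] by simp
qed

lemma integrable_lborel_affine:
 fixes f :: "'a::euclidean_space => 'b::{banach,second_countable_topology}"
 assumes f: "L1 f" and c: "c \<noteq> 0"
 shows "L1 (\<lambda>x. f (t + c *\<^sub>R x))"
proof -
 have [measurable]: "f \<in> Bm" using f by auto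
 have "(NNI x. norm (f x)) < \<infinity>" using f by (simp add: integrable_iff_bounded)
 then have "(NNI x. norm (f (t + c *\<^sub>R x))) < \<infinity>"
  using nn_integral_lborel_affine[of "\<lambda>x. enorm (f x)" c t] c
  by (auto simp: ennreal_mult_less_top)
 then show ?thesis by (simp add: integrable_iff_bounded)
qed

text \<open>An affine substitution preserves non-integrability, and then both sides are the default
  value 0; later substitutions thus carry no side condition.\<close>

lemma integral_lborel_affine:
 fixes f :: "'a::euclidean_space => 'b::{banach,second_countable_topology}"
 assumes c: "c \<noteq> 0"
 shows "(\<integral>x. f x \<partial>lborel) = \<bar>c\<bar> ^ DIM('a) *\<^sub>R (\<integral>x. f (t + c *\<^sub>R x) \<partial>lborel)"
proof (cases "L1 f")
 case True
 then have [measurable]: "f \<in> Bm" by auto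
 show ?thesis using c True integrable_lborel_affine[OF True c]
  by (subst lborel_affine[OF c, of t]) (simp add: integral_density integral_distr)
next
 case False
 have "\<not> L1 (\<lambda>x. f (t + c *\<^sub>R x))"
 proof
  assume "L1 (\<lambda>x. f (t + c *\<^sub>R x))"
  from integrable_lborel_affine[OF this, of "1/c" "- (1/c) *\<^sub>R t"] c False
  show False by (simp add: algebra_simps)
 qed
 with False show ?thesis by (simp add: not_integrable_integral_eq)
qed

lemma integral_lborel_translate:
 fixes f :: "'a::euclidean_space => 'b::{banach,second_countable_topology}"
 shows "(\<integral>x. f (x + t) \<partial>lborel) = (\<integral>x. f x \<partial>lborel)"
  and "(\<integral>x. f (x - t) \<partial>lborel) = (\<integral>x. f x \<partial>lborel)"
  and "(\<integral>x. f (t - x) \<partial>lborel) = (\<integral>x. f x \<partial>lborel)"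
  and "(\<integral>x. f (- x) \<partial>lborel) = (\<integral>x. f x \<partial>lborel)"
 using integral_lborel_affine[of 1 f t] integral_lborel_affine[of 1 f "-t"]
  integral_lborel_affine[of "-1" f t] integral_lborel_affine[of "-1" f 0]
 by (simp_all add: add.commute)

lemma integrable_lborel_translate:
 fixes f :: "'a::euclidean_space => 'b::{banach,second_countable_topology}"
 assumes "L1 f"
 shows "L1 (\<lambda>x. f (x + t))" "L1 (\<lambda>x. f (x - t))"
  "L1 (\<lambda>x. f (t - x))" "L1 (\<lambda>x. f (- x))"
 using integrable_lborel_affine[OF assms, of 1 t] integrable_lborel_affine[OF assms, of 1 "-t"]
  integrable_lborel_affine[OF assms, of "-1" t] integrable_lborel_affine[OF assms, of "-1" 0]
 by (simp_all add: add.commute)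

text \<open>Comparable to a power of \<open>jb\<close>, but submultiplicative with constant one for
  \<open>a \<ge> 0\<close> (\<open>wt_add_le\<close>). Weighted norms of products and of all powers
  therefore pick up no constants.\<close>

definition wt :: "real => 'a::real_normed_vector => real" where
 "wt a x = (1 + norm x) powr a"

abbreviation (input) ewt :: "real => 'a::real_normed_vector => ennreal" where
 "ewt a x \<equiv> ennreal (wt a x)"

lemma wt_pos [simp]: "0 < wt a x" and wt_nonneg [simp]: "0 \<le> wt a x" and wt_neq0 [simp]: "wt a x \<noteq> 0"
proof -
 have "1 + norm x > 0" by (simp add: add_pos_nonneg)
 then have "1 + norm x \<noteq> 0" by linarith
 then have "0 < wt a x" unfolding wt_def by (metis powr_gt_zero)
 then show "0 < wt a x" "0 \<le> wt a x" "wt a x \<noteq> 0" by simp_all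
qed

lemma wt_mult: "wt a x * wt b x = wt (a + b) x"
 by (simp add: wt_def powr_add)

lemma wt_zero_exp [simp]: "wt 0 x = 1"
proof -
 have "1 + norm x \<noteq> 0" using norm_ge_zero[of x] by linarith
 then show ?thesis by (simp add: wt_def)
qed

lemma wt_at_0 [simp]: "wt a 0 = 1" by (simp add: wt_def)

lemma wt_minus_arg [simp]: "wt a (- x) = wt a x" by (simp add: wt_def)

lemma wt_commute: "wt a (x - y) = wt a (y - x)" by (simp add: wt_def norm_minus_commute)

lemma wt_powr: "wt a x powr b = wt (a * b) x" by (simp add: wt_def powr_powr)

lemma wt_uminus_exp: "wt (- a) x = inverse (wt a x)" by (simp add: wt_def powr_minus)

lemma wt_mono: "a \<le> b ==> wt a x \<le> wt b x"
 unfolding wt_def by (rule powr_mono) auto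

lemma wt_ge_1: "0 \<le> a ==> 1 \<le> wt a x"
 using wt_mono[of 0 a x] by simp

lemma wt_le_1: "a \<le> 0 ==> wt a x \<le> 1"
 using wt_mono[of a 0 x] by simp

lemma wt_le_norm: "norm x \<le> norm y ==> 0 \<le> a ==> wt a x \<le> wt a y"
 unfolding wt_def by (rule powr_mono2) auto

lemma wt_add_le: "0 \<le> a ==> wt a (x + y) \<le> wt a x * wt a y"
proof -
 assume a: "0 \<le> a"
 have "1 + norm (x + y) \<le> (1 + norm x) * (1 + norm y)"
  using norm_triangle_ineq[of x y] mult_nonneg_nonneg[OF norm_ge_zero[of x] norm_ge_zero[of y]]
  by (simp only: algebra_simps mult_1_left mult_1_right)
 then have "(1 + norm (x + y)) powr a \<le> ((1 + norm x) * (1 + norm y)) powr a"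
  using a by (intro powr_mono2) auto
 then show ?thesis by (simp add: wt_def powr_mult)
qed

text \<open>Peetre's inequality; for negative \<open>a\<close> it is the submultiplicative bound of
  order \<open>- a\<close> with the roles of \<open>x\<close> and \<open>y\<close>
  exchanged.\<close>

lemma wt_peetre: "wt a x \<le> wt a y * wt \<bar>a\<bar> (x - y)"
proof (cases "0 \<le> a")
 case True
 then show ?thesis using wt_add_le[of a y "x - y"] by simp
next
 case False
 then have "wt (-a) y \<le> wt (-a) x * wt (-a) (x - y)"
  using wt_add_le[of "-a" x "y - x"] by (simp add: wt_commute)
 then show ?thesis using False by (simp add: wt_uminus_exp field_simps)
qed

lemma wt_continuous [continuous_intros]:
 "continuous_on S f ==> continuous_on S (\<lambda>x. wt a (f x))"
proof -
 assume f: "continuous_on S f"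
 have "1 + norm (f x) \<noteq> 0" for x using norm_ge_zero[of "f x"] by linarith
 then show ?thesis unfolding wt_def using f by (intro continuous_intros) auto
qed

lemma wt_measurable [measurable]:
 fixes f :: "_ => 'a::euclidean_space"
 assumes "f \<in> borel_measurable M" shows "(\<lambda>x. wt a (f x)) \<in> borel_measurable M"
 using assms unfolding wt_def by measurable

text \<open>Summation over the shells \<open>2 ^ k \<le> 1 + norm x < 2 ^ (k + 1)\<close>.\<close>
lemma wt_nn_integral_finite:
 assumes l: "real DIM('a) < l"
 shows "(NNI (x::'a::euclidean_space). ewt (- l) x) < \<infinity>"
proof -
 let ?n = "DIM('a)"
 define c where "c = unit_ball_vol (real ?n)"
 have c0: "0 \<le> c" unfolding c_def by (simp add: unit_ball_vol_def)
 have l0: "0 < l" using l by linarith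
 define f where "f k (x::'a) = ennreal (2 powr (- l * real k)) * indicator (ball 0 (2 ^ Suc k)) x" for k x
 have le: "ewt (- l) x \<le> (\<Sum>k. f k x)" for x :: 'a
 proof -
  obtain k where k: "2 ^ k \<le> 1 + norm x" "1 + norm x < 2 ^ Suc k"
  proof -
   define m where "m = (LEAST m. 1 + norm x < 2 ^ m)"
   have m: "1 + norm x < 2 ^ m"
    unfolding m_def using real_arch_pow[of 2 "1 + norm x"] by (auto intro: LeastI)
   have "m \<noteq> 0" using m by (cases m) auto
   then obtain k where k: "m = Suc k" by (cases m) auto
   have "\<not> 1 + norm x < 2 ^ k" using not_less_Least[of k "\<lambda>m. 1 + norm x < 2 ^ m"] k by (simp add: m_def)
   then have "2 ^ k \<le> 1 + norm x" by simp
   then show ?thesis using that m k by blast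
  qed
  have "(2 powr real k) powr l \<le> (1 + norm x) powr l"
   using k(1) l0 by (intro powr_mono2) (auto simp: powr_realpow)
  then have "(1 + norm x) powr (- l) \<le> (2 powr real k) powr (- l)"
   using powr_gt_zero[of "2 powr real k" l] by (simp add: powr_minus le_imp_inverse_le)
  then have "wt (- l) x \<le> 2 powr (- l * real k)"
   by (simp add: wt_def powr_powr mult.commute)
  moreover have "x \<in> ball 0 (2 ^ Suc k)" using k(2) by auto
  ultimately have "ewt (- l) x \<le> f k x"
   by (simp add: f_def ennreal_leI)
  also have "\<dots> \<le> (\<Sum>k. f k x)"
   using sum_le_suminf[of "\<lambda>k. f k x" "{k}"] by auto
  finally show ?thesis .
 qed
 have [measurable]: "f k \<in> Bm" for k unfolding f_def by (intro borel_measurable_times_ennreal borel_measurable_const borel_measurable_indicator) simp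
 \<comment> \<open>The volume of a ball of radius \<open>2 ^ Suc k\<close> against the weight on the
   shell gives a geometric series of ratio \<open>2 powr (n - l)\<close>, which is where
   \<open>n < l\<close> enters.\<close>
 have fk: "(NNI x. f k x) = ennreal (c * 2 ^ ?n * (2 powr (real ?n - l)) ^ k)" for k
 proof -
  have "(NNI x. f k x) = ennreal (2 powr (- l * real k)) * ennreal (c * (2 ^ Suc k) ^ ?n)"
   unfolding f_def by (subst nn_integral_cmult_indicator) (auto simp: emeasure_ball c_def)
  also have "\<dots> = ennreal (2 powr (- l * real k) * (c * (2 ^ Suc k) ^ ?n))"
   using c0 by (simp add: ennreal_mult)
  also have "2 powr (- l * real k) * (c * (2 ^ Suc k) ^ ?n) = c * 2 ^ ?n * (2 powr (real ?n - l)) ^ k"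
  proof -
   define N where "N = ?n"
   define r where "r = (2::real) powr (- l)"
   have p: "2 powr (- l * real k) = r ^ k"
    unfolding r_def by (subst powr_realpow[symmetric]) (simp_all add: powr_powr)
   have q: "2 powr (real N - l) = 2 ^ N * r"
    unfolding r_def diff_conv_add_uminus powr_add by (simp add: powr_realpow)
   have "r ^ k * (c * (2 ^ Suc k) ^ N) = c * 2 ^ N * (2 ^ N * r) ^ k"
    by (simp add: power_mult_distrib power_mult[symmetric] mult_ac)
   then show ?thesis unfolding N_def[symmetric] p q .
  qed
  finally show ?thesis .
 qed
 have r: "2 powr (real ?n - l) < 1" using l by (intro powr_less_one) auto
 have "(NNI (x::'a). ewt (- l) x) \<le> (NNI (x::'a). (\<Sum>k. f k x))"
  by (intro nn_integral_mono le)
 also have "\<dots> = (\<Sum>k. NNI x. f k x)"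
  by (intro nn_integral_suminf) auto
 also have "\<dots> = (\<Sum>k. ennreal (c * 2 ^ ?n * (2 powr (real ?n - l)) ^ k))" by (simp add: fk)
 also have "\<dots> < \<infinity>"
  using c0 r by (subst suminf_ennreal2) (auto intro!: summable_mult summable_geometric)
 finally show ?thesis .
qed

text \<open>The type token only transports the dimension. For \<open>l\<close> not above the
  dimension the integral diverges and the value is the default 0 of \<open>enn2real\<close>, hence
  the recurring condition on \<open>l\<close>.\<close>

definition wint :: "'a::euclidean_space itself => real => real" where
 "wint T l = enn2real (NNI (x::'a). ewt (- l) x)"

lemma wint_eq:
 assumes l: "real DIM('a) < l"
 shows "(NNI (x::'a::euclidean_space). ewt (- l) x) = ennreal (wint TYPE('a) l)"
 using wt_nn_integral_finite[OF l] by (simp add: wint_def less_top)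

lemma wint_nonneg [simp]: "0 \<le> wint T l" by (simp add: wint_def)

lemma wint_translate:
 assumes l: "real DIM('a) < l"
 shows "(NNI (x::'a::euclidean_space). ewt (- l) (x - y)) = ennreal (wint TYPE('a) l)"
  "(NNI (x::'a::euclidean_space). ewt (- l) (y - x)) = ennreal (wint TYPE('a) l)"
 using nn_integral_lborel_translate(2,3)[of "\<lambda>x. ewt (- l) x" y] wint_eq[OF l] by simp_all

lemma wint_pos:
 assumes l: "real DIM('a::euclidean_space) < l"
 shows "0 < wint TYPE('a) l"
proof -
 have "(NNI (x::'a). ewt (- l) x) \<noteq> 0"
  by (subst nn_integral_0_iff) (auto simp: emeasure_lborel_UNIV)
 then show ?thesis using wint_eq[OF l] by (metis ennreal_0 less_eq_real_def wint_nonneg)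
qed

lemma wt_integrable:
 assumes l: "real DIM('a) < l"
 shows "L1 (\<lambda>x::'a::euclidean_space. wt (- l) x)"
 using wt_nn_integral_finite[OF l] by (simp add: integrable_iff_bounded)

text \<open>Splitting each order into \<open>K\<close> and \<open>l\<close>, the two factors of
  order \<open>K\<close> are bounded by the decay in \<open>a - b\<close> through the triangle
  inequality, and one factor of order \<open>l\<close> is left for integrability.\<close>

lemma wt_convolution_le:
 assumes l: "real DIM('a) < l" and K: "0 \<le> K"
 shows "(NNI (x::'a::euclidean_space). ennreal (wt (- (K + l)) (x - a) * wt (- (K + l)) (x - b)))
  \<le> ennreal (wint TYPE('a) l * wt (- K) (a - b))"
proof -
 have "wt (- (K + l)) (x - a) * wt (- (K + l)) (x - b) \<le> wt (- K) (a - b) * wt (- l) (x - a)" for x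
 proof -
  have "wt K (a - b) \<le> wt K (x - a) * wt K (x - b)"
   using wt_add_le[OF K, of "a - x" "x - b"] by (simp add: wt_commute[of K a x])
  then have "wt (- K) (x - a) * wt (- K) (x - b) \<le> wt (- K) (a - b)"
   by (simp add: wt_uminus_exp field_simps)
  moreover have "wt (- l) (x - a) * wt (- l) (x - b) \<le> wt (- l) (x - a)"
   using wt_le_1[of "- l" "x - b"] l by (simp add: mult_left_le)
  ultimately have "(wt (- K) (x - a) * wt (- K) (x - b)) * (wt (- l) (x - a) * wt (- l) (x - b))
    \<le> wt (- K) (a - b) * wt (- l) (x - a)"
   by (intro mult_mono) auto
  moreover have "wt (- (K + l)) z = wt (- K) z * wt (- l) z" for z :: 'a by (simp add: wt_mult)
  ultimately show ?thesis by (simp add: mult_ac)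
 qed
 then have "(NNI x. ennreal (wt (- (K + l)) (x - a) * wt (- (K + l)) (x - b)))
  \<le> (NNI x. ewt (- K) (a - b) * ewt (- l) (x - a))"
  by (intro nn_integral_mono) (auto simp: ennreal_mult[symmetric] intro!: ennreal_leI)
 also have "\<dots> = ewt (- K) (a - b) * ennreal (wint TYPE('a) l)"
  by (subst nn_integral_cmult) (auto simp: wint_translate[OF l])
 finally show ?thesis by (simp add: ennreal_mult[symmetric] mult.commute)
qed

section \<open>Powers of extended nonnegative reals and Jensen's inequality\<close>

lemma enn_pow_ennreal [simp]: "0 \<le> x ==> enn_pow (ennreal x) r = ennreal (x powr r)"
 by (simp add: enn_pow_def)

lemma enn_pow_top [simp]: "enn_pow top r = top" by (simp add: enn_pow_def)
lemma enn_pow_0 [simp]: "enn_pow 0 r = 0" by (simp add: enn_pow_def)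

lemma enn_pow_1 [simp]: "enn_pow a 1 = a"
 by (cases a) auto

lemma enn_pow_mono: "0 \<le> r ==> a \<le> b ==> enn_pow a r \<le> enn_pow b r"
 by (cases a; cases b) (auto simp: top_unique intro!: ennreal_leI powr_mono2)

lemma enn_pow_mult: "0 < r ==> enn_pow (a * b) r = enn_pow a r * enn_pow b r"
proof (cases a; cases b)
 assume r: "0 < r"
 { fix x y assume "0 \<le> x" "a = ennreal x" "0 \<le> y" "b = ennreal y"
  then show ?thesis by (simp add: ennreal_mult[symmetric] powr_mult) }
 { fix x assume "0 \<le> x" "a = ennreal x" "b = top"
  then show ?thesis using r by (cases "x = 0") (auto simp: ennreal_mult_top) }
 { fix x assume "0 \<le> x" "b = ennreal x" "a = top"
  then show ?thesis using r by (cases "x = 0") (auto simp: ennreal_top_mult) }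
 { assume "a = top" "b = top" then show ?thesis by simp }
qed

lemma enn_pow_pow: "enn_pow (enn_pow a r) s = enn_pow a (r * s)"
 by (cases a) (auto simp: powr_powr)

lemma enn_pow_add_exp: "a \<noteq> 0 ==> enn_pow a r * enn_pow a s = enn_pow a (r + s)"
 by (cases a) (auto simp: powr_add ennreal_mult[symmetric])

lemma enn_pow_less_top [simp]: "enn_pow a r < top \<longleftrightarrow> a < top"
 by (cases a) (auto)

lemma enn_pow_eq_top [simp]: "enn_pow a r = top \<longleftrightarrow> a = top"
 by (cases a) (auto)

lemma enn_pow_eq_0 [simp]: "enn_pow a r = 0 \<longleftrightarrow> a = 0"
 by (cases a) (auto)

lemma enn_pow_measurable [measurable]:
 assumes [measurable]: "f \<in> borel_measurable M" shows "(\<lambda>x. enn_pow (f x) r) \<in> borel_measurable M"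
 unfolding enn_pow_def by measurable

lemma enn_pow_add_le: "0 < r ==> enn_pow (a + b) r \<le> ennreal (2 powr r) * (enn_pow a r + enn_pow b r)"
proof -
 assume r: "0 < r"
 have "a + b \<le> ennreal 2 * max a b"
  by (metis add_mono max.cobounded1 max.cobounded2 mult_2 ennreal_numeral zero_le_numeral)
 then have "enn_pow (a + b) r \<le> enn_pow (ennreal 2 * max a b) r"
  using r by (intro enn_pow_mono) auto
 also have "\<dots> = ennreal (2 powr r) * enn_pow (max a b) r"
  using r by (subst enn_pow_mult) (simp_all del: ennreal_numeral)
 also have "enn_pow (max a b) r \<le> enn_pow a r + enn_pow b r" by (auto simp: max_def)
 finally show ?thesis by (simp add: mult_left_mono)
qed

text \<open>Convexity: equality holds at \<open>b = c\<close>, so this compares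
  \<open>b powr r\<close> with the tangent at \<open>c\<close>, in the form in which Young's
  inequality delivers it.\<close>

lemma powr_tangent:
 fixes b c r :: real
 assumes "1 \<le> r" "0 \<le> b" "0 < c"
 shows "r * c powr (r - 1) * b \<le> b powr r + (r - 1) * c powr r"
proof (cases "r = 1")
 case True then show ?thesis using assms by simp
next
 case False
 then have a1: "1 < r" using assms by simp
 define q where "q = r / (r - 1)"
 have "b * c powr (r - 1) \<le> b powr r / r + (c powr (r - 1)) powr q / q"
  using assms a1 by (intro Youngs_inequality) (auto simp: q_def field_simps)
 moreover have "(c powr (r - 1)) powr q = c powr r" using a1 by (simp add: powr_powr q_def)
 ultimately have "b * c powr (r - 1) * r \<le> (b powr r / r + c powr r / q) * r"
  using a1 by (intro mult_right_mono) auto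
 also have "\<dots> = b powr r + (r - 1) * c powr r" using a1 by (simp add: q_def field_simps)
 finally show ?thesis by (simp add: mult_ac)
qed

text \<open>The tangent inequality at the mean value is integrated against \<open>w\<close>. Only an
  upper bound of the mass of \<open>w\<close> enters, so \<open>w\<close> need not be normalised.
  With weights \<open>wt (- l)\<close> the lemma serves as Hoelder's inequality as well.\<close>

lemma enn_pow_Jensen:
 fixes b w :: "'a => ennreal"
 assumes [measurable]: "b \<in> borel_measurable M" "w \<in> borel_measurable M"
  and m: "(\<integral>\<^sup>+x. w x \<partial>M) \<le> ennreal m" "0 < m" and q: "1 \<le> q"
 shows "enn_pow (\<integral>\<^sup>+x. b x * w x \<partial>M) q \<le> ennreal (m powr (q - 1)) * (\<integral>\<^sup>+x. enn_pow (b x) q * w x \<partial>M)"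
proof -
 define I where "I = (\<integral>\<^sup>+x. b x * w x \<partial>M)"
 define X where "X = (\<integral>\<^sup>+x. enn_pow (b x) q * w x \<partial>M)"
 show ?thesis unfolding I_def[symmetric] X_def[symmetric]
 proof (cases "X = top")
  case True
  then show "enn_pow I q \<le> ennreal (m powr (q - 1)) * X"
   using m by (simp add: ennreal_mult_top)
 next
  case False
  \<comment> \<open>The tangent point is computed from \<open>I\<close>, so \<open>I\<close> must
    first be known to be finite; the crude bound of \<open>b\<close> by \<open>1 + b powr q\<close>
    suffices for that.\<close>
  have "I \<le> (\<integral>\<^sup>+x. w x + enn_pow (b x) q * w x \<partial>M)" unfolding I_def
  proof (rule nn_integral_mono)
   fix x
   have "b x \<le> 1 + enn_pow (b x) q"
   proof (cases "b x")
    case (real r)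
    have "r \<le> 1 + r powr q"
    proof (cases "r \<le> 1")
     case False
     then have "r powr 1 \<le> r powr q" using q by (intro powr_mono) auto
     then show ?thesis using False by simp
    qed (auto intro: add_increasing2)
    then have "ennreal r \<le> ennreal (1 + r powr q)" by (rule ennreal_leI)
    then show ?thesis using real by (simp add: ennreal_plus)
   qed simp
   then have "b x * w x \<le> (1 + enn_pow (b x) q) * w x" by (rule mult_right_mono) simp
   then show "b x * w x \<le> w x + enn_pow (b x) q * w x" by (simp add: distrib_right)
  qed
  also have "\<dots> = (\<integral>\<^sup>+x. w x \<partial>M) + X" unfolding X_def by (rule nn_integral_add) auto
  also have "\<dots> \<le> ennreal m + X" using m by (simp add: add_right_mono)
  also have "\<dots> < top" using False by (simp add: less_top)
  finally have "I < top" .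
  then obtain i where i: "I = ennreal i" "0 \<le> i" by (cases I) auto
  obtain y where y: "X = ennreal y" "0 \<le> y" using False by (cases X) auto
  show "enn_pow I q \<le> ennreal (m powr (q - 1)) * X"
  proof (cases "i = 0")
   case True then show ?thesis using i by simp
  next
   case False
   then have i0: "0 < i" using i by simp
   \<comment> \<open>The mean value of \<open>b\<close> if \<open>w\<close> has mass
     \<open>m\<close>; tangency there produces the factor \<open>m powr (q - 1)\<close>.\<close>
   define c where "c = i / m"
   have c: "0 < c" using i0 m by (simp add: c_def)
   have "ennreal (q * c powr (q - 1)) * I = (\<integral>\<^sup>+x. ennreal (q * c powr (q - 1)) * (b x * w x) \<partial>M)"
    unfolding I_def by (rule nn_integral_cmult[symmetric]) auto
   also have "\<dots> \<le> (\<integral>\<^sup>+x. enn_pow (b x) q * w x + ennreal ((q - 1) * c powr q) * w x \<partial>M)"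
   proof (rule nn_integral_mono)
    fix x
    have "ennreal (q * c powr (q - 1)) * b x \<le> enn_pow (b x) q + ennreal ((q - 1) * c powr q)"
    proof (cases "b x")
     case (real r)
     then show ?thesis using q powr_tangent[OF q real(1) c]
      by (simp add: ennreal_mult[symmetric] ennreal_plus[symmetric] del: ennreal_plus)
    qed simp
    from mult_right_mono[OF this, of "w x"]
    show "ennreal (q * c powr (q - 1)) * (b x * w x) \<le> enn_pow (b x) q * w x + ennreal ((q - 1) * c powr q) * w x"
     by (simp add: distrib_right mult.assoc)
   qed
   also have "\<dots> = X + ennreal ((q - 1) * c powr q) * (\<integral>\<^sup>+x. w x \<partial>M)"
    unfolding X_def by (subst nn_integral_add) (auto simp: nn_integral_cmult)
   also have "\<dots> \<le> X + ennreal ((q - 1) * c powr q) * ennreal m"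
    using m by (intro add_left_mono mult_left_mono) auto
   finally have "q * c powr (q - 1) * i \<le> y + (q - 1) * c powr q * m"
    using i y q m i0 by (simp add: ennreal_mult[symmetric] ennreal_plus[symmetric] del: ennreal_plus)
   moreover have "c powr (q - 1) * i = c powr q * m"
    using c m i0 by (simp add: c_def powr_diff)
   ultimately have "q * (c powr q * m) \<le> y + (q - 1) * (c powr q * m)"
    by (simp add: mult.assoc)
   then have "c powr q * m \<le> y" by (simp add: algebra_simps)
   then have "m powr (q - 1) * (c powr q * m) \<le> m powr (q - 1) * y"
    by (intro mult_left_mono) auto
   moreover have "m powr (q - 1) * (c powr q * m) = i powr q"
    using m i0 by (simp add: c_def powr_divide powr_diff)
   ultimately show ?thesis using i y by (simp add: ennreal_mult[symmetric])
  qed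
 qed
qed

section \<open>Fourier inversion\<close>

lemma cis_measurable [measurable]:
 assumes [measurable]: "f \<in> borel_measurable M" shows "(\<lambda>x. cis (f x)) \<in> borel_measurable M"
proof -
 have "cis \<in> Bm" by (intro borel_measurable_continuous_onI continuous_intros)
 then show ?thesis by (rule measurable_compose[OF assms])
qed

lemma cis_add: "cis (a + b) = cis a * cis b" and cis_diff: "cis (a - b) = cis a * cis (- b)"
 by (simp_all add: cis_mult)

lemma cis_tendsto: "(f \<longlongrightarrow> l) F ==> ((\<lambda>x. cis (f x)) \<longlongrightarrow> cis l) F"
 by (intro tendsto_intros)

lemma integrable_cis_mult:
 fixes F :: "'a => complex"
 assumes "integrable M F" and [measurable]: "g \<in> borel_measurable M"
 shows "integrable M (\<lambda>x. F x * cis (g x))"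
proof -
 have [measurable]: "F \<in> borel_measurable M" using assms by auto
 show ?thesis by (rule Bochner_Integration.integrable_bound[OF assms(1)]) (auto simp: norm_mult)
qed

lemma fourier_eq_ifourier: "fourier f \<xi> = ifourier f (- \<xi>)"
 unfolding fourier_def ifourier_def by (simp add: inner_commute)

lemma ifourier_measurable [measurable (raw)]:
 fixes F :: "'a => real^'n::finite => complex"
 assumes F: "case_prod F \<in> borel_measurable (N \<Otimes>\<^sub>M lborel)" and [measurable]: "X \<in> measurable N borel"
 shows "(\<lambda>w. ifourier (F w) (X w)) \<in> borel_measurable N"
proof -
 note F[measurable]
 show ?thesis unfolding ifourier_def by measurable
qed

lemma fourier_measurable [measurable (raw)]:
 fixes F :: "'a => real^'n::finite => complex"
 assumes F: "case_prod F \<in> borel_measurable (N \<Otimes>\<^sub>M lborel)" and [measurable]: "X \<in> measurable N borel"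
 shows "(\<lambda>w. fourier (F w) (X w)) \<in> borel_measurable N"
 unfolding fourier_eq_ifourier using assms by measurable

lemma ifourier_borel [measurable]:
 assumes [measurable]: "F \<in> Bm"
 shows "ifourier F \<in> Bm"
 by measurable

text \<open>A non-integrable integrand gives the default integral 0, so the bound holds
  unconditionally.\<close>

lemma norm_ifourier_le_nn:
 "enorm (ifourier F x) \<le> (NNI h. enorm (F h))"
proof (cases "L1 (\<lambda>\<xi>. F \<xi> * cis (2 * pi * (x \<bullet> \<xi>)))")
 case True
 from integral_norm_bound_ennreal[OF True] show ?thesis
  by (simp add: ifourier_def norm_mult)
next
 case False then show ?thesis by (simp add: ifourier_def not_integrable_integral_eq)
qed

lemma norm_ifourier_le:
 assumes "L1 F"
 shows "norm (ifourier F x) \<le> (\<integral>h. norm (F h) \<partial>lborel)"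
proof -
 have "norm (ifourier F x) \<le> (\<integral>h. norm (F h * cis (2 * pi * (x \<bullet> h))) \<partial>lborel)"
  unfolding ifourier_def by (rule integral_norm_bound)
 then show ?thesis by (simp add: norm_mult)
qed

lemma ifourier_continuous:
 fixes F :: "real^'n::finite => complex"
 assumes F: "L1 F"
 shows "continuous_on UNIV (ifourier F)"
 unfolding continuous_on_sequentially
proof (intro allI ballI impI, elim conjE)
 fix x a assume x: "x \<longlonglongrightarrow> (a::real^'n)"
 have [measurable]: "F \<in> Bm" using F by auto
 have "(\<lambda>k. LBINT \<xi>. F \<xi> * cis (2 * pi * (x k \<bullet> \<xi>))) \<longlonglongrightarrow> (LBINT \<xi>. F \<xi> * cis (2 * pi * (a \<bullet> \<xi>)))"
 proof (rule integral_dominated_convergence[where w="\<lambda>\<xi>. norm (F \<xi>)"])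
  show "AE \<xi> in lborel. (\<lambda>k. F \<xi> * cis (2 * pi * (x k \<bullet> \<xi>))) \<longlonglongrightarrow> F \<xi> * cis (2 * pi * (a \<bullet> \<xi>))"
   using x by (intro AE_I2 tendsto_intros cis_tendsto)
 qed (use F in \<open>auto simp: norm_mult\<close>)
 then show "(ifourier F \<circ> x) \<longlonglongrightarrow> ifourier F a" by (simp add: ifourier_def o_def)
qed

lemma ifourier_Fubini:
 fixes G :: "'a => real^'n::finite => complex"
 assumes M: "sigma_finite_measure M" and i: "integrable (M \<Otimes>\<^sub>M lborel) (case_prod G)"
 shows "ifourier (\<lambda>h. LINT \<omega>|M. G \<omega> h) x = (LINT \<omega>|M. ifourier (G \<omega>) x)"
proof -
 interpret sigma_finite_measure M by fact
 interpret P: pair_sigma_finite M "lborel :: (real^'n) measure" ..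
 have i': "integrable (M \<Otimes>\<^sub>M lborel) (case_prod (\<lambda>\<omega> h. G \<omega> h * cis (2 * pi * (x \<bullet> h))))"
 proof -
  have [measurable]: "case_prod G \<in> borel_measurable (M \<Otimes>\<^sub>M lborel)" using i by auto
  show ?thesis by (rule Bochner_Integration.integrable_bound[OF i]) (auto simp: norm_mult)
 qed
 show ?thesis unfolding ifourier_def
  by (subst P.Fubini_integral[OF i', symmetric]) simp
qed

section \<open>Gaussians and their Fourier transforms\<close>

lemma integral_lborel_prod:
 fixes f :: "'a::euclidean_space => real => 'b::{real_normed_field,banach,second_countable_topology}"
 assumes f: "\<And>b. b \<in> Basis ==> L1 (f b)"
 shows "(\<integral>x. (\<Prod>b\<in>Basis. f b (x \<bullet> b)) \<partial>(lborel::'a measure)) = (\<Prod>b\<in>Basis. (\<integral>x. f b x \<partial>lborel))"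
  and "integrable (lborel::'a measure) (\<lambda>x. \<Prod>b\<in>Basis. f b (x \<bullet> b))"
proof -
 interpret product_sigma_finite "\<lambda>_::'a. lborel :: real measure" by standard
 have [measurable]: "f b \<in> Bm" if "b \<in> Basis" for b using f[OF that] by auto
 have *: "(\<lambda>x. \<Prod>b\<in>Basis. f b ((\<Sum>b\<in>Basis. x b *\<^sub>R b) \<bullet> b)) = (\<lambda>x. \<Prod>b\<in>Basis. f b (x b))"
  by (intro ext prod.cong) auto
 have "(\<integral>x. (\<Prod>b\<in>Basis. f b (x \<bullet> b)) \<partial>(lborel::'a measure)) =
   (\<integral>x. (\<Prod>b\<in>Basis. f b (x b)) \<partial>(\<Pi>\<^sub>M b\<in>(Basis::'a set). lborel))"
  by (subst lborel_eq, subst integral_distr) (simp_all add: *)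
 also have "\<dots> = (\<Prod>b\<in>Basis. (\<integral>x. f b x \<partial>lborel))"
  by (rule product_integral_prod) (auto intro: f)
 finally show "(\<integral>x. (\<Prod>b\<in>Basis. f b (x \<bullet> b)) \<partial>(lborel::'a measure)) = (\<Prod>b\<in>Basis. (\<integral>x. f b x \<partial>lborel))" .
 show "integrable (lborel::'a measure) (\<lambda>x. \<Prod>b\<in>Basis. f b (x \<bullet> b))"
  by (subst lborel_eq, subst integrable_distr_eq) (auto simp: * intro!: product_integrable_prod f)
qed

text \<open>The factor \<open>pi\<close> makes the Gaussian its own Fourier transform in the
  \<open>2 * pi\<close> normalisation and gives it total mass one.\<close>

definition gs :: "'a::real_normed_vector => real" where
 "gs y = exp (- pi * (norm y)^2)"

lemma gs_pos [simp]: "0 < gs y" and gs_nonneg [simp]: "0 \<le> gs y" and gs_le_1: "gs y \<le> 1" and gs_0 [simp]: "gs 0 = 1"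
 by (auto simp: gs_def)

lemma gs_continuous [continuous_intros]: "continuous_on S f ==> continuous_on S (\<lambda>x. gs (f x))"
 unfolding gs_def by (intro continuous_intros)

lemma gs_tendsto [tendsto_intros]: "(f \<longlongrightarrow> l) F ==> ((\<lambda>x. gs (f x)) \<longlongrightarrow> gs l) F"
 unfolding gs_def by (intro tendsto_intros)

lemma gs_measurable [measurable]:
 fixes f :: "_ => 'a::euclidean_space"
 assumes "f \<in> borel_measurable M" shows "(\<lambda>x. gs (f x)) \<in> borel_measurable M"
 using assms unfolding gs_def by measurable

text \<open>The substitution by \<open>sqrt (2 * pi)\<close> turns the characteristic function of
  the standard normal distribution into this self-duality.\<close>

lemma gs_real_fourier:
 "L1 (\<lambda>t::real. cor (gs t) * cis (2 * pi * (s * t)))"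
 "(\<integral>t. cor (gs t) * cis (2 * pi * (s * t)) \<partial>lborel) = cor (gs s)"
proof -
 define c where "c = sqrt (2 * pi)"
 have c: "0 < c" "c * c = 2 * pi" by (auto simp: c_def)
 define f where "f x = cor (std_normal_density x) * cis (c * s * x)" for x
 have f: "L1 f" unfolding f_def
  by (rule integrable_cis_mult) (auto intro!: integrable_of_real)
 have "cor (exp (- ((c * s)^2) / 2)) = char std_normal_distribution (c * s)"
  by (simp add: char_std_normal_distribution)
 also have "\<dots> = (\<integral>x. f x \<partial>lborel)"
  unfolding char_def f_def
  by (subst integral_density) (auto simp: cis_conv_exp scaleR_conv_of_real mult_ac)
 also have "\<dots> = c *\<^sub>R (\<integral>t. f (c * t) \<partial>lborel)"
  using lborel_integral_real_affine[of c f 0] c by simp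
 also have "\<dots> = (\<integral>t. c *\<^sub>R f (c * t) \<partial>lborel)" by simp
 finally have eq: "(\<integral>t. c *\<^sub>R f (c * t) \<partial>lborel) = cor (exp (- ((c * s)^2) / 2))" ..
 have fe: "c *\<^sub>R f (c * t) = cor (gs t) * cis (2 * pi * (s * t))" for t
 proof -
  have "c * std_normal_density (c * t) = gs t"
   using c by (simp add: std_normal_density_def gs_def c_def power_mult_distrib)
  moreover have "c * s * (c * t) = 2 * pi * (s * t)" using c(2) by (simp add: mult_ac)
  ultimately show ?thesis unfolding f_def scaleR_conv_of_real
   by (metis (no_types, lifting) mult.assoc of_real_mult)
 qed
 have ge: "exp (- ((c * s)^2) / 2) = gs s"
  by (simp add: gs_def c_def power_mult_distrib)
 show "(\<integral>t. cor (gs t) * cis (2 * pi * (s * t)) \<partial>lborel) = cor (gs s)"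
  using eq unfolding fe ge .
 have "L1 (\<lambda>t. c *\<^sub>R f (c * t))"
  using lborel_integrable_real_affine[OF f, of c 0] c by simp
 then show "L1 (\<lambda>t::real. cor (gs t) * cis (2 * pi * (s * t)))"
  unfolding fe .
qed

lemma gs_prod: "gs (y::'a::euclidean_space) = (\<Prod>b\<in>Basis. gs (y \<bullet> b))"
proof -
 have "- pi * (norm y)^2 = (\<Sum>b\<in>Basis. - pi * (norm (y \<bullet> b))^2)"
  by (simp add: norm_eq_sqrt_inner euclidean_inner[of y y] sum_nonneg sum_distrib_left power2_eq_square)
 then show ?thesis by (simp add: gs_def exp_sum)
qed

lemma cis_sum: "finite S ==> cis (\<Sum>b\<in>S. f b) = (\<Prod>b\<in>S. cis (f b))"
 by (induction S rule: finite_induct) (auto simp: cis_add)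

lemma gs_cis_prod: "cor (gs y) * cis (2 * pi * (x \<bullet> y)) =
  (\<Prod>b\<in>Basis. cor (gs (y \<bullet> b)) * cis (2 * pi * ((x \<bullet> b) * (y \<bullet> b))))"
 for x y :: "'a::euclidean_space"
 by (simp add: gs_prod[of y] prod.distrib cis_sum[symmetric] euclidean_inner[of x y] sum_distrib_left)

lemma gs_fourier_aux:
 fixes x :: "'a::euclidean_space"
 shows "(\<integral>y. cor (gs y) * cis (2 * pi * (x \<bullet> y)) \<partial>lborel) = cor (gs x)"
  and "L1 (\<lambda>y. cor (gs y) * cis (2 * pi * (x \<bullet> y)))"
proof -
 have i: "L1 (\<lambda>t::real. cor (gs t) * cis (2 * pi * ((x \<bullet> b) * t)))" for b
  by (rule gs_real_fourier)
 show "(\<integral>y. cor (gs y) * cis (2 * pi * (x \<bullet> y)) \<partial>lborel) = cor (gs x)"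
  unfolding gs_cis_prod
  by (subst integral_lborel_prod(1)[OF i]) (simp add: gs_real_fourier gs_prod[of x])
 show "L1 (\<lambda>y. cor (gs y) * cis (2 * pi * (x \<bullet> y)))"
  unfolding gs_cis_prod by (rule integral_lborel_prod(2)[OF i])
qed

lemma gs_integrable: "L1 (\<lambda>y::'a::euclidean_space. gs y)"
 and gs_integral: "integral\<^sup>L lborel (gs :: 'a => real) = 1"
proof -
 have c: "L1 (\<lambda>y::'a. cor (gs y))"
  using gs_fourier_aux(2)[of 0] by simp
 then show "L1 (\<lambda>y::'a. gs y)" by (simp add: complex_of_real_integrable_eq)
 have "cor (integral\<^sup>L lborel (gs :: 'a => real)) = 1"
  using gs_fourier_aux(1)[of "0::'a"] by simp
 then show "integral\<^sup>L lborel (gs :: 'a => real) = 1" by (simp only: of_real_eq_1_iff)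
qed

lemma ifourier_gs: "ifourier (\<lambda>y. cor (gs y)) x = cor (gs x)"
 unfolding ifourier_def by (rule gs_fourier_aux(1))

lemma ifourier_scale:
 fixes F :: "real^'n::finite => complex"
 assumes t: "0 < t"
 shows "ifourier (\<lambda>h. F (t *\<^sub>R h)) x = (1 / t ^ CARD('n)) *\<^sub>R ifourier F ((1 / t) *\<^sub>R x)"
proof -
 have "ifourier F ((1 / t) *\<^sub>R x) = t ^ CARD('n) *\<^sub>R (LBINT h. F (t *\<^sub>R h) * cis (2 * pi * ((1 / t) *\<^sub>R x \<bullet> (t *\<^sub>R h))))"
  unfolding ifourier_def
  using integral_lborel_affine[of t "\<lambda>\<xi>. F \<xi> * cis (2 * pi * ((1 / t) *\<^sub>R x \<bullet> \<xi>))" 0] t by simp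
 then show ?thesis using t by (simp add: ifourier_def)
qed

lemma ifourier_shift:
 "ifourier (\<lambda>h. F (h + v)) x = cis (- 2 * pi * (x \<bullet> v)) * ifourier F x"
proof -
 have "ifourier (\<lambda>h. F (h + v)) x = (LBINT h. F h * cis (2 * pi * (x \<bullet> (h - v))))"
  unfolding ifourier_def
  using integral_lborel_translate(1)[of "\<lambda>h. F h * cis (2 * pi * (x \<bullet> (h - v)))" v] by simp
 also have "\<dots> = (LBINT h. cis (- 2 * pi * (x \<bullet> v)) * (F h * cis (2 * pi * (x \<bullet> h))))"
  by (intro Bochner_Integration.integral_cong) (auto simp: inner_diff_right algebra_simps cis_add cis_diff)
 finally show ?thesis by (simp add: ifourier_def)
qed

lemma ifourier_modulate:
 "ifourier (\<lambda>h. cis (2 * pi * (v \<bullet> h)) * F h) x = ifourier F (x + v)"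
 unfolding ifourier_def
 by (intro Bochner_Integration.integral_cong) (auto simp: inner_add_left algebra_simps cis_add cis_diff)

lemma ifourier_cmult: "ifourier (\<lambda>h. c * F h) x = c * ifourier F x"
 by (simp add: ifourier_def mult.assoc)

lemma ifourier_cnj: "ifourier (\<lambda>h. cnj (F h)) x = cnj (ifourier F (- x))"
 unfolding ifourier_def by (simp add: Bochner_Integration.integral_cnj[symmetric] cis_cnj del: Bochner_Integration.integral_cnj)

text \<open>A class closed under products and convolutions, on which inversion holds at every point
  as soon as the transform is integrable; continuity is what excludes exceptional null sets.\<close>

definition good :: "(real^'n::finite => complex) => bool" where
 "good F \<longleftrightarrow> continuous_on UNIV F \<and> L1 F \<and> bounded (range F)"

lemma good_measurable: "good F ==> F \<in> Bm"
 unfolding good_def by (auto intro: borel_measurable_continuous_onI)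

lemma goodD: "good F ==> continuous_on UNIV F" "good F ==> L1 F"
 by (auto simp: good_def)

lemma good_bound: "good F ==> \<exists>B\<ge>0. \<forall>x. norm (F x) \<le> B"
 unfolding good_def bounded_iff by (metis norm_ge_zero order_trans rangeI)

text \<open>Gaussian summation: the double transform with a factor \<open>gs (e *\<^sub>R x)\<close>
  tends to the left side by dominated convergence, and Fubini identifies it with a Gaussian average
  of \<open>F\<close> around \<open>y\<close>, which tends to \<open>F y\<close> by
  continuity.\<close>

lemma fourier_inversion:
 fixes F :: "real^'n::finite => complex"
 assumes F: "good F" and i: "L1 (ifourier F)"
 shows "fourier (ifourier F) y = F y"
proof -
 have [measurable]: "F \<in> Bm" by (rule good_measurable[OF F])
 obtain B where B: "0 \<le> B" "\<And>x. norm (F x) \<le> B" using good_bound[OF F] by auto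
 define e where "e k = 1 / real (Suc k)" for k
 have e0: "0 < e k" for k by (simp add: e_def)
 have elim: "e \<longlonglongrightarrow> 0" unfolding e_def using LIMSEQ_inverse_real_of_nat by (simp add: inverse_eq_divide)
 define a where "a k = (LBINT x. ifourier F x * gs (e k *\<^sub>R x) * cis (- 2 * pi * (x \<bullet> y)))" for k
 have lim1: "a \<longlonglongrightarrow> fourier (ifourier F) y"
  unfolding a_def fourier_def
 proof (rule integral_dominated_convergence[where w="\<lambda>x. norm (ifourier F x)"])
  show "AE x in lborel. (\<lambda>k. ifourier F x * gs (e k *\<^sub>R x) * cis (- 2 * pi * (x \<bullet> y)))
   \<longlonglongrightarrow> ifourier F x * cis (- 2 * pi * (x \<bullet> y))"
  proof (rule AE_I2)
   fix x :: "real^'n"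
   have "(\<lambda>k. gs (e k *\<^sub>R x)) \<longlonglongrightarrow> gs (0 *\<^sub>R x)" by (intro tendsto_intros elim)
   then have "(\<lambda>k. ifourier F x * gs (e k *\<^sub>R x) * cis (- 2 * pi * (x \<bullet> y))) \<longlonglongrightarrow> ifourier F x * cor 1 * cis (- 2 * pi * (x \<bullet> y))"
    by (intro tendsto_intros) simp
   then show "(\<lambda>k. ifourier F x * gs (e k *\<^sub>R x) * cis (- 2 * pi * (x \<bullet> y)))
   \<longlonglongrightarrow> ifourier F x * cis (- 2 * pi * (x \<bullet> y))" by simp
  qed
  show "AE x in lborel. norm (ifourier F x * cor (gs (e k *\<^sub>R x)) * cis (- 2 * pi * (x \<bullet> y))) \<le> norm (ifourier F x)" for k
   by (intro AE_I2) (simp add: norm_mult mult_left_le gs_le_1)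
 qed (use i in auto)
 \<comment> \<open>Integrating first in \<open>x\<close> leaves the transform of a dilated Gaussian,
   that is, a Gaussian of width \<open>e k\<close> centred at \<open>y\<close>.\<close>
 have a_eq: "a k = (LBINT z. F (y + e k *\<^sub>R z) * gs z)" for k
 proof -
  let ?G = "\<lambda>h x. F h * cis (2 * pi * (x \<bullet> h)) * gs (e k *\<^sub>R x) * cis (- 2 * pi * (x \<bullet> y))"
  have gi: "L1 (\<lambda>x::real^'n. gs (e k *\<^sub>R x))"
   using integrable_lborel_affine[OF gs_integrable, of "e k" "0::real^'n"] e0[of k] by simp
  have int: "integrable (lborel \<Otimes>\<^sub>M lborel) (case_prod ?G)"
  proof (rule lborel_pair.Fubini_integrable)
   have "L1 (\<lambda>h. norm (F h) * (LBINT x. gs (e k *\<^sub>R (x::real^'n))))"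
    using goodD(2)[OF F] by simp
   then show "L1 (\<lambda>h. LBINT x. norm (case_prod ?G (h, x)))"
    by (simp add: norm_mult)
   show "AE h in lborel. L1 (\<lambda>x. case_prod ?G (h, x))"
   proof (rule AE_I2)
    fix h :: "real^'n"
    have "L1 (\<lambda>x::real^'n. F h * cor (gs (e k *\<^sub>R x)))"
     using gi by (intro integrable_mult_right) (simp add: complex_of_real_integrable_eq)
    then have "L1 (\<lambda>x. F h * cor (gs (e k *\<^sub>R x)) * cis (2 * pi * (x \<bullet> h)) * cis (- 2 * pi * (x \<bullet> y)))"
     by (intro integrable_cis_mult) auto
    then show "L1 (\<lambda>x. case_prod ?G (h, x))" by (simp add: mult_ac)
   qed
  qed measurable
  have "a k = (LBINT x. LBINT h. ?G h x)"
   unfolding a_def ifourier_def by (simp only: integral_mult_left_zero)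
  also have "\<dots> = (LBINT h. LBINT x. ?G h x)"
   by (rule lborel_pair.Fubini_integral[OF int])
  also have "\<dots> = (LBINT h. F h * ((1 / e k ^ CARD('n)) *\<^sub>R cor (gs ((1 / e k) *\<^sub>R (h - y)))))"
  proof (rule Bochner_Integration.integral_cong[OF refl])
   fix h :: "real^'n"
   have "(LBINT x. ?G h x) = (LBINT x. F h * (gs (e k *\<^sub>R x) * cis (2 * pi * ((h - y) \<bullet> x))))"
    by (intro Bochner_Integration.integral_cong)
     (auto simp: inner_diff_left inner_commute algebra_simps cis_add cis_diff)
   also have "\<dots> = F h * ifourier (\<lambda>x. gs (e k *\<^sub>R x)) (h - y)"
    by (simp add: ifourier_def)
   also have "ifourier (\<lambda>x. gs (e k *\<^sub>R x)) (h - y) = (1 / e k ^ CARD('n)) *\<^sub>R cor (gs ((1 / e k) *\<^sub>R (h - y)))"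
    using ifourier_scale[OF e0[of k], of "\<lambda>x. cor (gs x)" "h - y"] by (simp add: ifourier_gs)
   finally show "(LBINT x. ?G h x) = F h * ((1 / e k ^ CARD('n)) *\<^sub>R cor (gs ((1 / e k) *\<^sub>R (h - y))))" .
  qed
  also have "\<dots> = (LBINT z. F (y + e k *\<^sub>R z) * gs z)"
   using e0[of k] by (subst integral_lborel_affine[of "e k" _ y]) simp_all
  finally show ?thesis .
 qed
 have "(\<lambda>k. LBINT z. F (y + e k *\<^sub>R z) * gs z) \<longlonglongrightarrow> (LBINT z. F y * cor (gs (z::real^'n)))"
 proof (rule integral_dominated_convergence[where w="\<lambda>z. B * gs z"])
  show "AE z in lborel. (\<lambda>k. F (y + e k *\<^sub>R z) * cor (gs z)) \<longlonglongrightarrow> F y * cor (gs z)"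
  proof (rule AE_I2)
   fix z :: "real^'n"
   have "(\<lambda>k. y + e k *\<^sub>R z) \<longlonglongrightarrow> y + 0 *\<^sub>R z" by (intro tendsto_intros elim)
   then have l: "(\<lambda>k. y + e k *\<^sub>R z) \<longlonglongrightarrow> y" by simp
   have "isCont F y" using goodD(1)[OF F] by (simp add: continuous_on_eq_continuous_at)
   from isCont_tendsto_compose[OF this l] have "(\<lambda>k. F (y + e k *\<^sub>R z)) \<longlonglongrightarrow> F y" .
   then show "(\<lambda>k. F (y + e k *\<^sub>R z) * cor (gs z)) \<longlonglongrightarrow> F y * cor (gs z)"
    by (intro tendsto_intros)
  qed
  show "AE z in lborel. norm (F (y + e k *\<^sub>R z) * cor (gs z)) \<le> B * gs z" for k
   using B by (intro AE_I2) (auto simp: norm_mult intro!: mult_right_mono)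
 qed (use gs_integrable in auto)
 also have "(LBINT z. F y * cor (gs (z::real^'n))) = F y"
  by (simp add: gs_integral)
 finally have "(\<lambda>k. a k) \<longlonglongrightarrow> F y" unfolding a_eq .
 from LIMSEQ_unique[OF lim1 this] show ?thesis .
qed

lemma good_mult:
 assumes "good F" "good G" shows "good (\<lambda>h. F h * G h)"
proof -
 have [measurable]: "F \<in> Bm" "G \<in> Bm"
  using assms good_measurable by auto
 obtain B where B: "0 \<le> B" "\<And>x. norm (F x) \<le> B" using good_bound[OF assms(1)] by auto
 obtain C where C: "0 \<le> C" "\<And>x. norm (G x) \<le> C" using good_bound[OF assms(2)] by auto
 have "L1 (\<lambda>h. F h * G h)"
  by (rule Bochner_Integration.integrable_bound[of _ "\<lambda>h. B * norm (G h)"])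
   (use assms B in \<open>auto simp: norm_mult good_def intro!: mult_right_mono\<close>)
 moreover have "bounded (range (\<lambda>h. F h * G h))"
  unfolding bounded_iff using B C by (auto intro!: exI[of _ "B * C"] mult_mono simp: norm_mult)
 ultimately show ?thesis using assms by (auto simp: good_def intro: continuous_intros)
qed

text \<open>\<open>F\<close> is replaced by its inversion formula and the integrals are exchanged.
  Only one factor has to have an integrable transform, so \<open>G\<close> may be merely
  integrable.\<close>

lemma ifourier_mult:
 fixes F G :: "real^'n::finite => complex"
 assumes F: "good F" and i: "L1 (ifourier F)" and G: "L1 G"
 shows "ifourier (\<lambda>h. F h * G h) x = (LBINT y. ifourier F y * ifourier G (x - y))"
proof -
 have [measurable]: "F \<in> Bm" "G \<in> Bm"
  using F G good_measurable by auto
 let ?K = "\<lambda>y h. ifourier F y * (cis (- 2 * pi * (y \<bullet> h)) * G h * cis (2 * pi * (x \<bullet> h)))"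
 have int: "integrable (lborel \<Otimes>\<^sub>M lborel) (case_prod ?K)"
 proof (rule lborel_pair.Fubini_integrable)
  show "L1 (\<lambda>y. LBINT h. norm (case_prod ?K (y, h)))"
   using i by (simp add: norm_mult)
  show "AE y in lborel. L1 (\<lambda>h. case_prod ?K (y, h))"
  proof (rule AE_I2)
   fix y :: "real^'n"
   have "L1 (\<lambda>h. ifourier F y * (G h * cis (- 2 * pi * (y \<bullet> h)) * cis (2 * pi * (x \<bullet> h))))"
    using G by (intro integrable_mult_right integrable_cis_mult) auto
   then show "L1 (\<lambda>h. case_prod ?K (y, h))" by (simp add: mult_ac)
  qed
 qed measurable
 have "ifourier (\<lambda>h. F h * G h) x = (LBINT h. LBINT y. ?K y h)"
  unfolding ifourier_def[of "\<lambda>h. F h * G h"]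
 proof (rule Bochner_Integration.integral_cong[OF refl])
  fix h :: "real^'n"
  have "F h = (LBINT y. ifourier F y * cis (- 2 * pi * (y \<bullet> h)))"
   using fourier_inversion[OF F i, of h] by (simp add: fourier_def)
  moreover have "(LBINT y. ?K y h) = (LBINT y. ifourier F y * cis (- 2 * pi * (y \<bullet> h)) * (G h * cis (2 * pi * (x \<bullet> h))))"
   by (simp add: mult_ac)
  moreover have "\<dots> = (LBINT y. ifourier F y * cis (- 2 * pi * (y \<bullet> h))) * (G h * cis (2 * pi * (x \<bullet> h)))"
   by (rule integral_mult_left_zero)
  ultimately show "F h * G h * cis (2 * pi * (x \<bullet> h)) = (LBINT y. ?K y h)" by simp
 qed
 also have "\<dots> = (LBINT y. LBINT h. ?K y h)"
  by (rule lborel_pair.Fubini_integral[OF int])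
 also have "\<dots> = (LBINT y. ifourier F y * ifourier G (x - y))"
  unfolding ifourier_def[of G]
  by (intro Bochner_Integration.integral_cong)
   (auto simp: inner_diff_left algebra_simps cis_add cis_diff integral_mult_right_zero[symmetric] simp del: integral_mult_right_zero
    intro!: Bochner_Integration.integral_cong)
 finally show ?thesis .
qed

section \<open>Weighted norms of inverse Fourier transforms\<close>

lemma norm_integral_le_nn:
 fixes f :: "'a => 'b::{banach,second_countable_topology}"
 shows "enorm (integral\<^sup>L M f) \<le> (\<integral>\<^sup>+x. enorm (f x) \<partial>M)"
 by (cases "integrable M f") (auto simp: not_integrable_integral_eq intro: integral_norm_bound_ennreal)

text \<open>A Beurling algebra norm on the Fourier side. The centre \<open>x0\<close> and the rate
  \<open>r\<close> let the weight follow a kernel that sits far from the origin and has its own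
  length scale.\<close>

definition NW :: "real^'n => real => real => (real^'n::finite => complex) => ennreal" where
 "NW x0 r a F = (NNI x. ennreal (norm (ifourier F x) * wt a (r *\<^sub>R (x - x0))))"

lemma NW_integrable:
 assumes [measurable]: "F \<in> Bm" and a: "0 \<le> a" and fin: "NW x0 r a F < \<infinity>"
 shows "L1 (ifourier F)"
proof -
 have "(NNI x. enorm (ifourier F x)) \<le> NW x0 r a F"
  unfolding NW_def
 proof (rule nn_integral_mono)
  fix x
  show "enorm (ifourier F x) \<le> ennreal (norm (ifourier F x) * wt a (r *\<^sub>R (x - x0)))"
   using wt_ge_1[OF a, of "r *\<^sub>R (x - x0)"] by (intro ennreal_leI) (metis mult.right_neutral mult_left_mono norm_ge_zero)
 qed
 then show ?thesis using fin by (simp add: integrable_iff_bounded)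
qed

text \<open>Young's inequality for two integrable functions, the weight being split along
  \<open>x - x0 = (y - x0) + (x - y)\<close>. A single factor carries the centre, so localising
  factors can be centred at 0.\<close>

lemma NW_mult:
 assumes F: "good F" and G: "L1 G" and a: "0 \<le> a" and fin: "NW x0 r a F < \<infinity>"
 shows "NW x0 r a (\<lambda>h. F h * G h) \<le> NW x0 r a F * NW 0 r a G"
proof -
 have [measurable]: "F \<in> Bm" "G \<in> Bm"
  using F G good_measurable by auto
 define f g where "f x = ennreal (norm (ifourier F x) * wt a (r *\<^sub>R (x - x0)))"
  and "g x = ennreal (norm (ifourier G x) * wt a (r *\<^sub>R x))" for x
 have [measurable]: "f \<in> Bm" "g \<in> Bm"
  unfolding f_def g_def by measurable
 have i: "L1 (ifourier F)" by (rule NW_integrable[OF _ a fin]) simp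
 have "ennreal (norm (ifourier (\<lambda>h. F h * G h) x) * wt a (r *\<^sub>R (x - x0)))
   \<le> (NNI y. f y * g (x - y))" for x
 proof -
  have "ennreal (norm (ifourier (\<lambda>h. F h * G h) x) * wt a (r *\<^sub>R (x - x0)))
   \<le> (NNI y. enorm (ifourier F y * ifourier G (x - y))) * ewt a (r *\<^sub>R (x - x0))"
   unfolding ifourier_mult[OF F i G]
   by (subst ennreal_mult) (auto intro!: mult_right_mono norm_integral_le_nn)
  also have "\<dots> = (NNI y. enorm (ifourier F y * ifourier G (x - y)) * ewt a (r *\<^sub>R (x - x0)))"
   by (rule nn_integral_multc[symmetric]) measurable
  also have "\<dots> \<le> (NNI y. f y * g (x - y))"
  proof (rule nn_integral_mono)
   fix y
   have "wt a (r *\<^sub>R (x - x0)) \<le> wt a (r *\<^sub>R (y - x0)) * wt a (r *\<^sub>R (x - y))"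
    using wt_add_le[OF a, of "r *\<^sub>R (y - x0)" "r *\<^sub>R (x - y)"] by (simp add: scaleR_add_right[symmetric])
   then have "norm (ifourier F y * ifourier G (x - y)) * wt a (r *\<^sub>R (x - x0)) \<le>
     norm (ifourier F y * ifourier G (x - y)) * (wt a (r *\<^sub>R (y - x0)) * wt a (r *\<^sub>R (x - y)))"
    by (intro mult_left_mono) auto
   then show "enorm (ifourier F y * ifourier G (x - y)) * ewt a (r *\<^sub>R (x - x0)) \<le> f y * g (x - y)"
    unfolding f_def g_def by (simp add: ennreal_mult[symmetric] norm_mult mult_ac ennreal_leI)
  qed
  finally show ?thesis .
 qed
 then have "NW x0 r a (\<lambda>h. F h * G h) \<le> (NNI x. NNI y. f y * g (x - y))"
  unfolding NW_def by (intro nn_integral_mono)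
 also have "\<dots> = (NNI y. NNI x. f y * g (x - y))"
  by (rule lborel_pair.Fubini') measurable
 also have "\<dots> = (NNI y. f y * (NNI x. g x))"
  by (simp add: nn_integral_cmult nn_integral_lborel_translate)
 also have "\<dots> = NW x0 r a F * NW 0 r a G"
  by (simp add: nn_integral_multc NW_def f_def g_def)
 finally show ?thesis .
qed

lemma NW_mono_r:
 assumes "0 \<le> r" "r \<le> r'" "0 \<le> a" shows "NW x0 r a F \<le> NW x0 r' a F"
 unfolding NW_def using assms
 by (intro nn_integral_mono ennreal_leI mult_left_mono wt_le_norm) (auto intro!: mult_right_mono)

lemma NW_cmult:
 assumes [measurable]: "F \<in> Bm"
 shows "NW x0 r a (\<lambda>h. c * F h) = ennreal (norm c) * NW x0 r a F"
 unfolding NW_def ifourier_cmult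
 by (simp add: norm_mult mult.assoc ennreal_mult nn_integral_cmult)

text \<open>Pieces with different gradients are brought to a common centre this way; the cost stays
  bounded when the displacement is of the order of \<open>1 / r\<close>.\<close>

lemma NW_recentre:
 assumes [measurable]: "F \<in> Bm" and a: "0 \<le> a"
 shows "NW x1 r a F \<le> ewt a (r *\<^sub>R (x0 - x1)) * NW x0 r a F"
 unfolding NW_def
proof (subst nn_integral_cmult[symmetric], measurable, rule nn_integral_mono)
 fix x
 have "wt a (r *\<^sub>R (x - x1)) \<le> wt a (r *\<^sub>R (x - x0)) * wt a (r *\<^sub>R (x0 - x1))"
  using wt_add_le[OF a, of "r *\<^sub>R (x - x0)" "r *\<^sub>R (x0 - x1)"] by (simp add: scaleR_add_right[symmetric])
 then have "norm (ifourier F x) * wt a (r *\<^sub>R (x - x1)) \<le> norm (ifourier F x) * (wt a (r *\<^sub>R (x - x0)) * wt a (r *\<^sub>R (x0 - x1)))"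
  by (intro mult_left_mono) auto
 then show "ennreal (norm (ifourier F x) * wt a (r *\<^sub>R (x - x1))) \<le>
  ewt a (r *\<^sub>R (x0 - x1)) * ennreal (norm (ifourier F x) * wt a (r *\<^sub>R (x - x0)))"
  by (simp add: ennreal_mult[symmetric] mult_ac ennreal_leI)
qed

text \<open>Minkowski's inequality. It sums decompositions into pieces, Taylor remainders in
  integral form and, with counting measure, power series.\<close>

lemma NW_integral:
 fixes G :: "'a => real^'n::finite => complex"
 assumes M: "sigma_finite_measure M" and i: "integrable (M \<Otimes>\<^sub>M lborel) (case_prod G)"
 shows "NW x0 r a (\<lambda>h. LINT \<omega>|M. G \<omega> h) \<le> (\<integral>\<^sup>+\<omega>. NW x0 r a (G \<omega>) \<partial>M)"
proof -
 interpret sigma_finite_measure M by fact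
 interpret P: pair_sigma_finite M "lborel :: (real^'n) measure" ..
 have [measurable]: "case_prod G \<in> borel_measurable (M \<Otimes>\<^sub>M lborel)" using i by auto
 have m: "(\<lambda>(\<omega>, x). ifourier (G \<omega>) x) \<in> borel_measurable (M \<Otimes>\<^sub>M lborel)" by measurable
 note m[measurable]
 have "NW x0 r a (\<lambda>h. LINT \<omega>|M. G \<omega> h) =
   (NNI x. enorm (LINT \<omega>|M. ifourier (G \<omega>) x) * ewt a (r *\<^sub>R (x - x0)))"
  unfolding NW_def ifourier_Fubini[OF M i] by (simp add: ennreal_mult)
 also have "\<dots> \<le> (\<integral>\<^sup>+x. (\<integral>\<^sup>+\<omega>. enorm (ifourier (G \<omega>) x) \<partial>M) * ewt a (r *\<^sub>R (x - x0)) \<partial>lborel)"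
  by (intro nn_integral_mono mult_right_mono norm_integral_le_nn) auto
 also have "\<dots> = (\<integral>\<^sup>+x. (\<integral>\<^sup>+\<omega>. enorm (ifourier (G \<omega>) x) * ewt a (r *\<^sub>R (x - x0)) \<partial>M) \<partial>lborel)"
  by (intro nn_integral_cong nn_integral_multc[symmetric]) measurable
 also have "\<dots> = (\<integral>\<^sup>+\<omega>. (NNI x. enorm (ifourier (G \<omega>) x) * ewt a (r *\<^sub>R (x - x0))) \<partial>M)"
  by (rule P.Fubini') measurable
 also have "\<dots> = (\<integral>\<^sup>+\<omega>. NW x0 r a (G \<omega>) \<partial>M)" by (simp add: NW_def ennreal_mult)
 finally show ?thesis .
qed

lemma NW_shift: "NW x0 r a (\<lambda>h. F (h + v)) = NW x0 r a F"
 by (simp add: NW_def ifourier_shift norm_mult)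

text \<open>Modulation is a translation on the transformed side: an affine phase is free apart from
  the shift of the centre.\<close>

lemma NW_modulate:
 assumes [measurable]: "F \<in> Bm"
 shows "NW x0 r a (\<lambda>h. cis (2 * pi * (v \<bullet> h)) * F h) = NW (x0 + v) r a F"
 unfolding NW_def ifourier_modulate
 using nn_integral_lborel_translate(1)[of "\<lambda>x. ennreal (norm (ifourier F x) * wt a (r *\<^sub>R (x - (x0 + v))))" v]
 by (simp add: algebra_simps)

text \<open>The mass of the transform is dilation invariant, so only the weight changes. With
  \<open>NW_mono_r\<close> it follows that zooming in, \<open>t \<le> 1\<close>, does not increase a
  norm centred at 0.\<close>

lemma NW_scale:
 fixes F :: "real^'n::finite => complex"
 assumes [measurable]: "F \<in> Bm" and t: "0 < t"
 shows "NW x0 r a (\<lambda>h. F (t *\<^sub>R h)) = NW ((1 / t) *\<^sub>R x0) (t * r) a F"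
proof -
 have "NW x0 r a (\<lambda>h. F (t *\<^sub>R h)) = (NNI x. ennreal (1 / t ^ CARD('n)) *
   ennreal (norm (ifourier F ((1 / t) *\<^sub>R x)) * wt a (r *\<^sub>R (x - x0))))"
  unfolding NW_def ifourier_scale[OF t] using t by (simp add: ennreal_mult[symmetric])
 also have "\<dots> = ennreal (1 / t ^ CARD('n)) *
  (NNI x. ennreal (norm (ifourier F ((1 / t) *\<^sub>R x)) * wt a (r *\<^sub>R (x - x0))))"
  by (rule nn_integral_cmult) measurable
 also have "(NNI x. ennreal (norm (ifourier F ((1 / t) *\<^sub>R x)) * wt a (r *\<^sub>R (x - x0))))
   = ennreal (t ^ CARD('n)) * (NNI x. ennreal (norm (ifourier F x) * wt a (r *\<^sub>R (t *\<^sub>R x - x0))))"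
  using t by (subst nn_integral_lborel_affine[of _ t 0]) auto
 also have "(NNI x. ennreal (norm (ifourier F x) * wt a (r *\<^sub>R (t *\<^sub>R x - x0)))) = NW ((1 / t) *\<^sub>R x0) (t * r) a F"
 proof -
  have "r *\<^sub>R (t *\<^sub>R x - x0) = (t * r) *\<^sub>R (x - (1 / t) *\<^sub>R x0)" for x
   using t by (simp add: scaleR_diff_right mult.commute)
  then show ?thesis by (simp add: NW_def)
 qed
 finally show ?thesis using t by (simp add: mult.assoc[symmetric] ennreal_mult[symmetric])
qed

lemma NW_zero [simp]: "NW x0 r a (\<lambda>h. 0) = 0"
 by (simp add: NW_def ifourier_def)

lemma NW_add:
 assumes F: "L1 F" and G: "L1 G"
 shows "NW x0 r a (\<lambda>h. F h + G h) \<le> NW x0 r a F + NW x0 r a G"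
proof -
 have [measurable]: "F \<in> Bm" "G \<in> Bm" using F G by auto
 have eq: "ifourier (\<lambda>h. F h + G h) x = ifourier F x + ifourier G x" for x
  unfolding ifourier_def using integrable_cis_mult[OF F] integrable_cis_mult[OF G]
  by (simp add: distrib_right)
 show ?thesis unfolding NW_def eq
  by (subst nn_integral_add[symmetric])
   (auto intro!: nn_integral_mono simp: ennreal_plus[symmetric] distrib_right[symmetric] norm_triangle_ineq
     mult_right_mono simp del: ennreal_plus intro!: ennreal_leI)
qed

lemma NW_sum:
 assumes "finite S" "\<And>i. i \<in> S ==> L1 (F i)"
 shows "NW x0 r a (\<lambda>h. \<Sum>i\<in>S. F i h) \<le> (\<Sum>i\<in>S. NW x0 r a (F i))"
 using assms
proof (induction S rule: finite_induct)
 case (insert i S)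
 have "NW x0 r a (\<lambda>h. F i h + (\<Sum>i\<in>S. F i h)) \<le> NW x0 r a (F i) + NW x0 r a (\<lambda>h. \<Sum>i\<in>S. F i h)"
  using insert by (intro NW_add) auto
 also have "\<dots> \<le> NW x0 r a (F i) + (\<Sum>i\<in>S. NW x0 r a (F i))"
  using insert by (intro add_left_mono) auto
 finally show ?case using insert by simp
qed simp

text \<open>By inversion \<open>F y\<close> is an integral of its inverse transform against a
  unimodular factor, and the weight is at least 1.\<close>

lemma norm_le_NW:
 assumes F: "good F" and a: "0 \<le> a" and fin: "NW x0 r a F < \<infinity>"
 shows "enorm (F y) \<le> NW x0 r a F"
proof -
 have [measurable]: "F \<in> Bm" by (rule good_measurable[OF F])
 have i: "L1 (ifourier F)" by (rule NW_integrable[OF _ a fin]) simp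
 have "enorm (F y) \<le> (NNI x. enorm (ifourier F x))"
  using norm_ifourier_le_nn[of "ifourier F" "-y"] fourier_inversion[OF F i, of y]
  by (simp add: fourier_eq_ifourier)
 also have "\<dots> \<le> NW x0 r a F" unfolding NW_def
 proof (rule nn_integral_mono)
  fix x
  show "enorm (ifourier F x) \<le> ennreal (norm (ifourier F x) * wt a (r *\<^sub>R (x - x0)))"
   using wt_ge_1[OF a, of "r *\<^sub>R (x - x0)"] by (intro ennreal_leI) (metis mult.right_neutral mult_left_mono norm_ge_zero)
 qed
 finally show ?thesis .
qed

text \<open>Every term of the exponential series is a product in the algebra. The factor
  \<open>ch\<close> is needed throughout: the constant 1, the term of order 0, has no integrable
  transform.\<close>

lemma NW_exp:
 fixes E ch :: "real^'n::finite => complex"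
 assumes E: "good E" and X: "good ch" and a: "0 \<le> a"
  and B: "NW 0 r a E \<le> ennreal B" "0 \<le> B" and fin: "NW x0 r a ch < \<infinity>"
 shows "good (\<lambda>h. exp (c * E h) * ch h)"
  and "NW x0 r a (\<lambda>h. exp (c * E h) * ch h) \<le> ennreal (exp (norm c * B)) * NW x0 r a ch"
proof -
 have [measurable]: "E \<in> Bm" "ch \<in> Bm"
  using E X good_measurable by auto
 obtain D where D: "0 \<le> D" "\<And>x. norm (E x) \<le> D" using good_bound[OF E] by auto
 show "good (\<lambda>h. exp (c * E h) * ch h)"
 proof -
  obtain D' where D': "0 \<le> D'" "\<And>x. norm (ch x) \<le> D'" using good_bound[OF X] by auto
  have b: "norm (exp (c * E x)) \<le> exp (norm c * D)" for x
   using norm_exp[of "c * E x"] D(2)[of x] by (simp add: norm_mult mult_left_mono order_trans)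
  have "L1 (\<lambda>h. exp (c * E h) * ch h)"
   by (rule Bochner_Integration.integrable_bound[of _ "\<lambda>h. exp (norm c * D) * norm (ch h)"])
    (use goodD(2)[OF X] b in \<open>auto simp: norm_mult intro!: mult_right_mono\<close>)
  moreover have "bounded (range (\<lambda>h. exp (c * E h) * ch h))"
   unfolding bounded_iff using b D'
   by (auto intro!: exI[of _ "exp (norm c * D) * D'"] mult_mono simp: norm_mult simp del: norm_exp_eq_Re)
  ultimately show ?thesis
   using goodD(1)[OF E] goodD(1)[OF X] by (auto simp: good_def intro!: continuous_intros)
 qed
 \<comment> \<open>Each power keeps one copy of the cutoff, so that \<open>P k\<close> is integrable
   for \<open>k = 0\<close> too.\<close>
 define P where "P k h = E h ^ k * ch h" for k h
 have P: "good (P k) \<and> NW x0 r a (P k) \<le> ennreal (B ^ k) * NW x0 r a ch" for k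
 proof (induction k)
  case 0 then show ?case using X by (simp add: P_def)
 next
  case (Suc k)
  have eq: "P (Suc k) = (\<lambda>h. P k h * E h)" by (auto simp: P_def)
  have f: "NW x0 r a (P k) < \<infinity>" using Suc fin
   by (auto intro: order_le_less_trans simp: ennreal_mult_less_top)
  have "NW x0 r a (P (Suc k)) \<le> NW x0 r a (P k) * NW 0 r a E"
   unfolding eq using Suc goodD(2)[OF E] f a by (intro NW_mult) auto
  also have "\<dots> \<le> (ennreal (B ^ k) * NW x0 r a ch) * ennreal B"
   using Suc B by (intro mult_mono) auto
  also have "\<dots> = ennreal (B ^ Suc k) * NW x0 r a ch"
   using B by (simp add: ennreal_mult mult_ac)
  finally show ?case using Suc E by (simp add: eq good_mult)
 qed
 have [measurable]: "P k \<in> Bm" for k using P good_measurable by blast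
 define G where "G k h = (c ^ k / fact k) * P k h" for k h
 have nG: "norm (G k h) \<le> (norm c * D) ^ k / fact k * norm (ch h)" for k h
 proof -
  have "norm (G k h) = norm c ^ k / fact k * (norm (E h) ^ k * norm (ch h))"
   by (simp add: G_def P_def norm_mult norm_divide norm_power)
  also have "\<dots> \<le> norm c ^ k / fact k * (D ^ k * norm (ch h))"
   by (intro mult_left_mono mult_right_mono power_mono D) auto
  finally show ?thesis by (simp add: power_mult_distrib mult_ac)
 qed
 have sm: "summable (\<lambda>k. (norm c * D) ^ k / fact k * L)" for L
  using summable_exp[of "norm c * D"] by (intro summable_mult2) (simp add: field_simps)
 have [measurable]: "(\<lambda>(k, h). G k h) \<in> borel_measurable (count_space UNIV \<Otimes>\<^sub>M lborel)"
  by (intro measurable_pair_measure_countable1) (auto simp: G_def)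
 \<comment> \<open>The series is read as an integral over counting measure, to which
   \<open>NW_integral\<close> applies.\<close>
 interpret nat: sigma_finite_measure "count_space (UNIV :: nat set)" by (rule sigma_finite_measure_count_space)
 interpret P: pair_sigma_finite "count_space (UNIV :: nat set)" "lborel :: (real^'n) measure" ..
 have iG: "L1 (G k)" for k
  unfolding G_def by (intro integrable_mult_right goodD(2)) (use P[of k] in simp)
 have int: "integrable (count_space UNIV \<Otimes>\<^sub>M lborel) (case_prod G)"
 proof (rule P.Fubini_integrable)
  show "integrable (count_space UNIV) (\<lambda>k. LBINT h. norm (case_prod G (k, h)))"
   unfolding integrable_count_space_nat_iff
  proof (rule summable_comparison_test[OF _ sm[of "LBINT h. norm (ch h)"]], intro exI[of _ 0] allI impI)
   fix k
   have "(LBINT h. norm (G k h)) \<le> (LBINT h. (norm c * D) ^ k / fact k * norm (ch h))"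
    using nG iG goodD(2)[OF X] by (intro integral_mono) auto
   then show "norm (norm (LBINT h. norm (case_prod G (k, h)))) \<le> (norm c * D) ^ k / fact k * (LBINT h. norm (ch h))"
    by simp
  qed
 qed (use iG in auto)
 have eq: "exp (c * E h) * ch h = (LINT k|count_space UNIV. G k h)" for h
 proof -
  have "summable (\<lambda>k. norm (G k h))"
  proof (rule summable_comparison_test[OF _ sm[of "norm (ch h)"]], intro exI[of _ 0] allI impI)
   fix k show "norm (norm (G k h)) \<le> (norm c * D) ^ k / fact k * norm (ch h)"
    using nG[of k h] by (simp only: real_norm_def abs_norm_cancel)
  qed
  then have "(LINT k|count_space UNIV. G k h) = (\<Sum>k. G k h)"
   by (intro integral_count_space_nat) (simp add: integrable_count_space_nat_iff)
  also have "(\<lambda>k. G k h) sums (exp (c * E h) * ch h)"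
   using sums_mult2[OF exp_converges[of "c * E h"], of "ch h"]
   by (simp add: G_def P_def scaleR_conv_of_real power_mult_distrib field_simps)
  then have "(\<Sum>k. G k h) = exp (c * E h) * ch h" by (rule sums_unique[symmetric])
  finally show ?thesis ..
 qed
 have "NW x0 r a (\<lambda>h. exp (c * E h) * ch h) \<le> (\<integral>\<^sup>+k. NW x0 r a (G k) \<partial>count_space UNIV)"
  unfolding eq by (rule NW_integral[OF _ int]) unfold_locales
 also have "\<dots> = (\<Sum>k. NW x0 r a (G k))" by (rule nn_integral_count_space_nat)
 also have "\<dots> \<le> (\<Sum>k. ennreal ((norm c * B) ^ k / fact k) * NW x0 r a ch)"
 proof (intro suminf_le allI)
  fix k
  have "NW x0 r a (G k) = ennreal (norm c ^ k / fact k) * NW x0 r a (P k)"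
   unfolding G_def by (subst NW_cmult) (auto simp: norm_divide norm_power)
  also have "\<dots> \<le> ennreal (norm c ^ k / fact k) * (ennreal (B ^ k) * NW x0 r a ch)"
   using P by (intro mult_left_mono) auto
  finally show "NW x0 r a (G k) \<le> ennreal ((norm c * B) ^ k / fact k) * NW x0 r a ch"
   using B by (simp add: mult.assoc[symmetric] ennreal_mult[symmetric] power_mult_distrib)
 qed auto
 also have "\<dots> = (\<Sum>k. ennreal ((norm c * B) ^ k / fact k)) * NW x0 r a ch"
  by (rule ennreal_suminf_multc)
 also have "(\<Sum>k. ennreal ((norm c * B) ^ k / fact k)) = ennreal (exp (norm c * B))"
 proof -
  have "(\<lambda>k. (norm c * B) ^ k / fact k) sums exp (norm c * B)"
   using exp_converges[of "norm c * B"] by (simp add: field_simps)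
  then show ?thesis using B
   by (subst suminf_ennreal2) (auto simp: sums_iff)
 qed
 finally show "NW x0 r a (\<lambda>h. exp (c * E h) * ch h) \<le> ennreal (exp (norm c * B)) * NW x0 r a ch" .
qed

section \<open>Decay in space and frequency\<close>

text \<open>A symmetric substitute for the Schwartz class at finite order: decay of a function and
  of its transform, without derivatives. It is preserved by the Fourier transform and easy to
  construct on compactly supported functions.\<close>

definition dec :: "real => (real^'n::finite => complex) => bool" where
 "dec K F \<longleftrightarrow> continuous_on UNIV F \<and>
  (\<exists>C\<ge>0. \<forall>x. norm (F x) \<le> C * wt (- K) x \<and> norm (ifourier F x) \<le> C * wt (- K) x)"

lemma dec_bounds:
 "dec K F ==> \<exists>C\<ge>0. (\<forall>x. norm (F x) \<le> C * wt (- K) x) \<and> (\<forall>x. norm (ifourier F x) \<le> C * wt (- K) x)"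
 unfolding dec_def by blast

lemma dec_measurable: "dec K F ==> F \<in> Bm"
 unfolding dec_def by (auto intro: borel_measurable_continuous_onI)

lemma integrable_wt_bound:
 fixes F :: "real^'n::finite => 'b::{banach,second_countable_topology}"
 assumes [measurable]: "F \<in> Bm" and b: "\<And>x. norm (F x) \<le> C * wt (- K) x"
  and K: "real CARD('n) < K"
 shows "L1 F"
proof (rule Bochner_Integration.integrable_bound)
 show "L1 (\<lambda>x::real^'n. C * wt (- K) x)" using wt_integrable[where 'a="real^'n"] K by simp
 show "AE x in lborel. norm (F x) \<le> norm (C * wt (- K) x)"
  using b by (intro AE_I2) (metis abs_le_D1 abs_of_nonneg norm_ge_zero order_trans real_norm_def abs_ge_self)
qed simp

lemma dec_mono: "dec K F ==> K' \<le> K ==> dec K' F"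
proof -
 assume F: "dec K F" and K: "K' \<le> K"
 obtain C where C: "C \<ge> 0" "\<And>x. norm (F x) \<le> C * wt (- K) x" "\<And>x. norm (ifourier F x) \<le> C * wt (- K) x"
  using dec_bounds[OF F] by auto
 have "C * wt (- K) x \<le> C * wt (- K') x" for x using C(1) K by (intro mult_left_mono wt_mono) auto
 then show ?thesis using C F unfolding dec_def by (meson order_trans)
qed

lemma dec_good:
 fixes F :: "real^'n::finite => complex"
 assumes F: "dec K F" and K: "real CARD('n) < K" shows "good F"
proof -
 obtain C where C: "C \<ge> 0" "\<And>x. norm (F x) \<le> C * wt (- K) x" using dec_bounds[OF F] by auto
 have "norm (F x) \<le> C" for x
  using C(2)[of x] wt_le_1[of "-K" x] C(1) K by (meson mult_left_le order_trans neg_le_0_iff_le of_nat_0_le_iff less_imp_le)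
 then have "bounded (range F)" unfolding bounded_iff by auto
 moreover have "L1 F" by (rule integrable_wt_bound[OF dec_measurable[OF F] C(2) K])
 ultimately show ?thesis using F by (simp add: good_def dec_def)
qed

lemma dec_integrable_ifourier:
 fixes F :: "real^'n::finite => complex"
 assumes F: "dec K F" and K: "real CARD('n) < K" shows "L1 (ifourier F)"
proof -
 have [measurable]: "F \<in> Bm" by (rule dec_measurable[OF F])
 obtain C where C: "C \<ge> 0" "\<And>x. norm (ifourier F x) \<le> C * wt (- K) x" using dec_bounds[OF F] by auto
 show ?thesis by (rule integrable_wt_bound[OF _ C(2) K]) measurable
qed

lemma NW_wt_bound:
 fixes F :: "real^'n::finite => complex"
 assumes b: "\<And>x. norm (ifourier F x) \<le> C * wt (- K) x" and K: "real CARD('n) + a < K" and C: "0 \<le> C"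
 shows "NW 0 1 a F \<le> ennreal (C * wint TYPE(real^'n) (K - a))"
proof -
 have "NW 0 1 a F \<le> (NNI (x::real^'n). ennreal C * ewt (- (K - a)) x)"
  unfolding NW_def
 proof (rule nn_integral_mono)
  fix x :: "real^'n"
  have "norm (ifourier F x) * wt a x \<le> (C * wt (- K) x) * wt a x" by (intro mult_right_mono b) simp
  also have "\<dots> = C * wt (- (K - a)) x" by (simp add: mult.assoc wt_mult add.commute)
  finally show "ennreal (norm (ifourier F x) * wt a (1 *\<^sub>R (x - 0))) \<le> ennreal C * ewt (- (K - a)) x"
   using C by (simp add: ennreal_mult[symmetric] ennreal_leI)
 qed
 also have "\<dots> = ennreal C * ennreal (wint TYPE(real^'n) (K - a))"
  using K wint_eq[where 'a="real^'n", of "K - a"] by (subst nn_integral_cmult) auto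
 finally show ?thesis using C by (simp add: ennreal_mult)
qed

lemma dec_NW_finite:
 fixes F :: "real^'n::finite => complex"
 assumes F: "dec K F" and K: "real CARD('n) + a < K" shows "NW 0 1 a F < \<infinity>"
proof -
 obtain C where C: "C \<ge> 0" "\<And>x. norm (ifourier F x) \<le> C * wt (- K) x" using dec_bounds[OF F] by auto
 show ?thesis using NW_wt_bound[OF C(2) K C(1)] by (auto intro: order_le_less_trans)
qed

lemma dec_cnj: "dec K F ==> dec K (\<lambda>x. cnj (F x))"
 unfolding dec_def by (auto simp: ifourier_cnj intro!: continuous_intros) (metis wt_minus_arg)

lemma ifourier_reflect: "ifourier (\<lambda>h. F (- h)) x = ifourier F (- x)"
 unfolding ifourier_def
 using integral_lborel_translate(4)[of "\<lambda>\<xi>. F \<xi> * cis (2 * pi * (- x \<bullet> \<xi>))"] by simp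

lemma ifourier_fourier:
 fixes F :: "real^'n::finite => complex"
 assumes F: "dec K F" and K: "real CARD('n) < K" shows "ifourier (fourier F) x = F x"
proof -
 have "fourier F = (\<lambda>\<xi>. ifourier F (- \<xi>))" by (rule ext) (rule fourier_eq_ifourier)
 then have "ifourier (fourier F) x = fourier (ifourier F) x"
  by (simp add: ifourier_reflect fourier_eq_ifourier)
 then show ?thesis using fourier_inversion[OF dec_good[OF F K] dec_integrable_ifourier[OF F K]] by simp
qed

lemma dec_fourier:
 fixes F :: "real^'n::finite => complex"
 assumes F: "dec K F" and K: "real CARD('n) < K" shows "dec K (fourier F)"
proof -
 obtain C where C: "C \<ge> 0" "\<And>x. norm (F x) \<le> C * wt (- K) x" "\<And>x. norm (ifourier F x) \<le> C * wt (- K) x"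
  using dec_bounds[OF F] by auto
 have "continuous_on UNIV (\<lambda>x. ifourier F (- x))"
  by (rule continuous_on_compose2[OF ifourier_continuous[OF goodD(2)[OF dec_good[OF F K]]]]) (auto intro!: continuous_intros)
 moreover have "ifourier (fourier F) x = F x" for x by (rule ifourier_fourier[OF F K])
 moreover have "norm (fourier F x) \<le> C * wt (- K) x" for x
  using C(3)[of "-x"] by (simp add: fourier_eq_ifourier)
 moreover have "fourier F = (\<lambda>x. ifourier F (- x))" by (rule ext) (rule fourier_eq_ifourier)
 ultimately show ?thesis using C unfolding dec_def by auto
qed

text \<open>Multiplication by a coordinate is approximated by \<open>(cis (2 \<pi> \<delta> y\<^sub>i) - 1) / (2 \<pi> \<i> \<delta>)\<close>, which
 is a difference quotient on the Fourier side; \<open>\<delta> = wt (- K / 2) x\<close> balances the two errors.\<close>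
lemma dec_coord:
 fixes F :: "real^'n::finite => complex"
 assumes F: "dec K F" and K: "real CARD('n) + 2 < K"
 shows "dec (K / 2) (\<lambda>y. cor (y $ i) * F y)"
proof -
 have [measurable]: "F \<in> Bm" by (rule dec_measurable[OF F])
 have K2: "2 < K" using K by (metis add_strict_increasing of_nat_0_le_iff add.commute add_0 order_le_less_trans le_add_same_cancel2)
 obtain C where C: "C \<ge> 0" "\<And>x. norm (F x) \<le> C * wt (- K) x" "\<And>x. norm (ifourier F x) \<le> C * wt (- K) x"
  using dec_bounds[OF F] by auto
 have ni: "\<bar>y $ i\<bar> \<le> wt 1 y" for y :: "real^'n"
  using component_le_norm_cart[of y i] by (simp add: wt_def)
 have b1: "norm (cor (y $ i) * F y) \<le> C * wt (- (K - 1)) y" for y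
 proof -
  have "\<bar>y $ i\<bar> * norm (F y) \<le> wt 1 y * (C * wt (- K) y)" using C ni by (intro mult_mono) auto
  also have "\<dots> = C * (wt 1 y * wt (- K) y)" by simp
  finally show ?thesis by (simp add: wt_mult norm_mult)
 qed
 have b2: "norm (cor ((y $ i)^2) * F y) \<le> C * wt (- (K - 2)) y" for y
 proof -
  have "\<bar>y $ i\<bar> * \<bar>y $ i\<bar> \<le> wt 1 y * wt 1 y" by (intro mult_mono ni) auto
  then have "(y $ i)^2 \<le> wt 2 y" by (simp add: power2_eq_square wt_mult abs_mult[symmetric])
  then have "(y $ i)^2 * norm (F y) \<le> wt 2 y * (C * wt (- K) y)" using C by (intro mult_mono) auto
  also have "\<dots> = C * (wt 2 y * wt (- K) y)" by simp
  finally show ?thesis by (simp add: wt_mult norm_mult norm_power)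
 qed
 have FI: "L1 F" by (rule goodD(2)[OF dec_good[OF F]]) (use K in simp)
 have i1: "L1 (\<lambda>y. cor (y $ i) * F y)"
  by (rule integrable_wt_bound[OF _ b1]) (use K in auto)
 have i2: "L1 (\<lambda>y. cor ((y $ i)^2) * F y)"
  by (rule integrable_wt_bound[OF _ b2]) (use K in auto)
 define D where "D = (LBINT y. norm (cor ((y $ i)^2) * F y))"
 have D: "0 \<le> D" unfolding D_def by simp
 define e where "e = (axis i 1 :: real^'n)"
 have ye: "d *\<^sub>R e \<bullet> y = d * y $ i" for y d by (simp add: e_def inner_axis' mult.commute)
 have main: "norm (ifourier (\<lambda>y. cor (y $ i) * F y) x) \<le> (C * (2 powr K + 1) + 2 * pi * D) * wt (- (K / 2)) x" for x
 proof -
  define d where "d = wt (- (K / 2)) x"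
  have d: "0 < d" "d \<le> 1" using wt_le_1[of "- (K/2)" x] K2 by (auto simp: d_def)
  define Q where "Q y = (cis (2 * pi * (d *\<^sub>R e \<bullet> y)) * F y - F y) * (1 / (2 * pi * \<i> * d))" for y
  have iQ: "L1 Q" unfolding Q_def using FI integrable_cis_mult[OF FI]
   by (intro integrable_mult_left Bochner_Integration.integrable_diff) (auto simp: mult.commute)
  have Qx: "ifourier Q x = (ifourier F (x + d *\<^sub>R e) - ifourier F x) * (1 / (2 * pi * \<i> * d))"
  proof -
   have "L1 (\<lambda>y. cis (2 * pi * (d *\<^sub>R e \<bullet> y)) * F y * cis (2 * pi * (x \<bullet> y)))"
    using integrable_cis_mult[OF integrable_cis_mult[OF FI]] by (simp add: mult_ac)
   then have "ifourier Q x = (ifourier (\<lambda>y. cis (2 * pi * (d *\<^sub>R e \<bullet> y)) * F y) x - ifourier F x) * (1 / (2 * pi * \<i> * d))"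
    unfolding ifourier_def Q_def using integrable_cis_mult[OF FI]
    by (subst Bochner_Integration.integral_diff[symmetric])
      (auto simp: algebra_simps integral_mult_left_zero[symmetric] simp del: integral_mult_left_zero integral_mult_right_zero intro!: Bochner_Integration.integral_cong)
   then show ?thesis by (simp only: ifourier_modulate)
  qed
  have "norm (ifourier Q x) \<le> (C * (2 powr K + 1)) * wt (- K) x / d"
  proof -
   have "norm (ifourier F (x + d *\<^sub>R e)) \<le> C * wt (- K) (x + d *\<^sub>R e)" by (rule C)
   also have "\<dots> \<le> C * (wt (- K) x * 2 powr K)"
   proof (intro mult_left_mono C)
    have "wt (- K) (x + d *\<^sub>R e) \<le> wt (- K) x * wt K (d *\<^sub>R e)"
     using wt_peetre[of "- K" "x + d *\<^sub>R e" x] K2 by simp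
    also have "wt K (d *\<^sub>R e) \<le> 2 powr K"
     unfolding wt_def using d K2 by (intro powr_mono2) (auto simp: e_def)
    finally show "wt (- K) (x + d *\<^sub>R e) \<le> wt (- K) x * 2 powr K" by (simp add: mult_left_mono)
   qed
   finally have "norm (ifourier F (x + d *\<^sub>R e) - ifourier F x) \<le> C * (2 powr K + 1) * wt (- K) x"
    using C(3)[of x] norm_triangle_ineq4[of "ifourier F (x + d *\<^sub>R e)" "ifourier F x"]
    by (simp add: algebra_simps)
   moreover have "norm (1 / (2 * pi * \<i> * d)) \<le> 1 / d"
    using d pi_gt3 by (simp add: norm_divide norm_mult field_simps)
   ultimately have "norm (ifourier F (x + d *\<^sub>R e) - ifourier F x) * norm (1 / (2 * pi * \<i> * d))
     \<le> (C * (2 powr K + 1) * wt (- K) x) * (1 / d)"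
    using C(1) by (intro mult_mono) auto
   then show ?thesis unfolding Qx by (simp only: norm_mult) simp
  qed
  \<comment> \<open>Since \<open>d\<close> is the square root of \<open>wt (- K) x\<close>, this
    error becomes a multiple of \<open>d\<close>, as the next one will; half of the order is lost in
    the process.\<close>
  also have "(C * (2 powr K + 1)) * wt (- K) x / d = (C * (2 powr K + 1)) * d"
  proof -
   have "wt (- K) x = d * d" by (simp add: d_def wt_mult)
   then show ?thesis using d by simp
  qed
  finally have q1: "norm (ifourier Q x) \<le> (C * (2 powr K + 1)) * d" .
  have q2: "norm (ifourier (\<lambda>y. cor (y $ i) * F y) x - ifourier Q x) \<le> 2 * pi * D * d"
  proof -
   have "ifourier (\<lambda>y. cor (y $ i) * F y) x - ifourier Q x = ifourier (\<lambda>y. cor (y $ i) * F y - Q y) x"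
    unfolding ifourier_def left_diff_distrib
    by (rule Bochner_Integration.integral_diff[symmetric]) (intro integrable_cis_mult i1 iQ, simp)+
   also have "norm \<dots> \<le> (LBINT y. norm (cor (y $ i) * F y - Q y))"
    by (rule norm_ifourier_le) (intro Bochner_Integration.integrable_diff i1 iQ)
   also have "\<dots> \<le> (LBINT y. (2 * pi * d) * norm (cor ((y $ i)^2) * F y))"
   proof (rule integral_mono)
    show "L1 (\<lambda>y. norm (cor (y $ i) * F y - Q y))"
     by (intro integrable_norm Bochner_Integration.integrable_diff i1 iQ)
    show "L1 (\<lambda>y. (2 * pi * d) * norm (cor ((y $ i)^2) * F y))"
     by (intro integrable_mult_right integrable_norm i2)
    fix y :: "real^'n"
    define b where "b = 2 * pi * d * (y $ i)"
    \<comment> \<open>What remains of \<open>cis\<close> after its linear term is quadratic in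
      \<open>d\<close>; division by \<open>d\<close> leaves one power of \<open>d\<close> times the
      second moment \<open>D\<close>.\<close>
    have e1: "norm (cis b - (1 + \<i> * b)) \<le> b^2"
    proof -
     have "norm (cis b - (1 + \<i> * b)) \<le> \<bar>b\<bar> ^ 2 / 2"
      using iexp_approx1[of b 1] by (simp add: cis_conv_exp numeral_2_eq_2)
     also have "\<dots> \<le> b^2" by simp
     finally show ?thesis .
    qed
    have "cor (y $ i) * F y - Q y = - (cis b - (1 + \<i> * b)) * F y * (1 / (2 * pi * \<i> * d))"
     using d unfolding Q_def ye b_def by (simp add: field_simps)
    then have "norm (cor (y $ i) * F y - Q y) = norm (cis b - (1 + \<i> * b)) * norm (F y) * (1 / (2 * pi * d))"
     using d by (simp add: norm_mult norm_divide norm_minus_commute)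
    also have "\<dots> \<le> b^2 * norm (F y) * (1 / (2 * pi * d))"
     using d by (intro mult_right_mono e1) auto
    also have "\<dots> = (2 * pi * d) * norm (cor ((y $ i)^2) * F y)"
     using d by (simp add: b_def power2_eq_square norm_mult field_simps)
    finally show "norm (cor (y $ i) * F y - Q y) \<le> (2 * pi * d) * norm (cor ((y $ i)^2) * F y)" .
   qed
   also have "\<dots> = 2 * pi * D * d" by (simp add: D_def)
   finally show ?thesis .
  qed
  show ?thesis using q1 q2 norm_triangle_sub[of "ifourier (\<lambda>y. cor (y $ i) * F y) x" "ifourier Q x"]
   unfolding d_def[symmetric] by (simp add: algebra_simps)
 qed
 let ?C = "C * (2 powr K + 1) + 2 * pi * D"
 have Cle: "C \<le> ?C" using C(1) D by (simp add: algebra_simps add_increasing)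
 have "norm (cor (y $ i) * F y) \<le> ?C * wt (- (K / 2)) y" for y
 proof -
  have "C * wt (- (K - 1)) y \<le> ?C * wt (- (K / 2)) y"
   using Cle K2 C(1) by (intro mult_mono wt_mono) auto
  then show ?thesis using b1[of y] by linarith
 qed
 moreover have "continuous_on UNIV (\<lambda>y. cor (y $ i) * F y)"
  using F unfolding dec_def by (auto intro!: continuous_intros)
 ultimately show ?thesis unfolding dec_def using main Cle C(1)
  by (intro conjI exI[of _ ?C]) auto
qed

text \<open>The bound is the geometric mean of the trivial frequency-side bound, which decays in \<open>a - b\<close>,
 and of the convolution bound, which decays in \<open>x\<close>.\<close>
lemma dec_product_shift:
 fixes F G :: "real^'n::finite => complex"
 assumes F: "dec K F" and G: "dec K G" and L: "0 \<le> L" "real CARD('n) < K - 2 * L"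
 obtains C where "0 \<le> C"
  "\<And>a b x. norm (ifourier (\<lambda>h. F (h - a) * G (h - b)) x) \<le> C * wt (- L) (a - b) * wt (- L) x"
proof -
 \<comment> \<open>\<open>K = 2 * L + l\<close>: the part \<open>l\<close> pays for integrability,
   and the order \<open>2 * L\<close> becomes \<open>L\<close> under the square root in the
   geometric mean.\<close>
 define l where "l = K - 2 * L"
 have l: "real CARD('n) < l" "K = 2 * L + l" using L by (auto simp: l_def)
 have K: "real CARD('n) < K" using L by simp
 have [measurable]: "F \<in> Bm" "G \<in> Bm"
  using F G dec_measurable by auto
 obtain A where A: "A \<ge> 0" "\<And>x. norm (F x) \<le> A * wt (- K) x" "\<And>x. norm (ifourier F x) \<le> A * wt (- K) x"
  using dec_bounds[OF F] by auto
 obtain B where B: "B \<ge> 0" "\<And>x. norm (G x) \<le> B * wt (- K) x" "\<And>x. norm (ifourier G x) \<le> B * wt (- K) x"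
  using dec_bounds[OF G] by auto
 define C where "C = A * B * wint TYPE(real^'n) l"
 have C: "0 \<le> C" using A B by (simp add: C_def)
 have conv: "(NNI x. ennreal ((A * wt (- K) (x - u)) * (B * wt (- K) (x - v)))) \<le> ennreal (C * wt (- (2 * L)) (u - v))" for u v :: "real^'n"
 proof -
  have "(NNI x. ennreal ((A * wt (- K) (x - u)) * (B * wt (- K) (x - v)))) =
   (NNI x. ennreal (A * B) * ennreal (wt (- (2 * L + l)) (x - u) * wt (- (2 * L + l)) (x - v)))"
   using A B l by (intro nn_integral_cong) (simp add: ennreal_mult[symmetric] mult_ac)
  also have "\<dots> = ennreal (A * B) * (NNI x. ennreal (wt (- (2 * L + l)) (x - u) * wt (- (2 * L + l)) (x - v)))"
   by (rule nn_integral_cmult) measurable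
  also have "\<dots> \<le> ennreal (A * B) * ennreal (wint TYPE(real^'n) l * wt (- (2 * L)) (u - v))"
   using L l by (intro mult_left_mono wt_convolution_le) auto
  finally show ?thesis using A B by (simp add: ennreal_mult[symmetric] C_def mult_ac)
 qed
 have FG: "norm (ifourier (\<lambda>h. F (h - a) * G (h - b)) x) \<le> C * wt (- (2 * L)) (a - b)" for a b x
 proof -
  have "enorm (ifourier (\<lambda>h. F (h - a) * G (h - b)) x) \<le> (NNI h. enorm (F (h - a) * G (h - b)))"
   by (rule norm_ifourier_le_nn)
  also have "\<dots> \<le> (NNI h. ennreal ((A * wt (- K) (h - a)) * (B * wt (- K) (h - b))))"
   using A B by (intro nn_integral_mono ennreal_leI) (auto simp: norm_mult intro!: mult_mono)
  also have "\<dots> \<le> ennreal (C * wt (- (2 * L)) (a - b))" by (rule conv)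
  finally show ?thesis using C by simp
 qed
 have Fs: "ifourier (\<lambda>h. F (h - a)) x = cis (2 * pi * (x \<bullet> a)) * ifourier F x" for a x
  using ifourier_shift[of F "-a" x] by simp
 have Gs: "ifourier (\<lambda>h. G (h - a)) x = cis (2 * pi * (x \<bullet> a)) * ifourier G x" for a x
  using ifourier_shift[of G "-a" x] by simp
 have FGx: "norm (ifourier (\<lambda>h. F (h - a) * G (h - b)) x) \<le> C * wt (- (2 * L)) x" for a b x
 proof -
  have gF: "good (\<lambda>h. F (h - a))"
  proof -
   have "good F" by (rule dec_good[OF F K])
   moreover have "range (\<lambda>h. F (h - a)) \<subseteq> range F" by auto
   ultimately show ?thesis unfolding good_def
    by (auto intro: bounded_subset integrable_lborel_translate intro!: continuous_on_compose2[of UNIV F] continuous_intros)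
  qed
  have iF: "L1 (ifourier (\<lambda>h. F (h - a)))"
  proof -
   have "ifourier (\<lambda>h. F (h - a)) = (\<lambda>x. ifourier F x * cis (2 * pi * (x \<bullet> a)))" by (auto simp: Fs mult.commute)
   then show ?thesis using integrable_cis_mult[OF dec_integrable_ifourier[OF F K]] by simp
  qed
  have iG: "L1 (\<lambda>h. G (h - b))"
   using goodD(2)[OF dec_good[OF G K]] by (rule integrable_lborel_translate)
  have "enorm (ifourier (\<lambda>h. F (h - a) * G (h - b)) x) \<le>
   (NNI y. enorm (ifourier (\<lambda>h. F (h - a)) y * ifourier (\<lambda>h. G (h - b)) (x - y)))"
   unfolding ifourier_mult[OF gF iF iG] by (rule norm_integral_le_nn)
  also have "\<dots> \<le> (NNI y. ennreal ((A * wt (- K) (y - 0)) * (B * wt (- K) (y - x))))"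
  proof (intro nn_integral_mono ennreal_leI)
   fix y
   show "norm (ifourier (\<lambda>h. F (h - a)) y * ifourier (\<lambda>h. G (h - b)) (x - y)) \<le> A * wt (- K) (y - 0) * (B * wt (- K) (y - x))"
    unfolding Fs Gs norm_mult norm_cis mult_1 wt_commute[of _ y x]
    using A B by (intro mult_mono) auto
  qed
  also have "\<dots> \<le> ennreal (C * wt (- (2 * L)) (0 - x))" by (rule conv)
  finally show ?thesis using C by simp
 qed
 show ?thesis
 proof (rule that[OF C])
  fix a b x
  let ?z = "norm (ifourier (\<lambda>h. F (h - a) * G (h - b)) x)"
  have "?z * ?z \<le> (C * wt (- (2 * L)) (a - b)) * (C * wt (- (2 * L)) x)"
   using FG[of a b x] FGx[of a b x] C by (intro mult_mono) auto
  also have "\<dots> = (C * wt (- L) (a - b) * wt (- L) x)^2"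
   using wt_mult[of "-L" "a - b" "-L"] wt_mult[of "-L" x "-L"] by (simp add: power2_eq_square mult_ac)
  finally have "?z^2 \<le> (C * wt (- L) (a - b) * wt (- L) x)^2" by (simp add: power2_eq_square)
  then show "?z \<le> C * wt (- L) (a - b) * wt (- L) x" using C by (auto intro: power2_le_imp_le)
 qed
qed

section \<open>Bump functions and Schwartz functions\<close>

lemma convolution_good:
 fixes F G :: "real^'n::finite => complex"
 assumes F: "L1 F" and G: "good G"
 shows "good (\<lambda>y. LBINT z. F z * G (y - z))"
  and "ifourier (\<lambda>y. LBINT z. F z * G (y - z)) x = ifourier F x * ifourier G x"
proof -
 have [measurable]: "F \<in> Bm" "G \<in> Bm"
  using F G good_measurable by auto
 obtain B where B: "0 \<le> B" "\<And>x. norm (G x) \<le> B" using good_bound[OF G] by auto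
 have FGb: "norm (F z * G (y - z)) \<le> B * norm (F z)" for y z
  using mult_left_mono[OF B(2)[of "y - z"], of "norm (F z)"] by (simp add: norm_mult mult.commute)
 have FG: "L1 (\<lambda>z. F z * G (y - z))" for y
  by (rule Bochner_Integration.integrable_bound[of _ "\<lambda>z. B * norm (F z)"])
   (use F B FGb in auto)
 have iG: "L1 (\<lambda>h. G (h - z))" for z
  using goodD(2)[OF G] by (rule integrable_lborel_translate)
 have int: "integrable (lborel \<Otimes>\<^sub>M lborel) (case_prod (\<lambda>z h. F z * G (h - z)))"
 proof (rule lborel_pair.Fubini_integrable)
  have "L1 (\<lambda>z. norm (F z) * (LBINT h. norm (G h)))" using F by simp
  moreover have "(LBINT h. norm (G (h - z))) = (LBINT h. norm (G h))" for z
   by (rule integral_lborel_translate(2))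
  ultimately show "L1 (\<lambda>x. LBINT y. norm (case (x, y) of (z, h) => F z * G (h - z)))"
   by (simp add: norm_mult)
 qed (use iG in auto)
 show "ifourier (\<lambda>y. LBINT z. F z * G (y - z)) x = ifourier F x * ifourier G x"
 proof -
  have "ifourier (\<lambda>y. LBINT z. F z * G (y - z)) x = (LBINT z. ifourier (\<lambda>y. F z * G (y - z)) x)"
   by (rule ifourier_Fubini[OF _ int]) (rule sigma_finite_lborel)
  also have "\<dots> = (LBINT z. F z * cis (2 * pi * (x \<bullet> z)) * ifourier G x)"
  proof (intro Bochner_Integration.integral_cong refl)
   fix z
   show "ifourier (\<lambda>y. F z * G (y - z)) x = F z * cis (2 * pi * (x \<bullet> z)) * ifourier G x"
    using ifourier_shift[of G "-z" x] by (simp add: ifourier_cmult)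
  qed
  finally show ?thesis by (simp add: ifourier_def)
 qed
 have "continuous_on UNIV (\<lambda>y. LBINT z. F z * G (y - z))"
  unfolding continuous_on_sequentially
 proof (intro allI ballI impI, elim conjE)
  fix y a assume y: "y \<longlonglongrightarrow> (a::real^'n)"
  have "(\<lambda>k. LBINT z. F z * G (y k - z)) \<longlonglongrightarrow> (LBINT z. F z * G (a - z))"
  proof (rule integral_dominated_convergence[where w="\<lambda>z. B * norm (F z)"])
   show "AE z in lborel. (\<lambda>k. F z * G (y k - z)) \<longlonglongrightarrow> F z * G (a - z)"
   proof (rule AE_I2)
    fix z :: "real^'n"
    have "isCont G (a - z)" using goodD(1)[OF G] by (simp add: continuous_on_eq_continuous_at)
    then have "(\<lambda>k. G (y k - z)) \<longlonglongrightarrow> G (a - z)"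
     by (rule isCont_tendsto_compose) (intro tendsto_intros y)
    then show "(\<lambda>k. F z * G (y k - z)) \<longlonglongrightarrow> F z * G (a - z)" by (intro tendsto_intros)
   qed
  qed (use F FGb in auto)
  then show "((\<lambda>y. LBINT z. F z * G (y - z)) \<circ> y) \<longlonglongrightarrow> (LBINT z. F z * G (a - z))" by (simp add: o_def)
 qed
 moreover have "L1 (\<lambda>y. LBINT z. F z * G (y - z))"
  using lborel_pair.integrable_snd[OF int] by simp
 moreover have "norm (LBINT z. F z * G (y - z)) \<le> (LBINT z. B * norm (F z))" for y
 proof -
  have "norm (LBINT z. F z * G (y - z)) \<le> (LBINT z. norm (F z * G (y - z)))" by (rule integral_norm_bound)
  also have "\<dots> \<le> (LBINT z. B * norm (F z))"
   using F FG FGb by (intro integral_mono) auto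
  finally show ?thesis .
 qed
 ultimately show "good (\<lambda>y. LBINT z. F z * G (y - z))" unfolding good_def bounded_iff by blast
qed

lemma integrable_compact_support:
 fixes F :: "real^'n::finite => 'b::{banach,second_countable_topology}"
 assumes c: "continuous_on UNIV F" and z: "\<And>y. r \<le> norm y ==> F y = 0"
 shows "L1 F" "bounded (range F)"
proof -
 have eq: "F = (\<lambda>y. indicator (cball 0 r) y *\<^sub>R F y)"
  using z by (auto simp: fun_eq_iff indicator_def)
 have "L1 (\<lambda>y. indicator (cball 0 r) y *\<^sub>R F y)"
  by (rule borel_integrable_compact) (auto intro: continuous_on_subset[OF c])
 then show "L1 F" using eq by metis
 have "bounded (F ` cball 0 r)" by (intro compact_imp_bounded compact_continuous_image continuous_on_subset[OF c]) auto
 moreover have "range F \<subseteq> insert 0 (F ` cball 0 r)"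
 proof (rule image_subsetI)
  fix y show "F y \<in> insert 0 (F ` cball 0 r)"
   using z[of y] by (cases "norm y \<le> r") auto
 qed
 ultimately show "bounded (range F)" using bounded_subset bounded_insert by metis
qed

lemma good_compact_support:
 assumes "continuous_on UNIV F" and "\<And>y. r \<le> norm y ==> F y = 0"
 shows "good F"
 using integrable_compact_support[of F r] assms by (auto simp: good_def)

definition tent :: "real => real^'n::finite => complex" where
 "tent r y = cor (max 0 (1 - norm y / r))"

lemma tent_continuous: "0 < r ==> continuous_on UNIV (tent r)"
 unfolding tent_def by (auto intro!: continuous_intros)

lemma tent_outside: "0 < r ==> r \<le> norm y ==> tent r y = 0"
 by (simp add: tent_def)

lemma tent_integral:
 assumes r: "0 < r"
 shows "(LBINT y. (tent r :: real^'n::finite => complex) y) \<noteq> 0"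
proof -
 define f where "f y = max 0 (1 - norm y / r)" for y :: "real^'n"
 have bf: "tent r = (\<lambda>y. cor (f y))" by (auto simp: tent_def f_def)
 have fc: "continuous_on UNIV f" unfolding f_def using r by (auto intro!: continuous_intros)
 have fi: "L1 f" by (rule integrable_compact_support(1)[OF fc, of r]) (use r in \<open>simp add: f_def\<close>)
 have [measurable]: "f \<in> Bm" using fi by auto
 have "(LBINT y. f y) \<noteq> 0"
 proof
  assume "(LBINT y. f y) = 0"
  then have ae: "AE y in lborel. f y = 0"
   using fi by (subst (asm) integral_nonneg_eq_0_iff_AE) (auto simp: f_def)
  have "{y \<in> space lborel. \<not> f y = 0} \<in> sets lborel" by measurable
  from AE_iff_null[OF this] ae have "{y. f y \<noteq> 0} \<in> null_sets lborel" by simp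
  moreover have "ball (0::real^'n) r \<subseteq> {y. f y \<noteq> 0}" using r by (auto simp: f_def)
  ultimately have "emeasure lborel (ball (0::real^'n) r) = 0"
   by (metis null_setsD1 null_sets_subset open_ball borel_open sets_lborel)
  moreover have "0 < unit_ball_vol (real CARD('n)) * r ^ CARD('n)" using r by (intro mult_pos_pos) auto
  ultimately show False using r by (simp add: emeasure_ball ennreal_eq_0_iff)
 qed
 then show ?thesis by (simp add: bf)
qed

text \<open>Shifting by half a period \<open>x / (2 |x|^2)\<close> changes the sign of the oscillating factor, so the
 Lipschitz bound of the tent gives one order of decay.\<close>
lemma tent_decay:
 assumes r: "0 < r"
 shows "\<exists>C\<ge>0. \<forall>x. norm (ifourier (tent r :: real^'n::finite => complex) x) \<le> C * wt (- 1) x"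
proof -
 let ?b = "tent r :: real^'n => complex"
 have c: "continuous_on UNIV ?b" unfolding tent_def using r by (auto intro!: continuous_intros)
 have z: "r \<le> norm y ==> ?b y = 0" for y using r by (simp add: tent_def)
 note i = integrable_compact_support(1)[OF c z]
 have [measurable]: "?b \<in> Bm" using i by auto
 define V where "V = measure lborel (cball (0::real^'n) (r + 1))"
 define A where "A = (LBINT y. norm (?b y))"
 have fin: "emeasure lborel (cball (0::real^'n) (r + 1)) < \<infinity>" by (rule emeasure_compact_finite) simp
 have A: "0 \<le> A" "0 \<le> V" by (auto simp: A_def V_def)
 have small: "norm (ifourier ?b x) \<le> A" for x unfolding A_def by (rule norm_ifourier_le[OF i])
 have large: "norm (ifourier ?b x) \<le> V / r / norm x" if x: "1 \<le> norm x" for x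
 proof -
  define v where "v = (1 / (2 * (norm x)^2)) *\<^sub>R x"
  have xv: "x \<bullet> v = 1 / 2" using x by (auto simp: v_def power2_norm_eq_inner)
  have nv: "norm v = 1 / (2 * norm x)" using x by (auto simp: v_def power2_eq_square)
  have nv1: "norm v \<le> 1" unfolding nv using x by (intro mult_imp_div_pos_le) auto
  have iv: "L1 (\<lambda>y. ?b (y - v))" by (rule integrable_lborel_translate[OF i])
  have "ifourier (\<lambda>y. ?b (y - v)) x = cis (2 * pi * (x \<bullet> v)) * ifourier ?b x"
   using ifourier_shift[of ?b "-v" x] by simp
  also have "cis (2 * pi * (x \<bullet> v)) = -1" by (simp add: xv)
  finally have "2 * ifourier ?b x = ifourier ?b x - ifourier (\<lambda>y. ?b (y - v)) x" by simp
  also have "\<dots> = ifourier (\<lambda>y. ?b y - ?b (y - v)) x"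
   unfolding ifourier_def left_diff_distrib
   by (rule Bochner_Integration.integral_diff[symmetric]) (auto intro!: integrable_cis_mult i iv)
  finally have "norm (2 * ifourier ?b x) \<le> (LBINT y. norm (?b y - ?b (y - v)))"
   using norm_ifourier_le[of "\<lambda>y. ?b y - ?b (y - v)" x] i iv by auto
  also have "\<dots> \<le> (LBINT y. norm v / r * indicator (cball (0::real^'n) (r + 1)) y)"
  proof (rule integral_mono)
   show "L1 (\<lambda>y. norm (?b y - ?b (y - v)))" using i iv by auto
   show "L1 (\<lambda>y. norm v / r * indicator (cball (0::real^'n) (r + 1)) y)"
    using fin by (intro integrable_mult_right) (auto simp: integrable_indicator_iff)
   fix y :: "real^'n"
   show "norm (?b y - ?b (y - v)) \<le> norm v / r * indicator (cball 0 (r + 1)) y"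
   proof (cases "norm y \<le> r + 1")
    case True
    have "\<bar>norm y / r - norm (y - v) / r\<bar> \<le> norm v / r"
     using norm_triangle_ineq3[of y "y - v"] r by (simp add: diff_divide_distrib[symmetric] abs_divide divide_right_mono)
    then have "\<bar>max 0 (1 - norm y / r) - max 0 (1 - norm (y - v) / r)\<bar> \<le> norm v / r"
     by linarith
    moreover have "norm (?b y - ?b (y - v)) = \<bar>max 0 (1 - norm y / r) - max 0 (1 - norm (y - v) / r)\<bar>"
     by (simp only: tent_def of_real_diff[symmetric] norm_of_real)
    ultimately show ?thesis using True by simp
   next
    case False
    then have "r \<le> norm y" "r \<le> norm (y - v)" using norm_triangle_ineq2[of y v] nv1 by auto
    then show ?thesis using z False by (simp del: )
   qed
  qed
  also have "\<dots> = norm v / r * V" by (simp add: V_def)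
  finally have "2 * norm (ifourier ?b x) \<le> (1 / (2 * norm x)) / r * V" by (simp add: norm_mult nv)
  also have "\<dots> = (V / r / norm x) / 2" by simp
  also have "\<dots> \<le> 2 * (V / r / norm x)"
  proof -
   have "z / 2 \<le> 2 * z" if "0 \<le> z" for z :: real using that by simp
   moreover have "0 \<le> V / r / norm x" using r A by simp
   ultimately show ?thesis by blast
  qed
  finally show ?thesis by simp
 qed
 show ?thesis
 proof (intro exI[of _ "2 * A + 2 * (V / r)"] conjI allI)
  show "0 \<le> 2 * A + 2 * (V / r)" using A r by simp
  fix x :: "real^'n"
  have w: "wt (- 1) x = 1 / (1 + norm x)" by (simp add: wt_def powr_minus_divide add_nonneg_nonneg)
  have p: "0 < 1 + norm x" by (simp add: add_pos_nonneg)
  show "norm (ifourier ?b x) \<le> (2 * A + 2 * (V / r)) * wt (- 1) x"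
  proof (cases "1 \<le> norm x")
   case True
   have "V / r / norm x \<le> 2 * (V / r) * (1 / (1 + norm x))"
   proof -
    have "1 / n \<le> 2 * (1 / (1 + n))" if "1 \<le> n" for n :: real using that by (simp add: field_simps)
    from this[OF True] have "1 / norm x \<le> 2 * (1 / (1 + norm x))" .
    then have "V / r * (1 / norm x) \<le> V / r * (2 * (1 / (1 + norm x)))" using A r by (intro mult_left_mono) auto
    then show ?thesis by (simp add: field_simps)
   qed
   also have "\<dots> \<le> (2 * A + 2 * (V / r)) * (1 / (1 + norm x))" using A p by (intro mult_right_mono) auto
   finally show ?thesis using large[OF True] w by simp
  next
   case False
   then have "1 / 2 \<le> 1 / (1 + norm x)" using p by (simp add: field_simps)
   then have "A \<le> 2 * A * (1 / (1 + norm x))" using A mult_left_mono[of "1/2" "1 / (1 + norm x)" "2 * A"] by simp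
   also have "\<dots> \<le> (2 * A + 2 * (V / r)) * (1 / (1 + norm x))" using A p r by (intro mult_right_mono) auto
   finally show ?thesis using small[of x] w by simp
  qed
 qed
qed

text \<open>Convolution with one more tent of half the radius multiplies the transforms, gaining one
  order of decay, while the two radii \<open>r / 2\<close> add up to \<open>r\<close>. Any finite
  order is reached without a smooth bump function.\<close>

lemma bump_exists_nat:
 "0 < r ==> \<exists>f :: real^'n::finite => complex. continuous_on UNIV f \<and> (\<forall>y. r \<le> norm y \<longrightarrow> f y = 0) \<and>
   (LBINT y. f y) = 1 \<and> (\<exists>C\<ge>0. \<forall>x. norm (ifourier f x) \<le> C * wt (- real (Suc N)) x)"
proof (induction N arbitrary: r)
 case (0 r)
 define b where "b = (tent r :: real^'n => complex)"
 have bc: "continuous_on UNIV b" unfolding b_def by (rule tent_continuous[OF 0])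
 have bz: "r \<le> norm y ==> b y = 0" for y unfolding b_def by (rule tent_outside[OF 0])
 define I where "I = (LBINT y. b y)"
 have I: "I \<noteq> 0" unfolding I_def b_def by (rule tent_integral[OF 0])
 obtain C where C: "0 \<le> C" "\<And>x. norm (ifourier b x) \<le> C * wt (- 1) x" using tent_decay[OF 0] unfolding b_def by blast
 show ?case
 proof (intro exI[of _ "\<lambda>y. (1 / I) * b y"] conjI allI impI exI[of _ "norm (1 / I) * C"])
  show "continuous_on UNIV (\<lambda>y. (1 / I) * b y)" using bc by (intro continuous_intros)
  show "(LBINT y. (1 / I) * b y) = 1"
   using I by (simp add: I_def)
  fix x
  have "norm (1 / I) * norm (ifourier b x) \<le> norm (1 / I) * (C * wt (- 1) x)" by (intro mult_left_mono C) auto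
  then show "norm (ifourier (\<lambda>y. (1 / I) * b y) x) \<le> norm (1 / I) * C * wt (- real (Suc 0)) x"
   by (simp only: ifourier_cmult norm_mult mult.assoc of_nat_Suc of_nat_0 add_0 add_0_right)
 qed (use bz C in auto)
next
 case (Suc N r)
 have r2: "0 < r / 2" using Suc by simp
 from Suc.IH[OF r2] obtain f :: "real^'n => complex" and C where
  t: "continuous_on UNIV f" "\<And>y. r / 2 \<le> norm y ==> f y = 0" "(LBINT y. f y) = 1"
   "0 \<le> C" "\<And>x. norm (ifourier f x) \<le> C * wt (- real (Suc N)) x" by blast
 define b where "b = (tent (r / 2) :: real^'n => complex)"
 obtain D where D: "0 \<le> D" "\<And>x. norm (ifourier b x) \<le> D * wt (- 1) x" using tent_decay[OF r2] unfolding b_def by blast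
 have bc: "continuous_on UNIV b" unfolding b_def by (rule tent_continuous[OF r2])
 have bz: "r / 2 \<le> norm y ==> b y = 0" for y unfolding b_def by (rule tent_outside[OF r2])
 have gt: "good f" by (rule good_compact_support[OF t(1,2)])
 have gb: "good b" by (rule good_compact_support[OF bc bz])
 define I where "I = ifourier b 0"
 have I: "I \<noteq> 0" unfolding I_def b_def ifourier_def using tent_integral[OF r2] by simp
 define h where "h = (\<lambda>y. LBINT z. f z * b (y - z))"
 note h = convolution_good[OF goodD(2)[OF gt] gb, folded h_def]
 have hz: "h y = 0" if "r \<le> norm y" for y
 proof -
  have "f z * b (y - z) = 0" for z
  proof (cases "r / 2 \<le> norm z")
   case False
   then have "r / 2 \<le> norm (y - z)" using that norm_triangle_ineq2[of y z] by linarith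
   then show ?thesis using bz by simp
  qed (simp add: t)
  then have "(\<lambda>z. f z * b (y - z)) = (\<lambda>z. 0)" by (rule ext)
  then show ?thesis by (simp only: h_def Bochner_Integration.integral_zero)
 qed
 have h0: "(LBINT y. h y) = I"
  using h(2)[of 0] t(3) by (simp add: ifourier_def[of h] ifourier_def[of f] I_def)
 show ?case
 proof (intro exI[of _ "\<lambda>y. (1 / I) * h y"] conjI allI impI exI[of _ "norm (1 / I) * (C * D)"])
  show "continuous_on UNIV (\<lambda>y. (1 / I) * h y)" using goodD(1)[OF h(1)] by (intro continuous_intros)
  show "(LBINT y. (1 / I) * h y) = 1" using h0 I by simp
  fix x
  have "norm (ifourier f x) * norm (ifourier b x) \<le> (C * wt (- real (Suc N)) x) * (D * wt (- 1) x)"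
   using t D by (intro mult_mono) auto
  also have "\<dots> = C * D * wt (- real (Suc (Suc N))) x"
   using wt_mult[of "- real (Suc N)" x "- 1"] by (simp add: mult_ac)
  finally have "norm (1 / I) * norm (ifourier h x) \<le> norm (1 / I) * (C * D * wt (- real (Suc (Suc N))) x)"
   unfolding h(2) norm_mult by (intro mult_left_mono) auto
  then show "norm (ifourier (\<lambda>y. (1 / I) * h y) x) \<le> norm (1 / I) * (C * D) * wt (- real (Suc (Suc N))) x"
   by (simp only: ifourier_cmult norm_mult mult.assoc)
 qed (use hz t D in auto)
qed

text \<open>On the function's own side decay of any order is automatic for bounded functions of
  compact support, so only the transform has to be checked.\<close>

lemma dec_compact_supportI:
 fixes F :: "real^'n::finite => complex"
 assumes c: "continuous_on UNIV F" and z: "\<And>y. r \<le> norm y ==> F y = 0" and r: "0 \<le> r"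
  and K: "0 \<le> K" "K \<le> K'" and C: "0 \<le> C" "\<And>x. norm (ifourier F x) \<le> C * wt (- K') x"
 shows "dec K F"
proof -
 obtain B where B: "0 \<le> B" "\<And>x. norm (F x) \<le> B" using good_bound[OF good_compact_support[OF c z]] by auto
 have "norm (F x) \<le> (B * (1 + r) powr K) * wt (- K) x" for x
 proof (cases "r \<le> norm x")
  case True then show ?thesis using z B by simp
 next
  case False
  then have "wt K x \<le> (1 + r) powr K" unfolding wt_def using K by (intro powr_mono2) auto
  then have "1 \<le> (1 + r) powr K * wt (- K) x" by (simp add: wt_uminus_exp field_simps)
  then have "B \<le> B * ((1 + r) powr K * wt (- K) x)" using B mult_left_mono by fastforce
  then show ?thesis using B(2)[of x] by (simp add: mult.assoc)
 qed
 moreover have "norm (ifourier F x) \<le> C * wt (- K) x" for x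
  using C(2)[of x] mult_left_mono[OF wt_mono[of "-K'" "-K" x] C(1)] K by linarith
 moreover have "(B * (1 + r) powr K) * wt (- K) x \<le> max C (B * (1 + r) powr K) * wt (- K) x"
  "C * wt (- K) x \<le> max C (B * (1 + r) powr K) * wt (- K) x" for x :: "real^'n" by (auto intro!: mult_right_mono)
 ultimately show ?thesis unfolding dec_def using c C(1)
  by (intro conjI exI[of _ "max C (B * (1 + r) powr K)"] allI) (force intro: order_trans)+
qed

lemma bump_exists:
 assumes r: "0 < r" and K: "0 \<le> K"
 shows "\<exists>b :: real^'n::finite => complex. dec K b \<and> (\<forall>y. r \<le> norm y \<longrightarrow> b y = 0) \<and> (LBINT y. b y) = 1"
proof -
 obtain N where N: "K \<le> real N" using real_arch_simple by blast
 obtain b :: "real^'n => complex" and C where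
  t: "continuous_on UNIV b" "\<And>y. r \<le> norm y ==> b y = 0" "(LBINT y. b y) = 1"
   "0 \<le> C" "\<And>x. norm (ifourier b x) \<le> C * wt (- real (Suc N)) x" using bump_exists_nat[OF r] by blast
 have "dec K b" by (rule dec_compact_supportI[OF t(1,2) _ K _ t(4,5)]) (use r N in auto)
 then show ?thesis using t by blast
qed

text \<open>The indicator of the ball of radius \<open>R + 1\<close> mollified by a bump of radius
  1: within distance \<open>R\<close> the bump sees only the value 1, beyond \<open>R + 2\<close>
  only 0.\<close>

lemma plateau_exists:
 assumes R: "0 \<le> R" and K: "0 \<le> K"
 shows "\<exists>ch :: real^'n::finite => complex. dec K ch \<and> (\<forall>y. norm y \<le> R \<longrightarrow> ch y = 1) \<and> (\<forall>y. R + 2 \<le> norm y \<longrightarrow> ch y = 0)"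
proof -
 obtain b :: "real^'n => complex" where t: "dec K b" "\<And>y. 1 \<le> norm y ==> b y = 0" "(LBINT y. b y) = 1"
  using bump_exists[OF zero_less_one K] by blast
 obtain C where C: "0 \<le> C" "\<And>x. norm (ifourier b x) \<le> C * wt (- K) x" using dec_bounds[OF t(1)] by auto
 have tc: "continuous_on UNIV b" using t(1) by (simp add: dec_def)
 have gt: "good b" by (rule good_compact_support[OF tc t(2)])
 define F :: "real^'n => complex" where "F = indicat_real (cball 0 (R + 1))"
 have F: "L1 F"
  unfolding F_def using emeasure_compact_finite[of "cball (0::real^'n) (R + 1)"]
  by (intro integrable_of_real) (auto simp: integrable_indicator_iff)
 define h where "h = (\<lambda>y. LBINT z. F z * b (y - z))"
 note h = convolution_good[OF F gt, folded h_def]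
 have hz: "h y = 0" if "R + 2 \<le> norm y" for y
 proof -
  have "F z * b (y - z) = 0" for z
  proof (cases "R + 1 < norm z")
   case False
   then have "1 \<le> norm (y - z)" using that norm_triangle_ineq2[of y z] by linarith
   then show ?thesis using t by simp
  qed (simp add: F_def)
  then have "(\<lambda>z. F z * b (y - z)) = (\<lambda>z. 0)" by (rule ext)
  then show ?thesis by (simp only: h_def Bochner_Integration.integral_zero)
 qed
 have h1: "h y = 1" if "norm y \<le> R" for y
 proof -
  have "F z * b (y - z) = b (y - z)" for z
  proof (cases "R + 1 < norm z")
   case True
   then have "1 \<le> norm (y - z)" using that norm_triangle_ineq2[of z y] by (simp add: norm_minus_commute)
   then show ?thesis using t by simp
  qed (simp add: F_def)
  then have "(\<lambda>z. F z * b (y - z)) = (\<lambda>z. b (y - z))" by (rule ext)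
  then have "h y = (LBINT z. b (y - z))" by (simp only: h_def)
  then show ?thesis using t(3) by (simp add: integral_lborel_translate)
 qed
 define A where "A = (LBINT y. norm (F y))"
 have "norm (ifourier h x) \<le> (A * C) * wt (- K) x" for x
 proof -
  have "norm (ifourier F x) * norm (ifourier b x) \<le> A * (C * wt (- K) x)"
   using C norm_ifourier_le[OF F, of x] by (intro mult_mono) (auto simp: A_def)
  then show ?thesis by (simp add: h(2) norm_mult mult.assoc)
 qed
 then have "dec K h"
  using C R K goodD(1)[OF h(1)] hz
  by (intro dec_compact_supportI[where r="R + 2" and C="A * C" and K'=K]) (auto simp: A_def)
 then show ?thesis using hz h1 by blast
qed

section \<open>Schwartz functions and the decay of their Fourier transforms\<close>

lemma has_pd_vector_derivative:
 assumes "has_pd i f"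
 shows "((\<lambda>t. f (x + t *\<^sub>R axis i 1)) has_vector_derivative pd i f (x + t *\<^sub>R axis i 1)) (at t)"
proof -
 have "((\<lambda>s. f ((x + t *\<^sub>R axis i 1) + s *\<^sub>R axis i 1)) has_vector_derivative pd i f (x + t *\<^sub>R axis i 1)) (at (t - t))"
  using assms unfolding has_pd_def pd_def by (simp add: vector_derivative_works)
 moreover have "((\<lambda>u. u - t) has_vector_derivative 1) (at t)" by (auto intro!: derivative_eq_intros)
 ultimately have "((\<lambda>s. f ((x + t *\<^sub>R axis i 1) + s *\<^sub>R axis i 1)) \<circ> (\<lambda>u. u - t) has_vector_derivative 1 *\<^sub>R pd i f (x + t *\<^sub>R axis i 1)) (at t)"
  by (intro vector_diff_chain_at)
 then show ?thesis by (simp add: o_def algebra_simps scaleR_diff_left)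
qed

lemma vector_derivative_sequence:
 fixes h :: "real => 'a::real_normed_vector"
 assumes h: "(h has_vector_derivative D) (at 0)" and t: "t \<longlonglongrightarrow> 0" "\<And>k. t k \<noteq> (0::real)"
 shows "(\<lambda>k. (1 / t k) *\<^sub>R (h (t k) - h 0)) \<longlonglongrightarrow> D"
proof -
 have "((\<lambda>y. norm ((h y - h 0) - (y - 0) *\<^sub>R D) / norm (y - 0)) \<longlongrightarrow> 0) (at 0)"
  using h unfolding has_vector_derivative_def has_derivative_iff_norm by simp
 moreover have "filterlim t (at 0) sequentially" using t by (simp add: filterlim_at)
 ultimately have "(\<lambda>k. norm ((h (t k) - h 0) - (t k - 0) *\<^sub>R D) / norm (t k - 0)) \<longlonglongrightarrow> 0"
  by (rule filterlim_compose)
 moreover have "norm ((h (t k) - h 0) - (t k - 0) *\<^sub>R D) / norm (t k - 0) = norm ((1 / t k) *\<^sub>R (h (t k) - h 0) - D)" for k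
 proof -
  have "(1 / t k) *\<^sub>R (h (t k) - h 0) - D = (1 / t k) *\<^sub>R ((h (t k) - h 0) - t k *\<^sub>R D)"
   using t(2)[of k] by (simp add: scaleR_diff_right)
  then show ?thesis by (simp add: divide_inverse mult.commute)
 qed
 ultimately have "(\<lambda>k. norm ((1 / t k) *\<^sub>R (h (t k) - h 0) - D)) \<longlonglongrightarrow> 0" by simp
 then show ?thesis by (simp add: tendsto_norm_zero_iff LIM_zero_iff)
qed

text \<open>In place of integration by parts, the transform of the difference quotients in direction
  \<open>i\<close> has two limits: dominated convergence gives the left side, translation of the
  integral the right side. The mean value inequality supplies the dominating function.\<close>

lemma fourier_pd:
 fixes g :: "real^'n::finite => complex"
 assumes c: "continuous_on UNIV g" "continuous_on UNIV (pd i g)" and p: "has_pd i g"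
  and l: "real CARD('n) < l" and C: "\<And>x. norm (g x) \<le> C * wt (- l) x" "\<And>x. norm (pd i g x) \<le> C * wt (- l) x"
 shows "fourier (pd i g) \<xi> = 2 * pi * \<i> * (\<xi> $ i) * fourier g \<xi>"
proof -
 define e where "e = (axis i 1 :: real^'n)"
 have ne: "norm e = 1" by (simp add: e_def)
 have [measurable]: "g \<in> Bm" "pd i g \<in> Bm"
  using c by (auto intro: borel_measurable_continuous_onI)
 have l0: "0 \<le> l" using l by (metis less_eq_real_def of_nat_0_le_iff order_trans)
 have C0: "0 \<le> C" using C(1)[of 0] by simp (meson norm_ge_zero order_trans)
 have gi: "L1 g" by (rule integrable_wt_bound[OF _ C(1) l]) simp
 define t where "t k = 1 / real (Suc k)" for k
 have t: "0 < t k" "t k \<le> 1" for k by (auto simp: t_def)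
 have t0: "t \<longlonglongrightarrow> 0" unfolding t_def using LIMSEQ_inverse_real_of_nat by (simp add: inverse_eq_divide)
 define a where "a k = (LBINT x. (1 / t k) *\<^sub>R (g (x + t k *\<^sub>R e) - g x) * cis (- 2 * pi * (x \<bullet> \<xi>)))" for k
 have "a \<longlonglongrightarrow> fourier (pd i g) \<xi>"
  unfolding a_def fourier_def
 proof (rule integral_dominated_convergence[where w="\<lambda>x. (C * 2 powr l) * wt (- l) x"])
  show "L1 (\<lambda>x::real^'n. (C * 2 powr l) * wt (- l) x)" using wt_integrable[where 'a="real^'n"] l by simp
  show "AE x in lborel. (\<lambda>k. (1 / t k) *\<^sub>R (g (x + t k *\<^sub>R e) - g x) * cis (- 2 * pi * (x \<bullet> \<xi>)))
    \<longlonglongrightarrow> pd i g x * cis (- 2 * pi * (x \<bullet> \<xi>))"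
  proof (intro AE_I2 tendsto_mult tendsto_const)
   fix x :: "real^'n"
   have t_ne: "t k \<noteq> 0" for k using t(1)[of k] by simp
   show "(\<lambda>k. (1 / t k) *\<^sub>R (g (x + t k *\<^sub>R e) - g x)) \<longlonglongrightarrow> pd i g x"
    using vector_derivative_sequence[OF has_pd_vector_derivative[OF p, of x 0, simplified] t0 t_ne] by (simp add: e_def)
  qed
  fix k
  show "AE x in lborel. norm ((1 / t k) *\<^sub>R (g (x + t k *\<^sub>R e) - g x) * cis (- 2 * pi * (x \<bullet> \<xi>))) \<le> (C * 2 powr l) * wt (- l) x"
  proof (rule AE_I2)
   fix x :: "real^'n"
   let ?B = "(C * 2 powr l) * wt (- l) x"
   have "norm (g (x + t k *\<^sub>R e) - g (x + 0 *\<^sub>R e)) \<le> ?B * norm (t k - 0)"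
   proof (rule differentiable_bound[of "{0..1}"])
    fix s :: real assume s: "s \<in> {0..1}"
    show "((\<lambda>s. g (x + s *\<^sub>R e)) has_derivative (\<lambda>u. u *\<^sub>R pd i g (x + s *\<^sub>R e))) (at s within {0..1})"
     using has_pd_vector_derivative[OF p, of x s] unfolding has_vector_derivative_def e_def
     by (rule has_derivative_at_withinI)
    have "norm (pd i g (x + s *\<^sub>R e)) \<le> C * wt (- l) (x + s *\<^sub>R e)" by (rule C)
    also have "\<dots> \<le> C * (wt (- l) x * 2 powr l)"
    proof (intro mult_left_mono C0)
     have "wt (- l) (x + s *\<^sub>R e) \<le> wt (- l) x * wt l (s *\<^sub>R e)"
      using wt_peetre[of "- l" "x + s *\<^sub>R e" x] l0 by simp
     also have "wt l (s *\<^sub>R e) \<le> 2 powr l"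
      unfolding wt_def using s l0 ne by (intro powr_mono2) auto
     finally show "wt (- l) (x + s *\<^sub>R e) \<le> wt (- l) x * 2 powr l" by (simp add: mult_left_mono)
    qed
    finally have "norm (pd i g (x + s *\<^sub>R e)) \<le> ?B" by (simp add: mult_ac)
    then show "onorm (\<lambda>u. u *\<^sub>R pd i g (x + s *\<^sub>R e)) \<le> ?B"
     by (intro onorm_bound) (auto simp: mult.commute C0 intro!: mult_left_mono)
   qed (use t[of k] in auto)
   then have "norm (g (x + t k *\<^sub>R e) - g x) \<le> ?B * t k" using t[of k] by simp
   then show "norm ((1 / t k) *\<^sub>R (g (x + t k *\<^sub>R e) - g x) * cis (- 2 * pi * (x \<bullet> \<xi>))) \<le> ?B"
    using t[of k] by (simp add: norm_mult pos_divide_le_eq)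
  qed
 qed measurable
 moreover have "a \<longlonglongrightarrow> 2 * pi * \<i> * (\<xi> $ i) * fourier g \<xi>"
 proof -
  have a_eq: "a k = (1 / t k) *\<^sub>R (cis (2 * pi * (t k * (\<xi> $ i))) - 1) * fourier g \<xi>" for k
  proof -
   have xe: "t k *\<^sub>R e \<bullet> \<xi> = t k * \<xi> $ i" by (simp add: e_def inner_axis')
   have i1: "L1 (\<lambda>x. g (x + t k *\<^sub>R e) * cis (- 2 * pi * (x \<bullet> \<xi>)))"
    by (intro integrable_cis_mult integrable_lborel_translate gi) simp
   have i2: "L1 (\<lambda>x. g x * cis (- 2 * pi * (x \<bullet> \<xi>)))"
    by (intro integrable_cis_mult gi) simp
   have "(LBINT x. g (x + t k *\<^sub>R e) * cis (- 2 * pi * (x \<bullet> \<xi>))) = (LBINT x. g x * cis (- 2 * pi * ((x - t k *\<^sub>R e) \<bullet> \<xi>)))"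
    using integral_lborel_translate(1)[of "\<lambda>x. g x * cis (- 2 * pi * ((x - t k *\<^sub>R e) \<bullet> \<xi>))" "t k *\<^sub>R e"] by simp
   also have "\<dots> = (LBINT x. cis (2 * pi * (t k * (\<xi> $ i))) * (g x * cis (- 2 * pi * (x \<bullet> \<xi>))))"
    unfolding inner_diff_left xe
    by (intro Bochner_Integration.integral_cong refl) (simp add: right_diff_distrib cis_add[symmetric] cis_mult algebra_simps)
   finally have s: "(LBINT x. g (x + t k *\<^sub>R e) * cis (- 2 * pi * (x \<bullet> \<xi>))) = cis (2 * pi * (t k * (\<xi> $ i))) * fourier g \<xi>"
    by (simp add: fourier_def)
   have "a k = (1 / t k) *\<^sub>R ((LBINT x. g (x + t k *\<^sub>R e) * cis (- 2 * pi * (x \<bullet> \<xi>))) - fourier g \<xi>)"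
   proof -
    have "a k = (LBINT x. (1 / t k) *\<^sub>R (g (x + t k *\<^sub>R e) * cis (- 2 * pi * (x \<bullet> \<xi>)) - g x * cis (- 2 * pi * (x \<bullet> \<xi>))))"
     unfolding a_def by (simp only: left_diff_distrib mult_scaleR_left)
    then show ?thesis by (simp only: integral_scaleR_right Bochner_Integration.integral_diff[OF i1 i2] fourier_def)
   qed
   then show ?thesis unfolding s by (simp add: left_diff_distrib algebra_simps)
  qed
  have "((\<lambda>t. cis (2 * pi * (t * (\<xi> $ i)))) has_vector_derivative (2 * pi * \<i> * (\<xi> $ i))) (at 0)"
  proof -
   have "((\<lambda>z::complex. exp (2 * pi * \<i> * (\<xi> $ i) * z)) has_field_derivative (2 * pi * \<i> * (\<xi> $ i))) (at (of_real 0))"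
    by (auto intro!: derivative_eq_intros)
   from has_vector_derivative_real_field[OF this]
   show ?thesis by (simp add: cis_conv_exp mult_ac)
  qed
  from vector_derivative_sequence[OF this t0] t(1)
  have "(\<lambda>k. (1 / t k) *\<^sub>R (cis (2 * pi * (t k * (\<xi> $ i))) - 1)) \<longlonglongrightarrow> 2 * pi * \<i> * (\<xi> $ i)" by (simp add: less_imp_neq[symmetric])
  then show ?thesis unfolding a_eq[abs_def] by (rule tendsto_mult) simp
 qed
 ultimately show ?thesis by (rule LIMSEQ_unique)
qed

lemma schwartz_dpart_bound:
 assumes "schwartz f"
 shows "\<exists>C\<ge>0. \<forall>x. norm (dpart is f x) \<le> C * wt (- K) x"
proof -
 obtain N where N: "K \<le> real N" using real_arch_simple by blast
 have "bounded (range (\<lambda>x. (1 + norm x) ^ N *\<^sub>R dpart is f x))" using assms by (simp add: schwartz_def)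
 then obtain C where C: "\<And>x. norm ((1 + norm x) ^ N *\<^sub>R dpart is f x) \<le> C" unfolding bounded_iff by auto
 have C0: "0 \<le> C" using C[of 0] norm_ge_zero order_trans by blast
 have "norm (dpart is f x) \<le> C * wt (- K) x" for x
 proof -
  have p: "1 + norm x > 0" by (simp add: add_pos_nonneg)
  have w: "(1 + norm x) ^ N = wt (real N) x" using p by (simp add: wt_def powr_realpow)
  have "wt (real N) x * norm (dpart is f x) \<le> C" using C[of x] p by (simp add: w[symmetric])
  then have "norm (dpart is f x) \<le> C * wt (- real N) x" by (simp add: wt_uminus_exp field_simps)
  also have "\<dots> \<le> C * wt (- K) x" using C0 N by (intro mult_left_mono wt_mono) auto
  finally show ?thesis .
 qed
 then show ?thesis using C0 by blast
qed

text \<open>Pure derivatives in a single direction are enough: at every \<xi> some coordinate has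
  size at least \<open>norm \<xi> / n\<close>, and the \<open>N\<close>-fold derivative in that
  direction controls the transform there.\<close>

lemma schwartz_dec:
 fixes f :: "real^'n::finite => complex"
 assumes f: "schwartz f" shows "dec K f"
proof -
 define l where "l = real CARD('n) + 1"
 obtain N where N: "K \<le> real N" using real_arch_simple by blast
 have der: "fourier (dpart (replicate k i) f) \<xi> = (2 * pi * \<i> * (\<xi> $ i)) ^ k * fourier f \<xi>" for k i \<xi>
 proof (induction k)
  case (Suc k)
  obtain A where A: "\<And>x. norm (dpart (replicate k i) f x) \<le> A * wt (- l) x" using schwartz_dpart_bound[OF f] by blast
  obtain B where B: "\<And>x. norm (dpart (i # replicate k i) f x) \<le> B * wt (- l) x" using schwartz_dpart_bound[OF f] by blast
  have m: "A * wt (- l) x \<le> max A B * wt (- l) x" "B * wt (- l) x \<le> max A B * wt (- l) x" for x :: "real^'n"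
   by (auto intro!: mult_right_mono)
  have "fourier (pd i (dpart (replicate k i) f)) \<xi> = 2 * pi * \<i> * (\<xi> $ i) * fourier (dpart (replicate k i) f) \<xi>"
  proof (rule fourier_pd[where l=l and C="max A B"])
   show "continuous_on UNIV (dpart (replicate k i) f)" "has_pd i (dpart (replicate k i) f)" using f by (auto simp: schwartz_def)
   have "continuous_on UNIV (dpart (i # replicate k i) f)" using f unfolding schwartz_def by blast
   then show "continuous_on UNIV (pd i (dpart (replicate k i) f))" by simp
   show "norm (dpart (replicate k i) f x) \<le> max A B * wt (- l) x" for x using A m order_trans by blast
   show "norm (pd i (dpart (replicate k i) f) x) \<le> max A B * wt (- l) x" for x by (rule order_trans[OF B[simplified] m(2)])
  qed (simp add: l_def)
  then show ?case using Suc by (simp add: mult_ac)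
 qed simp
 have int: "L1 (dpart is f)" for "is"
 proof -
  obtain A where A: "\<And>x. norm (dpart is f x) \<le> A * wt (- l) x" using schwartz_dpart_bound[OF f] by blast
  have "continuous_on UNIV (dpart is f)" using f by (simp add: schwartz_def)
  then have [measurable]: "dpart is f \<in> Bm" by (rule borel_measurable_continuous_onI)
  show ?thesis by (rule integrable_wt_bound[OF _ A]) (auto simp: l_def)
 qed
 define D where "D k i = (LBINT x. norm (dpart (replicate k i) f x))" for k i
 have comp: "\<bar>\<xi> $ i\<bar> ^ N * norm (fourier f \<xi>) \<le> D N i" for \<xi> i
 proof -
  have "norm (fourier (dpart (replicate N i) f) \<xi>) \<le> D N i"
   unfolding D_def fourier_eq_ifourier by (rule norm_ifourier_le[OF int])
  then have "(2 * pi) ^ N * (\<bar>\<xi> $ i\<bar> ^ N * norm (fourier f \<xi>)) \<le> D N i"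
   unfolding der by (simp add: norm_mult norm_power power_mult_distrib)
  moreover have "1 * (\<bar>\<xi> $ i\<bar> ^ N * norm (fourier f \<xi>)) \<le> (2 * pi) ^ N * (\<bar>\<xi> $ i\<bar> ^ N * norm (fourier f \<xi>))"
   using pi_ge_two by (intro mult_right_mono one_le_power) auto
  ultimately show ?thesis by simp
 qed
 have D0: "norm (fourier f \<xi>) \<le> (LBINT x. norm (f x))" for \<xi>
  unfolding fourier_eq_ifourier using norm_ifourier_le[OF int[of "[]"]] by simp
 define m where "m = real CARD('n)"
 define A where "A = (LBINT x. norm (f x)) + (\<Sum>i\<in>UNIV. D N i)"
 have Dn: "0 \<le> D k i" for k i by (simp add: D_def)
 have m1: "1 \<le> m" by (simp add: m_def Suc_leI)
 have A0: "0 \<le> A" unfolding A_def using Dn by (intro add_nonneg_nonneg sum_nonneg) auto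
 have four: "norm (fourier f \<xi>) \<le> (A * (2 * m) ^ N) * wt (- K) \<xi>" for \<xi> :: "real^'n"
 proof -
  have "(1 + norm \<xi>) ^ N * norm (fourier f \<xi>) \<le> A * (2 * m) ^ N"
  proof (cases "norm \<xi> \<le> 1")
   case True
   have "(1 + norm \<xi>) ^ N \<le> (2 * m) ^ N" using True m1 by (intro power_mono) auto
   moreover have "norm (fourier f \<xi>) \<le> A" using D0[of \<xi>] Dn unfolding A_def by (simp add: add_increasing2 sum_nonneg)
   ultimately have "(1 + norm \<xi>) ^ N * norm (fourier f \<xi>) \<le> (2 * m) ^ N * A" using m1 by (intro mult_mono) auto
   then show ?thesis by (simp add: mult.commute)
  next
   case False
   have "\<exists>i. norm \<xi> \<le> m * \<bar>\<xi> $ i\<bar>"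
   proof (rule ccontr)
    assume "\<nexists>i. norm \<xi> \<le> m * \<bar>\<xi> $ i\<bar>"
    then have "(\<Sum>i\<in>UNIV. m * \<bar>\<xi> $ i\<bar>) < (\<Sum>i\<in>(UNIV::'n set). norm \<xi>)" by (intro sum_strict_mono) (auto simp: not_le)
    then have "m * (\<Sum>i\<in>UNIV. \<bar>\<xi> $ i\<bar>) < m * norm \<xi>" by (simp add: m_def sum_distrib_left)
    then show False using norm_le_l1_cart[of \<xi>] m1 by (simp add: not_less)
   qed
   then obtain i where i: "norm \<xi> \<le> m * \<bar>\<xi> $ i\<bar>" by blast
   have "1 + norm \<xi> \<le> (2 * m) * \<bar>\<xi> $ i\<bar>" using False i by simp
   then have "(1 + norm \<xi>) ^ N \<le> ((2 * m) * \<bar>\<xi> $ i\<bar>) ^ N" by (intro power_mono) auto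
   then have "(1 + norm \<xi>) ^ N * norm (fourier f \<xi>) \<le> ((2 * m) * \<bar>\<xi> $ i\<bar>) ^ N * norm (fourier f \<xi>)" by (intro mult_right_mono) auto
   also have "\<dots> = (2 * m) ^ N * (\<bar>\<xi> $ i\<bar> ^ N * norm (fourier f \<xi>))" by (simp add: power_mult_distrib)
   also have "\<dots> \<le> (2 * m) ^ N * A"
   proof (intro mult_left_mono)
    have "D N i \<le> (\<Sum>i\<in>UNIV. D N i)" using Dn by (intro member_le_sum) auto
    moreover have "0 \<le> (LBINT x. norm (f x))" by simp
    ultimately have "D N i \<le> A" unfolding A_def by linarith
    then show "\<bar>\<xi> $ i\<bar> ^ N * norm (fourier f \<xi>) \<le> A" using comp[of \<xi> i] by linarith
   qed (use m1 in auto)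
   finally show ?thesis by (simp add: mult.commute)
  qed
  moreover have "(1 + norm \<xi>) ^ N = wt (real N) \<xi>" using norm_ge_zero[of \<xi>] by (simp add: wt_def powr_realpow add_pos_nonneg)
  ultimately have "norm (fourier f \<xi>) \<le> (A * (2 * m) ^ N) * wt (- real N) \<xi>" by (simp add: wt_uminus_exp field_simps)
  also have "\<dots> \<le> (A * (2 * m) ^ N) * wt (- K) \<xi>" using A0 m1 N by (intro mult_left_mono wt_mono mult_nonneg_nonneg) auto
  finally show ?thesis .
 qed
 obtain B where B: "0 \<le> B" "\<And>x. norm (f x) \<le> B * wt (- K) x" using schwartz_dpart_bound[OF f, of "[]" K] by auto
 define C where "C = max B (A * (2 * m) ^ N)"
 have "norm (f x) \<le> C * wt (- K) x" for x
 proof -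
  have "B * wt (- K) x \<le> C * wt (- K) x" unfolding C_def by (intro mult_right_mono) auto
  then show ?thesis using B(2)[of x] by linarith
 qed
 moreover have "norm (ifourier f x) \<le> C * wt (- K) x" for x
 proof -
  have "(A * (2 * m) ^ N) * wt (- K) x \<le> C * wt (- K) x" unfolding C_def by (intro mult_right_mono) auto
  then show ?thesis using four[of "-x"] unfolding fourier_eq_ifourier minus_minus wt_minus_arg by linarith
 qed
 moreover have "0 \<le> C" using B by (simp add: C_def)
 moreover have "continuous_on UNIV (dpart [] f)" using f unfolding schwartz_def by blast
 ultimately show ?thesis unfolding dec_def by auto
qed

section \<open>Taylor expansion and dilations\<close>

text \<open>The coordinates of the increment are switched on one after another; each step is a
  one-dimensional mean value estimate for \<open>f\<close> minus its linear part, and the path stays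
  within distance \<open>norm h\<close> of \<open>x\<close>.\<close>

lemma has_derivative_continuous_partials:
 fixes f :: "real^'n::finite => real"
 assumes p: "\<And>i. has_pd i f" and c: "\<And>i. continuous_on UNIV (pd i f)"
 shows "(f has_derivative (\<lambda>h. \<Sum>i\<in>UNIV. h $ i * pd i f x)) (at x)"
 unfolding has_derivative_at_alt
proof (intro conjI allI impI)
 show "bounded_linear (\<lambda>h. \<Sum>i\<in>UNIV. h $ i * pd i f x)"
  by (intro bounded_linear_sum bounded_linear_mult_left bounded_linear_compose[OF bounded_linear_mult_left bounded_linear_vec_nth])
 fix e :: real assume e: "0 < e"
 define e' where "e' = e / real CARD('n)"
 have e': "0 < e'" using e by (simp add: e'_def)
 have "\<exists>d>0. \<forall>y. norm (y - x) < d \<longrightarrow> \<bar>pd i f y - pd i f x\<bar> < e'" for i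
  using c[of i] e' unfolding continuous_on_iff by (metis UNIV_I dist_norm real_norm_def)
 then obtain d where d: "\<And>i. 0 < d i" "\<And>i y. norm (y - x) < d i ==> \<bar>pd i f y - pd i f x\<bar> < e'" by metis
 define D where "D = Min (range d)"
 have D: "0 < D" using d(1) by (simp add: D_def)
 have Dd: "norm (y - x) < D ==> \<bar>pd i f y - pd i f x\<bar> < e'" for i y
  using d(2)[of y i] by (simp add: D_def)
 \<comment> \<open>The partial increment with only the coordinates in \<open>S\<close> switched on;
   induction over finite sets \<open>S\<close> reaches \<open>UNIV\<close>.\<close>
 define P where "P S h = (\<Sum>i\<in>S. (h $ i) *\<^sub>R (axis i 1 :: real^'n))" for S and h :: "real^'n"
 have main: "\<bar>f (x + P S h) - f x - (\<Sum>i\<in>S. h $ i * pd i f x)\<bar> \<le> e' * (\<Sum>i\<in>S. \<bar>h $ i\<bar>)"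
  if h: "norm h < D" for S h
  using finite[of S]
 proof (induction S rule: finite_induct)
  case empty then show ?case by (simp add: P_def)
 next
  case (insert j S)
  define z where "z = x + P S h"
  have Pj: "x + P (insert j S) h = z + (h $ j) *\<^sub>R axis j 1" using insert by (simp add: P_def z_def add_ac)
  define k where "k s = f (z + s *\<^sub>R axis j 1) - s * pd j f x" for s
  have "norm (k (h $ j) - k 0) \<le> e' * norm (h $ j - 0)"
  proof (rule differentiable_bound[of "closed_segment 0 (h $ j)"])
   fix s assume s: "s \<in> closed_segment 0 (h $ j)"
   then have sh: "\<bar>s\<bar> \<le> \<bar>h $ j\<bar>" by (auto simp: closed_segment_eq_real_ivl split: if_splits)
   have nz: "norm ((z + s *\<^sub>R axis j 1) - x) < D"
   proof -
    have "norm (P S h + s *\<^sub>R axis j 1) \<le> norm h"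
    proof (rule norm_le_componentwise_cart)
     fix i
     have "(P S h) $ i = (if i \<in> S then h $ i else 0)"
      unfolding P_def using finite[of S]
      by (simp add: axis_def if_distrib[of "\<lambda>t. _ * t"] sum.delta' cong: if_cong)
     then show "norm ((P S h + s *\<^sub>R axis j 1) $ i) \<le> norm (h $ i)"
      using insert(2) sh by (auto simp: axis_def)
    qed
    then show ?thesis using h by (simp add: z_def algebra_simps)
   qed
   have "((\<lambda>s. f (z + s *\<^sub>R axis j 1)) has_vector_derivative pd j f (z + s *\<^sub>R axis j 1)) (at s)"
    by (rule has_pd_vector_derivative[OF p])
   then have "(k has_vector_derivative (pd j f (z + s *\<^sub>R axis j 1) - pd j f x)) (at s)"
    unfolding k_def by (auto intro!: derivative_eq_intros)
   then show "(k has_derivative (\<lambda>u. u *\<^sub>R (pd j f (z + s *\<^sub>R axis j 1) - pd j f x))) (at s within closed_segment 0 (h $ j))"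
    unfolding has_vector_derivative_def by (rule has_derivative_at_withinI)
   have "\<bar>pd j f (z + s *\<^sub>R axis j 1) - pd j f x\<bar> \<le> e'" using Dd[OF nz] by (simp add: less_imp_le)
   then show "onorm (\<lambda>u. u *\<^sub>R (pd j f (z + s *\<^sub>R axis j 1) - pd j f x)) \<le> e'"
    using e' by (intro onorm_bound) (simp_all add: abs_mult mult.commute[of e'] mult_left_mono)
  qed auto
  then have 1: "\<bar>f (z + (h $ j) *\<^sub>R axis j 1) - f z - h $ j * pd j f x\<bar> \<le> e' * \<bar>h $ j\<bar>"
   by (simp add: k_def algebra_simps)
  show ?case unfolding Pj using insert 1 by (simp add: z_def[symmetric] algebra_simps)
 qed
 show "\<exists>d>0. \<forall>y. norm (y - x) < d \<longrightarrow> norm (f y - f x - (\<Sum>i\<in>UNIV. (y - x) $ i * pd i f x)) \<le> e * norm (y - x)"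
 proof (intro exI[of _ D] conjI D allI impI)
  fix y assume y: "norm (y - x) < D"
  have "P UNIV (y - x) = y - x" unfolding P_def
   by (simp add: vec_eq_iff axis_def if_distrib[of "\<lambda>t. _ * t"] sum.delta' cong: if_cong)
  then have "\<bar>f y - f x - (\<Sum>i\<in>UNIV. (y - x) $ i * pd i f x)\<bar> \<le> e' * (\<Sum>i\<in>UNIV. \<bar>(y - x) $ i\<bar>)"
   using main[OF y, of UNIV] by simp
  also have "\<dots> \<le> e' * (\<Sum>i\<in>(UNIV::'n set). norm (y - x))"
   using e' by (intro mult_left_mono sum_mono component_le_norm_cart) auto
  also have "\<dots> = e * norm (y - x)" by (simp add: e'_def)
  finally show "norm (f y - f x - (\<Sum>i\<in>UNIV. (y - x) $ i * pd i f x)) \<le> e * norm (y - x)" by simp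
 qed
qed

lemma line_derivative:
 fixes f :: "real^'n::finite => real"
 assumes p: "\<And>i. has_pd i f" and c: "\<And>i. continuous_on UNIV (pd i f)"
 shows "((\<lambda>t. f (x + t *\<^sub>R u)) has_real_derivative (\<Sum>i\<in>UNIV. u $ i * pd i f (x + t *\<^sub>R u))) (at t)"
proof -
 have "((\<lambda>t. f (x + t *\<^sub>R u)) has_derivative (\<lambda>s. \<Sum>i\<in>UNIV. (s *\<^sub>R u) $ i * pd i f (x + t *\<^sub>R u))) (at t)"
  by (rule has_derivative_compose[of "\<lambda>t. x + t *\<^sub>R u" "\<lambda>s. s *\<^sub>R u", OF _ has_derivative_continuous_partials[OF p c]])
   (auto intro!: derivative_eq_intros)
 moreover have "(\<lambda>s. \<Sum>i\<in>UNIV. (s *\<^sub>R u) $ i * pd i f (x + t *\<^sub>R u)) = (*) (\<Sum>i\<in>UNIV. u $ i * pd i f (x + t *\<^sub>R u))"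
  by (auto simp: sum_distrib_left mult_ac)
 ultimately show ?thesis unfolding has_field_derivative_def by simp
qed

lemma C2_Taylor:
 fixes \<mu> :: "real^'n::finite => real"
 assumes mu: "C2 \<mu>"
 shows "\<mu> (v + u) - \<mu> v - (\<Sum>i\<in>UNIV. u $ i * pd i \<mu> v) =
  (LBINT t. indicator {0..1} t *\<^sub>R ((1 - t) * (\<Sum>i\<in>UNIV. \<Sum>j\<in>UNIV. u $ i * u $ j * pd j (pd i \<mu>) (v + t *\<^sub>R u))))"
proof -
 have p: "has_pd i \<mu>" "continuous_on UNIV (pd i \<mu>)" "has_pd j (pd i \<mu>)" "continuous_on UNIV (pd j (pd i \<mu>))" for i j
  using mu by (auto simp: C2_def)
 define G1 where "G1 t = (\<Sum>i\<in>UNIV. u $ i * pd i \<mu> (v + t *\<^sub>R u))" for t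
 define G2 where "G2 t = (\<Sum>i\<in>UNIV. \<Sum>j\<in>UNIV. u $ i * u $ j * pd j (pd i \<mu>) (v + t *\<^sub>R u))" for t
 have d1: "((\<lambda>t. \<mu> (v + t *\<^sub>R u)) has_real_derivative G1 t) (at t)" for t
  unfolding G1_def by (rule line_derivative[OF p(1,2)])
 have d2: "(G1 has_real_derivative G2 t) (at t)" for t
 proof -
  have "((\<lambda>t. u $ i * pd i \<mu> (v + t *\<^sub>R u)) has_real_derivative u $ i * (\<Sum>j\<in>UNIV. u $ j * pd j (pd i \<mu>) (v + t *\<^sub>R u))) (at t)" for i
  proof -
   have "\<And>j. has_pd j (pd i \<mu>)" "\<And>j. continuous_on UNIV (pd j (pd i \<mu>))" using p by auto
   from DERIV_cmult[OF line_derivative[OF this], of "u $ i"] show ?thesis .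
  qed
  then have "((\<lambda>t. \<Sum>i\<in>UNIV. u $ i * pd i \<mu> (v + t *\<^sub>R u)) has_real_derivative
    (\<Sum>i\<in>UNIV. u $ i * (\<Sum>j\<in>UNIV. u $ j * pd j (pd i \<mu>) (v + t *\<^sub>R u)))) (at t)"
   by (intro DERIV_sum) auto
  then show ?thesis unfolding G1_def[abs_def] G2_def
   by (simp add: sum_distrib_left mult.assoc)
 qed
 \<comment> \<open>Chosen so that the terms in \<open>G1\<close> cancel in the derivative, which is
   then \<open>(1 - t) * G2 t\<close>: the integration by parts is carried out beforehand.\<close>
 define Fn where "Fn t = (1 - t) * G1 t + \<mu> (v + t *\<^sub>R u)" for t
 have d3: "(Fn has_real_derivative (1 - t) * G2 t) (at t)" for t
  unfolding Fn_def using d1[of t] d2[of t] by (auto intro!: derivative_eq_intros)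
 have c: "continuous_on {0..1} (\<lambda>t. (1 - t) * G2 t)" unfolding G2_def
  by (intro continuous_intros continuous_on_compose2[OF p(4)]) auto
 have "(LBINT t. indicator {0..1} t *\<^sub>R ((1 - t) * G2 t)) = Fn 1 - Fn 0"
  by (rule integral_FTC_atLeastAtMost[OF _ _ c])
   (auto intro: has_vector_derivative_at_within d3[unfolded has_real_derivative_iff_has_vector_derivative])
 then show ?thesis by (simp add: Fn_def G1_def G2_def)
qed

lemma C2_gradient_Lipschitz:
 fixes \<mu> :: "real^'n::finite => real"
 assumes mu: "C2 \<mu>" and B: "\<And>i j z. z \<in> closed_segment a b ==> \<bar>pd i (pd j \<mu>) z\<bar> \<le> B"
 shows "\<bar>pd j \<mu> a - pd j \<mu> b\<bar> \<le> real CARD('n) * B * norm (a - b)"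
proof (rule differentiable_bound[of "closed_segment a b" "pd j \<mu>" "\<lambda>z h. \<Sum>i\<in>UNIV. h $ i * pd i (pd j \<mu>) z", simplified real_norm_def])
 have p: "has_pd i (pd j \<mu>)" "continuous_on UNIV (pd i (pd j \<mu>))" for i j
  using mu by (auto simp: C2_def)
 fix z assume z: "z \<in> closed_segment a b"
 show "(pd j \<mu> has_derivative (\<lambda>h. \<Sum>i\<in>UNIV. h $ i * pd i (pd j \<mu>) z)) (at z within closed_segment a b)"
  by (rule has_derivative_at_withinI[OF has_derivative_continuous_partials[OF p]])
 have B0: "0 \<le> B" using B[OF z] abs_ge_zero order_trans by blast
 show "onorm (\<lambda>h. \<Sum>i\<in>UNIV. h $ i * pd i (pd j \<mu>) z) \<le> real CARD('n) * B"
 proof (rule onorm_bound)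
  fix h :: "real^'n"
  have "norm (\<Sum>i\<in>UNIV. h $ i * pd i (pd j \<mu>) z) \<le> (\<Sum>i\<in>UNIV. norm (h $ i * pd i (pd j \<mu>) z))" by (rule norm_sum)
  also have "\<dots> \<le> (\<Sum>i\<in>(UNIV::'n set). norm h * B)"
   using B[OF z] component_le_norm_cart[of h] by (intro sum_mono) (auto simp: abs_mult intro!: mult_mono)
  finally show "norm (\<Sum>i\<in>UNIV. h $ i * pd i (pd j \<mu>) z) \<le> real CARD('n) * B * norm h" by (simp add: mult_ac)
 qed (use B0 in auto)
qed auto

section \<open>Comparison of the two weights\<close>

lemma jb_pos [simp]: "0 < jb x" "jb x \<noteq> 0"
 unfolding jb_def by (simp_all add: add_pos_nonneg) (metis add_pos_nonneg less_irrefl zero_le_power2 zero_less_one)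

lemma jb_continuous [continuous_intros]: "continuous_on S f ==> continuous_on S (\<lambda>x. jb (f x))"
 unfolding jb_def by (intro continuous_intros)

lemma jb_measurable [measurable]:
 assumes [measurable]: "f \<in> borel_measurable M" shows "(\<lambda>x. jb (f x)) \<in> borel_measurable M"
 unfolding jb_def by measurable

lemma jb_le_wt: "jb x \<le> wt 1 x" and wt_le_jb: "wt 1 x \<le> 2 * jb x"
proof -
 have "1 + (norm x)^2 \<le> (1 + norm x)^2" by (simp add: power2_eq_square algebra_simps)
 then have "jb x \<le> sqrt ((1 + norm x)^2)" unfolding jb_def by (rule real_sqrt_le_mono)
 then have "jb x \<le> 1 + norm x" by simp
 then show "jb x \<le> wt 1 x" by (simp add: wt_def)
 have "1 \<le> jb x" "norm x \<le> jb x" unfolding jb_def by (auto intro: real_le_rsqrt)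
 then show "wt 1 x \<le> 2 * jb x" by (simp add: wt_def)
qed

lemma jb_powr_le_wt: "jb x powr s \<le> 2 powr \<bar>s\<bar> * wt s x"
 and wt_le_jb_powr: "wt s x \<le> 2 powr \<bar>s\<bar> * jb x powr s"
proof -
 have a: "jb x powr t \<le> wt t x" "wt t x \<le> 2 powr t * jb x powr t" if t: "0 \<le> t" for t
 proof -
  have "jb x powr t \<le> wt 1 x powr t" using jb_le_wt t by (intro powr_mono2) (auto simp: less_imp_le)
  then show "jb x powr t \<le> wt t x" by (simp add: wt_powr)
  have "wt 1 x powr t \<le> (2 * jb x) powr t" using wt_le_jb t by (intro powr_mono2) auto
  then show "wt t x \<le> 2 powr t * jb x powr t" by (simp add: wt_powr powr_mult)
 qed
 have one: "1 \<le> 2 powr \<bar>s\<bar>" by (simp add: ge_one_powr_ge_zero)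
 show "jb x powr s \<le> 2 powr \<bar>s\<bar> * wt s x"
 proof (cases "0 \<le> s")
  case True
  have "1 * wt s x \<le> 2 powr \<bar>s\<bar> * wt s x" by (intro mult_right_mono one) auto
  then show ?thesis using a(1)[OF True] by linarith
 next
  case False
  then show ?thesis using a(2)[of "-s"] by (simp add: powr_minus wt_uminus_exp[of "-s" x, simplified] field_simps)
 qed
 show "wt s x \<le> 2 powr \<bar>s\<bar> * jb x powr s"
 proof (cases "0 \<le> s")
  case True
  then show ?thesis using a(2)[OF True] by simp
 next
  case False
  have "1 * jb x powr s \<le> 2 powr \<bar>s\<bar> * jb x powr s" by (intro mult_right_mono one) auto
  moreover have "wt s x \<le> jb x powr s"
   using a(1)[of "-s"] False by (simp add: powr_minus wt_uminus_exp[of "-s" x, simplified] field_simps)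
  ultimately show ?thesis by linarith
 qed
qed

section \<open>Averages over the unit interval, dilations and resolvents\<close>

lemma integrable_pair_bound:
 fixes G :: "'a => 'b => 'c::{banach,second_countable_topology}"
 assumes M: "sigma_finite_measure M" and N: "sigma_finite_measure N"
  and m: "case_prod G \<in> borel_measurable (M \<Otimes>\<^sub>M N)"
  and b: "\<And>x y. norm (G x y) \<le> u x * v y" and u: "integrable M u" and v: "integrable N v"
 shows "integrable (M \<Otimes>\<^sub>M N) (case_prod G)"
proof -
 interpret M: sigma_finite_measure M by fact
 interpret N: sigma_finite_measure N by fact
 interpret pair_sigma_finite M N ..
 have [measurable]: "u \<in> borel_measurable M" "v \<in> borel_measurable N" using u v by auto
 note m[measurable]
 have "integrable (M \<Otimes>\<^sub>M N) (\<lambda>(x, y). norm (u x) * norm (v y))"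
 proof (rule Fubini_integrable)
  have "integrable M (\<lambda>x. norm (u x) * (LINT y|N. norm (v y)))" using u by simp
  then show "integrable M (\<lambda>x. LINT y|N. norm (case (x, y) of (x, y) => norm (u x) * norm (v y)))" by simp
 qed (use v in auto)
 then show ?thesis
 proof (rule Bochner_Integration.integrable_bound)
  show "AE x in M \<Otimes>\<^sub>M N. norm (case_prod G x) \<le> norm (case x of (x, y) => norm (u x) * norm (v y))"
  proof (rule AE_I2)
   fix z :: "'a \<times> 'b"
   have "norm (G (fst z) (snd z)) \<le> \<bar>u (fst z) * v (snd z)\<bar>" using b[of "fst z" "snd z"] by linarith
   then show "norm (case_prod G z) \<le> norm (case z of (x, y) => norm (u x) * norm (v y))"
    by (simp add: case_prod_beta abs_mult)
  qed
 qed (rule m)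
qed

text \<open>Serves remainders in integral form, whose integrands contain a dilation by
  \<open>t\<close>. The bound is assumed for \<open>t > 0\<close> only, because scaling degenerates
  at \<open>t = 0\<close>, a null set.\<close>

lemma NW_unit_interval:
 fixes G :: "real => real^'n::finite => complex"
 assumes m: "case_prod G \<in> Bm"
  and b: "\<And>t y. t \<in> {0..1} ==> norm y \<le> R ==> norm (G t y) \<le> B"
  and z: "\<And>t y. R \<le> norm y ==> G t y = 0"
  and C: "\<And>t. 0 < t ==> t \<le> 1 ==> NW x0 r a (G t) \<le> C"
 shows "NW x0 r a (\<lambda>y. LBINT t. indicator {0..1} t *\<^sub>R G t y) \<le> C"
proof -
 have [measurable]: "case_prod G \<in> Bm2" using m by (simp add: borel_prod)
 define B' where "B' = \<bar>B\<bar>"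
 have int: "integrable (lborel \<Otimes>\<^sub>M lborel) (case_prod (\<lambda>t y. indicator {0..1} t *\<^sub>R G t y))"
 proof (rule integrable_pair_bound[where u="\<lambda>t. B' * indicator {0..1} t" and v="indicator (cball 0 R)"])
  show "L1 (\<lambda>t. B' * indicator {0..1::real} t)" by (intro integrable_mult_right) simp
  show "L1 (indicator (cball (0::real^'n) R) :: _ => real)"
   using emeasure_compact_finite[of "cball (0::real^'n) R"] by (simp add: integrable_indicator_iff)
  show "norm (indicator {0..1} t *\<^sub>R G t y) \<le> B' * indicator {0..1} t * indicator (cball 0 R) y" for t y
   using b[of t y] z[of y t] by (cases "norm y \<le> R") (auto simp: B'_def indicator_def)
 qed (auto simp: sigma_finite_lborel)
 have "NW x0 r a (\<lambda>y. LBINT t. indicator {0..1} t *\<^sub>R G t y) \<le> (NNI t. NW x0 r a (\<lambda>y. indicator {0..1} t *\<^sub>R G t y))"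
  by (rule NW_integral[OF sigma_finite_lborel int])
 also have "\<dots> \<le> (NNI t. C * indicator {0..1::real} t)"
 proof (rule nn_integral_mono_AE)
  have "AE t in lborel. t \<noteq> (0::real)" by (rule AE_lborel_singleton)
  then show "AE t in lborel. NW x0 r a (\<lambda>y. indicator {0..1} t *\<^sub>R G t y) \<le> C * indicator {0..1::real} t"
   by (rule AE_mp) (auto intro!: AE_I2 C simp: indicator_def)
 qed
 also have "\<dots> = C" by (simp add: nn_integral_cmult_indicator)
 finally show ?thesis .
qed

lemma wt_dilate_le: "0 \<le> r ==> 0 \<le> a ==> wt a (r *\<^sub>R x) \<le> (1 + r) powr a * wt a x"
proof -
 assume r: "0 \<le> r" "0 \<le> a"
 have "1 + r * norm x \<le> (1 + r) * (1 + norm x)" using r by (simp add: algebra_simps)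
 then have "(1 + r * norm x) powr a \<le> ((1 + r) * (1 + norm x)) powr a" using r by (intro powr_mono2) auto
 then show ?thesis using r by (simp add: wt_def powr_mult)
qed

lemma NW_dilate:
 assumes [measurable]: "F \<in> Bm" and r: "0 \<le> r" "0 \<le> a"
 shows "NW 0 r a F \<le> ennreal ((1 + r) powr a) * NW 0 1 a F"
 unfolding NW_def
proof (subst nn_integral_cmult[symmetric], measurable, rule nn_integral_mono)
 fix x
 have "norm (ifourier F x) * wt a (r *\<^sub>R x) \<le> norm (ifourier F x) * ((1 + r) powr a * wt a x)"
  by (intro mult_left_mono wt_dilate_le r) auto
 then show "ennreal (norm (ifourier F x) * wt a (r *\<^sub>R (x - 0))) \<le> ennreal ((1 + r) powr a) * ennreal (norm (ifourier F x) * wt a (1 *\<^sub>R (x - 0)))"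
  by (simp add: ennreal_mult[symmetric] mult_ac ennreal_leI)
qed

lemma gs_wt_bound: "\<exists>C\<ge>0. \<forall>x. gs x \<le> C * wt (- K) x"
proof (intro exI[of _ "exp (K^2)"] conjI allI)
 fix x :: 'a
 define r where "r = norm x"
 have r: "0 \<le> r" by (simp add: r_def)
 have "1 + norm x \<noteq> 0" using r unfolding r_def by linarith
 then have "wt K x = exp (K * ln (1 + r))" using r by (simp add: wt_def powr_def r_def)
 also have "K * ln (1 + r) \<le> \<bar>K\<bar> * r"
 proof -
  have "0 \<le> ln (1 + r)" "ln (1 + r) \<le> r" using r ln_add_one_self_le_self by auto
  then have "\<bar>K\<bar> * ln (1 + r) \<le> \<bar>K\<bar> * r" by (intro mult_left_mono) auto
  moreover have "K * ln (1 + r) \<le> \<bar>K\<bar> * ln (1 + r)" using \<open>0 \<le> ln (1 + r)\<close> by (intro mult_right_mono) auto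
  ultimately show ?thesis by linarith
 qed
 also have "\<bar>K\<bar> * r \<le> K^2 + pi * r^2"
 proof -
  have "0 \<le> (\<bar>K\<bar> - r)^2" by simp
  then have "2 * (\<bar>K\<bar> * r) \<le> K^2 + r^2" by (simp add: power2_eq_square algebra_simps)
  moreover have "r^2 \<le> pi * r^2" using pi_ge_two by (simp add: mult_le_cancel_right1)
  moreover have "0 \<le> \<bar>K\<bar> * r" using r by simp
  ultimately show ?thesis by (smt (verit) zero_le_power2)
 qed
 finally have "wt K x \<le> exp (K^2) * exp (pi * r^2)" by (simp add: exp_add[symmetric])
 then have "wt K x * gs x \<le> exp (K^2) * exp (pi * r^2) * gs x" by (intro mult_right_mono) auto
 also have "\<dots> = exp (K^2)" by (simp add: gs_def r_def exp_minus)
 finally show "gs x \<le> exp (K^2) * wt (- K) x" by (simp add: wt_uminus_exp field_simps)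
qed simp

lemma dec_gs: "dec K (\<lambda>x::real^'n::finite. cor (gs x))"
proof -
 obtain C where "C \<ge> 0" "\<And>x::real^'n. gs x \<le> C * wt (- K) x" using gs_wt_bound[of K] by blast
 then show ?thesis unfolding dec_def by (auto simp: ifourier_gs intro!: continuous_intros)
qed

lemma resolvent_gaussian_integral:
 assumes A: "0 < A"
 shows "has_bochner_integral lborel (\<lambda>l::real. indicator {0..} l * (2 * pi * l * exp (- pi * l^2 * A))) (1 / A)"
proof (rule has_bochner_integral_nn_integral)
 have "(NNI l. ennreal (2 * pi * l * exp (- pi * l^2 * A)) * indicator {0..} l) = ennreal (0 - (- exp (- pi * 0^2 * A) / A))"
 proof (rule nn_integral_FTC_atLeast)
  show "((\<lambda>l. - exp (- pi * l^2 * A) / A) has_real_derivative 2 * pi * l * exp (- pi * l^2 * A)) (at l)" for l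
   using A by (auto intro!: derivative_eq_intros simp: field_simps)
  show "((\<lambda>l. - exp (- pi * l^2 * A) / A) \<longlongrightarrow> 0) at_top"
   using A by real_asymp
 qed auto
 then show "(NNI l. ennreal (indicator {0..} l * (2 * pi * l * exp (- pi * l^2 * A)))) = ennreal (1 / A)"
  by (simp add: ennreal_mult' ennreal_indicator mult.commute)
qed (use A in \<open>auto simp: indicator_def\<close>)

text \<open>The function \<open>z\<^sub>i / (1 + |z|^2)\<close> is a superposition of dilated Gaussians times \<open>z\<^sub>i\<close>, so that
 its Fourier side is controlled with an integrable weight in the dilation parameter \<open>\<lambda>\<close>.\<close>
lemma NW_resolvent:
 fixes ch :: "real^'n::finite => complex"
 assumes ch: "good ch" and fin: "NW 0 1 a ch < \<infinity>" and a: "0 \<le> a"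
 shows "\<exists>C<\<infinity>. \<forall>w t. 0 < t \<longrightarrow> t \<le> 1 \<longrightarrow>
  NW 0 1 a (\<lambda>y. cor ((w + t *\<^sub>R y) $ i / (1 + (norm (w + t *\<^sub>R y))^2)) * ch y) \<le> C"
proof -
 define q where "q z = cor (z $ i) * cor (gs z)" for z :: "real^'n"
 \<comment> \<open>Twice the order wanted for \<open>q\<close>, since multiplying by a coordinate
   halves the order (\<open>dec_coord\<close>).\<close>
 define K where "K = 2 * (real CARD('n) + 3 + a)"
 have "dec (K / 2) q" unfolding q_def by (rule dec_coord[OF dec_gs]) (use a in \<open>simp add: K_def\<close>)
 moreover have "K / 2 = real CARD('n) + 3 + a" by (simp add: K_def)
 ultimately have qd: "dec (real CARD('n) + 3 + a) q" by (simp only:)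
 have gq: "good q" by (rule dec_good[OF qd]) (use a in simp)
 have qm [measurable]: "q \<in> Bm" "ch \<in> Bm" using gq ch good_measurable by auto
 have nq: "NW 0 1 a q < \<infinity>" by (rule dec_NW_finite[OF qd]) simp
 obtain Q where Q: "0 \<le> Q" "\<And>z. norm (q z) \<le> Q" using good_bound[OF gq] by auto
 obtain D where D: "0 \<le> D" "\<And>l::real. gs l \<le> D * wt (- (a + 2)) l" using gs_wt_bound[of "a + 2"] by blast
 define C where "C = NW 0 1 a ch * NW 0 1 a q * ennreal (2 * pi * D * wint TYPE(real) 2)"
 have "C < \<infinity>" using fin nq by (simp add: C_def ennreal_mult_less_top)
 moreover have "NW 0 1 a (\<lambda>y. cor ((w + t *\<^sub>R y) $ i / (1 + (norm (w + t *\<^sub>R y))^2)) * ch y) \<le> C"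
  if t: "0 < t" "t \<le> 1" for w t
 proof -
  \<comment> \<open>The factor \<open>l\<close> of \<open>resolvent_gaussian_integral\<close> is
    contained in \<open>q\<close>, as
    \<open>q (l *\<^sub>R z) = l * z $ i * gs (l *\<^sub>R z)\<close> up to coercions.\<close>
  define G where "G l y = cor (indicator {0..} l * (2 * pi * gs l)) * (q (l *\<^sub>R (w + t *\<^sub>R y)) * ch y)" for l :: real and y
  have gi: "L1 (\<lambda>l::real. gs l)" using gs_integrable[where 'a=real] by simp
  have int: "integrable (lborel \<Otimes>\<^sub>M lborel) (case_prod G)"
  proof (rule integrable_pair_bound[where u="\<lambda>l. 2 * pi * gs l * Q" and v="\<lambda>y. norm (ch y)"])
   show "case_prod G \<in> borel_measurable (lborel \<Otimes>\<^sub>M lborel)" unfolding G_def by measurable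
   show "norm (G l y) \<le> 2 * pi * gs l * Q * norm (ch y)" for l y
   proof -
    have "norm (G l y) \<le> (2 * pi * gs l) * (norm (q (l *\<^sub>R (w + t *\<^sub>R y))) * norm (ch y))"
    proof -
     have "norm (cor (indicator {0..} l * (2 * pi * gs l))) \<le> 2 * pi * gs l"
      unfolding norm_of_real by (auto simp: indicator_def abs_mult)
     then show ?thesis unfolding G_def norm_mult[of "cor (indicator {0..} l * (2 * pi * gs l))"] norm_mult[of "q _"]
      by (intro mult_right_mono) auto
    qed
    also have "\<dots> \<le> (2 * pi * gs l) * (Q * norm (ch y))" by (intro mult_left_mono mult_right_mono Q) auto
    finally show ?thesis by (simp add: mult.assoc)
   qed
   show "L1 (\<lambda>l::real. 2 * pi * gs l * Q)" using gi by simp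
   show "L1 (\<lambda>y. norm (ch y))" using goodD(2)[OF ch] by simp
  qed (auto simp: sigma_finite_lborel)
  have eq: "cor ((w + t *\<^sub>R y) $ i / (1 + (norm (w + t *\<^sub>R y))^2)) * ch y = (LBINT l. G l y)" for y
  proof -
   define z where "z = w + t *\<^sub>R y"
   have "0 < 1 + (norm z)^2" by (simp add: add_pos_nonneg)
   note H = resolvent_gaussian_integral[OF this]
   have "(LBINT l. G l y) = (LBINT l. cor (indicator {0..} l * (2 * pi * l * exp (- pi * l^2 * (1 + (norm z)^2)))) * (cor (z $ i) * ch y))"
   proof (intro Bochner_Integration.integral_cong refl)
    fix l :: real
    have "gs l * gs (l *\<^sub>R z) = exp (- pi * l^2 * (1 + (norm z)^2))"
     by (simp add: gs_def exp_add[symmetric] power_mult_distrib algebra_simps)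
    then have e: "cor (gs l) * cor (gs (l *\<^sub>R z)) = cor (exp (- pi * l^2 * (1 + (norm z)^2)))"
     by (metis of_real_mult)
    have "G l y = cor (indicator {0..} l * (2 * pi * l)) * (cor (gs l) * cor (gs (l *\<^sub>R z))) * (cor (z $ i) * ch y)"
     by (simp add: G_def q_def z_def[symmetric] mult_ac)
    then show "G l y = cor (indicator {0..} l * (2 * pi * l * exp (- pi * l^2 * (1 + (norm z)^2)))) * (cor (z $ i) * ch y)"
     unfolding e by (simp add: mult_ac)
   qed
   also have "\<dots> = cor (1 / (1 + (norm z)^2)) * (cor (z $ i) * ch y)"
    using H unfolding has_bochner_integral_iff by (simp only: integral_mult_left_zero integral_complex_of_real)
   finally show ?thesis by (simp add: z_def)
  qed
  have "NW 0 1 a (\<lambda>y. LBINT l. G l y) \<le> (NNI l. NW 0 1 a (G l))"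
   by (rule NW_integral[OF sigma_finite_lborel int])
  also have "\<dots> \<le> (NNI (l::real). (NW 0 1 a ch * NW 0 1 a q) * ennreal (2 * pi * D * wt (- 2) l))"
  proof (rule nn_integral_mono_AE)
   have "AE l in lborel. l \<noteq> (0::real)" by (rule AE_lborel_singleton)
   then show "AE l in lborel. NW 0 1 a (G l) \<le> (NW 0 1 a ch * NW 0 1 a q) * ennreal (2 * pi * D * wt (- 2) (l::real))"
   proof (rule AE_mp, intro AE_I2 impI)
    fix l :: real assume l0: "l \<noteq> 0"
    show "NW 0 1 a (G l) \<le> (NW 0 1 a ch * NW 0 1 a q) * ennreal (2 * pi * D * wt (- 2) l)"
    proof (cases "0 < l")
     case False
     then have "G l = (\<lambda>y. 0)" using l0 by (auto simp: G_def)
     then show ?thesis by simp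
    next
     case True
     \<comment> \<open>The shift by \<open>w\<close> is free and the dilation by
       \<open>r \<le> l\<close> costs at most \<open>wt a l\<close>, which the Gaussian in
       \<open>l\<close> absorbs; this is the uniformity in \<open>w\<close> and
       \<open>t\<close>.\<close>
     define r where "r = l * t"
     have r: "0 < r" "r \<le> l" using t True by (auto simp: r_def mult_left_le)
     have qe: "(\<lambda>y. q (l *\<^sub>R (w + t *\<^sub>R y))) = (\<lambda>y. (\<lambda>y. q (r *\<^sub>R y)) (y + (1 / t) *\<^sub>R w))"
      using t by (auto simp: r_def algebra_simps)
     have qi: "L1 (\<lambda>y. q (l *\<^sub>R (w + t *\<^sub>R y)))"
     proof -
      have "L1 (\<lambda>y. q (0 + r *\<^sub>R y))" by (rule integrable_lborel_affine[OF goodD(2)[OF gq]]) (use r in simp)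
      from integrable_lborel_translate(1)[OF this, of "(1/t) *\<^sub>R w"] show ?thesis unfolding qe by simp
     qed
     have "NW 0 1 a (\<lambda>y. q (l *\<^sub>R (w + t *\<^sub>R y))) = NW 0 r a q"
      unfolding qe by (subst NW_shift, subst NW_scale) (use r in auto)
     also have "\<dots> \<le> ennreal ((1 + r) powr a) * NW 0 1 a q" by (rule NW_dilate) (use r a in auto)
     also have "\<dots> \<le> ewt a l * NW 0 1 a q"
      unfolding wt_def using r a by (intro mult_right_mono ennreal_leI powr_mono2) auto
     finally have n1: "NW 0 1 a (\<lambda>y. q (l *\<^sub>R (w + t *\<^sub>R y))) \<le> ewt a l * NW 0 1 a q" .
     have "NW 0 1 a (\<lambda>y. ch y * q (l *\<^sub>R (w + t *\<^sub>R y))) \<le> NW 0 1 a ch * NW 0 1 a (\<lambda>y. q (l *\<^sub>R (w + t *\<^sub>R y)))"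
      by (rule NW_mult[OF ch qi a fin])
     also have "\<dots> \<le> NW 0 1 a ch * (ewt a l * NW 0 1 a q)" by (intro mult_left_mono n1) auto
     finally have n2: "NW 0 1 a (\<lambda>y. ch y * q (l *\<^sub>R (w + t *\<^sub>R y))) \<le> NW 0 1 a ch * (ewt a l * NW 0 1 a q)" .
     have "NW 0 1 a (G l) = ennreal (2 * pi * gs l) * NW 0 1 a (\<lambda>y. ch y * q (l *\<^sub>R (w + t *\<^sub>R y)))"
     proof -
      have "G l = (\<lambda>y. cor (2 * pi * gs l) * (ch y * q (l *\<^sub>R (w + t *\<^sub>R y))))"
       using True by (auto simp: G_def)
      moreover have "(\<lambda>y. ch y * q (l *\<^sub>R (w + t *\<^sub>R y))) \<in> Bm" by measurable
      ultimately show ?thesis by (simp only: NW_cmult norm_of_real) (simp add: abs_mult)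
     qed
     also have "\<dots> \<le> ennreal (2 * pi * gs l) * (NW 0 1 a ch * (ewt a l * NW 0 1 a q))"
      by (intro mult_left_mono n2) auto
     also have "\<dots> = (NW 0 1 a ch * NW 0 1 a q) * ennreal (2 * pi * gs l * wt a l)"
      by (simp add: ennreal_mult mult_ac)
     also have "\<dots> \<le> (NW 0 1 a ch * NW 0 1 a q) * ennreal (2 * pi * D * wt (- 2) l)"
     proof (intro mult_left_mono ennreal_leI)
      have "gs l * wt a l \<le> (D * wt (- (a + 2)) l) * wt a l" by (intro mult_right_mono D) auto
      also have "\<dots> = D * wt (- 2) l" by (simp add: mult.assoc wt_mult)
      finally show "2 * pi * gs l * wt a l \<le> 2 * pi * D * wt (- 2) l" by simp
     qed auto
     finally show ?thesis .
    qed
   qed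
  qed
  also have "\<dots> = C"
   unfolding C_def using D(1)
   by (subst nn_integral_cmult) (auto simp: ennreal_mult nn_integral_cmult wint_eq[of 2, where 'a=real, simplified] mult.assoc)
  finally show ?thesis unfolding eq .
 qed
 ultimately show ?thesis by blast
qed

section \<open>Change of window\<close>

lemma vec_nth_measurable [measurable]:
 fixes f :: "'a => real^'n::finite"
 assumes [measurable]: "f \<in> borel_measurable M" shows "(\<lambda>x. f x $ i) \<in> borel_measurable M"
proof -
 have "(\<lambda>x. f x $ i) = (\<lambda>x. f x \<bullet> axis i 1)" by (simp add: inner_axis)
 then show ?thesis by simp
qed

lemma cnj_measurable [measurable]:
 assumes [measurable]: "f \<in> borel_measurable M" shows "(\<lambda>x. cnj (f x)) \<in> borel_measurable M"
proof -
 have "cnj \<in> Bm" by (intro borel_measurable_continuous_onI continuous_intros)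
 then show ?thesis by (rule measurable_compose[OF assms])
qed

text \<open>\<open>jb\<close> to the power \<open>s\<close> is the exponential of
  \<open>s / 2\<close> times a logarithm, so the ratio is the exponential of a difference of
  logarithms. The gradient of the logarithm consists of the resolvent functions, whose norms are
  bounded uniformly in the base point, and \<open>NW_exp\<close> finishes.\<close>

lemma NW_jb_ratio:
 fixes \<psi> :: "real^'n::finite => complex"
 assumes g: "good \<psi>" and fin: "NW 0 1 a \<psi> < \<infinity>" and a: "0 \<le> a"
  and R: "0 \<le> R" and supp: "\<And>y. R \<le> norm y ==> \<psi> y = 0"
 shows "\<exists>C<\<infinity>. \<forall>w. NW 0 1 a (\<lambda>y. cor (jb (w + y) powr s / jb w powr s) * \<psi> y) \<le> C"
proof -
 define K where "K = 2 * (real CARD('n) + 3 + a)"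
 obtain ch :: "real^'n => complex" where ch: "dec K ch" "\<And>y. norm y \<le> R ==> ch y = 1" "\<And>y. R + 2 \<le> norm y ==> ch y = 0"
  using plateau_exists[OF R, of K] a by (auto simp: K_def)
 define X where "X i y = cor (y $ i) * ch y" for i y
 have Kh: "K / 2 = real CARD('n) + 3 + a" by (simp add: K_def)
 have Xd: "dec (real CARD('n) + 3 + a) (X i)" for i
  using dec_coord[OF ch(1), of i] a unfolding X_def[abs_def] Kh by (simp add: K_def)
 have Xg: "good (X i)" for i by (rule dec_good[OF Xd]) (use a in simp)
 have Xf: "NW 0 1 a (X i) < \<infinity>" for i by (rule dec_NW_finite[OF Xd]) simp
 have chc: "continuous_on UNIV ch" using ch(1) by (simp add: dec_def)
 have [measurable]: "X i \<in> Bm" for i using Xg good_measurable by blast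
 obtain C where C: "\<And>i. C i < \<infinity>" "\<And>i w t. 0 < t ==> t \<le> 1 ==>
  NW 0 1 a (\<lambda>y. cor ((w + t *\<^sub>R y) $ i / (1 + (norm (w + t *\<^sub>R y))^2)) * X i y) \<le> C i"
 proof -
  have "\<forall>i. \<exists>C<\<infinity>. \<forall>w t. 0 < t \<longrightarrow> t \<le> 1 \<longrightarrow>
   NW 0 1 a (\<lambda>y. cor ((w + t *\<^sub>R y) $ i / (1 + (norm (w + t *\<^sub>R y))^2)) * X i y) \<le> C"
   using NW_resolvent[OF Xg Xf a] by blast
  then show ?thesis using that unfolding choice_iff by blast
 qed
 define B where "B = enn2real (\<Sum>i\<in>UNIV. 2 * C i)"
 have B: "(\<Sum>i\<in>UNIV. 2 * C i) = ennreal B"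
  unfolding B_def using C(1) by (intro ennreal_enn2real[symmetric]) (simp add: ennreal_mult_less_top)
 define Q where "Q i w t y = cor ((w + t *\<^sub>R y) $ i / (1 + (norm (w + t *\<^sub>R y))^2)) * X i y" for i w t y
 define E where "E w y = cor (ln (1 + (norm (w + y))^2) - ln (1 + (norm w)^2)) * ch y" for w y
 have p: "0 < 1 + (norm z)^2" "1 + (norm z)^2 \<noteq> 0" for z :: "real^'n"
  using zero_le_power2[of "norm z"] by linarith+
 have Ec: "continuous_on UNIV (E w)" for w unfolding E_def using p by (intro continuous_intros chc) auto
 have Eg: "good (E w)" for w by (rule good_compact_support[OF Ec, of "R + 2"]) (simp add: E_def ch)
 have Qz: "R + 2 \<le> norm y ==> Q i w t y = 0" for i w t y by (simp add: Q_def X_def ch)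
 have Qc: "continuous_on UNIV (\<lambda>y. Q i w t y)" for i w t unfolding Q_def
  using p goodD(1)[OF Xg] by (intro continuous_intros) auto
 have Qt: "continuous_on UNIV (\<lambda>t. Q i w t y)" for i w y unfolding Q_def
  using p by (intro continuous_intros) auto
 obtain D where D: "\<And>i x. norm (X i x) \<le> D i" using good_bound[OF Xg] by metis
 have Qb: "norm (Q i w t y) \<le> D i" for i w t y
 proof -
  define z where "z = w + t *\<^sub>R y"
  have "\<bar>z $ i\<bar> \<le> 1 + (norm z)^2"
  proof -
   have "norm z \<le> 1 + (norm z)^2" using zero_le_power2[of "norm z - 1"] norm_ge_zero[of z]
    by (simp only: power2_eq_square algebra_simps)
   then show ?thesis using component_le_norm_cart[of z i] by linarith
  qed
  then have "\<bar>z $ i\<bar> / (1 + (norm z)^2) \<le> 1" using p[of z] by (simp add: divide_le_eq_1)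
  then have le: "\<bar>z $ i / (1 + (norm z)^2)\<bar> \<le> 1" using p[of z] by (simp add: abs_divide)
  have "\<bar>z $ i / (1 + (norm z)^2)\<bar> * norm (X i y) \<le> 1 * D i" by (intro mult_mono D le) auto
  then show ?thesis by (simp only: Q_def z_def[symmetric] norm_mult norm_of_real mult_1)
 qed
 define I where "I i w y = (LBINT t. indicator {0..1} t *\<^sub>R Q i w t y)" for i w y
 have IN: "NW 0 1 a (I i w) \<le> C i" for i w unfolding I_def
 proof (rule NW_unit_interval[where R="R + 2" and B="D i"])
  show "case_prod (Q i w) \<in> Bm" unfolding Q_def borel_prod[symmetric] by measurable
  show "NW 0 1 a (Q i w t) \<le> C i" if "0 < t" "t \<le> 1" for t using C(2)[OF that] by (simp add: Q_def[abs_def])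
 qed (use Qb Qz in auto)
 have Qint: "L1 (\<lambda>t. indicator {0..1} t *\<^sub>R Q i w t y)" for i w y
  by (rule borel_integrable_compact) (auto intro: continuous_on_subset[OF Qt])
 have Ig: "L1 (I i w)" for i w
 proof -
  have "integrable (lborel \<Otimes>\<^sub>M lborel) (case_prod (\<lambda>t y. indicator {0..1} t *\<^sub>R Q i w t y))"
  proof (rule integrable_pair_bound[where u="\<lambda>t. \<bar>D i\<bar> * indicator {0..1} t" and v="indicator (cball 0 (R + 2))"])
   show "L1 (\<lambda>t. \<bar>D i\<bar> * indicator {0..1::real} t)" by (intro integrable_mult_right) simp
   show "L1 (indicator (cball (0::real^'n) (R + 2)) :: _ => real)"
    using emeasure_compact_finite[of "cball (0::real^'n) (R + 2)"] by (simp add: integrable_indicator_iff)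
   show "norm (indicator {0..1} t *\<^sub>R Q i w t y) \<le> \<bar>D i\<bar> * indicator {0..1} t * indicator (cball 0 (R + 2)) y" for t y
    using Qb[of i w t y] Qz[of y i w t] by (cases "norm y \<le> R + 2") (auto simp: indicator_def)
   show "(\<lambda>(t, y). indicator {0..1} t *\<^sub>R Q i w t y) \<in> borel_measurable (lborel \<Otimes>\<^sub>M lborel)"
    unfolding Q_def by measurable
  qed (auto simp: sigma_finite_lborel)
  then show ?thesis unfolding I_def[abs_def] by (rule lborel_pair.integrable_snd)
 qed
 \<comment> \<open>Fundamental theorem along the segment from \<open>w\<close> to
   \<open>w + y\<close>. The derivative is the scalar product of the gradient with \<open>y\<close>;
   the coordinate \<open>y $ i\<close> has been absorbed into \<open>X i\<close>.\<close>
 have EI: "E w y = (\<Sum>i\<in>UNIV. 2 * I i w y)" for w y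
 proof -
  define f where "f t = 2 * ((w + t *\<^sub>R y) \<bullet> y) / (1 + (norm (w + t *\<^sub>R y))^2)" for t
  have fd: "((\<lambda>t. ln (1 + (norm (w + t *\<^sub>R y))^2)) has_real_derivative f t) (at t)" for t
   unfolding power2_norm_eq_inner f_def using p[of "w + t *\<^sub>R y", unfolded power2_norm_eq_inner]
   by (auto intro!: derivative_eq_intros simp: inner_commute inner_add_left inner_add_right field_simps)
  have fc: "continuous_on {0..1} f" unfolding f_def using p by (intro continuous_intros) auto
  have 1: "(LBINT t. indicator {0..1} t *\<^sub>R f t) = ln (1 + (norm (w + 1 *\<^sub>R y))^2) - ln (1 + (norm (w + 0 *\<^sub>R y))^2)"
   by (rule integral_FTC_atLeastAtMost[OF _ _ fc])
    (auto intro: has_vector_derivative_at_within fd[unfolded has_real_derivative_iff_has_vector_derivative])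
  have "(\<Sum>i\<in>UNIV. 2 * I i w y) = (LBINT t. (\<Sum>i\<in>UNIV. 2 * (indicator {0..1} t *\<^sub>R Q i w t y)))"
   unfolding I_def
   by (subst Bochner_Integration.integral_sum) (intro integrable_mult_right Qint, simp only: integral_mult_right_zero)
  also have "\<dots> = (LBINT t. cor (indicator {0..1} t *\<^sub>R f t) * ch y)"
  proof (intro Bochner_Integration.integral_cong refl)
   fix t :: real
   define z where "z = w + t *\<^sub>R y"
   have "(\<Sum>i\<in>UNIV. 2 * (indicator {0..1} t *\<^sub>R Q i w t y)) = cor (\<Sum>i\<in>UNIV. 2 * (indicator {0..1} t * (z $ i / (1 + (norm z)^2) * y $ i))) * ch y"
    unfolding of_real_sum sum_distrib_right Q_def X_def z_def[symmetric]
    by (intro sum.cong refl) (simp add: scaleR_conv_of_real mult_ac)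
   also have "(\<Sum>i\<in>UNIV. 2 * (indicator {0..1} t * (z $ i / (1 + (norm z)^2) * y $ i))) = indicator {0..1} t *\<^sub>R f t"
    unfolding f_def z_def[symmetric] inner_vec_def by (simp add: sum_distrib_left sum_divide_distrib mult_ac)
   finally show "(\<Sum>i\<in>UNIV. 2 * (indicator {0..1} t *\<^sub>R Q i w t y)) = cor (indicator {0..1} t *\<^sub>R f t) * ch y" .
  qed
  also have "\<dots> = cor (LBINT t. indicator {0..1} t *\<^sub>R f t) * ch y"
   by (simp only: integral_mult_left_zero integral_complex_of_real)
  finally show ?thesis unfolding 1 E_def by simp
 qed
 have EN: "NW 0 1 a (E w) \<le> ennreal B" for w
 proof -
  have Im: "I i w \<in> Bm" for i using Ig[of i w] by auto
  have "NW 0 1 a (E w) = NW 0 1 a (\<lambda>y. \<Sum>i\<in>UNIV. 2 * I i w y)" by (simp add: EI[abs_def])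
  also have "\<dots> \<le> (\<Sum>i\<in>UNIV. NW 0 1 a (\<lambda>y. 2 * I i w y))"
   using Ig by (intro NW_sum integrable_mult_right) auto
  also have "\<dots> = (\<Sum>i\<in>UNIV. 2 * NW 0 1 a (I i w))"
  proof (intro sum.cong refl)
   fix i
   have "NW 0 1 a (\<lambda>y. 2 * I i w y) = enorm (2::complex) * NW 0 1 a (I i w)" by (rule NW_cmult[OF Im])
   then show "NW 0 1 a (\<lambda>y. 2 * I i w y) = 2 * NW 0 1 a (I i w)" by simp
  qed
  also have "\<dots> \<le> (\<Sum>i\<in>UNIV. 2 * C i)" by (intro sum_mono mult_left_mono IN) auto
  finally show ?thesis unfolding B .
 qed
 show ?thesis
 proof (intro exI[of _ "ennreal (exp (norm (cor (s / 2)) * B)) * NW 0 1 a \<psi>"] conjI allI)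
  show "ennreal (exp (norm (cor (s / 2)) * B)) * NW 0 1 a \<psi> < \<infinity>" using fin by (simp add: ennreal_mult_less_top)
  fix w
  have "(\<lambda>y. cor (jb (w + y) powr s / jb w powr s) * \<psi> y) = (\<lambda>y. exp (cor (s / 2) * E w y) * \<psi> y)"
  proof (rule ext)
   fix y
   show "cor (jb (w + y) powr s / jb w powr s) * \<psi> y = exp (cor (s / 2) * E w y) * \<psi> y"
   proof (cases "R \<le> norm y")
    case False
    then have "E w y = cor (ln (1 + (norm (w + y))^2) - ln (1 + (norm w)^2))" by (simp add: E_def ch)
    moreover have "exp (s / 2 * (ln (1 + (norm (w + y))^2) - ln (1 + (norm w)^2))) = jb (w + y) powr s / jb w powr s"
    proof -
     have j: "jb z powr s = exp (s / 2 * ln (1 + (norm z)^2))" for z :: "real^'n"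
      using p[of z] by (simp add: jb_def powr_def ln_sqrt)
     show ?thesis by (simp add: j right_diff_distrib exp_diff)
    qed
    ultimately show ?thesis by (simp only: of_real_mult[symmetric] exp_of_real)
   qed (simp add: supp)
  qed
  then show "NW 0 1 a (\<lambda>y. cor (jb (w + y) powr s / jb w powr s) * \<psi> y)
   \<le> ennreal (exp (norm (cor (s / 2)) * B)) * NW 0 1 a \<psi>"
   using NW_exp(2)[OF Eg g a EN _ fin, of "cor (s / 2)"] by (simp add: B_def)
 qed
qed

lemma L2_norm_pos:
 fixes \<phi> :: "real^'n::finite => complex"
 assumes g: "good \<phi>" and nz: "\<phi> \<noteq> (\<lambda>_. 0)"
 shows "L1 (\<lambda>y. (norm (\<phi> y))^2)" "0 < (LBINT y. (norm (\<phi> y))^2)"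
proof -
 have [measurable]: "\<phi> \<in> Bm" by (rule good_measurable[OF g])
 show i2: "L1 (\<lambda>y. (norm (\<phi> y))^2)"
  using integrable_norm[OF goodD(2)[OF good_mult[OF g g]]] by (simp add: norm_mult power2_eq_square)
 have "0 \<le> (LBINT y. (norm (\<phi> y))^2)" by (intro Bochner_Integration.integral_nonneg) simp
 moreover have "(LBINT y. (norm (\<phi> y))^2) \<noteq> 0"
 proof
  assume "(LBINT y. (norm (\<phi> y))^2) = 0"
  then have ae: "AE y in lborel. (norm (\<phi> y))^2 = 0"
   using i2 by (subst (asm) integral_nonneg_eq_0_iff_AE) auto
  obtain y0 where y0: "\<phi> y0 \<noteq> 0" using nz by auto
  have op: "open {y. \<phi> y \<noteq> 0}" using open_vimage[OF _ goodD(1)[OF g], of "- {0}"] by (simp add: vimage_def open_Compl)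
  have "{y \<in> space lborel. \<not> (norm (\<phi> y))^2 = 0} \<in> sets lborel" by measurable
  from AE_iff_null[OF this] ae have "{y. \<phi> y \<noteq> 0} \<in> null_sets lborel" by simp
  then have "{y. \<phi> y \<noteq> 0} = {}" using op by (meson null_sets_completionI open_not_negligible negligible_iff_null_sets)
  then show False using y0 by auto
 qed
 ultimately show "0 < (LBINT y. (norm (\<phi> y))^2)" by linarith
qed

text \<open>Passing from the window \<open>\<phi>\<close> to a compactly supported one:
 \<open>|\<phi>|\<^sub>2\<^sup>2 g \<psi> = \<integral> (g cnj \<phi>(\<cdot> - w)) (\<phi>(\<cdot> - w) \<psi>) dw\<close>.\<close>
lemma NW_window_change:
 fixes \<phi> \<psi> g :: "real^'n::finite => complex"
 assumes phi: "\<And>K. dec K \<phi>" and nz: "\<phi> \<noteq> (\<lambda>_. 0)" and psi: "dec K \<psi>" and K: "2 * (real CARD('n) + 1 + a) + real CARD('n) < K"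
  and a: "0 \<le> a" and supp: "\<And>y. R \<le> norm y ==> \<psi> y = 0" and g: "continuous_on UNIV g"
  and int: "\<And>x. L1 (\<lambda>y. g y * cnj (\<phi> (y - x)))"
  and D: "AE w in lborel. (NNI \<xi>. ennreal (norm (stft \<phi> g w \<xi>) * jb \<xi> powr a)) \<le> ennreal D"
 shows "\<exists>C\<ge>0. \<forall>z. NW 0 1 a (\<lambda>y. g (y + z) * \<psi> y) \<le> ennreal C"
proof -
 have n: "0 \<le> real CARD('n)" by simp
 define L where "L = real CARD('n) + 1 + a"
 have L: "0 \<le> L" "real CARD('n) < K - 2 * L" using K a by (auto simp: L_def)
 obtain C where C: "0 \<le> C" "\<And>u v x. norm (ifourier (\<lambda>h. \<phi> (h - u) * \<psi> (h - v)) x) \<le> C * wt (- L) (u - v) * wt (- L) x"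
  using dec_product_shift[OF phi psi L] by blast
 have gphi: "good \<phi>" by (rule dec_good[OF phi[of "real CARD('n) + 1"]]) simp
 have gpsi: "good \<psi>" by (rule dec_good[OF psi]) (use L a in \<open>simp add: L_def\<close>)
 have [measurable]: "\<phi> \<in> Bm" "\<psi> \<in> Bm" "g \<in> Bm"
  using gphi gpsi good_measurable g by (auto intro: borel_measurable_continuous_onI)
 have phic: "continuous_on UNIV \<phi>" by (rule goodD(1)[OF gphi])
 have psic: "continuous_on UNIV \<psi>" by (rule goodD(1)[OF gpsi])
 define n2 where "n2 = (LBINT y. (norm (\<phi> y))^2)"
 note i2 = L2_norm_pos(1)[OF gphi nz]
 have n2: "0 < n2" unfolding n2_def by (rule L2_norm_pos(2)[OF gphi nz])
 define CD where "CD = C * wint TYPE(real^'n) (L - a) * (2 powr a * D) * wint TYPE(real^'n) L"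
 \<comment> \<open>The norm of \<open>A z w\<close> is the weighted integral of the short-time
   Fourier transform at \<open>w\<close>, whatever \<open>z\<close> is; the norm of
   \<open>Bw z w\<close> decays in \<open>w - z\<close> and makes the integral over \<open>w\<close>
   converge.\<close>
 define A where "A z w y = g (y + z) * cnj (\<phi> (y + z - w))" for z w y
 define Bw where "Bw z w y = \<phi> (y - (w - z)) * \<psi> (y - 0)" for z w y
 \<comment> \<open>The hypothesis is an essential supremum, hence a bound for almost every
   \<open>w\<close>. This suffices because \<open>w\<close> is integrated out.\<close>
 have AN: "AE w in lborel. \<forall>z. NW 0 1 a (A z w) \<le> ennreal (2 powr a * D)"
 proof (rule AE_mp[OF D], intro AE_I2 impI allI)
  fix w z assume *: "(NNI \<xi>. ennreal (norm (stft \<phi> g w \<xi>) * jb \<xi> powr a)) \<le> ennreal D"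
  have "NW 0 1 a (A z w) = NW 0 1 a (\<lambda>y. g y * cnj (\<phi> (y - w)))"
   using NW_shift[of 0 1 a "\<lambda>y. g y * cnj (\<phi> (y - w))" z] by (simp add: A_def[abs_def])
  also have "\<dots> = (NNI x. ennreal (norm (stft \<phi> g w (- x)) * wt a (- x)))"
   unfolding NW_def by (simp add: stft_def ifourier_def inner_commute)
  also have "\<dots> \<le> (NNI x. ennreal (2 powr a) * ennreal (norm (stft \<phi> g w (- x)) * jb (- x) powr a))"
  proof (rule nn_integral_mono)
   fix x :: "real^'n"
   have "norm (stft \<phi> g w (- x)) * wt a (- x) \<le> norm (stft \<phi> g w (- x)) * (2 powr \<bar>a\<bar> * jb (- x) powr a)"
    by (intro mult_left_mono wt_le_jb_powr) auto
   then show "ennreal (norm (stft \<phi> g w (- x)) * wt a (- x)) \<le> ennreal (2 powr a) * ennreal (norm (stft \<phi> g w (- x)) * jb (- x) powr a)"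
    using a by (simp add: ennreal_mult[symmetric] mult_ac ennreal_leI)
  qed
  also have "\<dots> = ennreal (2 powr a) * (NNI x. ennreal (norm (stft \<phi> g w (- x)) * jb (- x) powr a))"
   unfolding stft_def by (rule nn_integral_cmult) measurable
  also have "(NNI x. ennreal (norm (stft \<phi> g w (- x)) * jb (- x) powr a)) = (NNI x. ennreal (norm (stft \<phi> g w x) * jb x powr a))"
   by (rule nn_integral_lborel_translate(4)[of "\<lambda>x. ennreal (norm (stft \<phi> g w x) * jb x powr a)"]) (unfold stft_def, measurable)
  also have "\<dots> \<le> ennreal D" by (rule *)
  finally show "NW 0 1 a (A z w) \<le> ennreal (2 powr a * D)" by (simp add: ennreal_mult' mult_left_mono)
 qed
 have Ai: "L1 (A z w)" for z w
  using integrable_lborel_translate(1)[OF int[of w], of z] by (simp add: A_def[abs_def])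
 have Bg: "good (Bw z w)" for z w unfolding Bw_def
  by (rule good_compact_support[of _ R])
   (auto simp: supp intro!: continuous_intros continuous_on_compose2[OF phic] continuous_on_compose2[OF psic])
 have BN: "NW 0 1 a (Bw z w) \<le> ennreal (C * wt (- L) (w - z) * wint TYPE(real^'n) (L - a))" for z w
  unfolding Bw_def by (rule NW_wt_bound) (use C(2)[of "w - z" 0] C(1) in \<open>auto simp: L_def\<close>)
 have main: "NW 0 1 a (\<lambda>y. g (y + z) * \<psi> y) \<le> ennreal (norm (1 / n2) * CD)" for z
 proof -
  define G where "G w y = Bw z w y * A z w y" for w y
  have [measurable]: "case_prod G \<in> borel_measurable (lborel \<Otimes>\<^sub>M lborel)" unfolding G_def A_def Bw_def by measurable
  have Ge: "G w y = (g (y + z) * \<psi> y) * cor ((norm (\<phi> (y + z - w)))^2)" for w y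
   unfolding G_def A_def Bw_def complex_norm_square by (simp add: algebra_simps)
  have Gn: "norm (G w y) = norm (g (y + z) * \<psi> y) * (norm (\<phi> (y + z - w)))^2" for w y
   unfolding Ge norm_mult[of "_ * _" "cor _"] norm_of_real by simp
  have gpsi_i: "L1 (\<lambda>y. g (y + z) * \<psi> y)"
   by (rule integrable_compact_support(1)[of _ R]) (auto simp: supp intro!: continuous_intros continuous_on_compose2[OF g] psic)
  have i2y: "L1 (\<lambda>w. (norm (\<phi> (y + z - w)))^2)" for y
   using integrable_lborel_translate(3)[OF i2, of "y + z"] .
  have i2v: "(LBINT w. (norm (\<phi> (y + z - w)))^2) = n2" for y
   unfolding n2_def by (rule integral_lborel_translate(3))
  have int2: "integrable (lborel \<Otimes>\<^sub>M lborel) (case_prod G)"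
  proof -
   have "integrable (lborel \<Otimes>\<^sub>M lborel) (\<lambda>(y, w). G w y)"
   proof (rule lborel_pair.Fubini_integrable)
    show "(\<lambda>(y, w). G w y) \<in> borel_measurable (lborel \<Otimes>\<^sub>M lborel)" by measurable
    show "L1 (\<lambda>y. LBINT w. norm (case (y, w) of (y, w) => G w y))"
     unfolding split Gn integral_mult_right_zero i2v by (intro integrable_mult_left integrable_norm gpsi_i)
    show "AE y in lborel. L1 (\<lambda>w. case (y, w) of (y, w) => G w y)"
     unfolding Ge split using i2y by (intro AE_I2 integrable_mult_right integrable_of_real)
   qed
   then show ?thesis by (subst (asm) lborel_pair.integrable_product_swap_iff[symmetric]) (simp add: case_prod_beta)
  qed
  have eq: "(\<lambda>y. g (y + z) * \<psi> y) = (\<lambda>y. cor (1 / n2) * (LBINT w. G w y))"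
  proof (rule ext)
   fix y
   have "(LBINT w. G w y) = (g (y + z) * \<psi> y) * cor n2"
    unfolding Ge by (simp only: integral_mult_right_zero integral_complex_of_real i2v)
   then show "g (y + z) * \<psi> y = cor (1 / n2) * (LBINT w. G w y)" using n2 by simp
  qed
  have "NW 0 1 a (\<lambda>y. LBINT w. G w y) \<le> (NNI w. NW 0 1 a (G w))"
   by (rule NW_integral[OF sigma_finite_lborel int2])
  also have "\<dots> \<le> (NNI w. ennreal (C * wint TYPE(real^'n) (L - a) * (2 powr a * D)) * ewt (- L) (w - z))"
  proof (rule nn_integral_mono_AE, rule AE_mp[OF AN], intro AE_I2 impI)
   fix w assume *: "\<forall>z. NW 0 1 a (A z w) \<le> ennreal (2 powr a * D)"
   have "NW 0 1 a (G w) \<le> NW 0 1 a (Bw z w) * NW 0 1 a (A z w)"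
    unfolding G_def by (rule NW_mult[OF Bg Ai a]) (use BN[of z w] in \<open>auto intro: order_le_less_trans\<close>)
   also have "\<dots> \<le> ennreal (C * wt (- L) (w - z) * wint TYPE(real^'n) (L - a)) * ennreal (2 powr a * D)"
    using * by (intro mult_mono BN) auto
   also have "\<dots> = ennreal (C * wint TYPE(real^'n) (L - a) * (2 powr a * D)) * ewt (- L) (w - z)"
    using C(1) by (simp add: ennreal_mult' ennreal_mult'' mult_ac)
   finally show "NW 0 1 a (G w) \<le> \<dots>" .
  qed
  also have "\<dots> = ennreal (C * wint TYPE(real^'n) (L - a) * (2 powr a * D)) * ennreal (wint TYPE(real^'n) L)"
  proof -
   have "(NNI w. ewt (- L) (w - z)) = ennreal (wint TYPE(real^'n) L)"
    by (rule wint_translate(1)) (use a in \<open>simp add: L_def\<close>)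
   then show ?thesis by (subst nn_integral_cmult) auto
  qed
  also have "\<dots> = ennreal CD" by (subst ennreal_mult''[symmetric]) (simp_all add: CD_def mult.assoc)
  finally have "NW 0 1 a (\<lambda>y. LBINT w. G w y) \<le> ennreal CD" .
  moreover have "(\<lambda>y. LBINT w. G w y) \<in> Bm"
  proof -
   have "(\<lambda>y. LBINT w. (\<lambda>y w. G w y) y w) \<in> borel_measurable lborel" by measurable
   then show ?thesis by simp
  qed
  ultimately have "NW 0 1 a (\<lambda>y. g (y + z) * \<psi> y) \<le> enorm (1 / n2) * ennreal CD"
   unfolding eq by (subst NW_cmult) (auto simp: norm_divide intro!: mult_left_mono)
  also have "\<dots> = ennreal (norm (1 / n2) * CD)" by (rule ennreal_mult'[symmetric]) simp
  finally show ?thesis .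
 qed
 show ?thesis
 proof (intro exI[of _ "max 0 (norm (1 / n2) * CD)"] conjI allI)
  fix z
  have "ennreal (norm (1 / n2) * CD) \<le> ennreal (max 0 (norm (1 / n2) * CD))" by (intro ennreal_leI) simp
  then show "NW 0 1 a (\<lambda>y. g (y + z) * \<psi> y) \<le> ennreal (max 0 (norm (1 / n2) * CD))"
   using main[of z] order_trans by blast
 qed simp
qed

section \<open>Small pieces of the phase\<close>

text \<open>The amalgam hypothesis enters only through \<open>local_bound\<close>, where arbitrary
  compactly supported windows have replaced the given one. The order \<open>4 * (n + 3 + a)\<close>
  leaves \<open>n + 3 + a\<close> after two coordinate multiplications, each of which halves
  it.\<close>

locale phase =
 fixes \<mu> :: "real^'n::finite => real" and s a :: real
 assumes C2: "C2 \<mu>" and s: "0 < s" and a: "0 \<le> a"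
  and local_bound: "\<And>\<psi> R. dec (4 * (real CARD('n) + 3 + a)) \<psi> ==> (\<And>y. R \<le> norm y ==> \<psi> y = 0) ==>
   \<exists>C\<ge>0. \<forall>i j v. NW 0 1 a (\<lambda>y. cor (jb (y + v) powr (- s) * pd i (pd j \<mu>) (y + v)) * \<psi> y) \<le> ennreal C"
begin

lemma K0_facts: "real CARD('n) < (4 * (real CARD('n) + 3 + a))" "real CARD('n) + a < (4 * (real CARD('n) + 3 + a))" "real CARD('n) + 2 < (4 * (real CARD('n) + 3 + a))" "real CARD('n) + 2 < (4 * (real CARD('n) + 3 + a)) / 2" "real CARD('n) + a < (4 * (real CARD('n) + 3 + a)) / 2 / 2" "0 \<le> (4 * (real CARD('n) + 3 + a))" "real CARD('n) < (4 * (real CARD('n) + 3 + a)) / 2 / 2"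
 using a by simp_all

lemma mu_cont: "continuous_on UNIV \<mu>" "continuous_on UNIV (pd i \<mu>)" "continuous_on UNIV (pd i (pd j \<mu>))"
 using C2 by (auto simp: C2_def)

lemma mu_measurable [measurable]: "\<mu> \<in> Bm" "pd i (pd j \<mu>) \<in> Bm"
 using mu_cont by (auto intro: borel_measurable_continuous_onI)

text \<open>The weight \<open>jb powr (- s)\<close> is undone by the ratio of
  \<open>NW_jb_ratio\<close>, at the price of its value at \<open>v\<close>. Each of the two factors
  takes its own copy of the plateau, so the cutoff is the square of a plateau.\<close>

lemma hess_local:
 "\<exists>\<psi> C. C \<ge> 0 \<and> continuous_on UNIV \<psi> \<and> (\<forall>y. norm y \<le> 3 \<longrightarrow> \<psi> y = 1) \<and> (\<forall>y. 5 \<le> norm y \<longrightarrow> \<psi> y = 0) \<and>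
  (\<forall>i j v. NW 0 1 a (\<lambda>y. cor (pd i (pd j \<mu>) (v + y)) * \<psi> y) \<le> ennreal (C * wt s v))"
proof -
 \<comment> \<open>The radius 3 has to cover the cutoff of the Taylor remainder in
   \<open>NW_piece\<close>, which vanishes from radius 3 on.\<close>
 obtain p :: "real^'n => complex" where p: "dec (4 * (real CARD('n) + 3 + a)) p" "\<And>y. norm y \<le> 3 ==> p y = 1" "\<And>y. 5 \<le> norm y ==> p y = 0"
  using plateau_exists[of 3 "4 * (real CARD('n) + 3 + a)"] K0_facts by auto
 have pg: "good p" by (rule dec_good[OF p(1) K0_facts(1)])
 have pc: "continuous_on UNIV p" by (rule goodD(1)[OF pg])
 have pN: "NW 0 1 a p < \<infinity>" by (rule dec_NW_finite[OF p(1) K0_facts(2)])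
 obtain C1 where C1: "0 \<le> C1" "\<And>i j v. NW 0 1 a (\<lambda>y. cor (jb (y + v) powr (- s) * pd i (pd j \<mu>) (y + v)) * p y) \<le> ennreal C1"
  using local_bound[OF p(1,3)] by blast
 obtain C2' where C2': "C2' < \<infinity>" "\<And>v. NW 0 1 a (\<lambda>y. cor (jb (v + y) powr s / jb v powr s) * p y) \<le> C2'"
 proof -
  have "\<exists>C<\<infinity>. \<forall>v. NW 0 1 a (\<lambda>y. cor (jb (v + y) powr s / jb v powr s) * p y) \<le> C"
   by (rule NW_jb_ratio[where R=5, OF pg pN a _ p(3)]) auto
  then show ?thesis using that by blast
 qed
 obtain c2 where c2: "C2' = ennreal c2" "0 \<le> c2" using C2'(1) by (cases C2') auto
 define C where "C = 2 powr \<bar>s\<bar> * (C1 * c2)"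
 have C0: "0 \<le> C" using C1 c2 by (simp add: C_def)
 define \<psi> where "\<psi> y = p y * p y" for y
 have main: "NW 0 1 a (\<lambda>y. cor (pd i (pd j \<mu>) (v + y)) * \<psi> y) \<le> ennreal (C * wt s v)" for i j v
 proof -
  define F where "F y = cor (jb (y + v) powr (- s) * pd i (pd j \<mu>) (y + v)) * p y" for y
  define G where "G y = cor (jb (v + y) powr s / jb v powr s) * p y" for y
  have Fg: "good F" unfolding F_def
   by (rule good_compact_support[of _ 5]) (auto simp: p intro!: continuous_intros pc continuous_on_compose2[OF mu_cont(3)])
  have Gg: "good G" unfolding G_def
   by (rule good_compact_support[of _ 5]) (auto simp: p intro!: continuous_intros pc)
  have [measurable]: "F \<in> Bm" "G \<in> Bm" using Fg Gg good_measurable by auto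
  have eq: "(\<lambda>y. cor (pd i (pd j \<mu>) (v + y)) * \<psi> y) = (\<lambda>y. cor (jb v powr s) * (F y * G y))"
  proof (rule ext)
   fix y
   have "jb (y + v) powr (- s) * jb (v + y) powr s = 1" by (simp add: powr_add[symmetric] add.commute)
   then have "jb v powr s * ((jb (y + v) powr (- s) * pd i (pd j \<mu>) (y + v)) * (jb (v + y) powr s / jb v powr s)) = pd i (pd j \<mu>) (v + y)"
    by (simp add: add.commute)
   then have "cor (jb v powr s) * (cor (jb (y + v) powr (- s) * pd i (pd j \<mu>) (y + v)) * cor (jb (v + y) powr s / jb v powr s)) = cor (pd i (pd j \<mu>) (v + y))"
    by (simp only: of_real_mult[symmetric])
   moreover have "J * ((P * z) * (Q * z)) = (J * (P * Q)) * (z * z)" for J P Q z :: complex by (simp only: mult_ac)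
   ultimately show "cor (pd i (pd j \<mu>) (v + y)) * \<psi> y = cor (jb v powr s) * (F y * G y)"
    unfolding F_def G_def \<psi>_def by (simp only:)
  qed
  have FN: "NW 0 1 a F \<le> ennreal C1" using C1(2)[of v i j] by (simp add: F_def[abs_def])
  have "NW 0 1 a (\<lambda>y. cor (pd i (pd j \<mu>) (v + y)) * \<psi> y) = enorm (cor (jb v powr s)) * NW 0 1 a (\<lambda>y. F y * G y)"
   unfolding eq by (rule NW_cmult) measurable
  also have "\<dots> = ennreal (jb v powr s) * NW 0 1 a (\<lambda>y. F y * G y)" by simp
  also have "\<dots> \<le> ennreal (2 powr \<bar>s\<bar> * wt s v) * (NW 0 1 a F * NW 0 1 a G)"
   by (intro mult_mono ennreal_leI jb_powr_le_wt NW_mult[OF Fg goodD(2)[OF Gg] a]) (use FN in \<open>auto intro: order_le_less_trans\<close>)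
  also have "\<dots> \<le> ennreal (2 powr \<bar>s\<bar> * wt s v) * (ennreal C1 * ennreal c2)"
   using FN C2'(2)[of v] c2 by (intro mult_left_mono mult_mono) (auto simp: G_def[abs_def])
  also have "\<dots> = ennreal (C * wt s v)" using C1 c2 by (simp add: C_def ennreal_mult[symmetric] mult_ac)
  finally show ?thesis .
 qed
 show ?thesis
  by (intro exI[of _ \<psi>] exI[of _ C] conjI C0 allI impI main) (auto simp: \<psi>_def p intro!: continuous_intros pc)
qed

text \<open>The algebra norm dominates the supremum norm, so evaluation at \<open>y = 0\<close>
  suffices.\<close>

lemma hess_bound: "\<exists>C\<ge>0. \<forall>i j v. \<bar>pd i (pd j \<mu>) v\<bar> \<le> C * wt s v"
proof -
 from hess_local obtain \<psi> C where P: "C \<ge> 0" "continuous_on UNIV \<psi>" "\<And>y. norm y \<le> 3 ==> \<psi> y = 1" "\<And>y. 5 \<le> norm y ==> \<psi> y = 0"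
  "\<And>i j v. NW 0 1 a (\<lambda>y. cor (pd i (pd j \<mu>) (v + y)) * \<psi> y) \<le> ennreal (C * wt s v)" by blast
 have "\<bar>pd i (pd j \<mu>) v\<bar> \<le> C * wt s v" for i j v
 proof -
  let ?F = "\<lambda>y. cor (pd i (pd j \<mu>) (v + y)) * \<psi> y"
  have "good ?F"
   by (rule good_compact_support[of _ 5]) (auto simp: P intro!: continuous_intros P continuous_on_compose2[OF mu_cont(3)])
  then have "enorm (?F 0) \<le> NW 0 1 a ?F"
   by (rule norm_le_NW[OF _ a]) (use P(5)[of i j v] in \<open>auto intro: order_le_less_trans\<close>)
  also have "\<dots> \<le> ennreal (C * wt s v)" by (rule P)
  finally show ?thesis using P by (simp add: ennreal_le_iff)
 qed
 then show ?thesis using P(1) by blast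
qed

text \<open>The kernel of \<open>cis \<mu>\<close> restricted to a small neighbourhood of \<open>v\<close> sits near \<open>- vel v\<close>.\<close>
definition vel :: "real^'n => real^'n" where
 "vel v = (\<chi> i. pd i \<mu> v / (2 * pi))"

lemma vel_inner: "2 * pi * (vel v \<bullet> y) = (\<Sum>i\<in>UNIV. y $ i * pd i \<mu> v)"
 by (simp add: vel_def inner_vec_def sum_distrib_left mult_ac)

lemma vel_Lipschitz: "\<exists>C\<ge>0. \<forall>u v. norm (vel u - vel v) \<le> C * (wt s v * wt (s + 1) (u - v))"
proof -
 obtain C where C: "0 \<le> C" "\<And>i j w. \<bar>pd i (pd j \<mu>) w\<bar> \<le> C * wt s w" using hess_bound by blast
 have "norm (vel u - vel v) \<le> (real CARD('n) * real CARD('n) * C) * (wt s v * wt (s + 1) (u - v))" for u v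
 proof -
  define B where "B = C * (wt s v * wt s (u - v))"
  have B0: "0 \<le> B" using C by (simp add: B_def)
  have B: "\<bar>pd i (pd j \<mu>) z\<bar> \<le> B" if z: "z \<in> closed_segment u v" for i j z
  proof -
   have "norm (z - v) \<le> norm (u - v)" using segment_bound(2)[OF z] by (simp add: norm_minus_commute)
   then have "wt s (z - v) \<le> wt s (u - v)" using s by (intro wt_le_norm) auto
   moreover have "wt s z \<le> wt s v * wt s (z - v)" using wt_peetre[of s z v] s by simp
   ultimately have "wt s z \<le> wt s v * wt s (u - v)" by (meson mult_left_mono order_trans wt_nonneg)
   then have "C * wt s z \<le> B" unfolding B_def using C by (intro mult_left_mono) auto
   then show ?thesis using C(2)[of i j z] by linarith
  qed
  have comp: "\<bar>(vel u - vel v) $ i\<bar> \<le> real CARD('n) * B * norm (u - v)" for i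
  proof -
   have "\<bar>(vel u - vel v) $ i\<bar> = \<bar>pd i \<mu> u - pd i \<mu> v\<bar> / (2 * pi)"
    by (simp add: vel_def diff_divide_distrib[symmetric] abs_divide)
   also have "\<dots> \<le> \<bar>pd i \<mu> u - pd i \<mu> v\<bar>" using pi_ge_two by (intro mult_imp_div_pos_le) (auto simp: mult_le_cancel_left1)
   also have "\<dots> \<le> real CARD('n) * B * norm (u - v)" by (rule C2_gradient_Lipschitz[OF C2 B])
   finally show ?thesis .
  qed
  have "norm (vel u - vel v) \<le> (\<Sum>i\<in>UNIV. \<bar>(vel u - vel v) $ i\<bar>)" by (rule norm_le_l1_cart)
  also have "\<dots> \<le> (\<Sum>i\<in>(UNIV::'n set). real CARD('n) * B * norm (u - v))" by (intro sum_mono comp)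
  also have "\<dots> = (real CARD('n) * real CARD('n) * C) * (wt s v * (wt s (u - v) * norm (u - v)))" by (simp add: B_def mult_ac)
  also have "\<dots> \<le> (real CARD('n) * real CARD('n) * C) * (wt s v * (wt s (u - v) * wt 1 (u - v)))"
   using C by (intro mult_left_mono) (auto simp: wt_def)
  finally show ?thesis by (simp add: wt_mult)
 qed
 moreover have "0 \<le> real CARD('n) * real CARD('n) * C" using C by simp
 ultimately show ?thesis by blast
qed

text \<open>Seen at scale \<open>h\<close>, the phase is affine plus a Taylor remainder
  \<open>E\<close>. The affine part only moves the centre to \<open>- vel w\<close>. The norm of
  \<open>E\<close> is of order \<open>h ^ 2 * wt s w\<close>, hence bounded, so its exponential
  costs a constant. The rate \<open>h\<close> reflects a kernel of width
  \<open>1 / h\<close>.\<close>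

lemma NW_piece:
 assumes th: "dec (4 * (real CARD('n) + 3 + a)) b" "\<And>y. 1 \<le> norm y ==> b y = 0" and A: "0 \<le> A"
 shows "\<exists>C\<ge>0. \<forall>w h. 0 < h \<longrightarrow> h \<le> 1 \<longrightarrow> h^2 * wt s w \<le> A \<longrightarrow>
  NW (- vel w) h a (\<lambda>e. cis (\<mu> e) * b ((1 / h) *\<^sub>R (e - w))) \<le> ennreal C"
proof -
 from hess_local obtain \<psi> C1 where P: "C1 \<ge> 0" "continuous_on UNIV \<psi>" "\<And>y. norm y \<le> 3 ==> \<psi> y = 1" "\<And>y. 5 \<le> norm y ==> \<psi> y = 0"
  "\<And>i j w. NW 0 1 a (\<lambda>y. cor (pd i (pd j \<mu>) (w + y)) * \<psi> y) \<le> ennreal (C1 * wt s w)" by blast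
 \<comment> \<open>\<open>ch\<close> is 1 on the support of \<open>b\<close>, so truncating the
   remainder is harmless there, and it vanishes where \<open>\<psi>\<close> may differ from 1, so
   \<open>\<psi>\<close> can be inserted next to the Hessian.\<close>
 obtain ch :: "real^'n => complex" where ch: "dec (4 * (real CARD('n) + 3 + a)) ch" "\<And>y. norm y \<le> 1 ==> ch y = 1" "\<And>y. 3 \<le> norm y ==> ch y = 0"
  using plateau_exists[of 1 "4 * (real CARD('n) + 3 + a)"] K0_facts by auto
 have chc: "continuous_on UNIV ch" using ch(1) by (simp add: dec_def)
 define X where "X i j y = cor (y $ i) * (cor (y $ j) * ch y)" for i j y
 have Xd: "dec ((4 * (real CARD('n) + 3 + a)) / 2 / 2) (X i j)" for i j
  unfolding X_def[abs_def] by (intro dec_coord ch(1) K0_facts)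
 have Xg: "good (X i j)" for i j by (rule dec_good[OF Xd K0_facts(7)])
 have XN: "NW 0 1 a (X i j) < \<infinity>" for i j by (rule dec_NW_finite[OF Xd K0_facts(5)])
 have Xz: "3 \<le> norm y ==> X i j y = 0" for i j y by (simp add: X_def ch)
 have [measurable]: "X i j \<in> Bm" for i j using Xg good_measurable by blast
 have [measurable]: "\<psi> \<in> Bm" using P(2) by (rule borel_measurable_continuous_onI)
 define N where "N i j = enn2real (NW 0 1 a (X i j))" for i j
 have N: "NW 0 1 a (X i j) = ennreal (N i j)" "0 \<le> N i j" for i j using XN[of i j] by (auto simp: N_def less_top)
 define B where "B = (\<Sum>i\<in>UNIV. \<Sum>j\<in>UNIV. A * C1 * N i j)"
 have B0: "0 \<le> B" unfolding B_def using A P(1) N(2) by (intro sum_nonneg) auto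
 have thg: "good b" by (rule dec_good[OF th(1) K0_facts(1)])
 have thN: "NW 0 1 a b < \<infinity>" by (rule dec_NW_finite[OF th(1) K0_facts(2)])
 have thc: "continuous_on UNIV b" by (rule goodD(1)[OF thg])
 have main: "NW (- vel w) h a (\<lambda>e. cis (\<mu> e) * b ((1 / h) *\<^sub>R (e - w))) \<le> ennreal (exp (norm \<i> * B)) * NW 0 1 a b"
  if h: "0 < h" "h \<le> 1" "h^2 * wt s w \<le> A" for w h
 proof -
  define E where "E y = cor (\<mu> (w + h *\<^sub>R y) - \<mu> w - (\<Sum>i\<in>UNIV. (h *\<^sub>R y) $ i * pd i \<mu> w)) * ch y" for y
  have Ec: "continuous_on UNIV E" unfolding E_def
   by (intro continuous_intros chc continuous_on_compose2[OF mu_cont(1)]) auto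
  have Eg: "good E" by (rule good_compact_support[OF Ec, of 3]) (simp add: E_def ch)
  define F where "F i j y = cor (pd j (pd i \<mu>) (w + y)) * \<psi> y" for i j y
  have Fc: "continuous_on UNIV (F i j)" for i j unfolding F_def
   by (intro continuous_intros P continuous_on_compose2[OF mu_cont(3)]) auto
  have Fg: "good (F i j)" for i j by (rule good_compact_support[OF Fc, of 5]) (simp add: F_def P)
  have [measurable]: "F i j \<in> Bm" for i j using Fg good_measurable by blast
  have FN: "NW 0 1 a (F i j) \<le> ennreal (C1 * wt s w)" for i j using P(5)[of j i w] by (simp add: F_def[abs_def])
  \<comment> \<open>The two increments contribute \<open>h ^ 2\<close> and the coordinates in
    \<open>X i j\<close>; the Hessian is evaluated at the contracted point
    \<open>(t * h) *\<^sub>R y\<close>, which does not raise its norm.\<close>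
  define G where "G i j t y = cor ((1 - t) * h^2) * (X i j y * F i j ((t * h) *\<^sub>R y))" for i j t y
  define I where "I i j y = (LBINT t. indicator {0..1} t *\<^sub>R G i j t y)" for i j y
  have Gz: "3 \<le> norm y ==> G i j t y = 0" for i j t y by (simp add: G_def Xz)
  obtain DX where DX: "\<And>i j x. norm (X i j x) \<le> DX i j" using good_bound[OF Xg] by metis
  obtain DF where DF: "\<And>i j x. norm (F i j x) \<le> DF i j" using good_bound[OF Fg] by metis
  have Gb: "norm (G i j t y) \<le> DX i j * DF i j" if "t \<in> {0..1}" for i j t y
  proof -
   have "(1 - t) * h^2 \<le> 1 * 1" using that h by (intro mult_mono power_le_one) auto
   then have 1: "\<bar>(1 - t) * h^2\<bar> \<le> 1" using that h by (simp add: abs_mult)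
   have 2: "norm (X i j y) * norm (F i j ((t * h) *\<^sub>R y)) \<le> DX i j * DF i j"
    using DX[of i j y] by (intro mult_mono DX DF) (auto intro: order_trans[OF norm_ge_zero])
   have "\<bar>(1 - t) * h^2\<bar> * (norm (X i j y) * norm (F i j ((t * h) *\<^sub>R y))) \<le> 1 * (DX i j * DF i j)"
    by (rule mult_mono[OF 1 2]) auto
   then show ?thesis unfolding G_def norm_mult norm_of_real by simp
  qed
  have Gm: "case_prod (G i j) \<in> borel_measurable (lborel \<Otimes>\<^sub>M lborel)" for i j unfolding G_def by measurable
  have Gt: "continuous_on UNIV (\<lambda>t. G i j t y)" for i j y unfolding G_def
   by (intro continuous_intros continuous_on_compose2[OF Fc]) auto
  have Gint: "L1 (\<lambda>t. indicator {0..1} t *\<^sub>R G i j t y)" for i j y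
   by (rule borel_integrable_compact) (auto intro: continuous_on_subset[OF Gt])
  have GN: "NW 0 1 a (G i j t) \<le> ennreal (A * C1 * N i j)" if t: "0 < t" "t \<le> 1" for i j t
  proof -
   have Fi: "L1 (\<lambda>y. F i j ((t * h) *\<^sub>R y))"
    using integrable_lborel_affine[OF goodD(2)[OF Fg], of "t * h" i j 0] t h by simp
   have "NW 0 1 a (\<lambda>y. F i j ((t * h) *\<^sub>R y)) = NW 0 (t * h) a (F i j)"
    by (subst NW_scale) (use t h in auto)
   also have "\<dots> \<le> NW 0 1 a (F i j)" by (rule NW_mono_r) (use t h a in \<open>auto simp: mult_le_one\<close>)
   also have "\<dots> \<le> ennreal (C1 * wt s w)" by (rule FN)
   finally have 1: "NW 0 1 a (\<lambda>y. F i j ((t * h) *\<^sub>R y)) \<le> ennreal (C1 * wt s w)" .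
   have "NW 0 1 a (G i j t) = enorm (cor ((1 - t) * h^2)) * NW 0 1 a (\<lambda>y. X i j y * F i j ((t * h) *\<^sub>R y))"
    unfolding G_def by (rule NW_cmult) measurable
   also have "\<dots> \<le> ennreal (h^2) * (NW 0 1 a (X i j) * NW 0 1 a (\<lambda>y. F i j ((t * h) *\<^sub>R y)))"
   proof (intro mult_mono NW_mult[OF Xg Fi a XN] ennreal_leI)
    show "norm (cor ((1 - t) * h^2)) \<le> h^2" unfolding norm_of_real using t by (simp add: abs_mult mult_left_le_one_le)
   qed auto
   also have "\<dots> \<le> ennreal (h^2) * (ennreal (N i j) * ennreal (C1 * wt s w))"
    unfolding N by (intro mult_left_mono 1) auto
   also have "\<dots> = ennreal ((h^2 * wt s w) * (C1 * N i j))" using N(2) P(1) by (simp add: ennreal_mult[symmetric] mult_ac)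
   also have "\<dots> \<le> ennreal (A * (C1 * N i j))" using h N(2) P(1) by (intro ennreal_leI mult_right_mono) auto
   finally show ?thesis by (simp add: mult.assoc)
  qed
  have IN: "NW 0 1 a (I i j) \<le> ennreal (A * C1 * N i j)" for i j unfolding I_def
  proof (rule NW_unit_interval[where R=3 and B="DX i j * DF i j"])
   show "case_prod (G i j) \<in> Bm" unfolding G_def borel_prod[symmetric] by measurable
  qed (use Gb Gz GN in auto)
  have Ii: "L1 (I i j)" for i j
  proof -
   have "integrable (lborel \<Otimes>\<^sub>M lborel) (case_prod (\<lambda>t y. indicator {0..1} t *\<^sub>R G i j t y))"
   proof (rule integrable_pair_bound[where u="\<lambda>t. \<bar>DX i j * DF i j\<bar> * indicator {0..1} t" and v="indicator (cball 0 3)"])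
    show "L1 (\<lambda>t. \<bar>DX i j * DF i j\<bar> * indicator {0..1::real} t)" by (intro integrable_mult_right) simp
    show "L1 (indicator (cball (0::real^'n) 3) :: _ => real)"
     using emeasure_compact_finite[of "cball (0::real^'n) 3"] by (simp add: integrable_indicator_iff)
    show "norm (indicator {0..1} t *\<^sub>R G i j t y) \<le> \<bar>DX i j * DF i j\<bar> * indicator {0..1} t * indicator (cball 0 3) y" for t y
     using Gb[of t i j y] Gz[of y i j t] by (cases "norm y \<le> 3") (auto simp: indicator_def)
    show "(\<lambda>(t, y). indicator {0..1} t *\<^sub>R G i j t y) \<in> borel_measurable (lborel \<Otimes>\<^sub>M lborel)"
     unfolding G_def by measurable
   qed (auto simp: sigma_finite_lborel)
   then show ?thesis unfolding I_def[abs_def] by (rule lborel_pair.integrable_snd)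
  qed
  have EI: "E y = (\<Sum>i\<in>UNIV. \<Sum>j\<in>UNIV. I i j y)" for y
  proof (cases "3 \<le> norm y")
   case True then show ?thesis by (simp add: E_def I_def Gz ch)
  next
   case False
   have T: "E y = cor (LBINT t. indicator {0..1} t *\<^sub>R ((1 - t) * (\<Sum>i\<in>UNIV. \<Sum>j\<in>UNIV. (h *\<^sub>R y) $ i * (h *\<^sub>R y) $ j * pd j (pd i \<mu>) (w + t *\<^sub>R (h *\<^sub>R y))))) * ch y"
    unfolding E_def C2_Taylor[OF C2] ..
   also have "\<dots> = (LBINT t. cor (indicator {0..1} t *\<^sub>R ((1 - t) * (\<Sum>i\<in>UNIV. \<Sum>j\<in>UNIV. (h *\<^sub>R y) $ i * (h *\<^sub>R y) $ j * pd j (pd i \<mu>) (w + t *\<^sub>R (h *\<^sub>R y))))) * ch y)"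
    by (simp only: integral_mult_left_zero integral_complex_of_real)
   also have "\<dots> = (LBINT t. (\<Sum>i\<in>UNIV. \<Sum>j\<in>UNIV. indicator {0..1} t *\<^sub>R G i j t y))"
   proof (intro Bochner_Integration.integral_cong refl)
    fix t :: real
    show "cor (indicator {0..1} t *\<^sub>R ((1 - t) * (\<Sum>i\<in>UNIV. \<Sum>j\<in>UNIV. (h *\<^sub>R y) $ i * (h *\<^sub>R y) $ j * pd j (pd i \<mu>) (w + t *\<^sub>R (h *\<^sub>R y))))) * ch y
     = (\<Sum>i\<in>UNIV. \<Sum>j\<in>UNIV. indicator {0..1} t *\<^sub>R G i j t y)"
    proof (cases "t \<in> {0..1}")
     case True
     have "norm ((t * h) *\<^sub>R y) \<le> 1 * norm y" unfolding norm_scaleR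
      using True h by (intro mult_right_mono) (auto simp: mult_le_one abs_mult)
     then have "\<psi> ((t * h) *\<^sub>R y) = 1" using False by (intro P) auto
     then show ?thesis using True
      by (simp add: G_def X_def F_def sum_distrib_left sum_distrib_right power2_eq_square mult_ac)
    qed simp
   qed
   also have "\<dots> = (\<Sum>i\<in>UNIV. \<Sum>j\<in>UNIV. I i j y)" unfolding I_def
    by (subst Bochner_Integration.integral_sum, intro Bochner_Integration.integrable_sum Gint,
      intro sum.cong refl, subst Bochner_Integration.integral_sum, intro Gint, rule refl)
   finally show ?thesis .
  qed
  have EN: "NW 0 1 a E \<le> ennreal B"
  proof -
   have "NW 0 1 a E = NW 0 1 a (\<lambda>y. \<Sum>i\<in>UNIV. \<Sum>j\<in>UNIV. I i j y)" by (simp add: EI[abs_def])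
   also have "\<dots> \<le> (\<Sum>i\<in>UNIV. NW 0 1 a (\<lambda>y. \<Sum>j\<in>UNIV. I i j y))"
    using Ii by (intro NW_sum Bochner_Integration.integrable_sum) auto
   also have "\<dots> \<le> (\<Sum>i\<in>UNIV. \<Sum>j\<in>UNIV. NW 0 1 a (I i j))"
    using Ii by (intro sum_mono NW_sum) auto
   also have "\<dots> \<le> (\<Sum>i\<in>UNIV. \<Sum>j\<in>UNIV. ennreal (A * C1 * N i j))" by (intro sum_mono IN)
   also have "\<dots> = ennreal B" unfolding B_def using A P(1) N(2) by (simp add: sum_nonneg)
   finally show ?thesis .
  qed
  define F0 where "F0 y = exp (\<i> * E y) * b y" for y
  have F0g: "good F0" unfolding F0_def by (rule NW_exp(1)[OF Eg thg a EN B0 thN])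
  have F0N: "NW 0 1 a F0 \<le> ennreal (exp (norm \<i> * B)) * NW 0 1 a b"
   unfolding F0_def by (rule NW_exp(2)[OF Eg thg a EN B0 thN])
  have [measurable]: "F0 \<in> Bm" by (rule good_measurable[OF F0g])
  define G0 where "G0 e = F0 ((1 / h) *\<^sub>R (e - w))" for e
  have [measurable]: "G0 \<in> Bm" unfolding G0_def by measurable
  define c0 where "c0 = cis (\<mu> w - 2 * pi * (vel w \<bullet> w))"
  have eq: "(\<lambda>e. cis (\<mu> e) * b ((1 / h) *\<^sub>R (e - w))) = (\<lambda>e. c0 * (cis (2 * pi * (vel w \<bullet> e)) * G0 e))"
  proof (rule ext)
   fix e
   define y where "y = (1 / h) *\<^sub>R (e - w)"
   have hy: "h *\<^sub>R y = e - w" using h by (simp add: y_def)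
   show "cis (\<mu> e) * b ((1 / h) *\<^sub>R (e - w)) = c0 * (cis (2 * pi * (vel w \<bullet> e)) * G0 e)"
   proof (cases "1 \<le> norm y")
    case True
    then have "b y = 0" by (rule th)
    then show ?thesis by (simp add: G0_def F0_def y_def[symmetric])
   next
    case False
    then have "E y = cor (\<mu> e - \<mu> w - 2 * pi * (vel w \<bullet> (e - w)))"
     unfolding E_def hy vel_inner by (simp add: ch)
    then have "exp (\<i> * E y) = cis (\<mu> e - \<mu> w - 2 * pi * (vel w \<bullet> (e - w)))" by (simp add: cis_conv_exp)
    then have "c0 * (cis (2 * pi * (vel w \<bullet> e)) * exp (\<i> * E y)) = cis (\<mu> e)"
     unfolding c0_def by (simp add: cis_mult inner_diff_right algebra_simps)
    then have "c0 * (cis (2 * pi * (vel w \<bullet> e)) * exp (\<i> * E y)) * b y = cis (\<mu> e) * b y" by (rule arg_cong)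
    then show ?thesis unfolding G0_def F0_def y_def[symmetric] by (simp only: mult.assoc)
   qed
  qed
  have "NW (- vel w) h a (\<lambda>e. cis (\<mu> e) * b ((1 / h) *\<^sub>R (e - w))) = NW (- vel w) h a (\<lambda>e. cis (2 * pi * (vel w \<bullet> e)) * G0 e)"
   unfolding eq by (subst NW_cmult) (auto simp: c0_def)
  also have "\<dots> = NW (- vel w + vel w) h a G0" by (rule NW_modulate) measurable
  also have "G0 = (\<lambda>e. (\<lambda>e. F0 ((1 / h) *\<^sub>R e)) (e + (- w)))" by (auto simp: G0_def)
  also have "NW (- vel w + vel w) h a \<dots> = NW 0 h a (\<lambda>e. F0 ((1 / h) *\<^sub>R e))" by (subst NW_shift) simp
  also have "\<dots> = NW 0 1 a F0" by (subst NW_scale) (use h in auto)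
  finally show ?thesis using F0N by simp
 qed
 obtain nt where nt: "NW 0 1 a b = ennreal nt" "0 \<le> nt" using thN by (cases "NW 0 1 a b") auto
 show ?thesis
  using main unfolding nt by (intro exI[of _ "exp (norm \<i> * B) * nt"]) (simp add: nt ennreal_mult)
qed

end

section \<open>The kernel estimate\<close>

lemma wt_power: "wt c x ^ k = wt (c * real k) x"
 by (induction k) (auto simp: wt_mult algebra_simps)

lemma NW_dilate_factor:
 assumes [measurable]: "F \<in> Bm" and c: "0 \<le> c" "0 \<le> a"
 shows "NW x0 (c * r) a F \<le> ennreal ((1 + c) powr a) * NW x0 r a F"
 unfolding NW_def
proof (subst nn_integral_cmult[symmetric], measurable, rule nn_integral_mono)
 fix x
 have "norm (ifourier F x) * wt a (c *\<^sub>R (r *\<^sub>R (x - x0))) \<le> norm (ifourier F x) * ((1 + c) powr a * wt a (r *\<^sub>R (x - x0)))"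
  by (intro mult_left_mono wt_dilate_le c) auto
 then show "ennreal (norm (ifourier F x) * wt a ((c * r) *\<^sub>R (x - x0))) \<le> ennreal ((1 + c) powr a) * ennreal (norm (ifourier F x) * wt a (r *\<^sub>R (x - x0)))"
  by (simp add: ennreal_mult[symmetric] mult_ac ennreal_leI)
qed

lemma good_shift:
 assumes F: "good F" shows "good (\<lambda>h. F (h - c))"
proof -
 have "range (\<lambda>h. F (h - c)) \<subseteq> range F" by auto
 then show ?thesis using F unfolding good_def
  by (auto intro: bounded_subset integrable_lborel_translate intro!: continuous_on_compose2[of UNIV F] continuous_intros)
qed

lemma good_unimodular:
 assumes F: "good F" and m: "continuous_on UNIV m"
 shows "good (\<lambda>h. cis (m h) * F h)"
proof -
 have [measurable]: "m \<in> Bm" "F \<in> Bm"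
  using m good_measurable[OF F] by (auto intro: borel_measurable_continuous_onI)
 have "L1 (\<lambda>h. cis (m h) * F h)"
  using integrable_cis_mult[OF goodD(2)[OF F], of m] by (simp add: mult.commute)
 moreover have "continuous_on UNIV (\<lambda>h. cis (m h) * F h)"
  using goodD(1)[OF F] m by (intro continuous_intros)
 ultimately show ?thesis using F unfolding good_def bounded_iff by (auto simp: norm_mult)
qed

context phase
begin

text \<open>The cell is averaged over pieces of size \<open>h\<close> centred at \<open>w\<close>
  near \<open>k\<close>. Every piece has bounded norm, and normalising the average costs
  \<open>h\<close> to the power \<open>- n\<close>, which is the weight of order
  \<open>s n / 2\<close>.\<close>

lemma NW_unit_cell:
 assumes th: "dec (4 * (real CARD('n) + 3 + a)) q" "\<And>y. 1 \<le> norm y ==> q y = 0" and th1: "(LBINT y. q y) = 1"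
 shows "\<exists>C\<ge>0. \<forall>k. NW (- vel k) (wt (- s) k) a (\<lambda>e. cis (\<mu> e) * q (e - k)) \<le> ennreal (C * wt (s * real CARD('n) / 2) k)"
proof -
 have p3: "(0::real) \<le> 3 powr s" by simp
 obtain C1 where C1: "0 \<le> C1" "\<And>w h. 0 < h ==> h \<le> 1 ==> h^2 * wt s w \<le> 3 powr s ==>
  NW (- vel w) h a (\<lambda>e. cis (\<mu> e) * q ((1 / h) *\<^sub>R (e - w))) \<le> ennreal C1"
  using NW_piece[OF th p3] by blast
 obtain CL where CL: "0 \<le> CL" "\<And>u v. norm (vel u - vel v) \<le> CL * (wt s v * wt (s + 1) (u - v))"
  using vel_Lipschitz by blast
 have thg: "good q" by (rule dec_good[OF th(1) K0_facts(1)])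
 have thN: "NW 0 1 a q < \<infinity>" by (rule dec_NW_finite[OF th(1) K0_facts(2)])
 have thc: "continuous_on UNIV q" by (rule goodD(1)[OF thg])
 have [measurable]: "q \<in> Bm" by (rule good_measurable[OF thg])
 obtain nt where nt: "NW 0 1 a q = ennreal nt" "0 \<le> nt" using thN by (cases "NW 0 1 a q") auto
 obtain B where B: "0 \<le> B" "\<And>x. norm (q x) \<le> B" using good_bound[OF thg] by auto
 define W where "W = (1 + CL * 3 powr (s + 1)) powr a"
 define V where "V = measure lborel (cball (0::real^'n) 2)"
 have V: "emeasure lborel (cball x 2) = ennreal V" for x :: "real^'n"
  unfolding V_def using emeasure_compact_finite[of "cball x 2"] by (simp add: emeasure_cball measure_def)
 define C where "C = W * C1 * nt * V"
 have W0: "0 \<le> W" "0 \<le> V" by (auto simp: W_def V_def)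
 have C0: "0 \<le> C" using W0 C1 nt by (simp add: C_def)
 have main: "NW (- vel k) (wt (- s) k) a (\<lambda>e. cis (\<mu> e) * q (e - k)) \<le> ennreal (C * wt (s * real CARD('n) / 2) k)" for k
 proof -
  \<comment> \<open>Up to a constant the largest scale at which \<open>h ^ 2\<close> times the
    Hessian bound \<open>wt s k\<close> stays bounded.\<close>
  define h where "h = wt (- (s / 2)) k"
  have h: "0 < h" "h \<le> 1" using wt_le_1[of "- (s/2)" k] s by (auto simp: h_def)
  have h2: "h^2 = wt (- s) k" by (simp add: h_def wt_power)
  have hn: "1 / h ^ CARD('n) = wt (s * real CARD('n) / 2) k"
   using wt_uminus_exp[of "s * real CARD('n) / 2" k] by (simp add: h_def wt_power field_simps)
  have h2h: "h^2 \<le> h" using h by (simp add: power2_eq_square mult_left_le)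
  define P where "P w e = cis (\<mu> e) * q ((1 / h) *\<^sub>R (e - w))" for w e
  have Pc: "continuous_on UNIV (P w)" for w unfolding P_def
   by (intro continuous_intros continuous_on_compose2[OF thc] mu_cont) auto
  have Pz: "P w e = 0" if "h \<le> norm (e - w)" for w e
  proof -
   have "1 \<le> norm ((1 / h) *\<^sub>R (e - w))" using that h unfolding norm_scaleR by (simp add: le_divide_eq)
   then show ?thesis by (simp add: P_def th)
  qed
  have Pg: "good (P w)" for w
  proof (rule good_compact_support[OF Pc, of "1 + norm w"])
   fix y :: "real^'n" assume "1 + norm w \<le> norm y"
   then have "h \<le> norm (y - w)" using norm_triangle_ineq2[of y w] h by linarith
   then show "P w y = 0" by (rule Pz)
  qed
  have [measurable]: "case_prod P \<in> Bm2" unfolding P_def by measurable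
  have [measurable]: "P w \<in> Bm" for w by (rule good_measurable[OF Pg])
  have thkg: "good (\<lambda>e. q (e - k))" by (rule good_shift[OF thg])
  have thkN: "NW 0 (h^2) a (\<lambda>e. q (e - k)) \<le> ennreal nt"
  proof -
   have "NW 0 (h^2) a (\<lambda>e. q (e - k)) = NW 0 (h^2) a q" using NW_shift[of 0 "h^2" a q "- k"] by simp
   also have "\<dots> \<le> NW 0 1 a q" using h2h h a by (intro NW_mono_r) auto
   finally show ?thesis by (simp add: nt)
  qed
  have [measurable]: "Measurable.pred (borel \<Otimes>\<^sub>M borel) (\<lambda>x. fst x \<in> cball k 2)" for k :: "real^'n"
   unfolding mem_cball by measurable
  \<comment> \<open>A piece centred at \<open>w\<close> meets the support of
    \<open>q (e - k)\<close> only if \<open>norm (w - k) < 1 + h\<close>, hence the radius 2; the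
    factor \<open>1 / h ^ n\<close> normalises the integral of the pieces over \<open>w\<close> to
    1.\<close>
  define G where "G w e = cor (indicator (cball k 2) w * (1 / h ^ CARD('n))) * (P w e * q (e - k))" for w e
  have vol: "L1 (\<lambda>w. indicat_real (cball k 2) w)"
   using V[of k] by (simp add: integrable_indicator_iff)
  have int: "integrable (lborel \<Otimes>\<^sub>M lborel) (case_prod G)"
  proof (rule integrable_pair_bound[where u="\<lambda>w. indicator (cball k 2) w * (1 / h ^ CARD('n) * B)" and v="\<lambda>e. norm (q (e - k))"])
   show "case_prod G \<in> borel_measurable (lborel \<Otimes>\<^sub>M lborel)" unfolding G_def P_def by measurable
   show "L1 (\<lambda>w. indicator (cball k 2) w * (1 / h ^ CARD('n) * B))" using vol by (rule integrable_mult_left)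
   show "L1 (\<lambda>e. norm (q (e - k)))" by (rule integrable_norm[OF goodD(2)[OF thkg]])
   fix w e
   have "norm (P w e) \<le> B" using B by (simp add: P_def norm_mult)
   then have "(indicator (cball k 2) w * (1 / h ^ CARD('n))) * (norm (P w e) * norm (q (e - k))) \<le>
     (indicator (cball k 2) w * (1 / h ^ CARD('n))) * (B * norm (q (e - k)))"
    using h by (intro mult_left_mono mult_right_mono) auto
   moreover have "norm (G w e) = (indicator (cball k 2) w * (1 / h ^ CARD('n))) * (norm (P w e) * norm (q (e - k)))"
    unfolding G_def norm_mult norm_of_real using h by (simp add: abs_mult)
   ultimately show "norm (G w e) \<le> indicator (cball k 2) w * (1 / h ^ CARD('n) * B) * norm (q (e - k))"
    by (simp add: mult_ac)
  qed (auto simp: sigma_finite_lborel)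
  have eq: "(\<lambda>e. cis (\<mu> e) * q (e - k)) = (\<lambda>e. LBINT w. G w e)"
  proof (rule ext)
   fix e
   show "cis (\<mu> e) * q (e - k) = (LBINT w. G w e)"
   proof (cases "1 \<le> norm (e - k)")
    case True then show ?thesis by (simp add: G_def th)
   next
    case False
    have "G w e = (cis (\<mu> e) * q (e - k) * cor (1 / h ^ CARD('n))) * q ((1 / h) *\<^sub>R (e - w))" for w
    proof (cases "norm (w - k) \<le> 2")
     case True then show ?thesis by (simp add: G_def P_def dist_norm norm_minus_commute)
    next
     case f: False
     have "h \<le> norm (e - w)" using f False h norm_triangle_ineq[of "w - e" "e - k"] by (simp add: norm_minus_commute)
     then have "q ((1 / h) *\<^sub>R (e - w)) = 0" using Pz[of e w] by (simp add: P_def)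
     then show ?thesis by (simp add: G_def P_def)
    qed
    then have "(LBINT w. G w e) = (cis (\<mu> e) * q (e - k) * cor (1 / h ^ CARD('n))) * (LBINT w. q ((1 / h) *\<^sub>R (e - w)))"
     by (simp only: integral_mult_right_zero)
    also have "(LBINT w. q ((1 / h) *\<^sub>R (e - w))) = cor (h ^ CARD('n))"
     using h th1 by (subst integral_lborel_affine[of "- h" _ e]) (simp_all add: scaleR_conv_of_real[of _ "1::complex", simplified])
    finally show ?thesis using h by simp
   qed
  qed
  have "NW (- vel k) (h^2) a (\<lambda>e. cis (\<mu> e) * q (e - k)) \<le> (NNI w. NW (- vel k) (h^2) a (G w))"
   unfolding eq by (rule NW_integral[OF sigma_finite_lborel int])
  also have "\<dots> \<le> (NNI w. ennreal (1 / h ^ CARD('n) * (W * C1 * nt)) * indicator (cball k 2) w)"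
  proof (rule nn_integral_mono)
   fix w
   show "NW (- vel k) (h^2) a (G w) \<le> ennreal (1 / h ^ CARD('n) * (W * C1 * nt)) * indicator (cball k 2) w"
   proof (cases "w \<in> cball k 2")
    case False
    then have "G w = (\<lambda>e. 0)" by (auto simp: G_def)
    then show ?thesis by simp
   next
    case True
    then have nk: "norm (w - k) \<le> 2" by (simp add: dist_norm norm_minus_commute)
    have w3: "wt b (w - k) \<le> 3 powr b" if "0 \<le> b" for b unfolding wt_def using nk that by (intro powr_mono2) auto
    have "wt s w \<le> wt s k * 3 powr s"
    proof -
     have "wt s w \<le> wt s k * wt s (w - k)" using wt_peetre[of s w k] s by simp
     also have "\<dots> \<le> wt s k * 3 powr s" using w3[of s] s by (intro mult_left_mono) auto
     finally show ?thesis .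
    qed
    then have "h^2 * wt s w \<le> h^2 * (wt s k * 3 powr s)" by (intro mult_left_mono) auto
    also have "\<dots> = 3 powr s" by (simp add: h2 mult.assoc[symmetric] wt_mult)
    finally have hs: "h^2 * wt s w \<le> 3 powr s" .
    \<comment> \<open>The rate drops from \<open>h\<close> to \<open>h ^ 2\<close> because the
      centres \<open>- vel w\<close> spread over a distance of order \<open>wt s k\<close>, the
      inverse of \<open>h ^ 2\<close>; at this rate recentring at \<open>- vel k\<close> costs only
      the constant \<open>W\<close>.\<close>
    have "NW (- vel w) (h^2) a (P w) \<le> NW (- vel w) h a (P w)" using h2h a by (intro NW_mono_r) auto
    also have "\<dots> \<le> ennreal C1" unfolding P_def by (rule C1(2)[OF h hs])
    finally have n1: "NW (- vel w) (h^2) a (P w) \<le> ennreal C1" .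
    have "NW (- vel k) (h^2) a (P w) \<le> ewt a (h^2 *\<^sub>R (- vel w - - vel k)) * NW (- vel w) (h^2) a (P w)"
     by (rule NW_recentre[OF _ a]) measurable
    also have "\<dots> \<le> ennreal W * ennreal C1"
    proof (intro mult_mono n1 ennreal_leI)
     have "norm (h^2 *\<^sub>R (- vel w - - vel k)) = h^2 * norm (vel w - vel k)" by (simp add: norm_minus_commute)
     also have "\<dots> \<le> h^2 * (CL * (wt s k * wt (s + 1) (w - k)))" by (intro mult_left_mono CL) auto
     also have "\<dots> = CL * wt (s + 1) (w - k) * (wt (- s) k * wt s k)" by (simp add: h2 mult_ac)
     also have "\<dots> \<le> CL * 3 powr (s + 1)" using CL(1) w3[of "s + 1"] s by (simp add: wt_mult mult_left_mono)
     finally show "wt a (h^2 *\<^sub>R (- vel w - - vel k)) \<le> W" unfolding W_def wt_def using a by (intro powr_mono2) auto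
    qed auto
    finally have n2: "NW (- vel k) (h^2) a (P w) \<le> ennreal W * ennreal C1" .
    have "NW (- vel k) (h^2) a (\<lambda>e. P w e * q (e - k)) \<le> NW (- vel k) (h^2) a (P w) * NW 0 (h^2) a (\<lambda>e. q (e - k))"
     by (rule NW_mult[OF Pg goodD(2)[OF thkg] a]) (use n2 in \<open>auto intro: order_le_less_trans simp: ennreal_mult_less_top\<close>)
    also have "\<dots> \<le> (ennreal W * ennreal C1) * ennreal nt" by (intro mult_mono n2 thkN) auto
    also have "\<dots> = ennreal (W * C1 * nt)" using W0 C1 nt by (simp add: ennreal_mult)
    finally have n3: "NW (- vel k) (h^2) a (\<lambda>e. P w e * q (e - k)) \<le> ennreal (W * C1 * nt)" .
    have "G w = (\<lambda>e. cor (1 / h ^ CARD('n)) * (P w e * q (e - k)))" using True by (auto simp: G_def)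
    then have "NW (- vel k) (h^2) a (G w) = enorm (cor (1 / h ^ CARD('n))) * NW (- vel k) (h^2) a (\<lambda>e. P w e * q (e - k))"
     by (simp only:) (rule NW_cmult, measurable)
    also have "\<dots> \<le> enorm (cor (1 / h ^ CARD('n))) * ennreal (W * C1 * nt)" by (intro mult_left_mono n3) auto
    also have "\<dots> = ennreal (1 / h ^ CARD('n) * (W * C1 * nt))" using h W0 C1 nt unfolding norm_of_real by (subst ennreal_mult[symmetric]) auto
    finally show ?thesis using True by simp
   qed
  qed
  also have "\<dots> = ennreal (1 / h ^ CARD('n) * (W * C1 * nt)) * ennreal V" by (subst nn_integral_cmult_indicator) (auto simp: V)
  also have "\<dots> = ennreal (C * wt (s * real CARD('n) / 2) k)"
   unfolding hn C_def using W0 C1 nt by (simp add: ennreal_mult[symmetric] mult_ac)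
  finally show ?thesis unfolding h2 .
 qed
 then show ?thesis using C0 by blast
qed

text \<open>\<open>F\<close> and \<open>G\<close> have no compact support, so the frequency space is
  cut into unit cells \<open>k\<close>. The localised \<open>F\<close> and \<open>G\<close> decay in
  \<open>k - \<xi>'\<close> and \<open>k - \<xi>\<close>, which beats the polynomial loss of
  comparing the cell at \<open>k\<close> with the one at \<xi> and leaves the decay in
  \<open>\<xi>' - \<xi>\<close>.\<close>

lemma NW_kernel:
 assumes F: "\<And>K. dec K F" and G: "\<And>K. dec K G" and M: "0 \<le> M"
 shows "\<exists>C\<ge>0. \<forall>\<xi> \<xi>'. NW (- vel \<xi>) (wt (- s) \<xi>) a (\<lambda>h. cis (\<mu> h) * (F (h - \<xi>') * G (h - \<xi>)))
   \<le> ennreal (C * (wt (s * real CARD('n) / 2) \<xi> * wt (- M) (\<xi>' - \<xi>)))"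
proof -
 define n where "n = real CARD('n)"
 have n0: "0 \<le> n" by (simp add: n_def)
 \<comment> \<open>The loss of passing from \<open>k\<close> to \<xi>: \<open>(s + 1) * a\<close>
   for the centre, \<open>s * a\<close> for the rate and \<open>s * n / 2\<close> for the mass. The
   order \<open>L\<close> below pays for this loss, for the weight \<open>a\<close>, for the
   integral over \<open>k\<close> with \<open>n + 1\<close>, and keeps \<open>M\<close>.\<close>
 define b where "b = (s + 1) * a + s * a + s * n / 2"
 have b0: "0 \<le> b" using s a n0 by (simp add: b_def)
 define L where "L = M + b + (n + 1) + a"
 have L: "0 \<le> L" "n + a < L" using M b0 a n0 by (auto simp: L_def)
 define K where "K = 2 * L + n + 1 + 4 * (n + 3 + a)"
 have K: "n < K - 2 * L" "4 * (n + 3 + a) \<le> K" "0 \<le> K" "n + a < K" "n < K" using L a n0 by (auto simp: K_def)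
 obtain f :: "real^'n => complex" where th: "dec K f" "\<And>y. 1 \<le> norm y ==> f y = 0" "(LBINT y. f y) = 1"
  using bump_exists[OF zero_less_one K(3)] by blast
 have th': "dec (4 * (real CARD('n) + 3 + a)) f" using dec_mono[OF th(1)] K by (simp add: n_def)
 \<comment> \<open>\<open>T\<close> is 1 on the support of the bump \<open>f\<close>, so it can be
   inserted twice, giving \<open>F\<close> and \<open>G\<close> a localising factor each.\<close>
 obtain T :: "real^'n => complex" where T: "dec K T" "\<And>y. norm y \<le> 1 ==> T y = 1"
  using plateau_exists[of 1 K] K(3) by auto
 obtain C1 where C1: "0 \<le> C1" "\<And>k. NW (- vel k) (wt (- s) k) a (\<lambda>h. cis (\<mu> h) * f (h - k)) \<le> ennreal (C1 * wt (s * real CARD('n) / 2) k)"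
  using NW_unit_cell[OF th' th(2,3)] by blast
 obtain CL where CL: "0 \<le> CL" "\<And>u v. norm (vel u - vel v) \<le> CL * (wt s v * wt (s + 1) (u - v))"
  using vel_Lipschitz by blast
 obtain CF where CF: "0 \<le> CF" "\<And>u v x. norm (ifourier (\<lambda>h. F (h - u) * T (h - v)) x) \<le> CF * wt (- L) (u - v) * wt (- L) x"
  using dec_product_shift[OF F T(1) L(1)] K(1) unfolding n_def by blast
 obtain CG where CG: "0 \<le> CG" "\<And>u v x. norm (ifourier (\<lambda>h. G (h - u) * T (h - v)) x) \<le> CG * wt (- L) (u - v) * wt (- L) x"
  using dec_product_shift[OF G T(1) L(1)] K(1) unfolding n_def by blast
 define cw where "cw = wint TYPE(real^'n) (L - a)"
 have cw: "0 \<le> cw" by (simp add: cw_def)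
 have Fg: "good F" and Gg: "good G" using dec_good[OF F[of K]] dec_good[OF G[of K]] K by (auto simp: n_def)
 have thg: "good f" and Tg: "good T" using dec_good[OF th(1)] dec_good[OF T(1)] K by (auto simp: n_def)
 have [measurable]: "F \<in> Bm" "G \<in> Bm" "f \<in> Bm" "T \<in> Bm"
  using Fg Gg thg Tg good_measurable by auto
 define A where "A \<xi>' k h = F (h - \<xi>') * T (h - k)" for \<xi>' k h
 define D where "D \<xi> k h = G (h - \<xi>) * T (h - k)" for \<xi> k h
 have Ag: "good (A \<xi>' k)" for \<xi>' k unfolding A_def by (intro good_mult good_shift Fg Tg)
 have Dg: "good (D \<xi> k)" for \<xi> k unfolding D_def by (intro good_mult good_shift Gg Tg)
 have AN: "NW 0 1 a (A \<xi>' k) \<le> ennreal (CF * wt (- L) (\<xi>' - k) * cw)" for \<xi>' k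
  unfolding A_def cw_def by (rule NW_wt_bound[OF CF(2)]) (use L CF in \<open>auto simp: n_def\<close>)
 have DN: "NW 0 1 a (D \<xi> k) \<le> ennreal (CG * wt (- L) (\<xi> - k) * cw)" for \<xi> k
  unfolding D_def cw_def by (rule NW_wt_bound[OF CG(2)]) (use L CG in \<open>auto simp: n_def\<close>)
 define P where "P k h = cis (\<mu> h) * f (h - k)" for k h
 have Pg: "good (P k)" for k unfolding P_def by (intro good_unimodular good_shift thg mu_cont)
 have [measurable]: "P k \<in> Bm" for k by (rule good_measurable[OF Pg])
 define C2 where "C2 = (1 + CL) powr a * 2 powr a * C1"
 have C2: "0 \<le> C2" using C1 by (simp add: C2_def)
 have PN: "NW (- vel \<xi>) (wt (- s) \<xi>) a (P k) \<le> ennreal (C2 * (wt (s * n / 2) \<xi> * wt b (k - \<xi>)))" for \<xi> k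
 proof -
  define r where "r = wt (- s) \<xi>"
  define c where "c = wt (- s) \<xi> / wt (- s) k"
  have rc: "r = c * wt (- s) k" by (simp add: r_def c_def)
  have c0: "0 \<le> c" by (simp add: c_def)
  have "wt (- s) \<xi> \<le> wt (- s) k * wt s (\<xi> - k)" using wt_peetre[of "- s" \<xi> k] s by simp
  then have "c \<le> wt s (k - \<xi>)" by (simp add: c_def pos_divide_le_eq mult.commute wt_commute[of s k])
  then have "1 + c \<le> 2 * wt s (k - \<xi>)" using wt_ge_1[of s "k - \<xi>"] s by simp
  then have "(1 + c) powr a \<le> (2 * wt s (k - \<xi>)) powr a" using c0 a by (intro powr_mono2) auto
  then have ca: "(1 + c) powr a \<le> 2 powr a * wt (s * a) (k - \<xi>)" by (simp add: powr_mult wt_powr)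
  have va: "wt a (r *\<^sub>R (- vel k - - vel \<xi>)) \<le> (1 + CL) powr a * wt ((s + 1) * a) (k - \<xi>)"
  proof -
   have "norm (r *\<^sub>R (- vel k - - vel \<xi>)) = r * norm (vel k - vel \<xi>)" by (simp add: r_def norm_minus_commute)
   also have "\<dots> \<le> r * (CL * (wt s \<xi> * wt (s + 1) (k - \<xi>)))" by (intro mult_left_mono CL) (simp add: r_def)
   also have "\<dots> = CL * wt (s + 1) (k - \<xi>) * (wt (- s) \<xi> * wt s \<xi>)" by (simp add: r_def mult_ac)
   also have "\<dots> = CL * wt (s + 1) (k - \<xi>)" by (simp add: wt_mult)
   finally have "1 + norm (r *\<^sub>R (- vel k - - vel \<xi>)) \<le> (1 + CL) * wt (s + 1) (k - \<xi>)"
    using wt_ge_1[of "s + 1" "k - \<xi>"] s by (simp add: distrib_right)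
   then have "wt a (r *\<^sub>R (- vel k - - vel \<xi>)) \<le> ((1 + CL) * wt (s + 1) (k - \<xi>)) powr a"
    unfolding wt_def[of a] using a by (intro powr_mono2) auto
   then show ?thesis using CL by (simp add: powr_mult wt_powr)
  qed
  have wk: "wt (s * n / 2) k \<le> wt (s * n / 2) \<xi> * wt (s * n / 2) (k - \<xi>)" using wt_peetre[of "s * n / 2" k \<xi>] s n0 by simp
  have "NW (- vel \<xi>) r a (P k) \<le> ewt a (r *\<^sub>R (- vel k - - vel \<xi>)) * NW (- vel k) r a (P k)"
   by (rule NW_recentre[OF _ a]) measurable
  also have "NW (- vel k) r a (P k) \<le> ennreal ((1 + c) powr a) * NW (- vel k) (wt (- s) k) a (P k)"
   unfolding rc by (rule NW_dilate_factor[OF _ c0 a]) measurable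
  also have "NW (- vel k) (wt (- s) k) a (P k) \<le> ennreal (C1 * wt (s * n / 2) k)" using C1(2)[of k] by (simp add: P_def[abs_def] n_def)
  finally have "NW (- vel \<xi>) r a (P k) \<le> ewt a (r *\<^sub>R (- vel k - - vel \<xi>)) * (ennreal ((1 + c) powr a) * ennreal (C1 * wt (s * n / 2) k))"
   by (simp add: mult_left_mono)
  also have "\<dots> = ennreal (wt a (r *\<^sub>R (- vel k - - vel \<xi>)) * ((1 + c) powr a * (C1 * wt (s * n / 2) k)))"
   using C1 by (simp add: ennreal_mult)
  also have "\<dots> \<le> ennreal (((1 + CL) powr a * wt ((s + 1) * a) (k - \<xi>)) * ((2 powr a * wt (s * a) (k - \<xi>)) * (C1 * (wt (s * n / 2) \<xi> * wt (s * n / 2) (k - \<xi>)))))"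
   using C1 by (intro ennreal_leI mult_mono va ca wk order_refl) auto
  also have "((1 + CL) powr a * wt ((s + 1) * a) (k - \<xi>)) * ((2 powr a * wt (s * a) (k - \<xi>)) * (C1 * (wt (s * n / 2) \<xi> * wt (s * n / 2) (k - \<xi>))))
    = C2 * (wt (s * n / 2) \<xi> * (wt ((s + 1) * a) (k - \<xi>) * wt (s * a) (k - \<xi>) * wt (s * n / 2) (k - \<xi>)))"
   by (simp add: C2_def)
  also have "wt ((s + 1) * a) (k - \<xi>) * wt (s * a) (k - \<xi>) * wt (s * n / 2) (k - \<xi>) = wt b (k - \<xi>)"
   by (simp only: wt_mult b_def)
  finally show ?thesis unfolding r_def .
 qed
 define C where "C = C2 * CF * cw * CG * cw * wint TYPE(real^'n) (n + 1)"
 have C0: "0 \<le> C" using C2 CF(1) CG(1) cw by (simp add: C_def)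
 have main: "NW (- vel \<xi>) (wt (- s) \<xi>) a (\<lambda>h. cis (\<mu> h) * (F (h - \<xi>') * G (h - \<xi>)))
   \<le> ennreal (C * (wt (s * real CARD('n) / 2) \<xi> * wt (- M) (\<xi>' - \<xi>)))" for \<xi> \<xi>'
 proof -
  define r where "r = wt (- s) \<xi>"
  have r: "0 \<le> r" "r \<le> 1" using wt_le_1[of "- s" \<xi>] s by (auto simp: r_def)
  define H where "H k h = P k h * (A \<xi>' k h * D \<xi> k h)" for k h
  have Ge: "H k h = f (h - k) * (cis (\<mu> h) * (F (h - \<xi>') * G (h - \<xi>)))" for k h
  proof (cases "1 \<le> norm (h - k)")
   case True then show ?thesis by (simp add: H_def P_def th)
  next
   case False then show ?thesis by (simp add: H_def P_def A_def D_def T)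
  qed
  have gFG: "good (\<lambda>h. cis (\<mu> h) * (F (h - \<xi>') * G (h - \<xi>)))"
   by (intro good_unimodular good_mult good_shift Fg Gg mu_cont)
  have eq: "(\<lambda>h. cis (\<mu> h) * (F (h - \<xi>') * G (h - \<xi>))) = (\<lambda>h. LBINT k. H k h)"
  proof (rule ext)
   fix h
   have "(LBINT k. f (h - k)) = 1" using th(3) by (simp add: integral_lborel_translate)
   then show "cis (\<mu> h) * (F (h - \<xi>') * G (h - \<xi>)) = (LBINT k. H k h)"
    unfolding Ge by (simp only: integral_mult_left_zero mult_1)
  qed
  have [measurable]: "case_prod H \<in> borel_measurable (lborel \<Otimes>\<^sub>M lborel)" unfolding Ge by measurable
  have int: "integrable (lborel \<Otimes>\<^sub>M lborel) (case_prod H)"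
  proof -
   have i1: "L1 (\<lambda>k. f (h - k))" for h using goodD(2)[OF thg] by (rule integrable_lborel_translate)
   have i2: "(LBINT k. norm (f (h - k))) = (LBINT k. norm (f k))" for h
    by (rule integral_lborel_translate(3))
   have "integrable (lborel \<Otimes>\<^sub>M lborel) (\<lambda>(h, k). H k h)"
   proof (rule lborel_pair.Fubini_integrable)
    show "(\<lambda>(h, k). H k h) \<in> borel_measurable (lborel \<Otimes>\<^sub>M lborel)" by measurable
    show "L1 (\<lambda>h. LBINT k. norm (case (h, k) of (h, k) => H k h))"
     unfolding split Ge norm_mult[of "f _"] integral_mult_left_zero i2
     by (intro integrable_mult_right integrable_norm goodD(2)[OF gFG])
    show "AE h in lborel. L1 (\<lambda>k. case (h, k) of (h, k) => H k h)"
     unfolding Ge split using i1 by (intro AE_I2 integrable_mult_left)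
   qed
   then show ?thesis by (subst (asm) lborel_pair.integrable_product_swap_iff[symmetric]) (simp add: case_prod_beta)
  qed
  have "NW (- vel \<xi>) r a (\<lambda>h. LBINT k. H k h) \<le> (NNI k. NW (- vel \<xi>) r a (H k))"
   by (rule NW_integral[OF sigma_finite_lborel int])
  also have "\<dots> \<le> (NNI k. ennreal (C2 * CF * cw * CG * cw * wt (s * n / 2) \<xi>) * ennreal (wt (- (M + (n + 1))) (k - \<xi>') * wt (- (M + (n + 1))) (k - \<xi>)))"
  proof (rule nn_integral_mono)
   fix k
   have ADg: "good (\<lambda>h. A \<xi>' k h * D \<xi> k h)" by (intro good_mult Ag Dg)
   have "NW 0 r a (\<lambda>h. A \<xi>' k h * D \<xi> k h) \<le> NW 0 1 a (\<lambda>h. A \<xi>' k h * D \<xi> k h)" using r a by (intro NW_mono_r) auto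
   also have "\<dots> \<le> NW 0 1 a (A \<xi>' k) * NW 0 1 a (D \<xi> k)"
    by (rule NW_mult[OF Ag goodD(2)[OF Dg] a]) (use AN[of \<xi>' k] in \<open>auto intro: order_le_less_trans\<close>)
   also have "\<dots> \<le> ennreal (CF * wt (- L) (\<xi>' - k) * cw) * ennreal (CG * wt (- L) (\<xi> - k) * cw)" by (intro mult_mono AN DN) auto
   finally have n1: "NW 0 r a (\<lambda>h. A \<xi>' k h * D \<xi> k h) \<le> ennreal (CF * wt (- L) (\<xi>' - k) * cw) * ennreal (CG * wt (- L) (\<xi> - k) * cw)" .
   have "NW (- vel \<xi>) r a (H k) \<le> NW (- vel \<xi>) r a (P k) * NW 0 r a (\<lambda>h. A \<xi>' k h * D \<xi> k h)"
    unfolding H_def r_def by (rule NW_mult[OF Pg goodD(2)[OF ADg] a]) (use PN[of \<xi> k] in \<open>auto intro: order_le_less_trans\<close>)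
   also have "\<dots> \<le> ennreal (C2 * (wt (s * n / 2) \<xi> * wt b (k - \<xi>))) * (ennreal (CF * wt (- L) (\<xi>' - k) * cw) * ennreal (CG * wt (- L) (\<xi> - k) * cw))"
    using PN[of \<xi> k] by (intro mult_mono n1) (auto simp: r_def)
   also have "\<dots> = ennreal ((C2 * CF * cw * CG * cw * wt (s * n / 2) \<xi>) * (wt (- L) (k - \<xi>') * (wt b (k - \<xi>) * wt (- L) (k - \<xi>))))"
    using C2 CF(1) CG(1) cw by (simp add: ennreal_mult[symmetric] mult_ac wt_commute[of "- L" k])
   also have "\<dots> \<le> ennreal ((C2 * CF * cw * CG * cw * wt (s * n / 2) \<xi>) * (wt (- (M + (n + 1))) (k - \<xi>') * wt (- (M + (n + 1))) (k - \<xi>)))"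
    unfolding wt_mult using C2 CF(1) CG(1) cw b0 a by (intro ennreal_leI mult_left_mono mult_mono wt_mono) (auto simp: L_def)
   also have "\<dots> = ennreal (C2 * CF * cw * CG * cw * wt (s * n / 2) \<xi>) * ennreal (wt (- (M + (n + 1))) (k - \<xi>') * wt (- (M + (n + 1))) (k - \<xi>))"
    using C2 CF(1) CG(1) cw by (intro ennreal_mult) auto
   finally show "NW (- vel \<xi>) r a (H k) \<le> \<dots>" .
  qed
  also have "\<dots> = ennreal (C2 * CF * cw * CG * cw * wt (s * n / 2) \<xi>) * (NNI k. ennreal (wt (- (M + (n + 1))) (k - \<xi>') * wt (- (M + (n + 1))) (k - \<xi>)))"
   by (rule nn_integral_cmult) measurable
  also have "\<dots> \<le> ennreal (C2 * CF * cw * CG * cw * wt (s * n / 2) \<xi>) * ennreal (wint TYPE(real^'n) (n + 1) * wt (- M) (\<xi>' - \<xi>))"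
   by (intro mult_left_mono wt_convolution_le) (auto simp: n_def M)
  also have "\<dots> = ennreal (C * (wt (s * real CARD('n) / 2) \<xi> * wt (- M) (\<xi>' - \<xi>)))"
   using C2 CF(1) CG(1) cw by (simp add: ennreal_mult[symmetric] C_def n_def mult_ac)
  finally show ?thesis unfolding eq r_def .
 qed
 then show ?thesis using C0 by blast
qed

end

section \<open>Convolution operators\<close>

lemma Fourier_multiplication_formula:
 fixes f w :: "real^'n::finite => complex"
 assumes f: "L1 f" and w: "L1 w"
 shows "(LBINT h. ifourier f h * w h) = (LBINT x. f x * ifourier w x)"
proof -
 have [measurable]: "f \<in> Bm" "w \<in> Bm" using f w by auto
 let ?G = "\<lambda>x h. f x * cis (2 * pi * (h \<bullet> x)) * w h"
 have int: "integrable (lborel \<Otimes>\<^sub>M lborel) (case_prod ?G)"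
  by (rule integrable_pair_bound[where u="\<lambda>x. norm (f x)" and v="\<lambda>x. norm (w x)"])
   (use f w in \<open>auto simp: norm_mult sigma_finite_lborel\<close>)
 have "(LBINT h. ifourier f h * w h) = (LBINT h. LBINT x. ?G x h)"
  unfolding ifourier_def by (simp only: integral_mult_left_zero)
 also have "\<dots> = (LBINT x. LBINT h. ?G x h)" by (rule lborel_pair.Fubini_integral[OF int])
 also have "\<dots> = (LBINT x. f x * ifourier w x)"
 proof (intro Bochner_Integration.integral_cong refl)
  fix x
  have "(LBINT h. ?G x h) = (LBINT h. f x * (w h * cis (2 * pi * (x \<bullet> h))))"
   by (simp add: inner_commute mult_ac)
  then show "(LBINT h. ?G x h) = f x * ifourier w x" unfolding ifourier_def by (simp only: integral_mult_right_zero)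
 qed
 finally show ?thesis .
qed

text \<open>The Gaussian approximate identity of width \<open>e\<close>; it is the inverse transform
  of \<open>gs (e *\<^sub>R h)\<close>.\<close>

definition gsK :: "real => real^'n::finite => real" where
 "gsK e z = (1 / e ^ CARD('n)) * gs ((1 / e) *\<^sub>R z)"

lemma gsK_measurable [measurable]: "f \<in> borel_measurable M ==> (\<lambda>x. gsK e (f x)) \<in> borel_measurable M"
 unfolding gsK_def by measurable

lemma gs_minus [simp]: "gs (- z) = gs z" by (simp add: gs_def)

lemma gsK_nn_integral:
 assumes e: "0 < e"
 shows "(NNI z. ennreal (gsK e (z::real^'n::finite))) = 1"
proof -
 have "(NNI z. ennreal (gsK e (z::real^'n))) = ennreal (e ^ CARD('n)) * (NNI z. ennreal (gsK e (e *\<^sub>R z::real^'n)))"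
  using e by (subst nn_integral_lborel_affine[of _ e 0]) auto
 also have "\<dots> = (NNI (z::real^'n). ennreal (e ^ CARD('n)) * ennreal (gsK e (e *\<^sub>R z)))"
  by (rule nn_integral_cmult[symmetric]) measurable
 also have "\<dots> = (NNI (z::real^'n). ennreal (gs z))"
  using e by (intro nn_integral_cong) (simp add: gsK_def ennreal_mult[symmetric])
 also have "\<dots> = 1" using gs_integrable[where 'a="real^'n"] gs_integral[where 'a="real^'n"] by (subst nn_integral_eq_integral) auto
 finally show ?thesis .
qed

text \<open>The multiplication formula applied twice. The Gaussian factor makes the energy finite
  for every integrable \<open>v\<close>, whose transform need not be square integrable.\<close>

lemma gaussian_Plancherel:
 fixes v :: "real^'n::finite => complex"
 assumes v: "L1 v" and e: "0 < e"
 shows "cor (LBINT h. gs (e *\<^sub>R h) * (norm (ifourier v h))^2) =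
   (LBINT x. v x * (LBINT y. cnj (v y) * gsK e (y - x)))"
proof -
 have [measurable]: "v \<in> Bm" using v by auto
 have gi: "L1 (\<lambda>x::real^'n. gs (e *\<^sub>R x))"
  using integrable_lborel_affine[OF gs_integrable, of e "0::real^'n"] e by simp
 have vc: "L1 (\<lambda>y. cnj (v y))" using v by simp
 define w where "w h = cor (gs (e *\<^sub>R h)) * cnj (ifourier v h)" for h
 have [measurable]: "w \<in> Bm" unfolding w_def[abs_def] by measurable
 have wi: "L1 w"
 proof (rule Bochner_Integration.integrable_bound)
  show "L1 (\<lambda>h::real^'n. gs (e *\<^sub>R h) * (LBINT y. norm (v y)))" using gi by simp
  show "AE h in lborel. norm (w h) \<le> norm (gs (e *\<^sub>R h) * (LBINT y. norm (v y)))"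
   using norm_ifourier_le[OF v] by (intro AE_I2) (auto simp: w_def norm_mult abs_mult intro!: mult_left_mono)
 qed measurable
 have fw: "ifourier w x = (LBINT y. cnj (v y) * gsK e (y - x))" for x
 proof -
  define g where "g h = cor (gs (e *\<^sub>R h))" for h :: "real^'n"
  have gc: "L1 g" unfolding g_def using gi by (simp add: complex_of_real_integrable_eq)
  define w' where "w' h = cis (2 * pi * (x \<bullet> - h)) * g h" for h
  have w'i: "L1 w'" unfolding w'_def using integrable_cis_mult[OF gc] by (simp add: mult.commute)
  have w': "ifourier w' y = gsK e (y - x)" for y
  proof -
   have "w' = (\<lambda>h. cis (2 * pi * (- x \<bullet> h)) * g h)" by (auto simp: w'_def)
   then have "ifourier w' y = ifourier g (y + - x)" by (simp only: ifourier_modulate)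
   also have "\<dots> = gsK e (y - x)" unfolding g_def
    using ifourier_scale[OF e, of "\<lambda>x. cor (gs x)" "y - x"] e by (simp add: ifourier_gs gsK_def scaleR_conv_of_real)
   finally show ?thesis .
  qed
  have "ifourier w x = (LBINT h. w (- h) * cis (2 * pi * (x \<bullet> - h)))"
   unfolding ifourier_def[of w] by (subst integral_lborel_translate(4)[symmetric]) simp
  also have "\<dots> = (LBINT h. ifourier (\<lambda>y. cnj (v y)) h * w' h)"
   by (intro Bochner_Integration.integral_cong refl) (simp add: w_def w'_def g_def ifourier_cnj mult_ac)
  also have "\<dots> = (LBINT y. cnj (v y) * ifourier w' y)" by (rule Fourier_multiplication_formula[OF vc w'i])
  finally show ?thesis unfolding w' .
 qed
 have "(LBINT x. v x * (LBINT y. cnj (v y) * gsK e (y - x))) = (LBINT x. v x * ifourier w x)"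
  by (simp only: fw)
 also have "\<dots> = (LBINT h. ifourier v h * w h)" by (rule Fourier_multiplication_formula[OF v wi, symmetric])
 also have "\<dots> = (LBINT h. cor (gs (e *\<^sub>R h) * (norm (ifourier v h))^2))"
  by (intro Bochner_Integration.integral_cong refl) (simp only: w_def of_real_mult complex_norm_square mult_ac)
 finally show ?thesis by (simp only: integral_complex_of_real)
qed

text \<open>The product \<open>v x * cnj (v y)\<close> is split by the arithmetic-geometric mean
  inequality; the Gaussian kernel has mass one in either variable, so each half contributes half of
  the squared norm.\<close>

lemma gaussian_energy_le:
 fixes v :: "real^'n::finite => complex"
 assumes v: "L1 v" and e: "0 < e"
 shows "ennreal (LBINT h. gs (e *\<^sub>R h) * (norm (ifourier v h))^2) \<le> (NNI x. ennreal ((norm (v x))^2))"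
proof -
 have [measurable]: "v \<in> Bm" using v by auto
 have g0: "0 \<le> gsK e z" for z :: "real^'n" using e by (simp add: gsK_def)
 define J where "J = (LBINT h. gs (e *\<^sub>R h) * (norm (ifourier v h))^2)"
 have "0 \<le> J" unfolding J_def by (intro Bochner_Integration.integral_nonneg) simp
 then have "ennreal J = enorm (cor J)" by simp
 also have "cor J = (LBINT x. v x * (LBINT y. cnj (v y) * gsK e (y - x)))"
  unfolding J_def by (rule gaussian_Plancherel[OF v e])
 also have "ennreal (norm \<dots>) \<le> (NNI x. enorm (v x * (LBINT y. cnj (v y) * gsK e (y - x))))"
  by (rule norm_integral_le_nn)
 also have "\<dots> \<le> (NNI x. (NNI y. ennreal (norm (v x) * (norm (v y) * gsK e (y - x)))))"
 proof (rule nn_integral_mono)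
  fix x
  have "enorm (v x * (LBINT y. cnj (v y) * gsK e (y - x))) = enorm (v x) * enorm (LBINT y. cnj (v y) * gsK e (y - x))"
   by (simp add: norm_mult ennreal_mult)
  also have "\<dots> \<le> enorm (v x) * (NNI y. enorm (cnj (v y) * gsK e (y - x)))"
   by (intro mult_left_mono norm_integral_le_nn) simp
  also have "\<dots> = (NNI y. enorm (v x) * enorm (cnj (v y) * gsK e (y - x)))"
   by (rule nn_integral_cmult[symmetric]) measurable
  also have "\<dots> = (NNI y. ennreal (norm (v x) * (norm (v y) * gsK e (y - x))))"
   using g0 by (intro nn_integral_cong) (simp add: norm_mult ennreal_mult[symmetric])
  finally show "enorm (v x * (LBINT y. cnj (v y) * gsK e (y - x))) \<le> \<dots>" .
 qed
 also have "\<dots> \<le> (NNI x. (NNI y. ennreal (1/2 * (norm (v x))^2) * ennreal (gsK e (y - x)) + ennreal (1/2 * (norm (v y))^2) * ennreal (gsK e (y - x))))"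
 proof (intro nn_integral_mono)
  fix x y
  have "0 \<le> (norm (v x) - norm (v y))^2" by simp
  then have "norm (v x) * norm (v y) \<le> 1/2 * (norm (v x))^2 + 1/2 * (norm (v y))^2"
   by (simp add: power2_eq_square algebra_simps)
  then have "norm (v x) * norm (v y) * gsK e (y - x) \<le> (1/2 * (norm (v x))^2 + 1/2 * (norm (v y))^2) * gsK e (y - x)"
   by (intro mult_right_mono g0)
  then show "ennreal (norm (v x) * (norm (v y) * gsK e (y - x))) \<le> ennreal (1/2 * (norm (v x))^2) * ennreal (gsK e (y - x)) + ennreal (1/2 * (norm (v y))^2) * ennreal (gsK e (y - x))"
   using g0 by (simp add: ennreal_mult[symmetric] ennreal_plus[symmetric] distrib_right mult.assoc ennreal_leI del: ennreal_plus)
 qed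
 also have "\<dots> = (NNI x. (NNI y. ennreal (1/2 * (norm (v x))^2) * ennreal (gsK e (y - x)))) + (NNI x. (NNI y. ennreal (1/2 * (norm (v y))^2) * ennreal (gsK e (y - x))))"
  by (subst nn_integral_add[symmetric], measurable, intro nn_integral_cong nn_integral_add) measurable
 also have "(NNI x. (NNI y. ennreal (1/2 * (norm (v y))^2) * ennreal (gsK e (y - x))))
   = (NNI y. (NNI x. ennreal (1/2 * (norm (v y))^2) * ennreal (gsK e (y - x))))"
  by (rule lborel_pair.Fubini') measurable
 also have "(NNI y. (NNI x. ennreal (1/2 * (norm (v y))^2) * ennreal (gsK e (y - x)))) = (NNI y. ennreal (1/2 * (norm (v y))^2))"
  using nn_integral_lborel_translate(3)[of "\<lambda>x::real^'n. ennreal (gsK e x)"]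
  by (intro nn_integral_cong) (simp add: nn_integral_cmult gsK_nn_integral[OF e])
 also have "(NNI x. (NNI y. ennreal (1/2 * (norm (v x))^2) * ennreal (gsK e (y - x)))) = (NNI y. ennreal (1/2 * (norm (v y))^2))"
  using nn_integral_lborel_translate(2)[of "\<lambda>x::real^'n. ennreal (gsK e x)"]
  by (intro nn_integral_cong) (simp add: nn_integral_cmult gsK_nn_integral[OF e])
 also have "(NNI y. ennreal (1/2 * (norm (v y))^2)) + (NNI y. ennreal (1/2 * (norm (v y))^2)) = (NNI x. ennreal ((norm (v x))^2))"
  by (subst nn_integral_add[symmetric]) (auto simp: ennreal_plus[symmetric] simp del: ennreal_plus intro!: nn_integral_cong)
 finally show ?thesis unfolding J_def .
qed

section \<open>Convolution on square integrable and on integrable functions\<close>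

definition conv :: "(real^'n::finite => complex) => (real^'n => complex) => real^'n => complex" where
 "conv k F x = (LBINT y. k y * F (x - y))"

lemma conv_good:
 assumes k: "good k" and F: "L1 F"
 shows "good (conv k F)" "ifourier (conv k F) x = ifourier F x * ifourier k x"
proof -
 have "conv k F = (\<lambda>x. LBINT z. F z * k (x - z))"
 proof (rule ext)
  fix x show "conv k F x = (LBINT z. F z * k (x - z))"
   unfolding conv_def by (subst integral_lborel_translate(3)[of _ x, symmetric]) (simp add: mult.commute)
 qed
 then show "good (conv k F)" "ifourier (conv k F) x = ifourier F x * ifourier k x"
  using convolution_good[OF F k] by simp_all
qed

lemma conv_integrable:
 assumes k: "good k" and F: "L1 F"
 shows "L1 (\<lambda>y. k y * F (x - y))"
proof -
 have [measurable]: "k \<in> Bm" "F \<in> Bm" using good_measurable[OF k] F by auto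
 obtain B where B: "0 \<le> B" "\<And>x. norm (k x) \<le> B" using good_bound[OF k] by auto
 show ?thesis
  by (rule Bochner_Integration.integrable_bound[of _ "\<lambda>y. B * norm (F (x - y))"])
   (use integrable_lborel_translate(3)[OF F, of x] B in \<open>auto simp: norm_mult intro!: mult_right_mono\<close>)
qed

text \<open>The symbol bound compares Gaussian energies before any limit is taken. The energy of
  \<open>F\<close> is at most its squared norm, and for the convolution, which is
  \<open>good\<close>, the energies converge to the squared norm. The right side may be
  infinite.\<close>

lemma L2_convolution:
 fixes k F :: "real^'n::finite => complex"
 assumes k: "good k" and A: "\<And>h. norm (ifourier k h) \<le> A" and F: "L1 F"
 shows "(NNI x. ennreal ((norm (conv k F x))^2)) \<le> ennreal (A^2) * (NNI x. ennreal ((norm (F x))^2))"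
proof -
 define u where "u = conv k F"
 have u: "good u" and uf: "ifourier u x = ifourier F x * ifourier k x" for x
  unfolding u_def by (rule conv_good[OF k F])+
 have ui: "L1 u" by (rule goodD(2)[OF u])
 have [measurable]: "u \<in> Bm" "F \<in> Bm" using good_measurable[OF u] F by auto
 obtain B where B: "0 \<le> B" "\<And>x. norm (u x) \<le> B" using good_bound[OF u] by auto
 have A0: "0 \<le> A" using A[of 0] norm_ge_zero order_trans by blast
 define Y where "Y = ennreal (A^2) * (NNI x. ennreal ((norm (F x))^2))"
 define e where "e j = 1 / real (Suc j)" for j
 have e0: "0 < e j" for j by (simp add: e_def)
 have elim: "e \<longlonglongrightarrow> 0" unfolding e_def using LIMSEQ_inverse_real_of_nat by (simp add: inverse_eq_divide)
 have gi: "L1 (\<lambda>x::real^'n. gs (e j *\<^sub>R x))" for j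
  using integrable_lborel_affine[OF gs_integrable, of "e j" "0::real^'n"] e0[of j] by simp
 define J where "J v j = (LBINT h. gs (e j *\<^sub>R h) * (norm (ifourier v h))^2)" for v :: "real^'n => complex" and j
 have Ji: "L1 (\<lambda>h. gs (e j *\<^sub>R h) * (norm (ifourier v h))^2)" if v: "L1 v" for v :: "real^'n => complex" and j
 proof (rule Bochner_Integration.integrable_bound)
  have [measurable]: "v \<in> Bm" using v by auto
  show "L1 (\<lambda>h::real^'n. gs (e j *\<^sub>R h) * (LBINT y. norm (v y))^2)" using gi by simp
  show "AE h in lborel. norm (gs (e j *\<^sub>R h) * (norm (ifourier v h))^2) \<le> norm (gs (e j *\<^sub>R h) * (LBINT y. norm (v y))^2)"
   using norm_ifourier_le[OF v] by (intro AE_I2) (auto simp: abs_mult intro!: mult_left_mono power_mono)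
  show "(\<lambda>h. gs (e j *\<^sub>R h) * (norm (ifourier v h))^2) \<in> borel_measurable lborel" by measurable
 qed
 have JY: "ennreal (J u j) \<le> Y" for j
 proof -
  have "J u j \<le> (LBINT h. A^2 * (gs (e j *\<^sub>R h) * (norm (ifourier F h))^2))"
   unfolding J_def
  proof (rule integral_mono)
   fix h
   have "(norm (ifourier k h))^2 \<le> A^2" by (intro power_mono A) simp
   then have "(gs (e j *\<^sub>R h) * (norm (ifourier F h))^2) * (norm (ifourier k h))^2 \<le> (gs (e j *\<^sub>R h) * (norm (ifourier F h))^2) * A^2"
    by (intro mult_left_mono) auto
   then show "gs (e j *\<^sub>R h) * (norm (ifourier u h))^2 \<le> A^2 * (gs (e j *\<^sub>R h) * (norm (ifourier F h))^2)"
    by (simp add: uf norm_mult power_mult_distrib mult_ac)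
  qed (use Ji[OF ui] Ji[OF F] in auto)
  also have "\<dots> = A^2 * J F j" by (simp add: J_def)
  finally have "ennreal (J u j) \<le> ennreal (A^2) * ennreal (J F j)" by (simp add: ennreal_mult'[symmetric] ennreal_leI)
  also have "\<dots> \<le> Y" unfolding Y_def J_def by (intro mult_left_mono gaussian_energy_le F e0) simp
  finally show ?thesis .
 qed
 \<comment> \<open>Gaussian averages of \<open>u\<close> converge pointwise, by continuity and
   boundedness, and stay below the bound of \<open>u\<close>; the outer integral is then dominated
   by a multiple of \<open>norm (u x)\<close>.\<close>
 have "(\<lambda>j. LBINT x. u x * (LBINT y. cnj (u y) * gsK (e j) (y - x))) \<longlonglongrightarrow> (LBINT x. u x * cnj (u x))"
 proof (rule integral_dominated_convergence[where w="\<lambda>x. norm (u x) * B"])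
  have inner: "(LBINT y. cnj (u y) * gsK (e j) (y - x)) = (LBINT z. cnj (u (x + e j *\<^sub>R z)) * gs z)" for j x
   using e0[of j] by (subst integral_lborel_affine[of "e j" _ x]) (simp_all add: gsK_def scaleR_conv_of_real[where 'a=complex])
  show "AE x in lborel. (\<lambda>j. u x * (LBINT y. cnj (u y) * gsK (e j) (y - x))) \<longlonglongrightarrow> u x * cnj (u x)"
  proof (intro AE_I2 tendsto_mult tendsto_const)
   fix x :: "real^'n"
   have "(\<lambda>j. LBINT z. cnj (u (x + e j *\<^sub>R z)) * gs z) \<longlonglongrightarrow> (LBINT z. cnj (u x) * cor (gs (z::real^'n)))"
   proof (rule integral_dominated_convergence[where w="\<lambda>z. B * gs z"])
    show "AE z in lborel. (\<lambda>j. cnj (u (x + e j *\<^sub>R z)) * cor (gs z)) \<longlonglongrightarrow> cnj (u x) * cor (gs z)"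
    proof (rule AE_I2)
     fix z :: "real^'n"
     have "(\<lambda>j. x + e j *\<^sub>R z) \<longlonglongrightarrow> x + 0 *\<^sub>R z" by (intro tendsto_intros elim)
     then have l: "(\<lambda>j. x + e j *\<^sub>R z) \<longlonglongrightarrow> x" by simp
     have "isCont u x" using goodD(1)[OF u] by (simp add: continuous_on_eq_continuous_at)
     from isCont_tendsto_compose[OF this l] have "(\<lambda>j. u (x + e j *\<^sub>R z)) \<longlonglongrightarrow> u x" .
     then show "(\<lambda>j. cnj (u (x + e j *\<^sub>R z)) * cor (gs z)) \<longlonglongrightarrow> cnj (u x) * cor (gs z)"
      by (intro tendsto_intros)
    qed
    show "AE z in lborel. norm (cnj (u (x + e j *\<^sub>R z)) * cor (gs z)) \<le> B * gs z" for j
     using B by (intro AE_I2) (auto simp: norm_mult intro!: mult_right_mono)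
   qed (use gs_integrable in auto)
   then show "(\<lambda>j. LBINT y. cnj (u y) * gsK (e j) (y - x)) \<longlonglongrightarrow> cnj (u x)"
    unfolding inner by (simp add: gs_integral)
  qed
  show "AE x in lborel. norm (u x * (LBINT y. cnj (u y) * gsK (e j) (y - x))) \<le> norm (u x) * B" for j
  proof (rule AE_I2)
   fix x :: "real^'n"
   have "norm (LBINT z. cnj (u (x + e j *\<^sub>R z)) * gs z) \<le> (LBINT z. norm (cnj (u (x + e j *\<^sub>R z)) * cor (gs z)))"
    by (rule integral_norm_bound)
   also have "\<dots> \<le> (LBINT z. B * gs (z::real^'n))"
   proof (rule integral_mono)
    show "L1 (\<lambda>z. norm (cnj (u (x + e j *\<^sub>R z)) * cor (gs z)))"
     by (rule Bochner_Integration.integrable_bound[of _ "\<lambda>z::real^'n. B * gs z"])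
      (use gs_integrable[where 'a="real^'n"] B in \<open>auto simp: norm_mult intro!: mult_right_mono\<close>)
    show "L1 (\<lambda>z::real^'n. B * gs z)" using gs_integrable[where 'a="real^'n"] by simp
    show "norm (cnj (u (x + e j *\<^sub>R z)) * cor (gs z)) \<le> B * gs z" for z
     using B by (auto simp: norm_mult intro!: mult_right_mono)
   qed
   also have "\<dots> = B" by (simp add: gs_integral)
   finally show "norm (u x * (LBINT y. cnj (u y) * gsK (e j) (y - x))) \<le> norm (u x) * B"
    unfolding inner norm_mult by (intro mult_left_mono) auto
  qed
  show "L1 (\<lambda>x. norm (u x) * B)" using ui by simp
 qed measurable
 also have "(\<lambda>j. LBINT x. u x * (LBINT y. cnj (u y) * gsK (e j) (y - x))) = (\<lambda>j. cor (J u j))"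
  unfolding J_def gaussian_Plancherel[OF ui e0] ..
 also have "(LBINT x. u x * cnj (u x)) = cor (LBINT x. (norm (u x))^2)"
  by (simp only: complex_norm_square[symmetric] integral_complex_of_real)
 finally have lim: "(\<lambda>j. J u j) \<longlonglongrightarrow> (LBINT x. (norm (u x))^2)" by (simp only: tendsto_of_real_iff)
 have u2: "L1 (\<lambda>x. (norm (u x))^2)"
  using integrable_norm[OF goodD(2)[OF good_mult[OF u u]]] by (simp add: norm_mult power2_eq_square)
 have "(\<lambda>j. ennreal (J u j)) \<longlonglongrightarrow> ennreal (LBINT x. (norm (u x))^2)" by (intro tendsto_ennrealI lim)
 then have "ennreal (LBINT x. (norm (u x))^2) \<le> Y" by (rule LIMSEQ_le_const2) (use JY in auto)
 then show ?thesis unfolding Y_def u_def[symmetric] by (subst nn_integral_eq_integral[OF u2]) auto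
qed

lemma L1_convolution:
 fixes k F :: "real^'n::finite => complex"
 assumes [measurable]: "k \<in> Bm" "F \<in> Bm"
 shows "(NNI x. enorm (conv k F x)) \<le> (NNI y. enorm (k y)) * (NNI x. enorm (F x))"
proof -
 have "(NNI x. enorm (conv k F x)) \<le> (NNI x. NNI y. enorm (k y) * enorm (F (x - y)))"
  unfolding conv_def by (intro nn_integral_mono order_trans[OF norm_integral_le_nn]) (simp add: norm_mult ennreal_mult)
 also have "\<dots> = (NNI y. NNI x. enorm (k y) * enorm (F (x - y)))"
  by (rule lborel_pair.Fubini') measurable
 also have "\<dots> = (NNI y. enorm (k y) * (NNI x. enorm (F x)))"
  using nn_integral_lborel_translate(2)[of "\<lambda>x. enorm (F x)"] by (simp add: nn_integral_cmult)
 also have "\<dots> = (NNI y. enorm (k y)) * (NNI x. enorm (F x))"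
  by (rule nn_integral_multc) measurable
 finally show ?thesis .
qed

lemma powr_nn_integral_0:
 assumes r: "0 < r" and z: "0 \<le> z"
 shows "(NNI t. ennreal (t powr (r - 1)) * indicator {0<..<z} t) = ennreal (z powr r / r)"
proof -
 have "((\<lambda>x. x powr (r - 1)) has_integral (z powr r / r)) {0..z}"
  using has_integral_powr_from_0[of "r - 1" z] r z by simp
 then have *: "((\<lambda>x. x powr (r - 1)) has_integral (z powr r / r)) {0<..<z}"
  by (simp add: has_integral_Icc_iff_Ioo)
 have "(NNI t. ennreal (indicator {0<..<z} t * t powr (r - 1))) = ennreal (z powr r / r)"
  by (rule nn_integral_has_integral_lebesgue[OF _ *]) auto
 then show ?thesis by (simp add: ennreal_mult' ennreal_indicator mult.commute)
qed

lemma powr_nn_integral_inf: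
 assumes r: "0 < r" and z: "0 < z"
 shows "(NNI t. ennreal (t powr (- r - 1)) * indicator {z..} t) = ennreal (z powr (- r) / r)"
proof -
 have *: "((\<lambda>x. x powr (- r - 1)) has_integral (z powr (- r) / r)) {z..}"
  using has_integral_powr_to_inf[of "- r - 1" z] r z by (simp add: divide_simps)
 have "(NNI t. ennreal (indicator {z..} t * t powr (- r - 1))) = ennreal (z powr (- r) / r)"
  by (rule nn_integral_has_integral_lebesgue[OF _ *]) auto
 then show ?thesis by (simp add: ennreal_mult' ennreal_indicator mult.commute)
qed

section \<open>Interpolation\<close>

lemma ennreal_mult_assoc:
 "0 \<le> a ==> 0 \<le> b ==> ennreal a * (ennreal b * c) = ennreal (a * b) * c"
 by (simp only: ennreal_mult mult.assoc)

lemma ennreal_mult3: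
 "0 \<le> a ==> 0 \<le> b ==> 0 \<le> c ==> ennreal a * (ennreal b * ennreal c) = ennreal (a * (b * c))"
 by (simp only: ennreal_mult mult_nonneg_nonneg)

text \<open>Tonelli's theorem in the form taken by layer-cake integrals: \<open>f\<close> lives on
  space, \<open>g\<close> on the levels, and \<open>h\<close> is the indicator that joins
  them.\<close>

lemma nn_integral_swap_mult:
 fixes f :: "'a::euclidean_space => ennreal" and g :: "'b::euclidean_space => ennreal"
 assumes [measurable]: "f \<in> Bm" "g \<in> Bm"
  and h: "case_prod h \<in> Bm2"
 shows "(NNI t. g t * (NNI x. f x * h t x)) = (NNI x. f x * (NNI t. g t * h t x))"
proof -
 have h2: "(\<lambda>(x, t). h t x) \<in> Bm2"
  using measurable_pair_swap_iff[THEN iffD1, OF h] by (simp add: case_prod_beta)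
 have [measurable]: "case_prod h \<in> borel_measurable (lborel \<Otimes>\<^sub>M lborel)" using h by simp
 have h1 [measurable]: "h t \<in> Bm" for t using measurable_Pair2[OF h, of t] by simp
 have h3 [measurable]: "(\<lambda>t. h t x) \<in> Bm" for x using measurable_Pair2[OF h2, of x] by simp
 have [measurable]: "(\<lambda>(x, t). h t x) \<in> borel_measurable (lborel \<Otimes>\<^sub>M lborel)" using h2 by simp
 have "(NNI t. g t * (NNI x. f x * h t x)) = (NNI t. (NNI x. g t * (f x * h t x)))"
  by (intro nn_integral_cong nn_integral_cmult[symmetric]) measurable
 also have "\<dots> = (NNI x. (NNI t. g t * (f x * h t x)))"
  by (rule lborel_pair.Fubini') measurable
 also have "\<dots> = (NNI x. (NNI t. f x * (g t * h t x)))" by (simp add: mult_ac)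
 also have "\<dots> = (NNI x. f x * (NNI t. g t * h t x))"
  by (intro nn_integral_cong nn_integral_cmult) measurable
 finally show ?thesis .
qed

lemma layer_cake:
 fixes z :: "'a::euclidean_space => real"
 assumes [measurable]: "z \<in> Bm" and z: "\<And>x. 0 \<le> z x" and p: "0 < p"
 shows "(NNI x. ennreal (z x powr p)) =
  (NNI t. ennreal (p * t powr (p - 1)) * (indicator {0<..} t * (NNI x. (if t < z x then 1 else 0))))"
proof -
 have e: "ennreal (z x powr p) = (NNI t. (ennreal (p * t powr (p - 1)) * indicator {0<..} t) * (if t < z x then 1 else 0))" for x
 proof -
  have "ennreal (z x powr p) = ennreal p * ennreal (z x powr p / p)" using p by (simp add: ennreal_mult[symmetric])
  also have "\<dots> = ennreal p * (NNI t. ennreal (t powr (p - 1)) * indicator {0<..<z x} t)"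
   by (simp add: powr_nn_integral_0[OF p z])
  also have "\<dots> = (NNI t. ennreal p * (ennreal (t powr (p - 1)) * indicator {0<..<z x} t))"
   by (rule nn_integral_cmult[symmetric]) measurable
  also have "\<dots> = (NNI t. (ennreal (p * t powr (p - 1)) * indicator {0<..} t) * (if t < z x then 1 else 0))"
   using p by (intro nn_integral_cong) (auto simp: ennreal_mult indicator_def)
  finally show ?thesis .
 qed
 have "(NNI x. ennreal (z x powr p)) = (NNI x. 1 * (NNI t. (ennreal (p * t powr (p - 1)) * indicator {0<..} t) * (if t < z x then 1 else 0)))"
  by (simp add: e)
 also have "\<dots> = (NNI t. (ennreal (p * t powr (p - 1)) * indicator {0<..} t) * (NNI x. 1 * (if t < z x then 1 else 0)))"
  by (rule nn_integral_swap_mult[symmetric]) measurable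
 finally show ?thesis by (simp add: mult.assoc)
qed

text \<open>The splitting of Marcinkiewicz interpolation between \<open>L\<^sup>2\<close> and \<open>L\<^sup>1\<close> or \<open>L\<^sup>\<infinity>\<close>.\<close>
lemma conv_level_sets:
 fixes k F :: "real^'n::finite => complex"
 assumes k: "good k" and F: "L1 F" and t: "0 < t"
  and S: "{x. S x} \<in> sets borel"
 defines "F1 \<equiv> (\<lambda>x. if S x then F x else 0)" and "F2 \<equiv> (\<lambda>x. if S x then 0 else F x)"
 shows "L1 F1" "L1 F2" "conv k F x = conv k F1 x + conv k F2 x"
proof -
 have [measurable]: "F \<in> Bm" "Measurable.pred borel S" using F S by (auto simp: pred_def)
 show i1: "L1 F1" unfolding F1_def by (rule Bochner_Integration.integrable_bound[OF F]) auto
 show i2: "L1 F2" unfolding F2_def by (rule Bochner_Integration.integrable_bound[OF F]) auto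
 have "conv k F x = (LBINT y. k y * F1 (x - y) + k y * F2 (x - y))"
  unfolding conv_def F1_def F2_def by (intro Bochner_Integration.integral_cong) auto
 also have "\<dots> = conv k F1 x + conv k F2 x" unfolding conv_def
  by (rule Bochner_Integration.integral_add) (intro conv_integrable k i1 i2)+
 finally show "conv k F x = conv k F1 x + conv k F2 x" .
qed

text \<open>Cut at height \<open>t / (2 * B)\<close>: the low part has a convolution of size at most
  \<open>t / 2\<close>, so on the level set the high part exceeds \<open>t / 2\<close>, and
  Chebyshev's inequality with the quadratic estimate applies. Integrating over \<open>t\<close>
  first gives the power of \<open>norm (F x)\<close>.\<close>

lemma Lp_convolution_gt2:
 fixes k F :: "real^'n::finite => complex"
 assumes k: "good k" and B: "(NNI y. enorm (k y)) \<le> ennreal B" "0 < B"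
  and A: "\<And>h. norm (ifourier k h) \<le> A" "0 < A" and F: "L1 F" and p: "2 < p"
 shows "(NNI x. ennreal (norm (conv k F x) powr p)) \<le>
  ennreal (4 * p / (p - 2) * 2 powr (p - 2) * (A^2 * B powr (p - 2))) * (NNI x. ennreal (norm (F x) powr p))"
proof -
 let ?w = "\<lambda>t. ennreal (p * 4 * A^2) * (ennreal (t powr (p - 2 - 1)) * indicator {0<..} t)"
 let ?c = "4 * p / (p - 2) * 2 powr (p - 2) * (A^2 * B powr (p - 2))"
 let ?level = "\<lambda>t. \<integral>\<^sup>+x. (if t < norm (conv k F x) then 1 else 0) \<partial>lborel"
 let ?high = "\<lambda>t. \<integral>\<^sup>+x. ennreal ((norm (F x))^2) * (if t < 2 * B * norm (F x) then 1 else 0) \<partial>lborel"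
 have cg: "good (conv k F)" by (rule conv_good[OF k F])
 have [measurable]: "F \<in> Bm" "conv k F \<in> Bm" using F good_measurable[OF cg] by auto
 have lev: "?level t \<le>
   ennreal (4 * A^2 * t powr (-2)) * ?high t" if t: "0 < t" for t
 proof -
  define S where "S x \<longleftrightarrow> t < 2 * B * norm (F x)" for x
  have S: "{x. S x} \<in> sets borel" unfolding S_def by measurable
  have [measurable]: "Measurable.pred borel S" using S by (simp add: pred_def)
  define F1 where "F1 = (\<lambda>x. if S x then F x else 0)"
  define F2 where "F2 = (\<lambda>x. if S x then 0 else F x)"
  note sp = conv_level_sets[OF k F t S, folded F1_def F2_def]
  have [measurable]: "conv k F1 \<in> Bm" using good_measurable[OF conv_good(1)[OF k sp(1)]] .
  have "norm (conv k F2 x) \<le> t / 2" for x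
  proof -
   have "enorm (conv k F2 x) \<le> (NNI y. enorm (k y * F2 (x - y)))" unfolding conv_def by (rule norm_integral_le_nn)
   also have "\<dots> \<le> (NNI y. enorm (k y) * ennreal (t / (2 * B)))"
   proof (rule nn_integral_mono)
    fix y
    have "norm (F2 (x - y)) \<le> t / (2 * B)" using B t by (auto simp: F2_def S_def not_less field_simps)
    then have "norm (k y) * norm (F2 (x - y)) \<le> norm (k y) * (t / (2 * B))" by (intro mult_left_mono) auto
    then show "enorm (k y * F2 (x - y)) \<le> enorm (k y) * ennreal (t / (2 * B))"
     using B t by (simp add: norm_mult ennreal_mult[symmetric] ennreal_leI)
   qed
   also have "\<dots> = (NNI y. enorm (k y)) * ennreal (t / (2 * B))"
    using good_measurable[OF k] by (intro nn_integral_multc) auto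
   also have "\<dots> \<le> ennreal B * ennreal (t / (2 * B))" by (intro mult_right_mono B) simp
   also have "\<dots> = ennreal (t / 2)" using B t by (simp add: ennreal_mult[symmetric])
   finally show ?thesis using t by (simp add: ennreal_le_iff)
  qed
  note F2b = this
  have "?level t \<le> (NNI x. ennreal (4 * t powr (-2)) * ennreal ((norm (conv k F1 x))^2))"
  proof (rule nn_integral_mono)
   fix x
   show "(if t < norm (conv k F x) then 1 else 0) \<le> ennreal (4 * t powr (-2)) * ennreal ((norm (conv k F1 x))^2)"
   proof (cases "t < norm (conv k F x)")
    case True
    then have "t / 2 \<le> norm (conv k F1 x)" using sp(3)[of x] F2b[of x] norm_triangle_ineq[of "conv k F1 x" "conv k F2 x"] by simp
    then have "(t / 2)^2 \<le> (norm (conv k F1 x))^2" using t by (intro power_mono) auto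
    then have "4 * t powr (-2) * (t / 2)^2 \<le> 4 * t powr (-2) * (norm (conv k F1 x))^2" by (intro mult_left_mono) auto
    moreover have "4 * t powr (-2) * (t / 2)^2 = 1" using t by (simp add: powr_minus power_divide field_simps)
    ultimately show ?thesis using True by (simp add: ennreal_mult[symmetric])
   qed simp
  qed
  also have "\<dots> = ennreal (4 * t powr (-2)) * (NNI x. ennreal ((norm (conv k F1 x))^2))"
   by (rule nn_integral_cmult) measurable
  also have "\<dots> \<le> ennreal (4 * t powr (-2)) * (ennreal (A^2) * (NNI x. ennreal ((norm (F1 x))^2)))"
   by (intro mult_left_mono L2_convolution k A sp) simp
  also have "(NNI x. ennreal ((norm (F1 x))^2)) = ?high t"
   by (intro nn_integral_cong) (auto simp: F1_def S_def)
  also have "ennreal (4 * t powr (-2)) * (ennreal (A^2) * X) = ennreal (4 * A^2 * t powr (-2)) * X" for X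
   by (subst ennreal_mult_assoc) (simp_all add: mult_ac)
  finally show ?thesis .
 qed
 have "(NNI x. ennreal (norm (conv k F x) powr p)) =
  (NNI t. ennreal (p * t powr (p - 1)) * (indicator {0<..} t * ?level t))"
  using p by (intro layer_cake) auto
 also have "\<dots> \<le> (NNI t. ?w t * ?high t)"
 proof (rule nn_integral_mono)
  fix t :: real
  show "ennreal (p * t powr (p - 1)) * (indicator {0<..} t * ?level t) \<le>
   ?w t * ?high t"
  proof (cases "0 < t")
   case True
   have e: "t powr (p - 1) * t powr (-2) = t powr (p - 2 - 1)" by (simp add: powr_add[symmetric])
   have "ennreal (p * t powr (p - 1)) * ?level t \<le>
    ennreal (p * t powr (p - 1)) * (ennreal (4 * A^2 * t powr (-2)) * ?high t)"
    by (intro mult_left_mono lev True) simp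
   also have "\<dots> = ennreal (p * 4 * A^2 * (t powr (p - 1) * t powr (-2))) * ?high t"
    using p by (subst ennreal_mult_assoc) (simp_all add: mult_ac)
   finally show ?thesis using True p unfolding e by (simp add: ennreal_mult mult.assoc)
  qed simp
 qed
 also have "\<dots> = (NNI x. ennreal ((norm (F x))^2) * (NNI t. ?w t * (if t < 2 * B * norm (F x) then 1 else 0)))"
  by (rule nn_integral_swap_mult) measurable
 also have "\<dots> = (NNI x. ennreal (?c) * ennreal (norm (F x) powr p))"
 proof (intro nn_integral_cong)
  fix x
  define z where "z = 2 * B * norm (F x)"
  have z: "0 \<le> z" using B by (simp add: z_def)
  have "(NNI t. ?w t * (if t < z then 1 else 0))
   = (NNI t. ennreal (p * 4 * A^2) * (ennreal (t powr (p - 2 - 1)) * indicator {0<..<z} t))"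
   by (intro nn_integral_cong) (auto simp: indicator_def)
  also have "\<dots> = ennreal (p * 4 * A^2) * ennreal (z powr (p - 2) / (p - 2))"
   using p z powr_nn_integral_0[of "p - 2" z] by (subst nn_integral_cmult) auto
  finally have "ennreal ((norm (F x))^2) * (NNI t. ?w t * (if t < z then 1 else 0))
   = ennreal ((norm (F x))^2 * (p * 4 * A^2 * (z powr (p - 2) / (p - 2))))"
   using p by (simp only: ) (rule ennreal_mult3, auto)
  also have "(norm (F x))^2 * (p * 4 * A^2 * (z powr (p - 2) / (p - 2))) = (?c) * norm (F x) powr p"
  proof (cases "F x = 0")
   case False
   then have "norm (F x) powr p = (norm (F x))^2 * norm (F x) powr (p - 2)" by (simp add: powr_diff)
   then show ?thesis unfolding z_def using B by (simp add: powr_mult)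
  qed simp
  finally show "ennreal ((norm (F x))^2) * (NNI t. ?w t * (if t < 2 * B * norm (F x) then 1 else 0))
   = ennreal (?c) * ennreal (norm (F x) powr p)"
   unfolding z_def[symmetric] by (simp only: ennreal_mult''[OF powr_ge_zero])
 qed
 also have "\<dots> = ennreal (?c) * (NNI x. ennreal (norm (F x) powr p))"
  by (rule nn_integral_cmult) measurable
 finally show ?thesis .
qed

text \<open>Here the high part is estimated in the integral norm with \<open>B\<close> and the low
  part in the quadratic norm with \<open>A\<close>, both through Chebyshev's inequality at height
  \<open>t / 2\<close>.\<close>

lemma Lp_convolution_lt2:
 fixes k F :: "real^'n::finite => complex"
 assumes k: "good k" and B: "(NNI y. enorm (k y)) \<le> ennreal B" "0 < B"
  and A: "\<And>h. norm (ifourier k h) \<le> A" "0 < A" and F: "L1 F" and p: "1 < p" "p < 2"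
 shows "(NNI x. ennreal (norm (conv k F x) powr p)) \<le>
  ennreal ((2 * p / (p - 1) + 4 * p / (2 - p)) * (A powr (2 * (p - 1)) * B powr (2 - p))) * (NNI x. ennreal (norm (F x) powr p))"
proof -
 let ?w1 = "\<lambda>t. ennreal (2 * p * B) * (ennreal (t powr ((p - 1) - 1)) * indicator {0<..} t)"
 let ?w2 = "\<lambda>t. ennreal (4 * p * A^2) * (ennreal (t powr (- (2 - p) - 1)) * indicator {0<..} t)"
 let ?c = "A powr (2 * (p - 1)) * B powr (2 - p)"
 let ?level = "\<lambda>t. \<integral>\<^sup>+x. (if t < norm (conv k F x) then 1 else 0) \<partial>lborel"
 have cg: "good (conv k F)" by (rule conv_good[OF k F])
 have [measurable]: "F \<in> Bm" "conv k F \<in> Bm" "k \<in> Bm"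
  using F good_measurable[OF cg] good_measurable[OF k] by auto
 \<comment> \<open>Balances the two contributions, which are proportional to
   \<open>B * c powr (p - 1)\<close> and \<open>A^2 * c powr (p - 2)\<close>.\<close>
 define c where "c = A^2 / B"
 have c: "0 < c" using A B by (simp add: c_def)
 define I1 where "I1 t = (NNI x. enorm (F x) * (if t < c * norm (F x) then 1 else 0))" for t
 define I2 where "I2 t = (NNI x. ennreal ((norm (F x))^2) * (if t < c * norm (F x) then 0 else 1))" for t
 have I1m [measurable]: "I1 \<in> Bm" and I2m [measurable]: "I2 \<in> Bm"
  unfolding I1_def[abs_def] I2_def[abs_def] by measurable
 have lev: "?level t \<le>
   ennreal (2 * B * t powr (-1)) * I1 t + ennreal (4 * A^2 * t powr (-2)) * I2 t" if t: "0 < t" for t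
 proof -
  define S where "S x \<longleftrightarrow> t < c * norm (F x)" for x
  have S: "{x. S x} \<in> sets borel" unfolding S_def by measurable
  have [measurable]: "Measurable.pred borel S" using S by (simp add: pred_def)
  define F1 where "F1 = (\<lambda>x. if S x then F x else 0)"
  define F2 where "F2 = (\<lambda>x. if S x then 0 else F x)"
  note sp = conv_level_sets[OF k F t S, folded F1_def F2_def]
  have [measurable]: "conv k F1 \<in> Bm" "conv k F2 \<in> Bm" "F1 \<in> Bm"
   using good_measurable[OF conv_good(1)[OF k sp(1)]] good_measurable[OF conv_good(1)[OF k sp(2)]] sp(1) by auto
  have "?level t \<le>
   (NNI x. ennreal (2 * t powr (-1)) * enorm (conv k F1 x) + ennreal (4 * t powr (-2)) * ennreal ((norm (conv k F2 x))^2))"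
  proof (rule nn_integral_mono)
   fix x
   show "(if t < norm (conv k F x) then 1 else 0) \<le> ennreal (2 * t powr (-1)) * enorm (conv k F1 x) + ennreal (4 * t powr (-2)) * ennreal ((norm (conv k F2 x))^2)"
   proof (cases "t < norm (conv k F x)")
    case True
    have "1 \<le> 2 * t powr (-1) * norm (conv k F1 x) + 4 * t powr (-2) * (norm (conv k F2 x))^2"
    proof (cases "t / 2 \<le> norm (conv k F1 x)")
     case T: True
     then have "2 * t powr (-1) * (t / 2) \<le> 2 * t powr (-1) * norm (conv k F1 x)" by (intro mult_left_mono) auto
     moreover have "2 * t powr (-1) * (t / 2) = 1" using t by (simp add: powr_minus field_simps)
     moreover have "0 \<le> 4 * t powr (-2) * (norm (conv k F2 x))^2" by simp
     ultimately show ?thesis by linarith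
    next
     case f: False
     then have "t / 2 \<le> norm (conv k F2 x)" using True sp(3)[of x] norm_triangle_ineq[of "conv k F1 x" "conv k F2 x"] by simp
     then have "(t / 2)^2 \<le> (norm (conv k F2 x))^2" using t by (intro power_mono) auto
     then have "4 * t powr (-2) * (t / 2)^2 \<le> 4 * t powr (-2) * (norm (conv k F2 x))^2" by (intro mult_left_mono) auto
     moreover have "4 * t powr (-2) * (t / 2)^2 = 1" using t by (simp add: powr_minus power_divide field_simps)
     moreover have "0 \<le> 2 * t powr (-1) * norm (conv k F1 x)" by simp
     ultimately show ?thesis by linarith
    qed
    then have "ennreal 1 \<le> ennreal (2 * t powr (-1) * norm (conv k F1 x) + 4 * t powr (-2) * (norm (conv k F2 x))^2)" by (rule ennreal_leI)
    then show ?thesis using True by (simp add: ennreal_mult[symmetric] ennreal_plus[symmetric] del: ennreal_plus)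
   qed simp
  qed
  also have "\<dots> = ennreal (2 * t powr (-1)) * (NNI x. enorm (conv k F1 x)) + ennreal (4 * t powr (-2)) * (NNI x. ennreal ((norm (conv k F2 x))^2))"
   by (subst nn_integral_add) (auto simp: nn_integral_cmult)
  also have "\<dots> \<le> ennreal (2 * t powr (-1)) * (ennreal B * (NNI x. enorm (F1 x))) + ennreal (4 * t powr (-2)) * (ennreal (A^2) * (NNI x. ennreal ((norm (F2 x))^2)))"
   by (intro add_mono mult_left_mono L2_convolution k A sp order_trans[OF L1_convolution] mult_right_mono B) auto
  also have "(NNI x. enorm (F1 x)) = I1 t"
   unfolding I1_def by (intro nn_integral_cong) (auto simp: F1_def S_def)
  also have "(NNI x. ennreal ((norm (F2 x))^2)) = I2 t"
   unfolding I2_def by (intro nn_integral_cong) (auto simp: F2_def S_def)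
  also have "ennreal (4 * t powr (-2)) * (ennreal (A^2) * X) = ennreal (4 * A^2 * t powr (-2)) * X" for X
   by (subst ennreal_mult_assoc) (simp_all add: mult_ac)
  also have "ennreal (2 * t powr (-1)) * (ennreal B * X) = ennreal (2 * B * t powr (-1)) * X" for X
   using B by (subst ennreal_mult_assoc) (simp_all add: mult_ac)
  finally show ?thesis .
 qed
 have "(NNI x. ennreal (norm (conv k F x) powr p)) =
  (NNI t. ennreal (p * t powr (p - 1)) * (indicator {0<..} t * ?level t))"
  using p by (intro layer_cake) auto
 also have "\<dots> \<le> (NNI t. ?w1 t * I1 t
   + ?w2 t * I2 t)"
 proof (rule nn_integral_mono)
  fix t :: real
  show "ennreal (p * t powr (p - 1)) * (indicator {0<..} t * ?level t) \<le>
   ?w1 t * I1 t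
   + ?w2 t * I2 t"
  proof (cases "0 < t")
   case True
   have e: "t powr (p - 1) * t powr (-1) = t powr ((p - 1) - 1)" "t powr (p - 1) * t powr (-2) = t powr (- (2 - p) - 1)"
    by (simp_all only: powr_add[symmetric]) (simp_all add: algebra_simps)
   have "ennreal (p * t powr (p - 1)) * ?level t \<le>
    ennreal (p * t powr (p - 1)) * (ennreal (2 * B * t powr (-1)) * I1 t + ennreal (4 * A^2 * t powr (-2)) * I2 t)"
    by (intro mult_left_mono lev True) simp
   also have "\<dots> = ennreal (2 * p * B * (t powr (p - 1) * t powr (-1))) * I1 t + ennreal (4 * p * A^2 * (t powr (p - 1) * t powr (-2))) * I2 t"
    unfolding distrib_left using p B by (subst (1 2) ennreal_mult_assoc) (simp_all add: mult_ac)
   finally show ?thesis using True p B unfolding e by (simp add: ennreal_mult mult.assoc)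
  qed simp
 qed
 also have "\<dots> = (NNI t. ?w1 t * I1 t)
   + (NNI t. ?w2 t * I2 t)"
  by (rule nn_integral_add) measurable
 also have "(NNI t. ?w1 t * I1 t)
   = (NNI x. enorm (F x) * (NNI t. ?w1 t * (if t < c * norm (F x) then 1 else 0)))"
  unfolding I1_def by (rule nn_integral_swap_mult) measurable
 also have "\<dots> = (NNI x. ennreal (2 * p / (p - 1) * ?c) * ennreal (norm (F x) powr p))"
 proof (intro nn_integral_cong)
  fix x
  define z where "z = c * norm (F x)"
  have z: "0 \<le> z" using c by (simp add: z_def)
  have "(NNI t. ?w1 t * (if t < z then 1 else 0))
   = (NNI t. ennreal (2 * p * B) * (ennreal (t powr ((p - 1) - 1)) * indicator {0<..<z} t))"
   by (intro nn_integral_cong) (auto simp: indicator_def)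
  also have "\<dots> = ennreal (2 * p * B) * ennreal (z powr (p - 1) / (p - 1))"
   using p z powr_nn_integral_0[of "p - 1" z] by (subst nn_integral_cmult) auto
  finally have "enorm (F x) * (NNI t. ?w1 t * (if t < z then 1 else 0))
   = ennreal (norm (F x) * (2 * p * B * (z powr (p - 1) / (p - 1))))"
   using p B by (simp only: ) (rule ennreal_mult3, auto)
  also have "norm (F x) * (2 * p * B * (z powr (p - 1) / (p - 1))) = (2 * p / (p - 1) * ?c) * norm (F x) powr p"
  proof (cases "F x = 0")
   case False
   then have "norm (F x) powr p = norm (F x) * norm (F x) powr (p - 1)" by (simp add: powr_diff)
   moreover have "B * c powr (p - 1) = A powr (2 * (p - 1)) * B powr (2 - p)"
   proof -
    have "A powr (2 * (p - 1)) = (A powr 2) powr (p - 1)" by (simp only: powr_powr)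
    then have "A powr (2 * (p - 1)) = (A^2) powr (p - 1)" using A by simp
    moreover have "B powr (2 - p) = B / B powr (p - 1)" using B powr_diff[of B 1 "p - 1"] by (simp add: algebra_simps)
    ultimately show ?thesis using A B by (simp add: c_def powr_divide)
   qed
   ultimately show ?thesis unfolding z_def using B c by (simp add: powr_mult)
  qed simp
  finally show "enorm (F x) * (NNI t. ?w1 t * (if t < c * norm (F x) then 1 else 0))
   = ennreal (2 * p / (p - 1) * ?c) * ennreal (norm (F x) powr p)"
   unfolding z_def[symmetric] by (simp only: ennreal_mult''[OF powr_ge_zero])
 qed
 also have "\<dots> = ennreal (2 * p / (p - 1) * ?c) * (NNI x. ennreal (norm (F x) powr p))"
  by (rule nn_integral_cmult) measurable
 also have "(NNI t. ?w2 t * I2 t)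
   = (NNI x. ennreal ((norm (F x))^2) * (NNI t. ?w2 t * (if t < c * norm (F x) then 0 else 1)))"
  unfolding I2_def by (rule nn_integral_swap_mult) measurable
 also have "\<dots> = (NNI x. ennreal (4 * p / (2 - p) * ?c) * ennreal (norm (F x) powr p))"
 proof (intro nn_integral_cong)
  fix x
  show "ennreal ((norm (F x))^2) * (NNI t. ?w2 t * (if t < c * norm (F x) then 0 else 1))
   = ennreal (4 * p / (2 - p) * ?c) * ennreal (norm (F x) powr p)"
  proof (cases "F x = 0")
   case False
   define z where "z = c * norm (F x)"
   have z: "0 < z" using c False by (simp add: z_def)
   have "(NNI t. ?w2 t * (if t < z then 0 else 1))
    = (NNI t. ennreal (4 * p * A^2) * (ennreal (t powr (- (2 - p) - 1)) * indicator {z..} t))"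
    using z by (intro nn_integral_cong) (auto simp: indicator_def)
   also have "\<dots> = ennreal (4 * p * A^2) * ennreal (z powr (- (2 - p)) / (2 - p))"
    using p z powr_nn_integral_inf[of "2 - p" z] by (subst nn_integral_cmult) auto
   finally have "ennreal ((norm (F x))^2) * (NNI t. ?w2 t * (if t < z then 0 else 1))
    = ennreal ((norm (F x))^2 * (4 * p * A^2 * (z powr (- (2 - p)) / (2 - p))))"
    using p by (simp only: ) (rule ennreal_mult3, auto)
   also have "(norm (F x))^2 * (4 * p * A^2 * (z powr (- (2 - p)) / (2 - p))) = (4 * p / (2 - p) * ?c) * norm (F x) powr p"
   proof -
    have "norm (F x) powr p = (norm (F x))^2 * norm (F x) powr (- (2 - p))" using False by (simp add: powr_diff)
    moreover have "A^2 * c powr (- (2 - p)) = A powr (2 * (p - 1)) * B powr (2 - p)"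
    proof -
     have A2: "A^2 = A powr 2" using A by simp
     have "A^2 * c powr (- (2 - p)) = A powr 2 * (A powr (2 * (- (2 - p))) / B powr (- (2 - p)))"
      unfolding c_def A2 by (simp only: powr_divide powr_powr)
     also have "\<dots> = A powr (2 + 2 * (- (2 - p))) * B powr (2 - p)"
     proof -
      have "B powr (2 - p) = inverse (B powr (- (2 - p)))" by (simp only: powr_minus inverse_inverse_eq)
      then show ?thesis unfolding powr_add by (simp only: divide_inverse mult.assoc)
     qed
     finally show ?thesis by (simp add: algebra_simps)
    qed
    ultimately show ?thesis unfolding z_def using B c by (simp add: powr_mult)
   qed
   finally show ?thesis unfolding z_def[symmetric] by (simp only: ennreal_mult''[OF powr_ge_zero])
  qed simp
 qed
 also have "\<dots> = ennreal (4 * p / (2 - p) * ?c) * (NNI x. ennreal (norm (F x) powr p))"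
  by (rule nn_integral_cmult) measurable
 finally show ?thesis using p by (simp add: distrib_right ennreal_plus)
qed

text \<open>\<open>C\<close> depends on \<open>p\<close> and the dimension only, while the powers of
  \<open>A\<close> and \<open>B\<close> are explicit, so a kernel mass growing in frequency enters
  with exponent \<open>\<bar>p - 2\<bar>\<close>. The exponents 1 and 2 are treated separately
  because the interpolation constants blow up there.\<close>

lemma Lp_convolution:
 assumes p: "1 \<le> p"
 shows "\<exists>C\<ge>0. \<forall>(k :: real^'n::finite => complex) F A B. good k \<longrightarrow> (NNI y. enorm (k y)) \<le> ennreal B \<longrightarrow> 0 < B \<longrightarrow>
  (\<forall>w. norm (ifourier k w) \<le> A) \<longrightarrow> 0 < A \<longrightarrow> L1 F \<longrightarrow>
  (NNI x. ennreal (norm (conv k F x) powr p)) \<le>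
   ennreal (C * (A powr (p - \<bar>p - 2\<bar>) * B powr \<bar>p - 2\<bar>)) * (NNI x. ennreal (norm (F x) powr p))"
proof -
 consider "p = 1" | "1 < p" "p < 2" | "p = 2" | "2 < p" using p by linarith
 then show ?thesis
 proof cases
  case 1
  show ?thesis
  proof (intro exI[of _ 1] conjI allI impI)
   fix k F :: "real^'n => complex" and A B :: real
   assume k: "good k" and B: "(NNI y. enorm (k y)) \<le> ennreal B" "0 < B" and F: "L1 F"
    and A: "\<forall>w. norm (ifourier k w) \<le> A" "0 < A"
   have "(NNI x. enorm (conv k F x)) \<le> (NNI y. enorm (k y)) * (NNI x. enorm (F x))"
    using F good_measurable[OF k] by (intro L1_convolution) auto
   also have "\<dots> \<le> ennreal B * (NNI x. enorm (F x))" by (intro mult_right_mono B) simp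
   finally show "(NNI x. ennreal (norm (conv k F x) powr p)) \<le> ennreal (1 * (A powr (p - \<bar>p - 2\<bar>) * B powr \<bar>p - 2\<bar>)) * (NNI x. ennreal (norm (F x) powr p))"
    using 1 B A by simp
  qed simp
 next
  case 2
  have e: "p - \<bar>p - 2\<bar> = 2 * (p - 1)" "\<bar>p - 2\<bar> = 2 - p" using 2 by auto
  show ?thesis unfolding e(1) unfolding e(2)
  proof (intro exI[of _ "2 * p / (p - 1) + 4 * p / (2 - p)"] conjI allI impI)
   fix k F :: "real^'n => complex" and A B :: real
   assume h: "good k" "(NNI y. enorm (k y)) \<le> ennreal B" "0 < B" "\<forall>w. norm (ifourier k w) \<le> A" "0 < A" "L1 F"
   show "(NNI x. ennreal (norm (conv k F x) powr p)) \<le>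
    ennreal ((2 * p / (p - 1) + 4 * p / (2 - p)) * (A powr (2 * (p - 1)) * B powr (2 - p))) * (NNI x. ennreal (norm (F x) powr p))"
    by (rule Lp_convolution_lt2[OF h(1-3) _ h(5,6) 2]) (use h(4) in blast)
  qed (use 2 in auto)
 next
  case 3
  show ?thesis
  proof (intro exI[of _ 1] conjI allI impI)
   fix k F :: "real^'n => complex" and A B :: real
   assume k: "good k" and B: "0 < B" and F: "L1 F"
    and A: "\<forall>w. norm (ifourier k w) \<le> A" "0 < A"
   show "(NNI x. ennreal (norm (conv k F x) powr p)) \<le> ennreal (1 * (A powr (p - \<bar>p - 2\<bar>) * B powr \<bar>p - 2\<bar>)) * (NNI x. ennreal (norm (F x) powr p))"
    using L2_convolution[OF k _ F, of A] A B 3 by simp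
  qed simp
 next
  case 4
  have e: "p - \<bar>p - 2\<bar> = 2" "\<bar>p - 2\<bar> = p - 2" using 4 by auto
  have P2: "A powr 2 = A^2" if "0 < A" for A :: real using that by simp
  show ?thesis unfolding e(1) unfolding e(2)
  proof (intro exI[of _ "4 * p / (p - 2) * 2 powr (p - 2)"] conjI allI impI)
   fix k F :: "real^'n => complex" and A B :: real
   assume h: "good k" "(NNI y. enorm (k y)) \<le> ennreal B" "0 < B" "\<forall>w. norm (ifourier k w) \<le> A" "0 < A" "L1 F"
   show "(NNI x. ennreal (norm (conv k F x) powr p)) \<le>
    ennreal (4 * p / (p - 2) * 2 powr (p - 2) * (A powr 2 * B powr (p - 2))) * (NNI x. ennreal (norm (F x) powr p))"
    unfolding P2[OF h(5)] by (rule Lp_convolution_gt2[OF h(1-3) _ h(5,6) 4]) (use h(4) in blast)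
  qed (use 4 in auto)
 qed
qed

section \<open>Slowly varying phase-space functions\<close>

text \<open>Short-time Fourier transforms have this property by the reproducing formula;
 \<open>C L\<close> is the constant for the weight of order \<open>L\<close>.\<close>
definition slow :: "(real => real) => (real^'n::finite => real^'n => real) => bool" where
 "slow C A \<longleftrightarrow> case_prod A \<in> Bm2 \<and> (\<exists>B. \<forall>x \<xi>. 0 \<le> A x \<xi> \<and> A x \<xi> \<le> B) \<and>
  (\<forall>L x \<xi>. ennreal (A x \<xi>) \<le> ennreal (C L) * (NNI y. NNI z. ennreal (A y z * (wt (- L) (x - y) * wt (- L) (\<xi> - z)))))"

lemma slow_nonneg: "slow C A ==> 0 \<le> A x \<xi>"
 by (auto simp: slow_def)

lemma slow_measurable: "slow C A ==> case_prod A \<in> Bm2"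
 by (auto simp: slow_def)

lemma wt_pair_integral:
 fixes x \<xi> :: "real^'n::finite"
 assumes l: "real CARD('n) < l"
 shows "(\<integral>\<^sup>+z. ennreal (wt (- l) (x - fst z) * wt (- l) (\<xi> - snd z)) \<partial>(lborel \<Otimes>\<^sub>M lborel)) = ennreal (wint TYPE(real^'n) l * wint TYPE(real^'n) l)"
proof -
 have l': "real DIM(real^'n) < l" using l by simp
 have "(\<integral>\<^sup>+z. ennreal (wt (- l) (x - fst z) * wt (- l) (\<xi> - snd z)) \<partial>(lborel \<Otimes>\<^sub>M lborel)) =
  (NNI y. NNI w. ewt (- l) (x - y) * ewt (- l) (\<xi> - w))"
  by (subst lborel.nn_integral_fst[symmetric]) (auto simp: ennreal_mult)
 also have "\<dots> = ennreal (wint TYPE(real^'n) l * wint TYPE(real^'n) l)"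
  by (simp add: nn_integral_cmult nn_integral_multc wint_translate[OF l'] ennreal_mult)
 finally show ?thesis .
qed

text \<open>Jensen's inequality on the product space; the order is raised above the dimension so
  that the averaging weight has finite mass.\<close>

lemma slow_power_ge1:
 fixes C :: "real => real"
 assumes r: "1 \<le> r"
 shows "\<exists>D\<ge>0. \<forall>A :: real^'n::finite => real^'n => real. slow C A \<longrightarrow> (\<forall>x \<xi>. ennreal (A x \<xi> powr r) \<le>
  ennreal D * (NNI y. NNI v. ennreal (A y v powr r * (wt (- L) (x - y) * wt (- L) (\<xi> - v)))))"
proof -
 define l where "l = max L (real CARD('n) + 1)"
 have l: "real CARD('n) < l" "L \<le> l" by (auto simp: l_def)
 define m where "m = wint TYPE(real^'n) l * wint TYPE(real^'n) l"
 have m: "0 < m" unfolding m_def using wint_pos[where 'a="real^'n", of l] l by simp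
 define c where "c = max 0 (C l)"
 have c0: "0 \<le> c" "C l \<le> c" by (auto simp: c_def)
 show ?thesis
 proof (intro exI[of _ "c powr r * m powr (r - 1)"] conjI allI impI)
  fix A :: "real^'n => real^'n => real" and x \<xi>
  assume A: "slow C A"
  have [measurable]: "case_prod A \<in> Bm2" by (rule slow_measurable[OF A])
  have A0: "0 \<le> A y v" for y v by (rule slow_nonneg[OF A])
  have [measurable]: "(\<lambda>z. A (fst z) (snd z)) \<in> borel_measurable (lborel \<Otimes>\<^sub>M lborel)"
   using slow_measurable[OF A] by (simp add: case_prod_beta)
  define w where "w z = ennreal (wt (- l) (x - fst z) * wt (- l) (\<xi> - snd z))" for z :: "(real^'n) \<times> (real^'n)"
  define b where "b z = ennreal (A (fst z) (snd z))" for z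
  have [measurable]: "w \<in> borel_measurable (lborel \<Otimes>\<^sub>M lborel)" "b \<in> borel_measurable (lborel \<Otimes>\<^sub>M lborel)"
   unfolding w_def b_def by measurable
  have "ennreal (A x \<xi>) \<le> ennreal (C l) * (NNI y. NNI v. ennreal (A y v * (wt (- l) (x - y) * wt (- l) (\<xi> - v))))"
   using A unfolding slow_def by blast
  also have "\<dots> \<le> ennreal c * (NNI y. NNI v. ennreal (A y v * (wt (- l) (x - y) * wt (- l) (\<xi> - v))))"
   by (intro mult_right_mono ennreal_leI c0) simp
  also have "(NNI y. NNI v. ennreal (A y v * (wt (- l) (x - y) * wt (- l) (\<xi> - v)))) = (\<integral>\<^sup>+z. b z * w z \<partial>(lborel \<Otimes>\<^sub>M lborel))"
   by (subst lborel.nn_integral_fst[symmetric]) (auto simp: b_def w_def ennreal_mult A0)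
  finally have "enn_pow (ennreal (A x \<xi>)) r \<le> enn_pow (ennreal c * (\<integral>\<^sup>+z. b z * w z \<partial>(lborel \<Otimes>\<^sub>M lborel))) r"
   using r by (intro enn_pow_mono) auto
  also have "\<dots> = ennreal (c powr r) * enn_pow (\<integral>\<^sup>+z. b z * w z \<partial>(lborel \<Otimes>\<^sub>M lborel)) r"
   using r by (subst enn_pow_mult) (simp_all add: c0)
  also have "\<dots> \<le> ennreal (c powr r) * (ennreal (m powr (r - 1)) * (\<integral>\<^sup>+z. enn_pow (b z) r * w z \<partial>(lborel \<Otimes>\<^sub>M lborel)))"
   using r m l by (intro mult_left_mono enn_pow_Jensen) (auto simp: w_def wt_pair_integral m_def)
  also have "\<dots> = ennreal (c powr r * m powr (r - 1)) * (\<integral>\<^sup>+z. enn_pow (b z) r * w z \<partial>(lborel \<Otimes>\<^sub>M lborel))"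
   by (simp add: ennreal_mult mult.assoc)
  also have "(\<integral>\<^sup>+z. enn_pow (b z) r * w z \<partial>(lborel \<Otimes>\<^sub>M lborel)) = (NNI y. NNI v. ennreal (A y v powr r * (wt (- l) (x - y) * wt (- l) (\<xi> - v))))"
   by (subst lborel.nn_integral_fst[symmetric]) (auto simp: b_def w_def ennreal_mult A0)
  also have "\<dots> \<le> (NNI y. NNI v. ennreal (A y v powr r * (wt (- L) (x - y) * wt (- L) (\<xi> - v))))"
   using l by (intro nn_integral_mono ennreal_leI mult_left_mono mult_mono wt_mono) auto
  finally show "ennreal (A x \<xi> powr r) \<le> ennreal (c powr r * m powr (r - 1)) * (NNI y. NNI v. ennreal (A y v powr r * (wt (- L) (x - y) * wt (- L) (\<xi> - v))))"
   using A0 by (simp add: mult_left_mono)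
 qed simp
qed

lemma wt_neg_submult: "0 \<le> N ==> wt (- N) (x - y) * wt (- N) (y - u) \<le> wt (- N) (x - u)"
 using wt_add_le[of N "x - y" "y - u"] by (simp add: wt_uminus_exp field_simps)

text \<open>For \<open>r < 1\<close> the maximal function \<open>M = sup A v\<close> is finite, and \<open>A v \<le> M powr (1 - r) (A v) powr r\<close>
 turns the averaging inequality into \<open>M \<le> C M powr (1 - r) Q\<close>.\<close>
lemma slow_power_lt1:
 fixes C :: "real => real"
 assumes r: "0 < r" "r < 1" and L: "0 \<le> L"
 shows "\<exists>D\<ge>0. \<forall>A :: real^'n::finite => real^'n => real. slow C A \<longrightarrow> (\<forall>x \<xi>. ennreal (A x \<xi> powr r) \<le>
  ennreal D * (NNI y. NNI w. ennreal (A y w powr r * (wt (- L) (x - y) * wt (- L) (\<xi> - w)))))"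
proof -
 \<comment> \<open>The averaging inequality is used at order \<open>N\<close> because the
   \<open>r\<close>-th power of a weight of order \<open>N\<close> has the desired order
   \<open>L\<close>.\<close>
 define N where "N = L / r"
 have N: "0 \<le> N" "N * r = L" using r L by (auto simp: N_def)
 define c where "c = max 1 (C N)"
 have c: "0 < c" "C N \<le> c" by (auto simp: c_def)
 show ?thesis
 proof (intro exI[of _ c] conjI allI impI)
  fix A :: "real^'n => real^'n => real" and x \<xi>
  assume A: "slow C A"
  have [measurable]: "case_prod A \<in> Bm2" by (rule slow_measurable[OF A])
  have A0: "0 \<le> A y w" for y w by (rule slow_nonneg[OF A])
  obtain B where B: "\<And>y w. A y w \<le> B" using A unfolding slow_def by blast
  define V where "V y w = wt (- N) (x - y) * wt (- N) (\<xi> - w)" for y w :: "real^'n"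
  have V: "0 < V y w" "V y w \<le> 1" for y w
   using wt_le_1[of "- N" "x - y"] wt_le_1[of "- N" "\<xi> - w"] N by (auto simp: V_def intro!: mult_le_one)
  define M where "M = (SUP z. A (fst z) (snd z) * V (fst z) (snd z))"
  have bdd: "bdd_above (range (\<lambda>z. A (fst z) (snd z) * V (fst z) (snd z)))"
  proof (rule bdd_aboveI2)
   fix z :: "(real^'n) \<times> (real^'n)"
   have "A (fst z) (snd z) * V (fst z) (snd z) \<le> A (fst z) (snd z) * 1" using A0 V by (intro mult_left_mono) auto
   then show "A (fst z) (snd z) * V (fst z) (snd z) \<le> B" using B[of "fst z" "snd z"] by simp
  qed
  have MU: "A y w * V y w \<le> M" for y w
   using cSUP_upper[OF _ bdd, of "(y, w)"] by (simp add: M_def)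
  have AM: "A x \<xi> \<le> M" using MU[of x \<xi>] by (simp add: V_def)
  have M0: "0 \<le> M" using AM A0[of x \<xi>] by linarith
  define Q where "Q = (NNI y. NNI w. ennreal (A y w powr r * (wt (- L) (x - y) * wt (- L) (\<xi> - w))))"
  show "ennreal (A x \<xi> powr r) \<le> ennreal c * Q"
  proof (cases "Q = \<infinity> \<or> M = 0")
   case True
   then show ?thesis
   proof
    assume "Q = \<infinity>" then show ?thesis using c by (simp add: ennreal_mult_top)
   next
    assume "M = 0" then have "A x \<xi> = 0" using AM A0[of x \<xi>] by simp
    then show ?thesis by simp
   qed
  next
   case False
   then obtain q where q: "Q = ennreal q" "0 \<le> q" by (cases Q) auto
   have M1: "0 < M" using False M0 by simp
   have key: "A y' w' * V y' w' \<le> c * (M powr (1 - r) * q)" for y' w'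
   proof -
    have "ennreal (A y' w' * V y' w') = ennreal (V y' w') * ennreal (A y' w')"
     using V(1)[of y' w'] A0 by (simp add: ennreal_mult[symmetric] mult.commute)
    also have "\<dots> \<le> ennreal (V y' w') * (ennreal (C N) * (NNI u. NNI \<tau>. ennreal (A u \<tau> * (wt (- N) (y' - u) * wt (- N) (w' - \<tau>)))))"
     using A unfolding slow_def by (intro mult_left_mono) auto
    also have "\<dots> \<le> ennreal (V y' w') * (ennreal c * (NNI u. NNI \<tau>. ennreal (A u \<tau> * (wt (- N) (y' - u) * wt (- N) (w' - \<tau>)))))"
     using c by (intro mult_left_mono mult_right_mono ennreal_leI) auto
    also have "\<dots> = ennreal c * (NNI u. NNI \<tau>. ennreal (V y' w') * ennreal (A u \<tau> * (wt (- N) (y' - u) * wt (- N) (w' - \<tau>))))"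
     by (simp add: nn_integral_cmult mult_ac)
    also have "\<dots> \<le> ennreal c * (NNI u. NNI \<tau>. ennreal (M powr (1 - r)) * ennreal (A u \<tau> powr r * (wt (- L) (x - u) * wt (- L) (\<xi> - \<tau>))))"
    proof (intro mult_left_mono nn_integral_mono)
     fix u \<tau>
     have "V y' w' * (A u \<tau> * (wt (- N) (y' - u) * wt (- N) (w' - \<tau>))) =
       A u \<tau> * ((wt (- N) (x - y') * wt (- N) (y' - u)) * (wt (- N) (\<xi> - w') * wt (- N) (w' - \<tau>)))"
      by (simp add: V_def mult_ac)
     also have "\<dots> \<le> A u \<tau> * (wt (- N) (x - u) * wt (- N) (\<xi> - \<tau>))"
      using A0 N by (intro mult_left_mono mult_mono wt_neg_submult) auto
     also have "\<dots> = A u \<tau> * V u \<tau>" by (simp add: V_def)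
     also have "\<dots> \<le> M powr (1 - r) * (A u \<tau> powr r * (wt (- L) (x - u) * wt (- L) (\<xi> - \<tau>)))"
     proof (cases "A u \<tau> = 0")
      case F: False
      define t where "t = A u \<tau> * V u \<tau>"
      have t: "0 < t" using F A0[of u \<tau>] V(1)[of u \<tau>] by (simp add: t_def)
      have "t = t powr (1 - r) * t powr r" using t by (simp add: powr_add[symmetric])
      also have "\<dots> \<le> M powr (1 - r) * t powr r"
       using t MU[of u \<tau>] r by (intro mult_right_mono powr_mono2) (auto simp: t_def)
      also have "t powr r = A u \<tau> powr r * (wt (- L) (x - u) * wt (- L) (\<xi> - \<tau>))"
       using A0[of u \<tau>] N by (simp add: t_def V_def powr_mult wt_powr)
      finally show ?thesis by (simp add: t_def)
     qed simp
     finally show "ennreal (V y' w') * ennreal (A u \<tau> * (wt (- N) (y' - u) * wt (- N) (w' - \<tau>))) \<le>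
       ennreal (M powr (1 - r)) * ennreal (A u \<tau> powr r * (wt (- L) (x - u) * wt (- L) (\<xi> - \<tau>)))"
      using V(1)[of y' w'] A0[of u \<tau>] by (simp add: ennreal_mult[symmetric] ennreal_leI)
    qed simp
    also have "\<dots> = ennreal c * (ennreal (M powr (1 - r)) * Q)"
     by (simp add: nn_integral_cmult Q_def)
    also have "\<dots> = ennreal (c * (M powr (1 - r) * q))" using c q by (simp add: ennreal_mult)
    finally show ?thesis using c q by (simp add: ennreal_le_iff)
   qed
   \<comment> \<open>\<open>key\<close> holds at every point, so the supremum passes to the left
     side. As \<open>A\<close> is bounded, \<open>M\<close> is finite, and being positive it allows
     cancelling \<open>M powr (1 - r)\<close>.\<close>
   have "M \<le> c * (M powr (1 - r) * q)" unfolding M_def[symmetric]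
    using cSUP_least[of UNIV "\<lambda>z. A (fst z) (snd z) * V (fst z) (snd z)"] key by (simp add: M_def)
   moreover have "M = M powr r * M powr (1 - r)" using M1 by (simp add: powr_add[symmetric])
   ultimately have "M powr r * M powr (1 - r) \<le> (c * q) * M powr (1 - r)" by (simp add: mult_ac)
   then have "M powr r \<le> c * q" using M1 by simp
   moreover have "A x \<xi> powr r \<le> M powr r" using AM A0 r by (intro powr_mono2) auto
   ultimately have "A x \<xi> powr r \<le> c * q" by linarith
   then show ?thesis using q c by (simp add: ennreal_mult[symmetric] ennreal_leI)
  qed
 qed (use c in simp)
qed

lemma slow_power:
 fixes C :: "real => real"
 assumes r: "0 < r" and L: "0 \<le> L"
 shows "\<exists>D\<ge>0. \<forall>A :: real^'n::finite => real^'n => real. slow C A \<longrightarrow> (\<forall>x \<xi>. ennreal (A x \<xi> powr r) \<le>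
  ennreal D * (NNI y. NNI z. ennreal (A y z powr r * (wt (- L) (x - y) * wt (- L) (\<xi> - z)))))"
 using slow_power_ge1[of r C L] slow_power_lt1[of r L C] r L by (cases "1 \<le> r") auto

section \<open>Slices, their kernels and the reproducing formula\<close>

locale window =
 fixes \<Phi> :: "real^'n::finite => complex"
 assumes Phi: "\<And>K. dec K \<Phi>" and Phi_nz: "\<Phi> \<noteq> (\<lambda>_. 0)"
begin

lemma Phi_good: "good \<Phi>"
 by (rule dec_good[OF Phi[of "real CARD('n) + 1"]]) simp

lemma Phi_measurable [measurable]: "\<Phi> \<in> Bm"
 by (rule good_measurable[OF Phi_good])

definition energy :: real where "energy = (LBINT y. (norm (\<Phi> y))^2)"

lemma energy_pos: "0 < energy"
 unfolding energy_def by (rule L2_norm_pos[OF Phi_good Phi_nz])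

definition slice :: "(real^'n => complex) => real^'n => real^'n => complex" where
 "slice u \<xi> = ifourier (\<lambda>h. u h * cnj (\<Phi> (h - \<xi>)))"

definition kern :: "(real^'n => real) => real^'n => real^'n => real^'n => complex" where
 "kern m \<xi> \<xi>' = ifourier (\<lambda>h. cis (m h) * (\<Phi> (h - \<xi>') * cnj (\<Phi> (h - \<xi>))))"

lemma good_cnj: "good F ==> good (\<lambda>h. cnj (F h))"
 unfolding good_def bounded_iff by (auto intro: continuous_intros)

lemma kern_symbol_good:
 assumes "continuous_on UNIV m" shows "good (\<lambda>h. cis (m h) * (\<Phi> (h - \<xi>') * cnj (\<Phi> (h - \<xi>))))"
 by (intro good_unimodular[OF _ assms] good_mult good_shift[OF Phi_good] good_shift[OF good_cnj[OF Phi_good]])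

lemma integrable_mult_good:
 assumes u: "L1 u" and F: "good F" shows "L1 (\<lambda>h. u h * F h)"
proof -
 have [measurable]: "u \<in> Bm" "F \<in> Bm" using u good_measurable[OF F] by auto
 obtain B where B: "0 \<le> B" "\<And>x. norm (F x) \<le> B" using good_bound[OF F] by auto
 have "norm (u h * F h) \<le> B * norm (u h)" for h
  using mult_left_mono[OF B(2)[of h], of "norm (u h)"] by (simp add: norm_mult mult.commute)
 then have le: "norm (u h * F h) \<le> norm (B * norm (u h))" for h using B(1) by simp
 show ?thesis
 proof (rule Bochner_Integration.integrable_bound)
  show "L1 (\<lambda>h. B * norm (u h))" using u by (intro integrable_mult_right integrable_norm)
  show "AE h in lborel. norm (u h * F h) \<le> norm (B * norm (u h))" using le by (rule AE_I2)
 qed measurable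
qed

lemma slice_symbol_integrable: "L1 u ==> L1 (\<lambda>h. u h * cnj (\<Phi> (h - \<xi>)))"
 by (rule integrable_mult_good[OF _ good_shift[OF good_cnj[OF Phi_good]]])

lemma slice_measurable:
 assumes u: "u \<in> Bm"
 shows "(\<lambda>(x, \<xi>). slice u \<xi> x) \<in> Bm2"
 using u unfolding slice_def by measurable

lemma slice_continuous: "L1 u ==> continuous_on UNIV (slice u \<xi>)"
 unfolding slice_def by (rule ifourier_continuous[OF slice_symbol_integrable])

lemma kern_measurable:
 assumes m [measurable]: "m \<in> Bm"
 shows "(\<lambda>(\<xi>', y). kern m \<xi> \<xi>' y) \<in> Bm2"
 unfolding kern_def by measurable

text \<open>The identity \<open>energy = LBINT \<xi>'. (norm (\<Phi> (h - \<xi>')))^2\<close> is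
  inserted into the symbol. One factor of the square goes to the kernel, its conjugate to the slice
  of \<open>u\<close>, and the product of symbols becomes a convolution.\<close>

lemma slice_reproducing:
 assumes m: "continuous_on UNIV m" and u: "L1 u"
  and k: "\<And>\<xi>'. L1 (kern m \<xi> \<xi>')"
 shows "slice (modulated m u) \<xi> x = cor (1 / energy) * (LBINT \<xi>'. conv (kern m \<xi> \<xi>') (slice u \<xi>') x)"
proof -
 have [measurable]: "m \<in> Bm" "u \<in> Bm"
  using m u by (auto intro: borel_measurable_continuous_onI)
 define G where "G \<xi>' h = (cis (m h) * (\<Phi> (h - \<xi>') * cnj (\<Phi> (h - \<xi>)))) * (u h * cnj (\<Phi> (h - \<xi>')))" for \<xi>' h
 define U where "U h = cis (m h) * u h * cnj (\<Phi> (h - \<xi>))" for h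
 have Ui: "L1 U"
 proof -
  have "L1 (\<lambda>h. (u h * cnj (\<Phi> (h - \<xi>))) * cis (m h))"
   by (intro integrable_cis_mult slice_symbol_integrable u) measurable
  then show ?thesis by (simp add: U_def[abs_def] mult_ac)
 qed
 have Ge: "G \<xi>' h = U h * cor ((norm (\<Phi> (h - \<xi>')))^2)" for \<xi>' h
  unfolding G_def U_def complex_norm_square by (simp add: mult_ac)
 have Gn: "norm (G \<xi>' h) = norm (U h) * (norm (\<Phi> (h - \<xi>')))^2" for \<xi>' h
  unfolding Ge norm_mult norm_of_real by simp
 have [measurable]: "case_prod G \<in> borel_measurable (lborel \<Otimes>\<^sub>M lborel)" unfolding G_def by measurable
 have e2: "L1 (\<lambda>\<xi>'. (norm (\<Phi> (h - \<xi>')))^2)" "(LBINT \<xi>'. (norm (\<Phi> (h - \<xi>')))^2) = energy" for h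
  using integrable_lborel_translate(3)[OF L2_norm_pos(1)[OF Phi_good Phi_nz], of h]
   integral_lborel_translate(3)[of "\<lambda>y. (norm (\<Phi> y))^2" h] by (auto simp: energy_def)
 have int: "integrable (lborel \<Otimes>\<^sub>M lborel) (case_prod G)"
 proof -
  have "integrable (lborel \<Otimes>\<^sub>M lborel) (\<lambda>(h, \<xi>'). G \<xi>' h)"
  proof (rule lborel_pair.Fubini_integrable)
   show "(\<lambda>(h, \<xi>'). G \<xi>' h) \<in> borel_measurable (lborel \<Otimes>\<^sub>M lborel)" by measurable
   show "L1 (\<lambda>h. LBINT \<xi>'. norm (case (h, \<xi>') of (h, \<xi>') => G \<xi>' h))"
    unfolding split Gn integral_mult_right_zero e2 by (intro integrable_mult_left integrable_norm Ui)
   show "AE h in lborel. L1 (\<lambda>\<xi>'. case (h, \<xi>') of (h, \<xi>') => G \<xi>' h)"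
    unfolding Ge split using e2(1) by (intro AE_I2 integrable_mult_right integrable_of_real)
  qed
  then show ?thesis by (subst (asm) lborel_pair.integrable_product_swap_iff[symmetric]) (simp add: case_prod_beta)
 qed
 have UG: "(\<lambda>h. cor energy * U h) = (\<lambda>h. LBINT \<xi>'. G \<xi>' h)"
  unfolding Ge by (simp only: integral_mult_right_zero integral_complex_of_real e2 mult.commute)
 have "cor energy * slice (modulated m u) \<xi> x = ifourier (\<lambda>h. cor energy * U h) x"
  unfolding slice_def ifourier_cmult U_def ..
 also have "\<dots> = (LBINT \<xi>'. ifourier (G \<xi>') x)"
  unfolding UG by (rule ifourier_Fubini[OF sigma_finite_lborel int])
 also have "\<dots> = (LBINT \<xi>'. conv (kern m \<xi> \<xi>') (slice u \<xi>') x)"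
 proof (intro Bochner_Integration.integral_cong refl)
  fix \<xi>'
  show "ifourier (G \<xi>') x = conv (kern m \<xi> \<xi>') (slice u \<xi>') x"
   unfolding G_def conv_def kern_def slice_def
   by (rule ifourier_mult[OF kern_symbol_good[OF m] k[unfolded kern_def] slice_symbol_integrable[OF u]])
 qed
 finally show ?thesis using energy_pos by (simp add: field_simps)
qed

lemma norm_slice_le:
 assumes m: "continuous_on UNIV m" and u: "L1 u"
  and k: "\<And>\<xi>'. L1 (kern m \<xi> \<xi>')"
 shows "enorm (slice (modulated m u) \<xi> x) \<le> ennreal (1 / energy) * (NNI \<xi>'. enorm (conv (kern m \<xi> \<xi>') (slice u \<xi>') x))"
proof -
 have "enorm (slice (modulated m u) \<xi> x) = ennreal (1 / energy) * enorm (LBINT \<xi>'. conv (kern m \<xi> \<xi>') (slice u \<xi>') x)"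
  unfolding slice_reproducing[OF assms] norm_mult norm_of_real using energy_pos by (simp add: ennreal_mult[symmetric])
 then show ?thesis by (simp add: mult_left_mono norm_integral_le_nn)
qed

lemma kern0_bound:
 "\<exists>C\<ge>0. \<forall>\<xi> \<xi>' x. norm (kern (\<lambda>_. 0) \<xi> \<xi>' x) \<le> C * wt (- L) (\<xi>' - \<xi>) * wt (- L) x"
proof -
 define l where "l = max 0 L"
 obtain C where C: "0 \<le> C" "\<And>a b x. norm (ifourier (\<lambda>h. \<Phi> (h - a) * cnj (\<Phi> (h - b))) x) \<le> C * wt (- l) (a - b) * wt (- l) x"
  using dec_product_shift[OF Phi[of "2 * l + real CARD('n) + 1"] dec_cnj[OF Phi[of "2 * l + real CARD('n) + 1"]], of l] by (auto simp: l_def)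
 have "norm (kern (\<lambda>_. 0) \<xi> \<xi>' x) \<le> C * wt (- L) (\<xi>' - \<xi>) * wt (- L) x" for \<xi> \<xi>' x
 proof -
  have "C * wt (- l) (\<xi>' - \<xi>) * wt (- l) x \<le> C * wt (- L) (\<xi>' - \<xi>) * wt (- L) x"
   using C(1) by (intro mult_mono wt_mono) (auto simp: l_def)
  then show ?thesis using C(2)[of \<xi>' \<xi> x] by (simp add: kern_def)
 qed
 then show ?thesis using C(1) by blast
qed

text \<open>The reproducing formula with phase zero dominates a slice by an average of slices, and
  its kernel decays to every order in both variables. The constants depend on the window alone,
  whence one \<open>C\<close> for all \<open>u\<close>.\<close>

lemma slice_slow: "\<exists>C. \<forall>u. L1 u \<longrightarrow> slow C (\<lambda>x \<xi>. norm (slice u \<xi> x))"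
proof -
 have "\<forall>L. \<exists>C. 0 \<le> C \<and> (\<forall>\<xi> \<xi>' x. norm (kern (\<lambda>_. 0) \<xi> \<xi>' x) \<le> C * wt (- L) (\<xi>' - \<xi>) * wt (- L) x)"
  using kern0_bound by blast
 then obtain C0 where C0: "\<And>L. 0 \<le> C0 L" "\<And>L \<xi> \<xi>' x. norm (kern (\<lambda>_. 0) \<xi> \<xi>' x) \<le> C0 L * wt (- L) (\<xi>' - \<xi>) * wt (- L) x"
  unfolding choice_iff by blast
 have ki: "L1 (kern (\<lambda>_. 0) \<xi> \<xi>')" for \<xi> \<xi>'
 proof (rule integrable_wt_bound)
  show "kern (\<lambda>_. 0) \<xi> \<xi>' \<in> Bm" unfolding kern_def by measurable
  show "norm (kern (\<lambda>_. 0) \<xi> \<xi>' x) \<le> (C0 (real CARD('n) + 1) * wt (- (real CARD('n) + 1)) (\<xi>' - \<xi>)) * wt (- (real CARD('n) + 1)) x" for x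
   using C0(2) by blast
 qed simp
 show ?thesis
 proof (intro exI[of _ "\<lambda>L. (1 / energy) * C0 L"] allI impI)
  fix u :: "real^'n => complex" assume u: "L1 u"
  have [measurable]: "u \<in> Bm" using u by auto
  have sm [measurable]: "(\<lambda>(x, \<xi>). slice u \<xi> x) \<in> Bm2" by (rule slice_measurable) measurable
  have sm2 [measurable]: "(\<lambda>(x, \<xi>). slice u \<xi> x) \<in> borel_measurable (lborel \<Otimes>\<^sub>M lborel)" using sm by simp
  obtain B where B: "0 \<le> B" "\<And>x. norm (\<Phi> x) \<le> B" using good_bound[OF Phi_good] by auto
  show "slow (\<lambda>L. (1 / energy) * C0 L) (\<lambda>x \<xi>. norm (slice u \<xi> x))"
   unfolding slow_def
  proof (intro conjI allI)
   show "(\<lambda>(x, \<xi>). norm (slice u \<xi> x)) \<in> Bm2" by measurable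
   show "\<exists>B. \<forall>x \<xi>. 0 \<le> norm (slice u \<xi> x) \<and> norm (slice u \<xi> x) \<le> B"
   proof (intro exI[of _ "LBINT h. B * norm (u h)"] allI conjI)
    fix x \<xi>
    have "norm (slice u \<xi> x) \<le> (LBINT h. norm (u h * cnj (\<Phi> (h - \<xi>))))"
     unfolding slice_def by (rule norm_ifourier_le[OF slice_symbol_integrable[OF u]])
    also have "\<dots> \<le> (LBINT h. B * norm (u h))"
    proof (rule integral_mono)
     show "L1 (\<lambda>h. norm (u h * cnj (\<Phi> (h - \<xi>))))" by (rule integrable_norm[OF slice_symbol_integrable[OF u]])
     show "L1 (\<lambda>h. B * norm (u h))" using u by simp
     show "norm (u h * cnj (\<Phi> (h - \<xi>))) \<le> B * norm (u h)" for h
      using mult_left_mono[OF B(2)[of "h - \<xi>"], of "norm (u h)"] by (simp add: norm_mult mult.commute)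
    qed
    finally show "norm (slice u \<xi> x) \<le> (LBINT h. B * norm (u h))" .
   qed simp
   fix L x \<xi>
   have "enorm (slice u \<xi> x) \<le> ennreal (1 / energy) * (NNI \<xi>'. enorm (conv (kern (\<lambda>_. 0) \<xi> \<xi>') (slice u \<xi>') x))"
    using norm_slice_le[OF continuous_on_const u ki, of \<xi> x] by simp
   also have "\<dots> \<le> ennreal (1 / energy) * (NNI \<xi>'. ennreal (C0 L) * (NNI y. ennreal (norm (slice u \<xi>' y) * (wt (- L) (x - y) * wt (- L) (\<xi> - \<xi>')))))"
   proof (intro mult_left_mono nn_integral_mono)
    fix \<xi>'
    have "enorm (conv (kern (\<lambda>_. 0) \<xi> \<xi>') (slice u \<xi>') x) \<le> (NNI y. enorm (kern (\<lambda>_. 0) \<xi> \<xi>' y * slice u \<xi>' (x - y)))"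
     unfolding conv_def by (rule norm_integral_le_nn)
    also have "\<dots> \<le> (NNI y. ennreal (C0 L * (norm (slice u \<xi>' (x - y)) * (wt (- L) (x - (x - y)) * wt (- L) (\<xi> - \<xi>')))))"
    proof (intro nn_integral_mono ennreal_leI)
     fix y
     have "norm (kern (\<lambda>_. 0) \<xi> \<xi>' y) * norm (slice u \<xi>' (x - y)) \<le> (C0 L * wt (- L) (\<xi>' - \<xi>) * wt (- L) y) * norm (slice u \<xi>' (x - y))"
      by (intro mult_right_mono C0) simp
     then show "norm (kern (\<lambda>_. 0) \<xi> \<xi>' y * slice u \<xi>' (x - y)) \<le> C0 L * (norm (slice u \<xi>' (x - y)) * (wt (- L) (x - (x - y)) * wt (- L) (\<xi> - \<xi>')))"
      by (simp add: norm_mult mult_ac wt_commute[of _ \<xi>])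
    qed
    also have "\<dots> = (NNI y. ennreal (C0 L * (norm (slice u \<xi>' y) * (wt (- L) (x - y) * wt (- L) (\<xi> - \<xi>')))))"
     by (rule nn_integral_lborel_translate(3)[of "\<lambda>y. ennreal (C0 L * (norm (slice u \<xi>' y) * (wt (- L) (x - y) * wt (- L) (\<xi> - \<xi>'))))" x]) measurable
    also have "\<dots> = ennreal (C0 L) * (NNI y. ennreal (norm (slice u \<xi>' y) * (wt (- L) (x - y) * wt (- L) (\<xi> - \<xi>'))))"
     using C0(1)[of L] by (subst nn_integral_cmult[symmetric]) (auto simp: ennreal_mult)
    finally show "enorm (conv (kern (\<lambda>_. 0) \<xi> \<xi>') (slice u \<xi>') x) \<le> \<dots>" .
   qed simp
   also have "\<dots> = ennreal (1 / energy * C0 L) * (NNI \<xi>'. (NNI y. ennreal (norm (slice u \<xi>' y) * (wt (- L) (x - y) * wt (- L) (\<xi> - \<xi>')))))"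
    using C0(1)[of L] energy_pos by (subst nn_integral_cmult) (auto simp: ennreal_mult_assoc)
   also have "(NNI \<xi>'. (NNI y. ennreal (norm (slice u \<xi>' y) * (wt (- L) (x - y) * wt (- L) (\<xi> - \<xi>')))))
     = (NNI y. (NNI \<xi>'. ennreal (norm (slice u \<xi>' y) * (wt (- L) (x - y) * wt (- L) (\<xi> - \<xi>')))))"
    by (rule lborel_pair.Fubini') measurable
   finally show "enorm (slice u \<xi> x) \<le> ennreal ((1 / energy) * C0 L) * (NNI y. NNI z. ennreal (norm (slice u z y) * (wt (- L) (x - y) * wt (- L) (\<xi> - z))))" .
  qed
 qed
qed

lemma slice_integrable:
 assumes u: "\<And>K. dec K u" shows "L1 (slice u \<xi>)"
proof -
 define K where "K = 2 * (real CARD('n) + 1) + real CARD('n) + 1"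
 obtain C where "0 \<le> C" and C: "\<And>a b x. norm (ifourier (\<lambda>h. u (h - a) * cnj (\<Phi> (h - b))) x) \<le> C * wt (- (real CARD('n) + 1)) (a - b) * wt (- (real CARD('n) + 1)) x"
  by (rule dec_product_shift[OF u[of K] dec_cnj[OF Phi[of K]], where L="real CARD('n) + 1"]) (auto simp: K_def)
 have um [measurable]: "u \<in> Bm" using u dec_measurable by blast
 show ?thesis
 proof (rule integrable_wt_bound)
  show "slice u \<xi> \<in> Bm" unfolding slice_def by measurable
  show "norm (slice u \<xi> x) \<le> (C * wt (- (real CARD('n) + 1)) (0 - \<xi>)) * wt (- (real CARD('n) + 1)) x" for x
   using C[of 0 \<xi> x] by (simp add: slice_def)
 qed simp
qed

end

text \<open>The multiplication formula moves the transform from \<open>u\<close> to the window,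
  whose translation and modulation turn into a modulation and a translation.\<close>

lemma stft_ifourier:
 fixes \<phi> u :: "real^'n::finite => complex"
 assumes phi: "\<And>K. dec K \<phi>" and u: "L1 u"
 shows "stft \<phi> (ifourier u) x \<xi> = cis (- 2 * pi * (x \<bullet> \<xi>)) * ifourier (\<lambda>h. u h * cnj (fourier \<phi> (h - \<xi>))) x"
proof -
 have phg: "good \<phi>" by (rule dec_good[OF phi[of "real CARD('n) + 1"]]) simp
 have [measurable]: "\<phi> \<in> Bm" by (rule good_measurable[OF phg])
 define w where "w y = cnj (\<phi> (y - x)) * cis (- 2 * pi * (y \<bullet> \<xi>))" for y
 have wi: "L1 w" unfolding w_def
  by (intro integrable_cis_mult integrable_lborel_translate) (use goodD(2)[OF phg] in auto)
 have fw: "ifourier w h = cis (- 2 * pi * (x \<bullet> \<xi>)) * (cis (2 * pi * (x \<bullet> h)) * cnj (fourier \<phi> (h - \<xi>)))" for h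
 proof -
  have "w = (\<lambda>y. cis (2 * pi * (- \<xi> \<bullet> y)) * (\<lambda>y. cnj (\<phi> y)) (y + (- x)))" by (auto simp: w_def inner_commute mult.commute)
  then have "ifourier w h = ifourier (\<lambda>y. (\<lambda>y. cnj (\<phi> y)) (y + (- x))) (h + - \<xi>)" by (simp only: ifourier_modulate)
  also have "\<dots> = cis (- 2 * pi * ((h + - \<xi>) \<bullet> - x)) * ifourier (\<lambda>y. cnj (\<phi> y)) (h + - \<xi>)" by (rule ifourier_shift)
  also have "ifourier (\<lambda>y. cnj (\<phi> y)) (h + - \<xi>) = cnj (fourier \<phi> (h - \<xi>))" by (simp add: ifourier_cnj fourier_eq_ifourier)
  also have "cis (- 2 * pi * ((h + - \<xi>) \<bullet> - x)) = cis (- 2 * pi * (x \<bullet> \<xi>)) * cis (2 * pi * (x \<bullet> h))"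
   by (simp add: cis_mult inner_diff_left inner_commute algebra_simps)
  finally show ?thesis by (simp only: mult.assoc)
 qed
 have "stft \<phi> (ifourier u) x \<xi> = (LBINT y. ifourier u y * w y)"
  unfolding stft_def w_def by (simp add: mult.assoc)
 also have "\<dots> = (LBINT h. u h * ifourier w h)" by (rule Fourier_multiplication_formula[OF u wi])
 also have "\<dots> = (LBINT h. cis (- 2 * pi * (x \<bullet> \<xi>)) * (u h * cnj (fourier \<phi> (h - \<xi>)) * cis (2 * pi * (x \<bullet> h))))"
  unfolding fw by (intro Bochner_Integration.integral_cong refl) (simp only: mult_ac)
 also have "\<dots> = cis (- 2 * pi * (x \<bullet> \<xi>)) * ifourier (\<lambda>h. u h * cnj (fourier \<phi> (h - \<xi>))) x"
  unfolding ifourier_def by (simp only: integral_mult_right_zero)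
 finally show ?thesis .
qed

section \<open>Estimates for slices\<close>

text \<open>\<open>J\<close> is bounded by a multiple of \<open>(\<integral>J powr p) powr (1 / p)\<close>; interpolating with \<open>J powr p\<close> bounds \<open>\<integral>J\<close>.\<close>
lemma moderate_power:
 fixes J :: "'a::euclidean_space => ennreal"
 assumes [measurable]: "J \<in> Bm" and p: "0 < p" "p < 1" and R: "0 \<le> R"
  and mod: "\<And>y z. J y \<le> ewt R (y - z) * J z"
 shows "enn_pow (NNI y. J y) p \<le>
  ennreal (wint TYPE('a) (p * R + real DIM('a) + 1) powr (p - 1)) * (NNI y. enn_pow (J y) p)"
proof -
 define l where "l = p * R + real DIM('a) + 1"
 have l: "real DIM('a) < l" using mult_nonneg_nonneg[of p R] p R unfolding l_def by linarith
 define w where "w = wint TYPE('a) l"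
 have w: "0 < w" unfolding w_def by (rule wint_pos[OF l])
 define T where "T = (NNI y. enn_pow (J y) p)"
 \<comment> \<open>By \<open>mod\<close> the value at any \<open>z\<close> is at least
   \<open>wt (- R) (z - y)\<close> times the value at \<open>y\<close>; integrating the
   \<open>p\<close>-th powers bounds a single value by the whole integral \<open>T\<close>.\<close>
 have low: "enn_pow (J y) p * ennreal w \<le> T" for y
 proof -
  have "enn_pow (J y) p * ennreal w = (NNI z. enn_pow (J y) p * ewt (- l) (y - z))"
   by (subst nn_integral_cmult) (auto simp: wint_translate(2)[OF l] w_def)
  also have "\<dots> \<le> T" unfolding T_def
  proof (intro nn_integral_mono)
   fix z
   have "enn_pow (J y) p \<le> enn_pow (ewt R (y - z) * J z) p" using p by (intro enn_pow_mono mod) simp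
   also have "\<dots> = ewt (R * p) (y - z) * enn_pow (J z) p" using p by (simp add: enn_pow_mult wt_powr)
   finally have "enn_pow (J y) p * ewt (- l) (y - z) \<le> ewt (R * p) (y - z) * enn_pow (J z) p * ewt (- l) (y - z)"
    by (rule mult_right_mono) simp
   also have "\<dots> = ewt (R * p - l) (y - z) * enn_pow (J z) p"
    by (simp add: wt_mult ennreal_mult[symmetric] mult_ac ennreal_mult_assoc)
   also have "\<dots> \<le> 1 * enn_pow (J z) p"
    by (intro mult_right_mono) (auto simp: l_def mult.commute intro!: wt_le_1)
   finally show "enn_pow (J y) p * ewt (- l) (y - z) \<le> enn_pow (J z) p" by simp
  qed
  finally show ?thesis .
 qed
 define v where "v = T * ennreal (1 / w)"
 have Jv: "enn_pow (J y) p \<le> v" for y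
 proof -
  have "enn_pow (J y) p = enn_pow (J y) p * (ennreal w * ennreal (1 / w))" using w by (simp flip: ennreal_mult)
  also have "\<dots> \<le> v" unfolding v_def mult.assoc[symmetric] by (intro mult_right_mono low) simp
  finally show ?thesis .
 qed
 have "(NNI y. J y) \<le> (NNI y. enn_pow v ((1 - p) / p) * enn_pow (J y) p)"
 proof (intro nn_integral_mono)
  fix y
  have "J y = enn_pow (J y) (1 - p) * enn_pow (J y) p"
   by (cases "J y = 0") (auto simp: enn_pow_add_exp)
  also have "enn_pow (J y) (1 - p) = enn_pow (enn_pow (J y) p) ((1 - p) / p)" using p by (simp add: enn_pow_pow)
  also have "\<dots> \<le> enn_pow v ((1 - p) / p)" using p by (intro enn_pow_mono Jv) simp
  finally show "J y \<le> enn_pow v ((1 - p) / p) * enn_pow (J y) p" by (simp add: mult_right_mono)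
 qed
 also have "\<dots> = enn_pow v ((1 - p) / p) * T" by (simp add: nn_integral_cmult T_def)
 finally have "enn_pow (NNI y. J y) p \<le> enn_pow (enn_pow v ((1 - p) / p) * T) p"
  using p by (intro enn_pow_mono) auto
 also have "\<dots> = enn_pow v (1 - p) * enn_pow T p" using p by (simp add: enn_pow_mult enn_pow_pow)
 also have "\<dots> = ennreal (w powr (p - 1)) * (enn_pow T (1 - p) * enn_pow T p)"
  using p w by (simp add: v_def enn_pow_mult powr_divide powr_minus_divide[symmetric] mult_ac)
 also have "enn_pow T (1 - p) * enn_pow T p = T" by (cases "T = 0") (auto simp: enn_pow_add_exp)
 finally show ?thesis by (simp add: w_def l_def T_def)
qed

context window begin

definition pmass :: "real => (real^'n => complex) => real^'n => ennreal" where
 "pmass p u \<xi> = (NNI x. ennreal (norm (slice u \<xi> x) powr p))"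

lemma pmass_measurable:
 assumes "u \<in> Bm" shows "pmass p u \<in> Bm"
proof -
 have [measurable]: "(\<lambda>(x, \<xi>). slice u \<xi> x) \<in> Bm2" by (rule slice_measurable[OF assms])
 show ?thesis unfolding pmass_def[abs_def] by measurable
qed

end

section \<open>Kernels of the multiplier and the estimates for its slices\<close>

locale multiplier = phase \<mu> s a + window \<Phi>
 for \<mu> :: "real^'n::finite => real" and s a :: real and \<Phi> :: "real^'n => complex"
begin

lemma kern_NW:
 assumes M: "0 \<le> M"
 shows "\<exists>C>0. \<forall>\<xi> \<xi>'. (NNI y. ennreal (norm (kern \<mu> \<xi> \<xi>' y) * wt a (wt (- s) \<xi> *\<^sub>R (y + vel \<xi>))))
  \<le> ennreal (C * (wt (s * real CARD('n) / 2) \<xi> * wt (- M) (\<xi>' - \<xi>)))"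
proof -
 obtain C where C: "0 \<le> C" "\<And>\<xi> \<xi>'. NW (- vel \<xi>) (wt (- s) \<xi>) a (\<lambda>h. cis (\<mu> h) * (\<Phi> (h - \<xi>') * cnj (\<Phi> (h - \<xi>))))
   \<le> ennreal (C * (wt (s * real CARD('n) / 2) \<xi> * wt (- M) (\<xi>' - \<xi>)))"
  using NW_kernel[OF Phi dec_cnj[OF Phi] M] by auto
 show ?thesis
 proof (intro exI[of _ "C + 1"] conjI allI)
  fix \<xi> \<xi>'
  have "(NNI y. ennreal (norm (kern \<mu> \<xi> \<xi>' y) * wt a (wt (- s) \<xi> *\<^sub>R (y + vel \<xi>))))
    \<le> ennreal (C * (wt (s * real CARD('n) / 2) \<xi> * wt (- M) (\<xi>' - \<xi>)))"
   using C(2)[of \<xi> \<xi>'] by (simp add: NW_def kern_def)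
  also have "\<dots> \<le> ennreal ((C + 1) * (wt (s * real CARD('n) / 2) \<xi> * wt (- M) (\<xi>' - \<xi>)))"
   by (intro ennreal_leI mult_right_mono) auto
  finally show "(NNI y. ennreal (norm (kern \<mu> \<xi> \<xi>' y) * wt a (wt (- s) \<xi> *\<^sub>R (y + vel \<xi>))))
    \<le> ennreal ((C + 1) * (wt (s * real CARD('n) / 2) \<xi> * wt (- M) (\<xi>' - \<xi>)))" .
 qed (use C in simp)
qed

lemma kern_L1:
 assumes M: "0 \<le> M"
 shows "\<exists>C>0. \<forall>\<xi> \<xi>'. (NNI y. enorm (kern \<mu> \<xi> \<xi>' y))
  \<le> ennreal (C * (wt (s * real CARD('n) / 2) \<xi> * wt (- M) (\<xi>' - \<xi>)))"
proof -
 obtain C where C: "0 < C" "\<And>\<xi> \<xi>'. (NNI y. ennreal (norm (kern \<mu> \<xi> \<xi>' y) * wt a (wt (- s) \<xi> *\<^sub>R (y + vel \<xi>))))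
  \<le> ennreal (C * (wt (s * real CARD('n) / 2) \<xi> * wt (- M) (\<xi>' - \<xi>)))"
  using kern_NW[OF M] by auto
 have "(NNI y. enorm (kern \<mu> \<xi> \<xi>' y)) \<le> ennreal (C * (wt (s * real CARD('n) / 2) \<xi> * wt (- M) (\<xi>' - \<xi>)))" for \<xi> \<xi>'
 proof -
  have "norm (kern \<mu> \<xi> \<xi>' y) \<le> norm (kern \<mu> \<xi> \<xi>' y) * wt a (wt (- s) \<xi> *\<^sub>R (y + vel \<xi>))" for y
   using mult_left_mono[OF wt_ge_1[OF a], of "norm (kern \<mu> \<xi> \<xi>' y)" "wt (- s) \<xi> *\<^sub>R (y + vel \<xi>)"] by simp
  then show ?thesis by (intro order_trans[OF nn_integral_mono C(2)] ennreal_leI)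
 qed
 then show ?thesis using C(1) by blast
qed

lemma mu_measurable [measurable]: "\<mu> \<in> Bm"
 by (rule borel_measurable_continuous_onI[OF mu_cont(1)])

lemma kern_integrable: "L1 (kern \<mu> \<xi> \<xi>')"
proof -
 have [measurable]: "kern \<mu> \<xi> \<xi>' \<in> Bm" unfolding kern_def by measurable
 obtain C where "(NNI y. enorm (kern \<mu> \<xi> \<xi>' y)) \<le> ennreal (C * (wt (s * real CARD('n) / 2) \<xi> * wt (- 0) (\<xi>' - \<xi>)))"
  using kern_L1[of 0] by auto
 then show ?thesis by (intro integrableI_bounded) (auto simp: less_top[symmetric] top_unique)
qed

lemma kern_good: "good (kern \<mu> \<xi> \<xi>')"
proof -
 note g = goodD(2)[OF kern_symbol_good[OF mu_cont(1), of \<xi>' \<xi>]]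
 have "bounded (range (kern \<mu> \<xi> \<xi>'))" unfolding bounded_iff kern_def using norm_ifourier_le[OF g] by blast
 then show ?thesis using kern_integrable unfolding good_def by (simp add: kern_def ifourier_continuous[OF g])
qed

text \<open>Inversion returns the symbol, in which the phase is a unimodular factor. So this bound
  does not grow in \<xi>, in contrast to the mass of the kernel; it is the bound \<open>A\<close> of
  the interpolation.\<close>

lemma kern_symbol_bound:
 assumes M: "0 \<le> M"
 shows "\<exists>C>0. \<forall>\<xi> \<xi>' h. norm (ifourier (kern \<mu> \<xi> \<xi>') h) \<le> C * wt (- M) (\<xi>' - \<xi>)"
proof -
 obtain C where C: "0 \<le> C" "\<And>x. norm (\<Phi> x) \<le> C * wt (- M) x" using dec_bounds[OF Phi[of M]] by auto
 show ?thesis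
 proof (intro exI[of _ "C * C + 1"] conjI allI)
  fix \<xi> \<xi>' h
  have "ifourier (kern \<mu> \<xi> \<xi>') h = fourier (kern \<mu> \<xi> \<xi>') (- h)" by (simp add: fourier_eq_ifourier)
  also have "\<dots> = cis (\<mu> (- h)) * (\<Phi> (- h - \<xi>') * cnj (\<Phi> (- h - \<xi>)))"
   unfolding kern_def by (rule fourier_inversion[OF kern_symbol_good[OF mu_cont(1)] kern_integrable[unfolded kern_def]])
  finally have "norm (ifourier (kern \<mu> \<xi> \<xi>') h) = norm (\<Phi> (- h - \<xi>')) * norm (\<Phi> (- h - \<xi>))" by (simp add: norm_mult)
  also have "\<dots> \<le> (C * wt (- M) (- h - \<xi>')) * (C * wt (- M) (- h - \<xi>))" using C by (intro mult_mono) auto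
  also have "\<dots> = (C * C) * (wt (- M) (\<xi>' - - h) * wt (- M) (- h - \<xi>))" by (simp only: mult_ac wt_commute[of _ \<xi>'])
  also have "\<dots> \<le> (C * C) * wt (- M) (\<xi>' - \<xi>)" using C by (intro mult_left_mono wt_neg_submult M) auto
  also have "\<dots> \<le> (C * C + 1) * wt (- M) (\<xi>' - \<xi>)" by (intro mult_right_mono) auto
  finally show "norm (ifourier (kern \<mu> \<xi> \<xi>') h) \<le> (C * C + 1) * wt (- M) (\<xi>' - \<xi>)" .
 qed (use C in \<open>simp add: add_nonneg_pos\<close>)
qed

text \<open>Each convolution is interpolated between its bounded symbol and its mass of order
  \<open>s n / 2\<close>; Jensen's inequality then moves the \<open>p\<close>-th power inside the
  average over \<open>\<xi>'\<close>.\<close>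

lemma slice_estimate_ge1:
 assumes p: "1 \<le> p"
 shows "\<exists>C\<ge>0. \<forall>u. L1 u \<longrightarrow> (\<forall>\<xi>. L1 (slice u \<xi>)) \<longrightarrow>
  (\<forall>\<xi>. pmass p (modulated \<mu> u) \<xi> \<le>
   ennreal (C * wt (s * real CARD('n) * \<bar>1 / p - 1 / 2\<bar> * p) \<xi>) * (NNI \<xi>'. ewt (- M) (\<xi>' - \<xi>) * pmass p u \<xi>'))"
proof -
 define N where "N = max M (real CARD('n) + 1)"
 have N: "real CARD('n) < N" "M \<le> N" "0 \<le> N" by (auto simp: N_def)
 define m where "m = wint TYPE(real^'n) N"
 have m: "0 < m" unfolding m_def using N by (intro wint_pos) simp
 obtain CB where CB: "0 < CB" "\<And>\<xi> \<xi>'. (NNI y. enorm (kern \<mu> \<xi> \<xi>' y)) \<le> ennreal (CB * (wt (s * real CARD('n) / 2) \<xi> * wt (- N) (\<xi>' - \<xi>)))"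
  using kern_L1[OF N(3)] by auto
 obtain CA where CA: "0 < CA" "\<And>\<xi> \<xi>' h. norm (ifourier (kern \<mu> \<xi> \<xi>') h) \<le> CA * wt (- N) (\<xi>' - \<xi>)"
  using kern_symbol_bound[OF N(3)] by auto
 obtain C where C: "0 \<le> C" "\<And>k F A B. good k ==> (NNI y. enorm (k y)) \<le> ennreal B ==> 0 < B ==>
  (\<And>h. norm (ifourier k h) \<le> A) ==> 0 < A ==> L1 F ==>
  (NNI x. ennreal (norm (conv k F x) powr p)) \<le>
   ennreal (C * (A powr (p - \<bar>p - 2\<bar>) * B powr \<bar>p - 2\<bar>)) * (NNI (x::real^'n). ennreal (norm (F x) powr p))"
  using Lp_convolution[OF p, where 'n='n] by blast
 define D where "D = C * (CA powr (p - \<bar>p - 2\<bar>) * CB powr \<bar>p - 2\<bar>)"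
 have D: "0 \<le> D" using C(1) by (simp add: D_def)
 define \<sigma> where "\<sigma> = s * real CARD('n) * \<bar>1 / p - 1 / 2\<bar> * p"
 \<comment> \<open>This is
   \<open>p * \<bar>1 / p - 1 / 2\<bar> = \<bar>p - 2\<bar> / 2\<close>.\<close>
 have sig: "s * real CARD('n) / 2 * \<bar>p - 2\<bar> = \<sigma>"
  using p by (simp add: \<sigma>_def abs_if field_simps split: if_splits)
 define E where "E = (1 / energy) powr p * m powr (p - 1)"
 have E: "0 \<le> E" by (simp add: E_def)
 show ?thesis
 proof (intro exI[of _ "E * D"] conjI allI impI)
  fix u :: "real^'n => complex" and \<xi> assume u: "L1 u" and gi: "\<forall>\<xi>. L1 (slice u \<xi>)"
  have [measurable]: "u \<in> Bm" using u by auto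
  have pm [measurable]: "pmass p u \<in> Bm" by (rule pmass_measurable) measurable
  have [measurable]: "(\<lambda>(x, \<xi>). slice u \<xi> x) \<in> Bm2" by (rule slice_measurable) measurable
  have [measurable]: "(\<lambda>(\<xi>', y). kern \<mu> \<xi> \<xi>' y) \<in> Bm2" by (rule kern_measurable) measurable
  define c where "c \<xi>' x = conv (kern \<mu> \<xi> \<xi>') (slice u \<xi>') x" for \<xi>' x
  have [measurable]: "(\<lambda>(\<xi>', x). c \<xi>' x) \<in> Bm2" unfolding c_def conv_def by measurable
  have cm2 [measurable]: "(\<lambda>(\<xi>', x). c \<xi>' x) \<in> borel_measurable (lborel \<Otimes>\<^sub>M lborel)" by measurable
  have conv: "(NNI x. ennreal (norm (c \<xi>' x) powr p)) \<le> ennreal (D * (wt \<sigma> \<xi> * wt (- N * p) (\<xi>' - \<xi>))) * pmass p u \<xi>'" for \<xi>'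
  proof -
   have "(NNI x. ennreal (norm (c \<xi>' x) powr p)) \<le> ennreal (C * ((CA * wt (- N) (\<xi>' - \<xi>)) powr (p - \<bar>p - 2\<bar>) *
     (CB * (wt (s * real CARD('n) / 2) \<xi> * wt (- N) (\<xi>' - \<xi>))) powr \<bar>p - 2\<bar>)) * pmass p u \<xi>'"
    unfolding pmass_def c_def using CA CB(1) gi by (intro C(2) kern_good CB(2)) auto
   also have "C * ((CA * wt (- N) (\<xi>' - \<xi>)) powr (p - \<bar>p - 2\<bar>) *
     (CB * (wt (s * real CARD('n) / 2) \<xi> * wt (- N) (\<xi>' - \<xi>))) powr \<bar>p - 2\<bar>) =
     D * (wt \<sigma> \<xi> * (wt (- N * (p - \<bar>p - 2\<bar>)) (\<xi>' - \<xi>) * wt (- N * \<bar>p - 2\<bar>) (\<xi>' - \<xi>)))"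
    unfolding D_def sig[symmetric] using CA CB by (simp add: powr_mult wt_powr mult_ac)
   also have "wt (- N * (p - \<bar>p - 2\<bar>)) (\<xi>' - \<xi>) * wt (- N * \<bar>p - 2\<bar>) (\<xi>' - \<xi>) = wt (- N * p) (\<xi>' - \<xi>)"
    unfolding wt_mult by (simp add: algebra_simps)
   finally show ?thesis .
  qed
  have ptw: "ennreal (norm (slice (modulated \<mu> u) \<xi> x) powr p) \<le>
    ennreal E * (NNI \<xi>'. ewt (N * p - N) (\<xi>' - \<xi>) * ennreal (norm (c \<xi>' x) powr p))" for x
  proof -
   have "enorm (slice (modulated \<mu> u) \<xi> x) \<le> ennreal (1 / energy) * (NNI \<xi>'. enorm (c \<xi>' x))"
    unfolding c_def by (rule norm_slice_le[OF mu_cont(1) u kern_integrable])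
   \<comment> \<open>A finite measure \<open>wt (- N)\<close> is split off for Jensen's inequality.
     It costs the order \<open>N * p - N\<close>, and the decay of order \<open>N * p\<close> from
     the convolutions leaves exactly \<open>- N\<close>.\<close>
   also have "(NNI \<xi>'. enorm (c \<xi>' x)) = (NNI \<xi>'. ennreal (norm (c \<xi>' x) * wt N (\<xi>' - \<xi>)) * ewt (- N) (\<xi>' - \<xi>))"
    by (intro nn_integral_cong) (simp add: ennreal_mult[symmetric] wt_mult mult.assoc)
   finally have "enn_pow (enorm (slice (modulated \<mu> u) \<xi> x)) p \<le>
    enn_pow (ennreal (1 / energy) * (NNI \<xi>'. ennreal (norm (c \<xi>' x) * wt N (\<xi>' - \<xi>)) * ewt (- N) (\<xi>' - \<xi>))) p"
    using p by (intro enn_pow_mono) auto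
   also have "\<dots> = ennreal ((1 / energy) powr p) * enn_pow (NNI \<xi>'. ennreal (norm (c \<xi>' x) * wt N (\<xi>' - \<xi>)) * ewt (- N) (\<xi>' - \<xi>)) p"
    using p energy_pos by (simp add: enn_pow_mult)
   also have "\<dots> \<le> ennreal ((1 / energy) powr p) * (ennreal (m powr (p - 1)) *
     (NNI \<xi>'. enn_pow (ennreal (norm (c \<xi>' x) * wt N (\<xi>' - \<xi>))) p * ewt (- N) (\<xi>' - \<xi>)))"
    using p m N by (intro mult_left_mono enn_pow_Jensen) (auto simp: wint_translate m_def)
   also have "\<dots> = ennreal E * (NNI \<xi>'. ewt (N * p - N) (\<xi>' - \<xi>) * ennreal (norm (c \<xi>' x) powr p))"
   proof -
    have "enn_pow (ennreal (norm (c \<xi>' x) * wt N (\<xi>' - \<xi>))) p * ewt (- N) (\<xi>' - \<xi>) = ennreal (norm (c \<xi>' x) powr p * (wt (N * p) (\<xi>' - \<xi>) * wt (- N) (\<xi>' - \<xi>)))" for \<xi>'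
     by (simp add: powr_mult wt_powr ennreal_mult[symmetric] mult_ac)
    then show ?thesis unfolding wt_mult by (simp add: ennreal_mult_assoc E_def ennreal_mult mult.commute)
   qed
   finally show ?thesis by simp
  qed
  have "pmass p (modulated \<mu> u) \<xi> \<le> (NNI x. ennreal E * (NNI \<xi>'. ewt (N * p - N) (\<xi>' - \<xi>) * ennreal (norm (c \<xi>' x) powr p)))"
   unfolding pmass_def by (intro nn_integral_mono ptw)
  also have "\<dots> = ennreal E * (NNI x. (NNI \<xi>'. ewt (N * p - N) (\<xi>' - \<xi>) * ennreal (norm (c \<xi>' x) powr p)))"
   by (rule nn_integral_cmult) measurable
  also have "(NNI x. (NNI \<xi>'. ewt (N * p - N) (\<xi>' - \<xi>) * ennreal (norm (c \<xi>' x) powr p)))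
    = (NNI \<xi>'. (NNI x. ewt (N * p - N) (\<xi>' - \<xi>) * ennreal (norm (c \<xi>' x) powr p)))"
   by (rule lborel_pair.Fubini') measurable
  also have "\<dots> = (NNI \<xi>'. ewt (N * p - N) (\<xi>' - \<xi>) * (NNI x. ennreal (norm (c \<xi>' x) powr p)))"
   by (intro nn_integral_cong nn_integral_cmult) measurable
  also have "ennreal E * \<dots> \<le> ennreal E * (NNI \<xi>'. ennreal (D * wt \<sigma> \<xi>) * (ewt (- M) (\<xi>' - \<xi>) * pmass p u \<xi>'))"
  proof (intro mult_left_mono nn_integral_mono)
   fix \<xi>'
   have "ewt (N * p - N) (\<xi>' - \<xi>) * (NNI x. ennreal (norm (c \<xi>' x) powr p)) \<le>
    ewt (N * p - N) (\<xi>' - \<xi>) * (ennreal (D * (wt \<sigma> \<xi> * wt (- N * p) (\<xi>' - \<xi>))) * pmass p u \<xi>')"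
    by (intro mult_left_mono conv) simp
   also have "\<dots> = ennreal (wt (N * p - N) (\<xi>' - \<xi>) * (D * (wt \<sigma> \<xi> * wt (- N * p) (\<xi>' - \<xi>)))) * pmass p u \<xi>'"
    using D by (intro ennreal_mult_assoc) auto
   also have "wt (N * p - N) (\<xi>' - \<xi>) * (D * (wt \<sigma> \<xi> * wt (- N * p) (\<xi>' - \<xi>))) = (D * wt \<sigma> \<xi>) * (wt (N * p - N) (\<xi>' - \<xi>) * wt (- N * p) (\<xi>' - \<xi>))"
    by (simp only: mult_ac)
   also have "wt (N * p - N) (\<xi>' - \<xi>) * wt (- N * p) (\<xi>' - \<xi>) = wt (- N) (\<xi>' - \<xi>)" unfolding wt_mult by simp
   also have "ennreal ((D * wt \<sigma> \<xi>) * wt (- N) (\<xi>' - \<xi>)) * pmass p u \<xi>' \<le> ennreal ((D * wt \<sigma> \<xi>) * wt (- M) (\<xi>' - \<xi>)) * pmass p u \<xi>'"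
    using D N by (intro mult_right_mono ennreal_leI mult_left_mono wt_mono) auto
   also have "\<dots> = ennreal (D * wt \<sigma> \<xi>) * (ewt (- M) (\<xi>' - \<xi>) * pmass p u \<xi>')"
    using D by (intro ennreal_mult_assoc[symmetric]) auto
   finally show "ewt (N * p - N) (\<xi>' - \<xi>) * (NNI x. ennreal (norm (c \<xi>' x) powr p)) \<le> \<dots>" .
  qed simp
  also have "\<dots> = ennreal E * (ennreal (D * wt \<sigma> \<xi>) * (NNI \<xi>'. ewt (- M) (\<xi>' - \<xi>) * pmass p u \<xi>'))"
   by (subst nn_integral_cmult) auto
  also have "\<dots> = ennreal (E * (D * wt \<sigma> \<xi>)) * (NNI \<xi>'. ewt (- M) (\<xi>' - \<xi>) * pmass p u \<xi>')"
   using D E by (intro ennreal_mult_assoc) auto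
  finally show "pmass p (modulated \<mu> u) \<xi> \<le>
   ennreal (E * D * wt (s * real CARD('n) * \<bar>1 / p - 1 / 2\<bar> * p) \<xi>) * (NNI \<xi>'. ewt (- M) (\<xi>' - \<xi>) * pmass p u \<xi>')"
   by (simp only: \<sigma>_def mult.assoc)
 qed (use D E in simp)
qed

text \<open>Here \<open>G\<close> is the majorant of the input slices given by \<open>slow_power\<close>; after averaging the kernel
 to \<open>k\<close>, the integrand \<open>G (x - y) k y\<close> varies slowly enough for \<open>moderate_power\<close>.\<close>
lemma slice_estimate_lt1:
 assumes p: "0 < p" "p < 1" and ap: "real CARD('n) * (1 / p - 1) < a"
 shows "\<exists>C\<ge>0. \<forall>u. L1 u \<longrightarrow>
  (\<forall>\<xi>. pmass p (modulated \<mu> u) \<xi> \<le>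
   ennreal (C * wt (s * real CARD('n) * \<bar>1 / p - 1 / 2\<bar> * p) \<xi>) * (NNI \<xi>'. ewt (- M) (\<xi>' - \<xi>) * pmass p u \<xi>'))"
proof -
 define n where "n = real CARD('n)"
 have n: "0 \<le> n" "real DIM(real^'n) = n" by (auto simp: n_def)
 define L where "L = max M (n + 1)"
 have L: "n < L" "M \<le> L" "0 \<le> L" using n by (auto simp: L_def)
 \<comment> \<open>The majorant is built for \<open>p\<close>-th powers with weights of order
   \<open>L\<close>; taking the root of order \<open>p\<close> turns \<open>L\<close> into
   \<open>P\<close>.\<close>
 define P where "P = L / p"
 have P: "0 \<le> P" "P * p = L" using L p by (auto simp: P_def)
 define N where "N = a + n + 1"
 have N: "n < N" "0 \<le> N" using a n by (auto simp: N_def)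
 \<comment> \<open>Chosen so that a weight of order \<open>lam\<close> on the \<open>p\<close>-th
   power of the kernel amounts to the order \<open>a\<close> on the kernel itself after Hoelder's
   inequality; the hypothesis on \<open>a\<close> says that \<open>wt (- lam)\<close> is
   integrable.\<close>
 define lam where "lam = a * p / (1 - p)"
 have lamn: "n < lam" "lam * (1 / p - 1) = a"
  using p ap by (auto simp: lam_def n_def field_simps)
 have lam1: "lam / p = lam + a" using lamn(2) by (simp add: algebra_simps)
 define wl where "wl = wint TYPE(real^'n) lam"
 have wl: "0 < wl" unfolding wl_def using lamn n by (intro wint_pos) simp
 define w1 where "w1 = wint TYPE(real^'n) (n + 1)"
 have w1: "0 \<le> w1" by (simp add: w1_def)
 define wN where "wN = wint TYPE(real^'n) (N + P)"
 have wN: "0 < wN" unfolding wN_def using N P n by (intro wint_pos) simp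
 define wL where "wL = wint TYPE(real^'n) L"
 have wL: "0 \<le> wL" by (simp add: wL_def)
 obtain CK where CK: "0 < CK" "\<And>\<xi> \<xi>'. (NNI y. ennreal (norm (kern \<mu> \<xi> \<xi>' y) * wt a (wt (- s) \<xi> *\<^sub>R (y + vel \<xi>))))
  \<le> ennreal (CK * (wt (s * real CARD('n) / 2) \<xi> * wt (- (P + n + 1)) (\<xi>' - \<xi>)))"
  using kern_NW[of "P + n + 1"] P n by auto
 obtain Cs where Cs: "\<And>u. L1 u ==> slow Cs (\<lambda>x \<xi>. norm (slice u \<xi> x))" using slice_slow by auto
 obtain D where D: "0 \<le> D" "\<And>A :: real^'n => real^'n => real. slow Cs A ==> (\<forall>x \<xi>. ennreal (A x \<xi> powr p) \<le>
  ennreal D * (NNI y. NNI w. ennreal (A y w powr p * (wt (- L) (x - y) * wt (- L) (\<xi> - w)))))"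
  using slow_power[OF p(1) L(3), of Cs] by blast
 define cJ where "cJ = wint TYPE(real^'n) (p * (P + N) + real DIM(real^'n) + 1) powr (p - 1)"
 define E where "E = (1 / energy * (1 / wN)) powr p * cJ"
 define F where "F = wl powr (1 - p) * (w1 * (CK * w1)) powr p"
 have EF: "0 \<le> E" "0 \<le> F" "0 \<le> cJ" by (auto simp: E_def F_def cJ_def)
 \<comment> \<open>Below, \<sigma> is split into \<open>s * n * (1 - p)\<close>, the volume of the
   region carrying the kernel in Hoelder's inequality, and \<open>s * n / 2 * p\<close>, the mass of
   the kernel.\<close>
 define \<sigma> where "\<sigma> = s * real CARD('n) * \<bar>1 / p - 1 / 2\<bar> * p"
 have "2 \<le> 2 / p" using p by (simp add: field_simps)
 then have sig: "\<sigma> = s * n * (1 - p) + s * n / 2 * p"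
  using p by (simp add: \<sigma>_def n_def abs_if field_simps split: if_splits)
 show ?thesis
 proof (intro exI[of _ "E * (F * (D * wL))"] conjI allI impI)
  fix u :: "real^'n => complex" and \<xi> assume u: "L1 u"
  have [measurable]: "u \<in> Bm" using u by auto
  have pm [measurable]: "pmass p u \<in> Bm" by (rule pmass_measurable) measurable
  have [measurable]: "(\<lambda>(x, \<xi>). slice u \<xi> x) \<in> Bm2" by (rule slice_measurable) measurable
  have [measurable]: "(\<lambda>(\<xi>', y). kern \<mu> \<xi> \<xi>' y) \<in> Bm2" by (rule kern_measurable) measurable
  define Q where "Q x = (NNI y. ewt (- L) (x - y) * (NNI w. ewt (- L) (\<xi> - w) * ennreal (norm (slice u w y) powr p)))" for x
  have [measurable]: "Q \<in> Bm" unfolding Q_def[abs_def] by measurable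
  define G where "G x = enn_pow (ennreal D * Q x) (1 / p)" for x
  have [measurable]: "G \<in> Bm" unfolding G_def[abs_def] by measurable
  have Gp: "enn_pow (G x) p = ennreal D * Q x" for x using p by (simp add: G_def enn_pow_pow)
  have AQ: "enorm (slice u \<xi>' x) \<le> ewt P (\<xi>' - \<xi>) * G x" for x \<xi>'
  proof -
   have "ennreal (norm (slice u \<xi>' x) powr p) \<le> ennreal D * (NNI y. NNI w. ennreal (norm (slice u w y) powr p * (wt (- L) (x - y) * wt (- L) (\<xi>' - w))))"
    using D(2)[OF Cs[OF u]] by blast
   also have "\<dots> \<le> ennreal D * (NNI y. NNI w. ewt L (\<xi>' - \<xi>) * (ewt (- L) (x - y) * (ewt (- L) (\<xi> - w) * ennreal (norm (slice u w y) powr p))))"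
   proof (intro mult_left_mono nn_integral_mono)
    fix y w
    have "wt (- L) (\<xi>' - w) \<le> wt (- L) (\<xi> - w) * wt L (\<xi>' - \<xi>)"
     using wt_peetre[of "- L" "\<xi>' - w" "\<xi> - w"] L by simp
    then have "norm (slice u w y) powr p * (wt (- L) (x - y) * wt (- L) (\<xi>' - w)) \<le> norm (slice u w y) powr p * (wt (- L) (x - y) * (wt (- L) (\<xi> - w) * wt L (\<xi>' - \<xi>)))"
     by (intro mult_left_mono) auto
    then show "ennreal (norm (slice u w y) powr p * (wt (- L) (x - y) * wt (- L) (\<xi>' - w))) \<le> ewt L (\<xi>' - \<xi>) * (ewt (- L) (x - y) * (ewt (- L) (\<xi> - w) * ennreal (norm (slice u w y) powr p)))"
     by (simp add: ennreal_mult[symmetric] mult_ac ennreal_leI)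
   qed simp
   also have "\<dots> = ewt L (\<xi>' - \<xi>) * (ennreal D * Q x)"
    unfolding Q_def by (simp add: nn_integral_cmult mult.left_commute[of "ennreal D"])
   finally have "enn_pow (ennreal (norm (slice u \<xi>' x) powr p)) (1 / p) \<le> enn_pow (ewt L (\<xi>' - \<xi>) * (ennreal D * Q x)) (1 / p)"
    using p by (intro enn_pow_mono) auto
   also have "\<dots> = ewt P (\<xi>' - \<xi>) * G x" using p by (simp add: enn_pow_mult[of "1 / p" "ewt L (\<xi>' - \<xi>)"] G_def wt_powr P_def)
   finally show ?thesis using p by (simp add: powr_powr)
  qed
  have Gmod: "G y \<le> ewt P (y - z) * G z" for y z
  proof -
   have "Q y \<le> (NNI v. ewt L (y - z) * (ewt (- L) (z - v) * (NNI w. ewt (- L) (\<xi> - w) * ennreal (norm (slice u w v) powr p))))"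
    unfolding Q_def
   proof (intro nn_integral_mono)
    fix v
    have "ewt (- L) (y - v) \<le> ewt L (y - z) * ewt (- L) (z - v)"
     using wt_peetre[of "- L" "y - v" "z - v"] L by (simp add: ennreal_mult[symmetric] mult.commute ennreal_leI)
    then show "ewt (- L) (y - v) * (NNI w. ewt (- L) (\<xi> - w) * ennreal (norm (slice u w v) powr p)) \<le>
     ewt L (y - z) * (ewt (- L) (z - v) * (NNI w. ewt (- L) (\<xi> - w) * ennreal (norm (slice u w v) powr p)))"
     unfolding mult.assoc[symmetric] by (rule mult_right_mono) simp
   qed
   also have "\<dots> = ewt L (y - z) * Q z" unfolding Q_def by (simp add: nn_integral_cmult)
   finally have "ennreal D * Q y \<le> ewt L (y - z) * (ennreal D * Q z)" by (subst mult.left_commute) (rule mult_left_mono, auto)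
   then have "G y \<le> enn_pow (ewt L (y - z) * (ennreal D * Q z)) (1 / p)" unfolding G_def using p by (intro enn_pow_mono) auto
   then show ?thesis using p by (simp add: enn_pow_mult[of "1 / p" "ewt L (y - z)"] G_def wt_powr P_def)
  qed
  define K where "K y = (NNI \<xi>'. ennreal (norm (kern \<mu> \<xi> \<xi>' y) * wt P (\<xi>' - \<xi>)))" for y
  have [measurable]: "K \<in> Bm" unfolding K_def[abs_def] by measurable
  \<comment> \<open>Averaging \<open>K\<close> at unit scale makes it vary moderately. As
    \<open>G\<close> already does by \<open>Gmod\<close>, replacing \<open>K\<close> by
    \<open>k\<close> under the integral costs only the constant \<open>1 / wN\<close>.\<close>
  define k where "k y = (NNI v. ewt (- N) (y - v) * K v)" for y
  have [measurable]: "k \<in> Bm" unfolding k_def[abs_def] by measurable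
  have kmod: "k y \<le> ewt N (y - z) * k z" for y z
  proof -
   have "k y \<le> (NNI v. ewt N (y - z) * (ewt (- N) (z - v) * K v))"
    unfolding k_def
   proof (intro nn_integral_mono)
    fix v
    have "ewt (- N) (y - v) \<le> ewt N (y - z) * ewt (- N) (z - v)"
     using wt_peetre[of "- N" "y - v" "z - v"] N by (simp add: ennreal_mult[symmetric] mult.commute ennreal_leI)
    then show "ewt (- N) (y - v) * K v \<le> ewt N (y - z) * (ewt (- N) (z - v) * K v)"
     unfolding mult.assoc[symmetric] by (rule mult_right_mono) simp
   qed
   also have "\<dots> = ewt N (y - z) * k z" unfolding k_def by (simp add: nn_integral_cmult)
   finally show ?thesis .
  qed
  have HG: "enorm (slice (modulated \<mu> u) \<xi> x) \<le> ennreal (1 / energy) * (NNI v. G (x - v) * K v)" for x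
  proof -
   have "enorm (slice (modulated \<mu> u) \<xi> x) \<le> ennreal (1 / energy) * (NNI \<xi>'. enorm (conv (kern \<mu> \<xi> \<xi>') (slice u \<xi>') x))"
    by (rule norm_slice_le[OF mu_cont(1) u kern_integrable])
   also have "\<dots> \<le> ennreal (1 / energy) * (NNI \<xi>'. (NNI v. G (x - v) * ennreal (norm (kern \<mu> \<xi> \<xi>' v) * wt P (\<xi>' - \<xi>))))"
   proof (intro mult_left_mono nn_integral_mono)
    fix \<xi>'
    have "enorm (conv (kern \<mu> \<xi> \<xi>') (slice u \<xi>') x) \<le> (NNI v. enorm (kern \<mu> \<xi> \<xi>' v * slice u \<xi>' (x - v)))"
     unfolding conv_def by (rule norm_integral_le_nn)
    also have "\<dots> \<le> (NNI v. G (x - v) * ennreal (norm (kern \<mu> \<xi> \<xi>' v) * wt P (\<xi>' - \<xi>)))"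
    proof (intro nn_integral_mono)
     fix v
     have "enorm (kern \<mu> \<xi> \<xi>' v * slice u \<xi>' (x - v)) = enorm (kern \<mu> \<xi> \<xi>' v) * enorm (slice u \<xi>' (x - v))"
      by (simp add: norm_mult ennreal_mult)
     also have "\<dots> \<le> enorm (kern \<mu> \<xi> \<xi>' v) * (ewt P (\<xi>' - \<xi>) * G (x - v))" by (intro mult_left_mono AQ) simp
     also have "\<dots> = G (x - v) * ennreal (norm (kern \<mu> \<xi> \<xi>' v) * wt P (\<xi>' - \<xi>))" by (simp add: ennreal_mult mult_ac)
     finally show "enorm (kern \<mu> \<xi> \<xi>' v * slice u \<xi>' (x - v)) \<le> \<dots>" .
    qed
    finally show "enorm (conv (kern \<mu> \<xi> \<xi>') (slice u \<xi>') x) \<le> \<dots>" .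
   qed simp
   also have "(NNI \<xi>'. (NNI v. G (x - v) * ennreal (norm (kern \<mu> \<xi> \<xi>' v) * wt P (\<xi>' - \<xi>))))
    = (NNI v. (NNI \<xi>'. G (x - v) * ennreal (norm (kern \<mu> \<xi> \<xi>' v) * wt P (\<xi>' - \<xi>))))"
    by (rule lborel_pair.Fubini') measurable
   also have "\<dots> = (NNI v. G (x - v) * K v)"
    unfolding K_def by (intro nn_integral_cong nn_integral_cmult) measurable
   finally show ?thesis .
  qed
  have GK: "(NNI v. G (x - v) * K v) \<le> ennreal (1 / wN) * (NNI y. G (x - y) * k y)" for x
  proof -
   have "ennreal wN * (NNI v. G (x - v) * K v) = (NNI v. (NNI y. ewt (- (N + P)) (y - v) * (G (x - v) * K v)))"
    using wint_translate(1)[where 'a="real^'n", of "N + P"] N P n by (simp add: nn_integral_multc wN_def nn_integral_cmult)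
   also have "\<dots> \<le> (NNI v. (NNI y. G (x - y) * (ewt (- N) (y - v) * K v)))"
   proof (intro nn_integral_mono)
    fix v y
    have "ewt (- (N + P)) (y - v) * (G (x - v) * K v) \<le> ewt (- (N + P)) (y - v) * ((ewt P (y - v) * G (x - y)) * K v)"
     using Gmod[of "x - v" "x - y"] by (intro mult_left_mono mult_right_mono) auto
    also have "\<dots> = (ewt (- (N + P)) (y - v) * ewt P (y - v)) * (G (x - y) * K v)" by (simp only: mult_ac)
    also have "ewt (- (N + P)) (y - v) * ewt P (y - v) = ewt (- N) (y - v)"
     by (simp add: ennreal_mult[symmetric] wt_mult)
    finally show "ewt (- (N + P)) (y - v) * (G (x - v) * K v) \<le> G (x - y) * (ewt (- N) (y - v) * K v)" by (simp only: mult_ac)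
   qed
   also have "\<dots> = (NNI y. (NNI v. G (x - y) * (ewt (- N) (y - v) * K v)))"
    by (rule lborel_pair.Fubini') measurable
   also have "\<dots> = (NNI y. G (x - y) * k y)"
    unfolding k_def by (intro nn_integral_cong nn_integral_cmult) measurable
   finally have "ennreal (1 / wN) * (ennreal wN * (NNI v. G (x - v) * K v)) \<le> ennreal (1 / wN) * (NNI y. G (x - y) * k y)"
    by (rule mult_left_mono) simp
   then show ?thesis using wN by (simp add: ennreal_mult_assoc)
  qed
  have Hp: "ennreal (norm (slice (modulated \<mu> u) \<xi> x) powr p) \<le> ennreal E * (NNI y. (ennreal D * Q (x - y)) * enn_pow (k y) p)" for x
  proof -
   have "enorm (slice (modulated \<mu> u) \<xi> x) \<le> ennreal (1 / energy) * (ennreal (1 / wN) * (NNI y. G (x - y) * k y))"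
    by (rule order_trans[OF HG]) (intro mult_left_mono GK, simp)
   also have "\<dots> = ennreal (1 / energy * (1 / wN)) * (NNI y. G (x - y) * k y)"
    using energy_pos wN by (intro ennreal_mult_assoc) auto
   finally have "enn_pow (enorm (slice (modulated \<mu> u) \<xi> x)) p \<le> enn_pow (ennreal (1 / energy * (1 / wN)) * (NNI y. G (x - y) * k y)) p"
    using p by (intro enn_pow_mono) auto
   also have "\<dots> = ennreal ((1 / energy * (1 / wN)) powr p) * enn_pow (NNI y. G (x - y) * k y) p"
    using p energy_pos wN by (subst enn_pow_mult) auto
   also have "\<dots> \<le> ennreal ((1 / energy * (1 / wN)) powr p) * (ennreal cJ * (NNI y. enn_pow (G (x - y) * k y) p))"
    unfolding cJ_def
   proof (intro mult_left_mono moderate_power p)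
    fix y z
    have "G (x - y) * k y \<le> (ewt P (x - y - (x - z)) * G (x - z)) * (ewt N (y - z) * k z)" by (intro mult_mono Gmod kmod) auto
    also have "\<dots> = (ewt P (y - z) * ewt N (y - z)) * (G (x - z) * k z)" by (simp add: wt_commute[of P z] mult_ac)
    also have "ewt P (y - z) * ewt N (y - z) = ewt (P + N) (y - z)" by (simp add: ennreal_mult[symmetric] wt_mult)
    finally show "G (x - y) * k y \<le> ewt (P + N) (y - z) * (G (x - z) * k z)" .
   qed (use P N in auto)
   also have "\<dots> = ennreal E * (NNI y. (ennreal D * Q (x - y)) * enn_pow (k y) p)"
    using EF p by (simp add: ennreal_mult_assoc E_def enn_pow_mult Gp)
   finally show ?thesis by simp
  qed
  define \<omega> where "\<omega> y = wt (- s) \<xi> *\<^sub>R (y + vel \<xi>)" for y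
  have [measurable]: "\<omega> \<in> Bm" unfolding \<omega>_def[abs_def] by measurable
  \<comment> \<open>The averaging moves \<open>\<omega>\<close> by at most
    \<open>norm (y - v)\<close>, since the dilation factor is at most 1; the loss
    \<open>wt a (y - v)\<close> is covered by \<open>N = a + n + 1\<close>. So \<open>k\<close>
    keeps the weighted mass of the kernels.\<close>
  have kap1: "(NNI y. k y * ewt a (\<omega> y)) \<le> ennreal (w1 * (CK * w1) * wt (s * n / 2) \<xi>)"
  proof -
   have "(NNI y. k y * ewt a (\<omega> y)) = (NNI y. (NNI v. (ewt (- N) (y - v) * K v) * ewt a (\<omega> y)))"
    unfolding k_def by (intro nn_integral_cong nn_integral_multc[symmetric]) measurable
   also have "\<dots> = (NNI v. (NNI y. (ewt (- N) (y - v) * K v) * ewt a (\<omega> y)))"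
    by (rule lborel_pair.Fubini') measurable
   also have "\<dots> \<le> (NNI v. (NNI y. ewt (- (n + 1)) (y - v) * (K v * ewt a (\<omega> v))))"
   proof (intro nn_integral_mono)
    fix v y
    have "\<omega> y = wt (- s) \<xi> *\<^sub>R (y - v) + \<omega> v" by (simp add: \<omega>_def algebra_simps)
    then have "wt a (\<omega> y) \<le> wt a (wt (- s) \<xi> *\<^sub>R (y - v)) * wt a (\<omega> v)" using wt_add_le[OF a] by metis
    also have "\<dots> \<le> wt a (y - v) * wt a (\<omega> v)"
     using a s wt_le_1[of "- s" \<xi>] by (intro mult_right_mono wt_le_norm) (auto simp: mult_left_le_one_le)
    finally have "wt (- N) (y - v) * wt a (\<omega> y) \<le> wt (- N) (y - v) * (wt a (y - v) * wt a (\<omega> v))" by (rule mult_left_mono) simp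
    also have "\<dots> = wt (- (n + 1)) (y - v) * wt a (\<omega> v)" by (simp add: mult.assoc[symmetric] wt_mult N_def)
    finally have le: "ewt (- N) (y - v) * ewt a (\<omega> y) \<le> ewt (- (n + 1)) (y - v) * ewt a (\<omega> v)"
     by (simp add: ennreal_mult[symmetric] ennreal_leI)
    have "(ewt (- N) (y - v) * K v) * ewt a (\<omega> y) = K v * (ewt (- N) (y - v) * ewt a (\<omega> y))" by (simp only: mult_ac)
    also have "\<dots> \<le> K v * (ewt (- (n + 1)) (y - v) * ewt a (\<omega> v))" by (intro mult_left_mono le) simp
    finally show "(ewt (- N) (y - v) * K v) * ewt a (\<omega> y) \<le> ewt (- (n + 1)) (y - v) * (K v * ewt a (\<omega> v))"
     by (simp only: mult_ac)
   qed
   also have "\<dots> = ennreal w1 * (NNI v. K v * ewt a (\<omega> v))"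
    using wint_translate(1)[where 'a="real^'n", of "n + 1"] n by (simp add: nn_integral_multc w1_def nn_integral_cmult)
   also have "(NNI v. K v * ewt a (\<omega> v)) = (NNI v. (NNI \<xi>'. ennreal (norm (kern \<mu> \<xi> \<xi>' v) * wt P (\<xi>' - \<xi>)) * ewt a (\<omega> v)))"
    unfolding K_def by (intro nn_integral_cong nn_integral_multc[symmetric]) measurable
   also have "\<dots> = (NNI \<xi>'. (NNI v. ennreal (norm (kern \<mu> \<xi> \<xi>' v) * wt P (\<xi>' - \<xi>)) * ewt a (\<omega> v)))"
    by (rule lborel_pair.Fubini') measurable
   also have "\<dots> \<le> (NNI \<xi>'. ennreal (CK * wt (s * n / 2) \<xi>) * ewt (- (n + 1)) (\<xi>' - \<xi>))"
   proof (intro nn_integral_mono)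
    fix \<xi>'
    have "(NNI v. ennreal (norm (kern \<mu> \<xi> \<xi>' v) * wt P (\<xi>' - \<xi>)) * ewt a (\<omega> v)) = (NNI v. ewt P (\<xi>' - \<xi>) * ennreal (norm (kern \<mu> \<xi> \<xi>' v) * wt a (\<omega> v)))"
     by (intro nn_integral_cong) (simp add: ennreal_mult[symmetric] mult_ac)
    also have "\<dots> = ewt P (\<xi>' - \<xi>) * (NNI v. ennreal (norm (kern \<mu> \<xi> \<xi>' v) * wt a (\<omega> v)))"
     by (rule nn_integral_cmult) measurable
    also have "\<dots> \<le> ewt P (\<xi>' - \<xi>) * ennreal (CK * (wt (s * n / 2) \<xi> * wt (- (P + n + 1)) (\<xi>' - \<xi>)))"
     using CK(2)[of \<xi> \<xi>'] by (intro mult_left_mono) (auto simp: \<omega>_def n_def)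
    also have "\<dots> = ennreal (CK * wt (s * n / 2) \<xi> * (wt P (\<xi>' - \<xi>) * wt (- (P + n + 1)) (\<xi>' - \<xi>)))"
     using CK(1) by (simp add: ennreal_mult[symmetric] mult_ac)
    also have "\<dots> = ennreal (CK * wt (s * n / 2) \<xi>) * ewt (- (n + 1)) (\<xi>' - \<xi>)"
     unfolding wt_mult using CK(1) by (simp add: ennreal_mult[symmetric])
    finally show "(NNI v. ennreal (norm (kern \<mu> \<xi> \<xi>' v) * wt P (\<xi>' - \<xi>)) * ewt a (\<omega> v)) \<le> \<dots>" .
   qed
   also have "\<dots> = ennreal (CK * wt (s * n / 2) \<xi> * w1)"
    using wint_translate(1)[where 'a="real^'n", of "n + 1" \<xi>] n w1 CK(1) by (subst nn_integral_cmult) (simp_all add: w1_def[symmetric] ennreal_mult[symmetric])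
   finally have "(NNI y. k y * ewt a (\<omega> y)) \<le> ennreal w1 * ennreal (CK * wt (s * n / 2) \<xi> * w1)" by (simp add: mult_left_mono)
   also have "\<dots> = ennreal (w1 * (CK * w1) * wt (s * n / 2) \<xi>)" using w1 CK(1) by (simp add: ennreal_mult[symmetric] mult_ac)
   finally show ?thesis .
  qed
  have kapp: "(NNI y. enn_pow (k y) p) \<le> ennreal (F * wt \<sigma> \<xi>)"
  proof -
   \<comment> \<open>The mass of \<open>wt (- lam) (\<omega> y)\<close>, that is, up to a constant
     the volume of the region of radius \<open>wt s \<xi>\<close> around \<open>- vel \<xi>\<close>;
     Jensen's inequality with exponent \<open>1 / p\<close> against it is the Hoelder step.\<close>
   define mm where "mm = wt (s * n) \<xi> * wl"
   have mm: "0 < mm" using wl by (simp add: mm_def)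
   have mass: "(NNI y. ewt (- lam) (\<omega> y)) \<le> ennreal mm"
   proof -
    have "ennreal wl = ennreal (\<bar>wt (- s) \<xi>\<bar> ^ DIM(real^'n)) * (NNI y. ewt (- lam) (wt (- s) \<xi> *\<^sub>R vel \<xi> + wt (- s) \<xi> *\<^sub>R y))"
     unfolding wl_def using lamn n by (subst wint_eq[symmetric], simp) (rule nn_integral_lborel_affine; simp)
    also have "(\<lambda>y. wt (- lam) (wt (- s) \<xi> *\<^sub>R vel \<xi> + wt (- s) \<xi> *\<^sub>R y)) = (\<lambda>y. wt (- lam) (\<omega> y))"
     by (simp add: \<omega>_def scaleR_right_distrib add.commute)
    also have "\<bar>wt (- s) \<xi>\<bar> ^ DIM(real^'n) = wt (- (s * n)) \<xi>" by (simp add: powr_realpow[symmetric] wt_powr n_def)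
    finally have "ewt (s * n) \<xi> * ennreal wl = (ewt (s * n) \<xi> * ewt (- (s * n)) \<xi>) * (NNI y. ewt (- lam) (\<omega> y))"
     by (simp add: mult.assoc)
    also have "ewt (s * n) \<xi> * ewt (- (s * n)) \<xi> = 1" by (simp add: ennreal_mult[symmetric] wt_mult)
    finally show ?thesis using wl by (simp add: mm_def ennreal_mult)
   qed
   have "enn_pow (NNI y. enn_pow (k y) p) (1 / p) = enn_pow (NNI y. (enn_pow (k y) p * ewt lam (\<omega> y)) * ewt (- lam) (\<omega> y)) (1 / p)"
    by (simp add: mult.assoc ennreal_mult[symmetric] wt_mult)
   also have "\<dots> \<le> ennreal (mm powr (1 / p - 1)) * (NNI y. enn_pow (enn_pow (k y) p * ewt lam (\<omega> y)) (1 / p) * ewt (- lam) (\<omega> y))"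
    using p mass mm by (intro enn_pow_Jensen) auto
   also have "\<dots> = ennreal (mm powr (1 / p - 1)) * (NNI y. k y * ewt a (\<omega> y))"
    using p by (simp add: enn_pow_mult enn_pow_pow mult.assoc wt_powr wt_mult ennreal_mult[symmetric] lam1)
   also have "\<dots> \<le> ennreal (mm powr (1 / p - 1)) * ennreal (w1 * (CK * w1) * wt (s * n / 2) \<xi>)" by (intro mult_left_mono kap1) simp
   also have "\<dots> = ennreal (mm powr (1 / p - 1) * (w1 * (CK * w1) * wt (s * n / 2) \<xi>))" using w1 CK by (simp add: ennreal_mult)
   finally have "enn_pow (enn_pow (NNI y. enn_pow (k y) p) (1 / p)) p \<le> enn_pow (ennreal (mm powr (1 / p - 1) * (w1 * (CK * w1) * wt (s * n / 2) \<xi>))) p"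
    using p by (intro enn_pow_mono) auto
   also have "\<dots> = ennreal ((mm powr (1 / p - 1) * (w1 * (CK * w1) * wt (s * n / 2) \<xi>)) powr p)" using w1 CK by simp
   also have "(mm powr (1 / p - 1) * (w1 * (CK * w1) * wt (s * n / 2) \<xi>)) powr p = mm powr (1 - p) * ((w1 * (CK * w1)) powr p * wt (s * n / 2 * p) \<xi>)"
   proof -
    have "(1 / p - 1) * p = 1 - p" using p by (simp add: field_simps)
    then show ?thesis using w1 CK by (simp add: powr_mult powr_powr wt_powr)
   qed
   also have "\<dots> = F * (wt (s * n * (1 - p)) \<xi> * wt (s * n / 2 * p) \<xi>)" using wl by (simp add: mm_def F_def powr_mult wt_powr mult_ac)
   also have "\<dots> = F * wt \<sigma> \<xi>" unfolding wt_mult sig ..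
   finally show ?thesis using p by (simp add: enn_pow_pow)
  qed
  have Qint: "(NNI x. Q x) = ennreal wL * (NNI w. ewt (- L) (w - \<xi>) * pmass p u w)"
  proof -
   have "(NNI x. Q x) = (NNI y. (NNI x. ewt (- L) (x - y) * (NNI w. ewt (- L) (\<xi> - w) * ennreal (norm (slice u w y) powr p))))"
    unfolding Q_def by (rule lborel_pair.Fubini') measurable
   also have "\<dots> = ennreal wL * (NNI y. (NNI w. ewt (- L) (\<xi> - w) * ennreal (norm (slice u w y) powr p)))"
    using L n by (simp add: nn_integral_multc wint_translate(1) wL_def nn_integral_cmult)
   also have "(NNI y. (NNI w. ewt (- L) (\<xi> - w) * ennreal (norm (slice u w y) powr p))) = (NNI w. (NNI y. ewt (- L) (\<xi> - w) * ennreal (norm (slice u w y) powr p)))"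
    by (rule lborel_pair.Fubini') measurable
   also have "\<dots> = (NNI w. ewt (- L) (w - \<xi>) * pmass p u w)"
    unfolding pmass_def wt_commute[of _ \<xi>] by (intro nn_integral_cong nn_integral_cmult) measurable
   finally show ?thesis .
  qed
  have "pmass p (modulated \<mu> u) \<xi> \<le> (NNI x. ennreal E * (NNI y. (ennreal D * Q (x - y)) * enn_pow (k y) p))"
   unfolding pmass_def by (intro nn_integral_mono Hp)
  also have "\<dots> = ennreal E * (NNI x. (NNI y. (ennreal D * Q (x - y)) * enn_pow (k y) p))"
   by (rule nn_integral_cmult) measurable
  also have "(NNI x. (NNI y. (ennreal D * Q (x - y)) * enn_pow (k y) p)) = (NNI y. (NNI x. (ennreal D * Q (x - y)) * enn_pow (k y) p))"
   by (rule lborel_pair.Fubini') measurable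
  also have "\<dots> = (NNI y. (ennreal D * (NNI x. Q x)) * enn_pow (k y) p)"
   by (simp add: nn_integral_multc nn_integral_cmult nn_integral_lborel_translate(2))
  also have "\<dots> = (ennreal D * (NNI x. Q x)) * (NNI y. enn_pow (k y) p)"
   by (rule nn_integral_cmult) measurable
  also have "ennreal E * \<dots> \<le> ennreal E * ((ennreal D * (ennreal wL * (NNI w. ewt (- M) (w - \<xi>) * pmass p u w))) * ennreal (F * wt \<sigma> \<xi>))"
   unfolding Qint using L by (intro mult_left_mono mult_mono nn_integral_mono mult_right_mono kapp ennreal_leI wt_mono) auto
  also have "\<dots> = (ennreal E * (ennreal (F * wt \<sigma> \<xi>) * (ennreal D * ennreal wL))) * (NNI w. ewt (- M) (w - \<xi>) * pmass p u w)"
   by (simp only: mult_ac)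
  also have "ennreal E * (ennreal (F * wt \<sigma> \<xi>) * (ennreal D * ennreal wL)) = ennreal (E * (F * (D * wL)) * wt \<sigma> \<xi>)"
   using EF D(1) wL by (simp add: ennreal_mult[symmetric] mult_ac)
  finally show "pmass p (modulated \<mu> u) \<xi> \<le>
   ennreal (E * (F * (D * wL)) * wt (s * real CARD('n) * \<bar>1 / p - 1 / 2\<bar> * p) \<xi>) * (NNI \<xi>'. ewt (- M) (\<xi>' - \<xi>) * pmass p u \<xi>')"
   by (simp only: \<sigma>_def)
 qed (use EF D(1) wL in simp)
qed

text \<open>The endpoint of bounded slices: nothing but the mass of the kernel enters, giving order
  \<open>s n / 2\<close>, and Peetre's inequality carries the weight from \<open>\<xi>'\<close> to
  \<xi>.\<close>

lemma slice_bounded: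
 "\<exists>C\<ge>0. \<forall>u D. L1 u \<longrightarrow> 0 \<le> D \<longrightarrow> (\<forall>x \<xi>. norm (slice u \<xi> x) \<le> D * wt (- \<delta>) \<xi>) \<longrightarrow>
  (\<forall>x \<xi>. norm (slice (modulated \<mu> u) \<xi> x) \<le> C * D * wt (s * real CARD('n) / 2 - \<delta>) \<xi>)"
proof -
 define l where "l = real CARD('n) + 1"
 have l: "real DIM(real^'n) < l" by (simp add: l_def)
 define m where "m = wint TYPE(real^'n) l"
 have m: "0 \<le> m" by (simp add: m_def)
 obtain C where C: "0 < C" "\<And>\<xi> \<xi>'. (NNI y. enorm (kern \<mu> \<xi> \<xi>' y)) \<le> ennreal (C * (wt (s * real CARD('n) / 2) \<xi> * wt (- (\<bar>\<delta>\<bar> + l)) (\<xi>' - \<xi>)))"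
  using kern_L1[of "\<bar>\<delta>\<bar> + l"] by (auto simp: l_def)
 show ?thesis
 proof (intro exI[of _ "(1 / energy) * (C * m)"] conjI allI impI)
  fix u D and x \<xi> :: "real^'n"
  assume u: "L1 u" and D: "0 \<le> D" and A: "\<forall>x \<xi>. norm (slice u \<xi> x) \<le> D * wt (- \<delta>) \<xi>"
  define S where "S = D * (C * wt (s * real CARD('n) / 2 - \<delta>) \<xi>)"
  have S: "0 \<le> S" using D C by (simp add: S_def)
  have kv: "enorm (conv (kern \<mu> \<xi> \<xi>') (slice u \<xi>') x) \<le> ennreal S * ewt (- l) (\<xi>' - \<xi>)" for \<xi>'
  proof -
   have "enorm (conv (kern \<mu> \<xi> \<xi>') (slice u \<xi>') x) \<le> (NNI y. enorm (kern \<mu> \<xi> \<xi>' y * slice u \<xi>' (x - y)))"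
    unfolding conv_def by (rule norm_integral_le_nn)
   also have "\<dots> \<le> (NNI y. enorm (kern \<mu> \<xi> \<xi>' y) * ennreal (D * wt (- \<delta>) \<xi>'))"
    using A D by (intro nn_integral_mono) (auto simp: norm_mult ennreal_mult[symmetric] intro!: ennreal_leI mult_left_mono)
   also have "\<dots> = (NNI y. enorm (kern \<mu> \<xi> \<xi>' y)) * ennreal (D * wt (- \<delta>) \<xi>')"
    using good_measurable[OF kern_good] by (intro nn_integral_multc) auto
   also have "\<dots> \<le> ennreal (C * (wt (s * real CARD('n) / 2) \<xi> * wt (- (\<bar>\<delta>\<bar> + l)) (\<xi>' - \<xi>))) * ennreal (D * (wt (- \<delta>) \<xi> * wt \<bar>\<delta>\<bar> (\<xi>' - \<xi>)))"
    using D wt_peetre[of "- \<delta>" \<xi>' \<xi>] by (intro mult_mono C(2) ennreal_leI mult_left_mono) auto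
   also have "\<dots> = ennreal (D * (C * (wt (s * real CARD('n) / 2) \<xi> * wt (- \<delta>) \<xi>)) * (wt (- (\<bar>\<delta>\<bar> + l)) (\<xi>' - \<xi>) * wt \<bar>\<delta>\<bar> (\<xi>' - \<xi>)))"
    using D C by (simp add: ennreal_mult[symmetric] mult_ac)
   also have "\<dots> = ennreal S * ewt (- l) (\<xi>' - \<xi>)"
    unfolding wt_mult using S by (simp add: ennreal_mult[symmetric] S_def)
   finally show ?thesis .
  qed
  have "enorm (slice (modulated \<mu> u) \<xi> x) \<le> ennreal (1 / energy) * (NNI \<xi>'. enorm (conv (kern \<mu> \<xi> \<xi>') (slice u \<xi>') x))"
   by (rule norm_slice_le[OF mu_cont(1) u kern_integrable])
  also have "\<dots> \<le> ennreal (1 / energy) * (NNI \<xi>'. ennreal S * ewt (- l) (\<xi>' - \<xi>))"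
   by (intro mult_left_mono nn_integral_mono kv) simp
  also have "\<dots> = ennreal (1 / energy * (S * m))"
   using S m energy_pos by (subst nn_integral_cmult) (simp_all add: wint_translate(1)[OF l] m_def[symmetric] ennreal_mult[symmetric])
  also have "1 / energy * (S * m) = (1 / energy) * (C * m) * D * wt (s * real CARD('n) / 2 - \<delta>) \<xi>" by (simp add: S_def mult_ac)
  finally show "norm (slice (modulated \<mu> u) \<xi> x) \<le> (1 / energy) * (C * m) * D * wt (s * real CARD('n) / 2 - \<delta>) \<xi>"
   using C m D energy_pos by (simp add: ennreal_le_iff)
 qed (use C m energy_pos in simp)
qed

end

section \<open>Mixed norms\<close>

lemma Lpnorm_real: "0 < q ==> Lpnorm (ennreal q) h = enn_pow (NNI x. enn_pow (h x) q) (1 / q)"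
 by (simp add: Lpnorm_def)

lemma Lpnorm_power: "0 < q ==> enn_pow (Lpnorm (ennreal q) h) q = (NNI x. enn_pow (h x) q)"
 by (simp add: Lpnorm_real enn_pow_pow)

lemma Lpnorm_top: "Lpnorm top h = esssup lborel h"
 by (simp add: Lpnorm_def)

lemma exponent_cases:
 fixes q :: ennreal
 assumes "0 < q" obtains "q = top" | r where "q = ennreal r" "0 < r"
 using assms by (cases q) auto

lemma nn_integral_enn_pow_le:
 assumes [measurable]: "g \<in> borel_measurable M" and le: "\<And>x. h x \<le> ennreal c * g x" and c: "0 \<le> c" and r: "0 < r"
 shows "(\<integral>\<^sup>+x. enn_pow (h x) r \<partial>M) \<le> ennreal (c powr r) * (\<integral>\<^sup>+x. enn_pow (g x) r \<partial>M)"
proof -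
 have "(\<integral>\<^sup>+x. enn_pow (h x) r \<partial>M) \<le> (\<integral>\<^sup>+x. enn_pow (ennreal c * g x) r \<partial>M)" using r by (intro nn_integral_mono enn_pow_mono le) simp
 also have "\<dots> = ennreal (c powr r) * (\<integral>\<^sup>+x. enn_pow (g x) r \<partial>M)" using r c by (simp add: enn_pow_mult nn_integral_cmult)
 finally show ?thesis .
qed

lemma Lpnorm_le_cmult:
 assumes [measurable]: "h \<in> Bm" "g \<in> Bm"
  and le: "\<And>x. h x \<le> ennreal c * g x" and c: "0 \<le> c" and q: "0 < q"
 shows "Lpnorm q h \<le> ennreal c * Lpnorm q g"
 using q
proof (cases rule: exponent_cases)
 case 1
 have "h x \<le> ennreal c * e" if "g x \<le> e" for x e
  using that by (intro order_trans[OF le] mult_left_mono) auto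
 then have "AE x in lborel. h x \<le> ennreal c * esssup lborel g" using esssup_AE[of g lborel] by auto
 then show ?thesis unfolding 1 Lpnorm_top by (intro esssup_I) auto
next
 case (2 r)
 have "enn_pow (NNI x. enn_pow (h x) r) (1 / r) \<le> enn_pow (ennreal (c powr r) * (NNI x. enn_pow (g x) r)) (1 / r)"
  using 2 by (intro enn_pow_mono nn_integral_enn_pow_le le c) auto
 also have "\<dots> = ennreal c * enn_pow (NNI x. enn_pow (g x) r) (1 / r)"
  using 2 c by (simp add: enn_pow_mult powr_powr)
 finally show ?thesis using 2 by (simp add: Lpnorm_real)
qed

text \<open>Jensen's inequality against an integrable power of \<open>wt\<close>. The lower bound on
  \<open>k\<close> is the integrability condition for that power, and its strictness is the origin
  of the strict inequality required of \<delta>.\<close>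

lemma Lpnorm_Holder:
 assumes r: "0 < r" "ennreal r < t" and k: "real CARD('n) * (1 / r - recip t) < k"
 shows "\<exists>C\<ge>0. \<forall>h :: real^'n::finite => real. h \<in> Bm \<longrightarrow> (\<forall>\<xi>. 0 \<le> h \<xi>) \<longrightarrow>
  Lpnorm (ennreal r) (\<lambda>\<xi>. ennreal (h \<xi>)) \<le> ennreal C * Lpnorm t (\<lambda>\<xi>. ennreal (h \<xi> * wt k \<xi>))"
proof (cases "t = top")
 case True
 define l where "l = k * r"
 have l: "real DIM(real^'n) < l" using k r True by (simp add: l_def recip_def field_simps)
 define m where "m = wint TYPE(real^'n) l"
 have m: "0 \<le> m" by (simp add: m_def)
 show ?thesis
 proof (intro exI[of _ "m powr (1 / r)"] conjI allI impI)
  fix h :: "real^'n => real" assume [measurable]: "h \<in> Bm" and h: "\<forall>\<xi>. 0 \<le> h \<xi>"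
  define E where "E = esssup lborel (\<lambda>\<xi>. ennreal (h \<xi> * wt k \<xi>))"
  have "(NNI \<xi>. enn_pow (ennreal (h \<xi>)) r) \<le> (NNI (\<xi>::real^'n). enn_pow E r * ewt (- l) \<xi>)"
  proof (rule nn_integral_mono_AE)
   have "AE \<xi> in lborel. ennreal (h \<xi> * wt k \<xi>) \<le> E" unfolding E_def by (rule esssup_AE)
   then show "AE \<xi> in lborel. enn_pow (ennreal (h \<xi>)) r \<le> enn_pow E r * ewt (- l) \<xi>"
   proof eventually_elim
    fix \<xi> assume E: "ennreal (h \<xi> * wt k \<xi>) \<le> E"
    have "ennreal (h \<xi>) = ennreal (h \<xi> * wt k \<xi>) * ewt (- k) \<xi>"
     using h by (simp add: ennreal_mult[symmetric] mult.assoc wt_mult)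
    also have "\<dots> \<le> E * ewt (- k) \<xi>" by (intro mult_right_mono E) simp
    finally have "enn_pow (ennreal (h \<xi>)) r \<le> enn_pow (E * ewt (- k) \<xi>) r" using r by (intro enn_pow_mono) auto
    then show "enn_pow (ennreal (h \<xi>)) r \<le> enn_pow E r * ewt (- l) \<xi>" using r by (simp add: enn_pow_mult wt_powr l_def)
   qed
  qed
  also have "\<dots> = enn_pow E r * ennreal m" unfolding m_def wint_eq[OF l, symmetric] by (rule nn_integral_cmult) measurable
  finally have "Lpnorm (ennreal r) (\<lambda>\<xi>. ennreal (h \<xi>)) \<le> enn_pow (enn_pow E r * ennreal m) (1 / r)"
   unfolding Lpnorm_real[OF r(1)] using r by (intro enn_pow_mono) auto
  also have "\<dots> = ennreal (m powr (1 / r)) * E" using r m by (simp add: enn_pow_mult enn_pow_pow mult.commute)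
  finally show "Lpnorm (ennreal r) (\<lambda>\<xi>. ennreal (h \<xi>)) \<le> ennreal (m powr (1 / r)) * Lpnorm t (\<lambda>\<xi>. ennreal (h \<xi> * wt k \<xi>))"
   by (simp add: True Lpnorm_top E_def)
 qed simp
next
 case False
 then obtain t' where t: "t = ennreal t'" "0 \<le> t'" by (cases t) auto
 have rt: "r < t'" using r t by (simp add: ennreal_less_iff)
 \<comment> \<open>Determined by the identity \<open>la\<close> below: after raising to the power
   \<open>t' / r\<close>, the order \<open>l * (t' / r) - l\<close> has to equal
   \<open>k * t'\<close>.\<close>
 define l where "l = k * t' * r / (t' - r)"
 have "real CARD('n) * (1 / r - 1 / t') < k" using k t by (simp add: recip_def)
 then have "real CARD('n) * (t' - r) < k * t' * r" using r rt by (simp add: field_simps)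
 then have l: "real DIM(real^'n) < l" using rt by (simp add: l_def field_simps)
 have la: "l * (t' / r) + - l = k * t'"
 proof -
  have "l * (t' - r) = k * t' * r" using rt by (simp add: l_def)
  then show ?thesis using r by (simp add: field_simps)
 qed
 define m where "m = wint TYPE(real^'n) l"
 have m: "0 < m" unfolding m_def by (rule wint_pos[OF l])
 define c where "c = m powr (t' / r - 1)"
 show ?thesis
 proof (intro exI[of _ "c powr (1 / t')"] conjI allI impI)
  fix h :: "real^'n => real" assume [measurable]: "h \<in> Bm" and h: "\<forall>\<xi>. 0 \<le> h \<xi>"
  define T where "T = (NNI \<xi>. enn_pow (ennreal (h \<xi> * wt k \<xi>)) t')"
  have "enn_pow (NNI \<xi>. enn_pow (ennreal (h \<xi>)) r) (t' / r) =
   enn_pow (NNI \<xi>. ennreal (h \<xi> powr r * wt l \<xi>) * ewt (- l) \<xi>) (t' / r)"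
   using h by (simp add: ennreal_mult[symmetric] mult.assoc wt_mult)
  also have "\<dots> \<le> ennreal (m powr (t' / r - 1)) * (NNI \<xi>. enn_pow (ennreal (h \<xi> powr r * wt l \<xi>)) (t' / r) * ewt (- l) \<xi>)"
   using r rt m by (intro enn_pow_Jensen) (auto simp: wint_eq[OF l] m_def)
  also have "(NNI \<xi>. enn_pow (ennreal (h \<xi> powr r * wt l \<xi>)) (t' / r) * ewt (- l) \<xi>) = T"
   unfolding T_def
  proof (intro nn_integral_cong)
   fix \<xi>
   have "enn_pow (ennreal (h \<xi> powr r * wt l \<xi>)) (t' / r) * ewt (- l) \<xi> = ennreal (h \<xi> powr t' * (wt (l * (t' / r)) \<xi> * wt (- l) \<xi>))"
    using h r by (simp add: powr_mult powr_powr wt_powr ennreal_mult[symmetric] mult.assoc)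
   also have "\<dots> = enn_pow (ennreal (h \<xi> * wt k \<xi>)) t'" unfolding wt_mult la using h by (simp add: powr_mult wt_powr)
   finally show "enn_pow (ennreal (h \<xi> powr r * wt l \<xi>)) (t' / r) * ewt (- l) \<xi> = enn_pow (ennreal (h \<xi> * wt k \<xi>)) t'" .
  qed
  finally have "enn_pow (enn_pow (NNI \<xi>. enn_pow (ennreal (h \<xi>)) r) (t' / r)) (1 / t') \<le> enn_pow (ennreal c * T) (1 / t')"
   unfolding c_def using t by (intro enn_pow_mono) auto
  also have "\<dots> = ennreal (c powr (1 / t')) * enn_pow T (1 / t')" using r rt by (simp add: enn_pow_mult c_def)
  finally show "Lpnorm (ennreal r) (\<lambda>\<xi>. ennreal (h \<xi>)) \<le> ennreal (c powr (1 / t')) * Lpnorm t (\<lambda>\<xi>. ennreal (h \<xi> * wt k \<xi>))"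
   using r rt t by (simp add: Lpnorm_real enn_pow_pow T_def)
 qed simp
qed

lemma esssup_continuous:
 fixes h :: "real^'n::finite => ennreal"
 assumes h: "continuous_on UNIV h" shows "esssup lborel h = (SUP x. h x)"
proof (rule antisym)
 have [measurable]: "h \<in> Bm" by (rule borel_measurable_continuous_onI[OF h])
 show "esssup lborel h \<le> (SUP x. h x)" by (intro esssup_I) (auto intro!: AE_I2 SUP_upper)
 show "(SUP x. h x) \<le> esssup lborel h"
 proof (rule ccontr)
  assume "\<not> (SUP x. h x) \<le> esssup lborel h"
  then obtain x0 where x0: "esssup lborel h < h x0" by (auto simp: not_le less_SUP_iff)
  have op: "open {x. esssup lborel h < h x}"
   using open_vimage[OF open_greaterThan h, of "esssup lborel h"] by (simp add: vimage_def)
  have "{x. esssup lborel h < h x} \<in> null_sets lborel"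
   using esssup_zero_measure[of lborel h] by (intro null_setsI) (auto simp: space_lborel)
  then have "{x. esssup lborel h < h x} = {}" using op by (meson null_sets_completionI open_not_negligible negligible_iff_null_sets)
  then show False using x0 by auto
 qed
qed

text \<open>For \<open>q = top\<close> measurability of an essential supremum in a parameter is not
  evident. Continuity in \<xi> turns it into a supremum, and continuity in \<open>x\<close> makes
  its strict superlevel sets unions of open sets.\<close>

lemma Lpnorm_measurable:
 fixes V :: "real^'n::finite => real^'n => real"
 assumes V [measurable]: "case_prod V \<in> Bm2"
  and c: "\<And>x. continuous_on UNIV (V x)" "\<And>\<xi>. continuous_on UNIV (\<lambda>x. V x \<xi>)" and q: "0 < q"
 shows "(\<lambda>x. Lpnorm q (\<lambda>\<xi>. ennreal (V x \<xi>))) \<in> Bm"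
 using q
proof (cases rule: exponent_cases)
 case 1
 have "Lpnorm q (\<lambda>\<xi>. ennreal (V x \<xi>)) = (SUP \<xi>. ennreal (V x \<xi>))" for x
  unfolding 1 Lpnorm_top by (intro esssup_continuous continuous_on_ennreal c)
 moreover have "(\<lambda>x. SUP \<xi>. ennreal (V x \<xi>)) \<in> Bm"
 proof (rule borel_measurableI_greater)
  fix b :: ennreal
  have "{x \<in> space borel. b < (SUP \<xi>. ennreal (V x \<xi>))} = (\<Union>\<xi>. {x. b < ennreal (V x \<xi>)})" by (auto simp: less_SUP_iff)
  moreover have "open {x. b < ennreal (V x \<xi>)}" for \<xi>
   using open_vimage[OF open_greaterThan continuous_on_ennreal[OF c(2)[of \<xi>]], of b] by (simp add: vimage_def)
  ultimately show "{x \<in> space borel. b < (SUP \<xi>. ennreal (V x \<xi>))} \<in> sets borel" by (simp only:) (intro borel_open open_UN, auto)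
 qed
 ultimately show ?thesis by simp
next
 case (2 r)
 then show ?thesis by (simp add: Lpnorm_real)
qed

section \<open>Weighted fibre norms and their embedding\<close>

definition fibre :: "ennreal => real => (real^'n::finite => real^'n => real) => real^'n => ennreal" where
 "fibre q \<tau> A x = Lpnorm q (\<lambda>\<xi>. ennreal (A x \<xi> * wt \<tau> \<xi>))"

text \<open>The weight in \<xi> is moved to the integration variable by Peetre's inequality, which
  uses up \<open>\<bar>\<tau> * r\<bar>\<close> of the available decay.\<close>

lemma slow_power_wt:
 assumes r: "0 < r" and l: "0 \<le> l"
 shows "\<exists>D\<ge>0. \<forall>A :: real^'n::finite => real^'n => real. slow C A \<longrightarrow> (\<forall>x \<xi>. ennreal ((A x \<xi> * wt \<tau> \<xi>) powr r) \<le>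
  ennreal D * (NNI y. ewt (- l) (x - y) * (NNI z. ewt (- l) (\<xi> - z) * ennreal ((A y z * wt \<tau> z) powr r))))"
proof -
 define L where "L = l + \<bar>\<tau> * r\<bar>"
 have L: "0 \<le> L" using l by (simp add: L_def)
 obtain D where D: "0 \<le> D" "\<And>A :: real^'n => real^'n => real. slow C A ==> (\<forall>x \<xi>. ennreal (A x \<xi> powr r) \<le>
  ennreal D * (NNI y. NNI z. ennreal (A y z powr r * (wt (- L) (x - y) * wt (- L) (\<xi> - z)))))"
  using slow_power[OF r L, of C] by blast
 show ?thesis
 proof (intro exI[of _ D] conjI allI impI)
  fix A :: "real^'n => real^'n => real" and x \<xi> assume A: "slow C A"
  have [measurable]: "case_prod A \<in> Bm2" by (rule slow_measurable[OF A])
  note A0 = slow_nonneg[OF A]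
  have "ennreal ((A x \<xi> * wt \<tau> \<xi>) powr r) = ewt (\<tau> * r) \<xi> * ennreal (A x \<xi> powr r)"
   using A0 by (simp add: powr_mult wt_powr ennreal_mult mult.commute)
  also have "\<dots> \<le> ewt (\<tau> * r) \<xi> * (ennreal D * (NNI y. NNI z. ennreal (A y z powr r * (wt (- L) (x - y) * wt (- L) (\<xi> - z)))))"
   using D(2)[OF A] by (intro mult_left_mono) auto
  also have "\<dots> = ennreal D * (NNI y. NNI z. ewt (\<tau> * r) \<xi> * ennreal (A y z powr r * (wt (- L) (x - y) * wt (- L) (\<xi> - z))))"
   by (simp add: nn_integral_cmult mult.left_commute[of "ennreal D"])
  also have "\<dots> \<le> ennreal D * (NNI y. NNI z. ewt (- l) (x - y) * (ewt (- l) (\<xi> - z) * ennreal ((A y z * wt \<tau> z) powr r)))"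
  proof (intro mult_left_mono nn_integral_mono)
   fix y z
   have "wt (\<tau> * r) \<xi> * (A y z powr r * (wt (- L) (x - y) * wt (- L) (\<xi> - z))) \<le> (wt (\<tau> * r) z * wt \<bar>\<tau> * r\<bar> (\<xi> - z)) * (A y z powr r * (wt (- l) (x - y) * wt (- L) (\<xi> - z)))"
    using wt_mono[of "- L" "- l" "x - y"] by (intro mult_mono wt_peetre mult_left_mono mult_right_mono) (auto simp: L_def)
   also have "\<dots> = (A y z powr r * wt (\<tau> * r) z) * (wt (- l) (x - y) * (wt \<bar>\<tau> * r\<bar> (\<xi> - z) * wt (- L) (\<xi> - z)))" by (simp only: mult_ac)
   also have "\<dots> = (A y z * wt \<tau> z) powr r * (wt (- l) (x - y) * wt (- l) (\<xi> - z))"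
    unfolding wt_mult using A0 by (simp add: powr_mult wt_powr L_def)
   finally show "ewt (\<tau> * r) \<xi> * ennreal (A y z powr r * (wt (- L) (x - y) * wt (- L) (\<xi> - z))) \<le>
    ewt (- l) (x - y) * (ewt (- l) (\<xi> - z) * ennreal ((A y z * wt \<tau> z) powr r))"
    by (simp add: ennreal_mult[symmetric] ennreal_leI mult_ac)
  qed simp
  also have "\<dots> = ennreal D * (NNI y. ewt (- l) (x - y) * (NNI z. ewt (- l) (\<xi> - z) * ennreal ((A y z * wt \<tau> z) powr r)))"
   by (intro arg_cong2[where f="(*)"] refl nn_integral_cong nn_integral_cmult) measurable
  finally show "ennreal ((A x \<xi> * wt \<tau> \<xi>) powr r) \<le> \<dots>" .
 qed (rule D(1))
qed

text \<open>With \<open>T\<close> the \<open>r\<close>-th power of the fibre norm and \<open>B\<close> a spatial average of \<open>T\<close>, slow variation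
 bounds the supremum over the fibre by \<open>B powr (1 / r)\<close>, and \<open>L^t\<close> lies between \<open>L^r\<close> and \<open>L^\<infinity>\<close>.\<close>
lemma fibre_embedding:
 assumes r: "0 < r" "ennreal r < t" "r \<le> p"
 shows "\<exists>D\<ge>0. \<forall>A :: real^'n::finite => real^'n => real. slow C A \<longrightarrow>
  (NNI x. enn_pow (fibre t \<tau> A x) p) \<le> ennreal D * (NNI x. enn_pow (fibre (ennreal r) \<tau> A x) p)"
proof -
 define l where "l = real CARD('n) + 1"
 have l: "real DIM(real^'n) < l" "0 \<le> l" by (auto simp: l_def)
 define m where "m = wint TYPE(real^'n) l"
 have m: "0 < m" unfolding m_def by (rule wint_pos[OF l(1)])
 \<comment> \<open>\<open>r \<le> p\<close> makes this exponent at least 1, so the spatial average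
   \<open>B\<close> of \<open>T\<close> is controlled in the norm of exponent \<open>q\<close> by
   Jensen's inequality.\<close>
 define q where "q = p / r"
 have al: "1 \<le> q" "0 < q" using r by (auto simp: q_def)
 obtain D0 where D0: "0 \<le> D0" "\<And>A :: real^'n => real^'n => real. slow C A ==> (\<forall>x \<xi>. ennreal ((A x \<xi> * wt \<tau> \<xi>) powr r) \<le>
  ennreal D0 * (NNI y. ewt (- l) (x - y) * (NNI z. ewt (- l) (\<xi> - z) * ennreal ((A y z * wt \<tau> z) powr r))))"
  using slow_power_wt[OF r(1) l(2), of C \<tau>] by blast
 define D where "D = max 1 D0"
 have D: "1 \<le> D" "D0 \<le> D" by (auto simp: D_def)
 define k where "k = m powr (q - 1) * m + 1"
 have k: "0 \<le> k" "ennreal k = ennreal (m powr (q - 1) * m) + 1" using m by (auto simp: k_def)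
 define c where "c = D powr q * (2 powr q * k)"
 have c: "0 \<le> c" using k by (simp add: c_def)
 show ?thesis
 proof (intro exI[of _ c] conjI allI impI)
  fix A :: "real^'n => real^'n => real" assume A: "slow C A"
  have [measurable]: "case_prod A \<in> Bm2" by (rule slow_measurable[OF A])
  note A0 = slow_nonneg[OF A]
  define U where "U x \<xi> = ennreal ((A x \<xi> * wt \<tau> \<xi>) powr r)" for x \<xi>
  have [measurable]: "case_prod U \<in> Bm2" unfolding U_def by measurable
  have Upow: "enn_pow (ennreal (A x \<xi> * wt \<tau> \<xi>)) (r * k) = enn_pow (U x \<xi>) k" for x \<xi> k
   using A0 by (simp add: U_def powr_powr)
  define T where "T x = (NNI z. U x z)" for x
  have [measurable]: "T \<in> Bm" unfolding T_def[abs_def] by measurable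
  have T: "fibre (ennreal r) \<tau> A x = enn_pow (T x) (1 / r)" for x
   using r Upow[of x _ 1] by (simp add: fibre_def Lpnorm_real T_def)
  define B where "B x = (NNI y. T y * ewt (- l) (x - y))" for x
  have [measurable]: "B \<in> Bm" unfolding B_def[abs_def] by measurable
  \<comment> \<open>A common majorant of the pointwise values \<open>U x \<xi>\<close> and of their
    integral \<open>T x\<close>; the second use is why \<open>D\<close> is at least 1 and
    \<open>T x\<close> is added.\<close>
  define Z where "Z x = ennreal D * (B x + T x)" for x
  have [measurable]: "Z \<in> Bm" unfolding Z_def[abs_def] by measurable
  have UZ: "U x \<xi> \<le> Z x" for x \<xi>
  proof -
   have "U x \<xi> \<le> ennreal D0 * (NNI y. ewt (- l) (x - y) * (NNI z. ewt (- l) (\<xi> - z) * U y z))"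
    using D0(2)[OF A] unfolding U_def by blast
   also have "\<dots> \<le> ennreal D * (NNI y. ewt (- l) (x - y) * (NNI z. 1 * U y z))"
    using l D by (intro mult_mono mult_left_mono nn_integral_mono mult_right_mono ennreal_leI) (auto intro: wt_le_1)
   also have "\<dots> = ennreal D * B x" by (simp add: B_def T_def mult.commute)
   also have "\<dots> \<le> Z x" unfolding Z_def by (intro mult_left_mono) auto
   finally show ?thesis .
  qed
  have TZ: "T x \<le> Z x" for x
  proof -
   have "1 * T x \<le> ennreal D * (B x + T x)" using D by (intro mult_mono) (auto simp: ennreal_1[symmetric] simp del: ennreal_1 intro!: ennreal_leI)
   then show ?thesis by (simp add: Z_def)
  qed
  have t0: "0 < t" using r by (metis ennreal_less_zero_iff order.strict_trans)
  have fZ: "fibre t \<tau> A x \<le> enn_pow (Z x) (1 / r)" for x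
   using t0
  proof (cases rule: exponent_cases)
   case 1
   have "ennreal (A x \<xi> * wt \<tau> \<xi>) \<le> enn_pow (Z x) (1 / r)" for \<xi>
    using enn_pow_mono[OF _ UZ[of x \<xi>], of "1 / r"] Upow[of x \<xi> "1 / r"] r by simp
   then show ?thesis unfolding fibre_def 1 Lpnorm_top by (intro esssup_I) auto
  next
   case (2 t')
   have rt: "r < t'" using r 2 by (simp add: ennreal_less_iff)
   have "(NNI \<xi>. enn_pow (ennreal (A x \<xi> * wt \<tau> \<xi>)) t') = (NNI \<xi>. enn_pow (U x \<xi>) (t' / r))"
    using r Upow[of x _ "t' / r"] by simp
   also have "\<dots> \<le> (NNI \<xi>. enn_pow (Z x) (t' / r - 1) * U x \<xi>)"
   proof (intro nn_integral_mono)
    fix \<xi>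
    have "enn_pow (U x \<xi>) (t' / r) = enn_pow (U x \<xi>) (t' / r - 1) * enn_pow (U x \<xi>) 1"
     by (cases "U x \<xi> = 0") (simp, subst enn_pow_add_exp, auto)
    also have "\<dots> \<le> enn_pow (Z x) (t' / r - 1) * enn_pow (U x \<xi>) 1" using r rt by (intro mult_right_mono enn_pow_mono UZ) auto
    finally show "enn_pow (U x \<xi>) (t' / r) \<le> enn_pow (Z x) (t' / r - 1) * U x \<xi>" by simp
   qed
   also have "\<dots> = enn_pow (Z x) (t' / r - 1) * T x" unfolding T_def by (rule nn_integral_cmult) measurable
   also have "\<dots> \<le> enn_pow (Z x) (t' / r - 1) * enn_pow (Z x) 1" using TZ[of x] by (simp add: mult_left_mono)
   also have "\<dots> = enn_pow (Z x) (t' / r)" by (cases "Z x = 0") (simp, subst enn_pow_add_exp, auto)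
   finally have "fibre t \<tau> A x \<le> enn_pow (enn_pow (Z x) (t' / r)) (1 / t')"
    unfolding fibre_def 2(1) Lpnorm_real[OF 2(2)] using 2 by (intro enn_pow_mono) auto
   then show ?thesis using 2 by (simp add: enn_pow_pow)
  qed
  have IB: "(NNI x. enn_pow (B x) q) \<le> ennreal (m powr (q - 1) * m) * (NNI x. enn_pow (T x) q)"
  proof -
   have "(NNI x. enn_pow (B x) q) \<le> (NNI x. ennreal (m powr (q - 1)) * (NNI y. enn_pow (T y) q * ewt (- l) (x - y)))"
    unfolding B_def using al m by (intro nn_integral_mono enn_pow_Jensen) (auto simp: wint_translate(2)[OF l(1)] m_def)
   also have "\<dots> = ennreal (m powr (q - 1)) * (NNI x. (NNI y. enn_pow (T y) q * ewt (- l) (x - y)))"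
    by (rule nn_integral_cmult) measurable
   also have "(NNI x. (NNI y. enn_pow (T y) q * ewt (- l) (x - y))) = (NNI y. (NNI x. enn_pow (T y) q * ewt (- l) (x - y)))"
    by (rule lborel_pair.Fubini') measurable
   also have "\<dots> = (NNI y. enn_pow (T y) q * ennreal m)"
    by (intro nn_integral_cong) (subst nn_integral_cmult, auto simp: wint_translate(1)[OF l(1)] m_def)
   also have "\<dots> = (NNI y. enn_pow (T y) q) * ennreal m" by (rule nn_integral_multc) measurable
   finally show ?thesis using m by (simp add: ennreal_mult mult_ac)
  qed
  have "(NNI x. enn_pow (fibre t \<tau> A x) p) \<le> (NNI x. enn_pow (enn_pow (Z x) (1 / r)) p)"
   using r by (intro nn_integral_mono enn_pow_mono fZ) simp
  also have "\<dots> = (NNI x. enn_pow (Z x) q)" by (simp add: enn_pow_pow q_def)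
  also have "\<dots> \<le> ennreal (D powr q) * (NNI x. enn_pow (B x + T x) q)"
   using al D by (intro nn_integral_enn_pow_le) (auto simp: Z_def)
  also have "\<dots> \<le> ennreal (D powr q) * (NNI x. ennreal (2 powr q) * (enn_pow (B x) q + enn_pow (T x) q))"
   using al by (intro mult_left_mono nn_integral_mono enn_pow_add_le) auto
  also have "\<dots> = ennreal (D powr q) * (ennreal (2 powr q) * ((NNI x. enn_pow (B x) q) + (NNI x. enn_pow (T x) q)))"
   by (simp add: nn_integral_cmult nn_integral_add)
  also have "\<dots> \<le> ennreal (D powr q) * (ennreal (2 powr q) * (ennreal (m powr (q - 1) * m) * (NNI x. enn_pow (T x) q) + (NNI x. enn_pow (T x) q)))"
   by (intro mult_left_mono add_right_mono IB) auto
  also have "ennreal (m powr (q - 1) * m) * (NNI x. enn_pow (T x) q) + (NNI x. enn_pow (T x) q) = ennreal k * (NNI x. enn_pow (T x) q)"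
   by (simp add: distrib_right k(2))
  also have "ennreal (D powr q) * (ennreal (2 powr q) * (ennreal k * (NNI x. enn_pow (T x) q))) = ennreal c * (NNI x. enn_pow (T x) q)"
   using k(1) by (simp add: ennreal_mult_assoc c_def mult.assoc)
  also have "(NNI x. enn_pow (T x) q) = (NNI x. enn_pow (fibre (ennreal r) \<tau> A x) p)"
   by (simp add: T enn_pow_pow q_def)
  finally show "(NNI x. enn_pow (fibre t \<tau> A x) p) \<le> ennreal c * (NNI x. enn_pow (fibre (ennreal r) \<tau> A x) p)" .
 qed (rule c)
qed

section \<open>Boundedness of the multiplier\<close>

context window begin

definition amp :: "(real^'n => complex) => real^'n => real^'n => real" where
 "amp u x \<xi> = norm (slice u \<xi> x)"

lemma amp_measurable:
 assumes "u \<in> Bm" shows "case_prod (amp u) \<in> Bm2"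
proof -
 have [measurable]: "(\<lambda>(x, \<xi>). slice u \<xi> x) \<in> Bm2" by (rule slice_measurable[OF assms])
 show ?thesis unfolding amp_def by measurable
qed

lemma amp_continuous:
 assumes u: "L1 u"
 shows "continuous_on UNIV (amp u x)" "continuous_on UNIV (\<lambda>x. amp u x \<xi>)"
proof -
 show "continuous_on UNIV (\<lambda>x. amp u x \<xi>)" unfolding amp_def by (intro continuous_on_norm slice_continuous u)
 have [measurable]: "u \<in> Bm" using u by auto
 obtain B where B: "0 \<le> B" "\<And>x. norm (\<Phi> x) \<le> B" using good_bound[OF Phi_good] by auto
 have "(\<lambda>k. slice u (X k) x) \<longlonglongrightarrow> slice u \<xi> x" if X: "X \<longlonglongrightarrow> \<xi>" for X \<xi>
  unfolding slice_def ifourier_def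
 proof (rule integral_dominated_convergence)
  show "L1 (\<lambda>h. B * norm (u h))" using u by simp
  show "AE h in lborel. (\<lambda>k. u h * cnj (\<Phi> (h - X k)) * cis (2 * pi * (x \<bullet> h))) \<longlonglongrightarrow> u h * cnj (\<Phi> (h - \<xi>)) * cis (2 * pi * (x \<bullet> h))"
  proof (rule AE_I2)
   fix h
   have "(\<lambda>k. \<Phi> (h - X k)) \<longlonglongrightarrow> \<Phi> (h - \<xi>)"
    by (rule continuous_on_tendsto_compose[OF goodD(1)[OF Phi_good]]) (auto intro: tendsto_intros X)
   then show "(\<lambda>k. u h * cnj (\<Phi> (h - X k)) * cis (2 * pi * (x \<bullet> h))) \<longlonglongrightarrow> u h * cnj (\<Phi> (h - \<xi>)) * cis (2 * pi * (x \<bullet> h))"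
    by (intro tendsto_intros)
  qed
  show "AE h in lborel. norm (u h * cnj (\<Phi> (h - X k)) * cis (2 * pi * (x \<bullet> h))) \<le> B * norm (u h)" for k
  proof (rule AE_I2)
   fix h show "norm (u h * cnj (\<Phi> (h - X k)) * cis (2 * pi * (x \<bullet> h))) \<le> B * norm (u h)"
    using mult_left_mono[OF B(2)[of "h - X k"], of "norm (u h)"] by (simp add: norm_mult mult.commute)
  qed
 qed measurable
 then have "continuous_on UNIV (\<lambda>\<xi>. slice u \<xi> x)"
  unfolding continuous_on_sequentially by (simp add: comp_def)
 then show "continuous_on UNIV (amp u x)" unfolding amp_def[abs_def] by (rule continuous_on_norm)
qed

lemma amp_weighted_measurable:
 assumes u: "L1 u" and w: "continuous_on UNIV w" and q: "0 < q"
 shows "(\<lambda>x. Lpnorm q (\<lambda>\<xi>. ennreal (amp u x \<xi> * w \<xi>))) \<in> Bm"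
proof (rule Lpnorm_measurable)
 have [measurable]: "case_prod (amp u) \<in> Bm2" using u by (intro amp_measurable) auto
 have [measurable]: "w \<in> Bm" by (rule borel_measurable_continuous_onI[OF w])
 show "(\<lambda>(x, \<xi>). amp u x \<xi> * w \<xi>) \<in> Bm2" by measurable
qed (auto intro!: continuous_intros w amp_continuous[OF u] q)

lemma fibre_measurable: "L1 u ==> 0 < q ==> fibre q \<tau> (amp u) \<in> Bm"
 unfolding fibre_def[abs_def] by (rule amp_weighted_measurable) (auto intro!: continuous_intros)

lemma amp_slice_measurable: "L1 u ==> (\<lambda>\<xi>. amp u x \<xi> * wt \<tau> \<xi>) \<in> Bm"
 by (intro borel_measurable_continuous_onI continuous_intros amp_continuous)

lemma amp_nonneg [simp]: "0 \<le> amp u x \<xi>" by (simp add: amp_def)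

text \<open>With equal exponents the mixed norm is a double integral and may be evaluated in
  \<open>x\<close> first, which is the order in which the slice estimates apply.\<close>

lemma fibre_mass:
 assumes u: "L1 u" and p: "0 < p"
 shows "(NNI x. enn_pow (fibre (ennreal p) \<tau> (amp u) x) p) = (NNI \<xi>. ewt (\<tau> * p) \<xi> * pmass p u \<xi>)"
proof -
 have [measurable]: "u \<in> Bm" using u by auto
 have [measurable]: "(\<lambda>(x, \<xi>). slice u \<xi> x) \<in> Bm2" by (rule slice_measurable) measurable
 have "(NNI x. enn_pow (fibre (ennreal p) \<tau> (amp u) x) p) = (NNI x. (NNI \<xi>. ewt (\<tau> * p) \<xi> * ennreal (norm (slice u \<xi> x) powr p)))"
 proof (intro nn_integral_cong)
  fix x
  have "enn_pow (ennreal (amp u x \<xi> * wt \<tau> \<xi>)) p = ewt (\<tau> * p) \<xi> * ennreal (norm (slice u \<xi> x) powr p)" for \<xi>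
   by (simp add: amp_def powr_mult wt_powr ennreal_mult[symmetric] mult.commute)
  then show "enn_pow (fibre (ennreal p) \<tau> (amp u) x) p = (NNI \<xi>. ewt (\<tau> * p) \<xi> * ennreal (norm (slice u \<xi> x) powr p))"
   unfolding fibre_def Lpnorm_power[OF p] by simp
 qed
 also have "\<dots> = (NNI \<xi>. (NNI x. ewt (\<tau> * p) \<xi> * ennreal (norm (slice u \<xi> x) powr p)))"
  by (rule lborel_pair.Fubini') measurable
 also have "\<dots> = (NNI \<xi>. ewt (\<tau> * p) \<xi> * pmass p u \<xi>)"
  unfolding pmass_def by (intro nn_integral_cong nn_integral_cmult) measurable
 finally show ?thesis .
qed

end

context multiplier begin

lemma modulated_integrable: "L1 u ==> L1 (modulated \<mu> u)"
 using integrable_cis_mult[of lborel u \<mu>] by (simp add: mult.commute)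

definition growth :: "real => real" where
 "growth p = s * real CARD('n) * \<bar>1 / p - 1 / 2\<bar>"

lemma slice_estimate:
 assumes p: "0 < p" "p < 1 ==> real CARD('n) * (1 / p - 1) < a"
 shows "\<exists>C\<ge>0. \<forall>u. (\<forall>K. dec K u) \<longrightarrow>
  (\<forall>\<xi>. pmass p (modulated \<mu> u) \<xi> \<le>
   ennreal (C * wt (growth p * p) \<xi>) * (NNI \<xi>'. ewt (- M) (\<xi>' - \<xi>) * pmass p u \<xi>'))"
proof -
 have di: "L1 u" if "\<forall>K. dec K u" for u :: "real^'n => complex"
  using that by (intro goodD(2) dec_good[of "real CARD('n) + 1"]) auto
 have ds: "\<forall>\<xi>. L1 (slice u \<xi>)" if "\<forall>K. dec K u" for u
  using that slice_integrable by blast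
 show ?thesis
 proof (cases "p < 1")
  case True
  show ?thesis using slice_estimate_lt1[OF p(1) True p(2)[OF True], of M] di unfolding growth_def by meson
 next
  case False
  then have "1 \<le> p" by simp
  from slice_estimate_ge1[OF this, of M] show ?thesis using di ds unfolding growth_def by meson
 qed
qed

text \<open>The slice estimate is integrated in \<xi>: the weight of order
  \<open>(\<tau> + growth p) * p\<close> is moved to \<open>\<xi>'\<close> by Peetre's inequality,
  for which the decay of the average is chosen, and the rest of the decay is integrable.\<close>

lemma diagonal_bound:
 assumes p: "0 < p" "p < 1 ==> real CARD('n) * (1 / p - 1) < a"
 shows "\<exists>C\<ge>0. \<forall>u. (\<forall>K. dec K u) \<longrightarrow> (NNI x. enn_pow (fibre (ennreal p) \<tau> (amp (modulated \<mu> u)) x) p)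
  \<le> ennreal C * (NNI x. enn_pow (fibre (ennreal p) (\<tau> + growth p) (amp u) x) p)"
proof -
 define \<rho> where "\<rho> = (\<tau> + growth p) * p"
 define l where "l = real CARD('n) + 1"
 have l: "real DIM(real^'n) < l" by (simp add: l_def)
 define m where "m = wint TYPE(real^'n) l"
 have m: "0 \<le> m" by (simp add: m_def)
 obtain C where C: "0 \<le> C" "\<And>u. \<forall>K. dec K u ==> (\<forall>\<xi>. pmass p (modulated \<mu> u) \<xi> \<le>
   ennreal (C * wt (growth p * p) \<xi>) * (NNI \<xi>'. ewt (- (\<bar>\<rho>\<bar> + l)) (\<xi>' - \<xi>) * pmass p u \<xi>'))"
  using slice_estimate[OF p, of "\<bar>\<rho>\<bar> + l"] by auto
 show ?thesis
 proof (intro exI[of _ "C * m"] conjI allI impI)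
  fix u :: "real^'n => complex" assume d: "\<forall>K. dec K u"
  have u: "L1 u" using d by (intro goodD(2) dec_good[of "real CARD('n) + 1"]) auto
  have [measurable]: "pmass p u \<in> Bm" using u by (intro pmass_measurable) auto
  have "(NNI x. enn_pow (fibre (ennreal p) \<tau> (amp (modulated \<mu> u)) x) p)
   = (NNI \<xi>. ewt (\<tau> * p) \<xi> * pmass p (modulated \<mu> u) \<xi>)"
   by (rule fibre_mass[OF modulated_integrable[OF u] p(1)])
  also have "\<dots> \<le> (NNI \<xi>. ennreal C * (NNI \<xi>'. ewt (- l) (\<xi>' - \<xi>) * (ewt \<rho> \<xi>' * pmass p u \<xi>')))"
  proof (intro nn_integral_mono)
   fix \<xi>
   have "ewt (\<tau> * p) \<xi> * pmass p (modulated \<mu> u) \<xi> \<le> ewt (\<tau> * p) \<xi> * (ennreal (C * wt (growth p * p) \<xi>) * (NNI \<xi>'. ewt (- (\<bar>\<rho>\<bar> + l)) (\<xi>' - \<xi>) * pmass p u \<xi>'))"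
    using C(2)[OF d] by (intro mult_left_mono) auto
   also have "\<dots> = ennreal (C * (wt (\<tau> * p) \<xi> * wt (growth p * p) \<xi>)) * (NNI \<xi>'. ewt (- (\<bar>\<rho>\<bar> + l)) (\<xi>' - \<xi>) * pmass p u \<xi>')"
    using C(1) by (simp add: ennreal_mult_assoc mult_ac)
   also have "wt (\<tau> * p) \<xi> * wt (growth p * p) \<xi> = wt \<rho> \<xi>" unfolding wt_mult \<rho>_def by (simp add: algebra_simps)
   also have "ennreal (C * wt \<rho> \<xi>) * (NNI \<xi>'. ewt (- (\<bar>\<rho>\<bar> + l)) (\<xi>' - \<xi>) * pmass p u \<xi>') =
    ennreal C * (NNI \<xi>'. ewt \<rho> \<xi> * (ewt (- (\<bar>\<rho>\<bar> + l)) (\<xi>' - \<xi>) * pmass p u \<xi>'))"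
    using C(1) by (subst nn_integral_cmult) (auto simp: ennreal_mult mult.assoc)
   also have "\<dots> \<le> ennreal C * (NNI \<xi>'. ewt (- l) (\<xi>' - \<xi>) * (ewt \<rho> \<xi>' * pmass p u \<xi>'))"
   proof (intro mult_left_mono nn_integral_mono)
    fix \<xi>'
    have "wt \<rho> \<xi> * wt (- (\<bar>\<rho>\<bar> + l)) (\<xi>' - \<xi>) \<le> (wt \<rho> \<xi>' * wt \<bar>\<rho>\<bar> (\<xi> - \<xi>')) * wt (- (\<bar>\<rho>\<bar> + l)) (\<xi>' - \<xi>)"
     by (intro mult_right_mono wt_peetre) simp
    also have "\<dots> = wt \<rho> \<xi>' * (wt \<bar>\<rho>\<bar> (\<xi>' - \<xi>) * wt (- (\<bar>\<rho>\<bar> + l)) (\<xi>' - \<xi>))" by (simp only: mult.assoc wt_commute[of _ \<xi>])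
    also have "\<dots> = wt (- l) (\<xi>' - \<xi>) * wt \<rho> \<xi>'" unfolding wt_mult by simp
    finally have "ewt \<rho> \<xi> * ewt (- (\<bar>\<rho>\<bar> + l)) (\<xi>' - \<xi>) \<le> ewt (- l) (\<xi>' - \<xi>) * ewt \<rho> \<xi>'"
     by (simp add: ennreal_mult[symmetric] ennreal_leI)
    then show "ewt \<rho> \<xi> * (ewt (- (\<bar>\<rho>\<bar> + l)) (\<xi>' - \<xi>) * pmass p u \<xi>') \<le> ewt (- l) (\<xi>' - \<xi>) * (ewt \<rho> \<xi>' * pmass p u \<xi>')"
     unfolding mult.assoc[symmetric] by (rule mult_right_mono) simp
   qed simp
   finally show "ewt (\<tau> * p) \<xi> * pmass p (modulated \<mu> u) \<xi> \<le> \<dots>" .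
  qed
  also have "\<dots> = ennreal C * (NNI \<xi>. (NNI \<xi>'. ewt (- l) (\<xi>' - \<xi>) * (ewt \<rho> \<xi>' * pmass p u \<xi>')))"
   by (rule nn_integral_cmult) measurable
  also have "(NNI \<xi>. (NNI \<xi>'. ewt (- l) (\<xi>' - \<xi>) * (ewt \<rho> \<xi>' * pmass p u \<xi>')))
    = (NNI \<xi>'. (NNI \<xi>. ewt (- l) (\<xi>' - \<xi>) * (ewt \<rho> \<xi>' * pmass p u \<xi>')))"
   by (rule lborel_pair.Fubini') measurable
  also have "\<dots> = (NNI \<xi>'. ennreal m * (ewt \<rho> \<xi>' * pmass p u \<xi>'))"
   by (intro nn_integral_cong) (subst nn_integral_multc, auto simp: wint_translate(2)[OF l] m_def)
  also have "\<dots> = ennreal m * (NNI \<xi>'. ewt \<rho> \<xi>' * pmass p u \<xi>')"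
   by (rule nn_integral_cmult) measurable
  also have "ennreal C * \<dots> = ennreal (C * m) * (NNI \<xi>'. ewt \<rho> \<xi>' * pmass p u \<xi>')"
   using C(1) m by (rule ennreal_mult_assoc)
  also have "(NNI \<xi>'. ewt \<rho> \<xi>' * pmass p u \<xi>') = (NNI x. enn_pow (fibre (ennreal p) (\<tau> + growth p) (amp u) x) p)"
   unfolding \<rho>_def by (rule fibre_mass[OF u p(1), symmetric])
  finally show "(NNI x. enn_pow (fibre (ennreal p) \<tau> (amp (modulated \<mu> u)) x) p)
   \<le> ennreal (C * m) * (NNI x. enn_pow (fibre (ennreal p) (\<tau> + growth p) (amp u) x) p)" .
 qed (use C m in simp)
qed

lemma amp_slow: "\<exists>C. \<forall>u. L1 u \<longrightarrow> slow C (amp u)"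
 unfolding amp_def[abs_def] by (rule slice_slow)

text \<open>The embedding lowers the inner exponent at no cost in weights. For \<open>q > p\<close>
  it is applied to the output and Hoelder's inequality to the input; for \<open>q < p\<close> the
  other way round, with the diagonal estimate shifted by the weight
  \<open>c = \<delta> - growth p\<close>. That difference is what \<delta> leaves for Hoelder's
  inequality.\<close>

lemma finite_exponent_bound:
 assumes p: "0 < p" "p < 1 ==> real CARD('n) * (1 / p - 1) < a" and q: "0 < q"
  and \<delta>: "growth p + real CARD('n) * \<bar>1 / p - recip q\<bar> \<le> \<delta>"
   "q \<noteq> ennreal p ==> growth p + real CARD('n) * \<bar>1 / p - recip q\<bar> < \<delta>"
 shows "\<exists>C\<ge>0. \<forall>u. (\<forall>K. dec K u) \<longrightarrow> (NNI x. enn_pow (fibre q 0 (amp (modulated \<mu> u)) x) p)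
  \<le> ennreal C * (NNI x. enn_pow (fibre q \<delta> (amp u) x) p)"
proof -
 have di: "L1 u" if "\<forall>K. dec K u" for u :: "real^'n => complex"
  using that by (intro goodD(2) dec_good[of "real CARD('n) + 1"]) auto
 obtain Cs where Cs: "\<And>u. L1 u ==> slow Cs (amp u)" using amp_slow by auto
 define c where "c = \<delta> - growth p"
 let ?I = "\<lambda>q \<tau> u. (NNI x. enn_pow (fibre q \<tau> (amp u) x) p)"
 let ?m = "\<lambda>u e. cis (\<mu> e) * u e"
 consider "q = ennreal p" | "ennreal p < q" | r where "q = ennreal r" "0 < r" "r < p"
 proof (cases rule: exponent_cases[OF q])
  case 1
  then show thesis using that(2) by simp
 next
  case (2 r)
  then show thesis using that p(1) by (cases r p rule: linorder_cases) (auto simp: ennreal_less_iff)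
 qed
 then show ?thesis
 proof cases
  case 1
  obtain C where C: "0 \<le> C" "\<And>u. \<forall>K. dec K u ==> ?I (ennreal p) 0 (?m u) \<le> ennreal C * ?I (ennreal p) (0 + growth p) u"
   using diagonal_bound[OF p, of 0] by blast
  have "growth p \<le> \<delta>" using \<delta>(1) 1 p(1) by (simp add: recip_def)
  then have "?I (ennreal p) (0 + growth p) u \<le> ?I (ennreal p) \<delta> u" if "\<forall>K. dec K u" for u
   unfolding fibre_mass[OF di[OF that] p(1)] using p by (intro nn_integral_mono mult_right_mono ennreal_leI wt_mono) auto
  then have "?I q 0 (?m u) \<le> ennreal C * ?I q \<delta> u" if "\<forall>K. dec K u" for u
   unfolding 1 using that by (intro order_trans[OF C(2)] mult_left_mono) auto
  then show ?thesis using C(1) by blast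
 next
  case 2
  have k: "real CARD('n) * (1 / p - recip q) < c"
  proof -
   have "real CARD('n) * (1 / p - recip q) \<le> real CARD('n) * \<bar>1 / p - recip q\<bar>" by (intro mult_left_mono) auto
   moreover have "q \<noteq> ennreal p" using 2 by simp
   ultimately show ?thesis using \<delta>(2) unfolding c_def by linarith
  qed
  obtain C1 where C1: "0 \<le> C1" "\<And>A :: real^'n => real^'n => real. slow Cs A ==>
   (NNI x. enn_pow (fibre q 0 A x) p) \<le> ennreal C1 * (NNI x. enn_pow (fibre (ennreal p) 0 A x) p)"
   using fibre_embedding[OF p(1) 2 order_refl, of Cs 0] by blast
  obtain C2 where C2: "0 \<le> C2" "\<And>u. \<forall>K. dec K u ==> ?I (ennreal p) 0 (?m u) \<le> ennreal C2 * ?I (ennreal p) (0 + growth p) u"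
   using diagonal_bound[OF p, of 0] by blast
  obtain C3 where C3: "0 \<le> C3" "\<And>h :: real^'n => real. h \<in> Bm ==> (\<forall>\<xi>. 0 \<le> h \<xi>) ==>
   Lpnorm (ennreal p) (\<lambda>\<xi>. ennreal (h \<xi>)) \<le> ennreal C3 * Lpnorm q (\<lambda>\<xi>. ennreal (h \<xi> * wt c \<xi>))"
   using Lpnorm_Holder[OF p(1) 2 k] by blast
  have "?I q 0 (?m u) \<le> ennreal (C1 * C2 * C3 powr p) * ?I q \<delta> u" if d: "\<forall>K. dec K u" for u
  proof -
   note u = di[OF d]
   have "fibre (ennreal p) (0 + growth p) (amp u) x \<le> ennreal C3 * fibre q \<delta> (amp u) x" for x
    using C3(2)[OF amp_slice_measurable[OF u], of x "growth p"] by (simp add: fibre_def mult.assoc wt_mult c_def)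
   then have "?I (ennreal p) (0 + growth p) u \<le> ennreal (C3 powr p) * ?I q \<delta> u"
    using C3(1) p(1) q by (intro nn_integral_enn_pow_le) (auto intro: fibre_measurable[OF u])
   then have "?I q 0 (?m u) \<le> ennreal C1 * (ennreal C2 * (ennreal (C3 powr p) * ?I q \<delta> u))"
    by (intro order_trans[OF C1(2)[OF Cs[OF modulated_integrable[OF u]]]] mult_left_mono order_trans[OF C2(2)[OF d]]) auto
   then show ?thesis using C1(1) C2(1) by (simp add: ennreal_mult mult.assoc)
  qed
  then show ?thesis using C1(1) C2(1) by (intro exI[of _ "C1 * C2 * C3 powr p"]) auto
 next
  case (3 r)
  have k: "real CARD('n) * (1 / r - recip (ennreal p)) < c"
  proof -
   have "real CARD('n) * (1 / r - 1 / p) \<le> real CARD('n) * \<bar>1 / p - 1 / r\<bar>" by (intro mult_left_mono) auto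
   moreover have "growth p + real CARD('n) * \<bar>1 / p - 1 / r\<bar> < \<delta>" using \<delta>(2) 3 p by (simp add: recip_def)
   ultimately have "real CARD('n) * (1 / r - 1 / p) < c" unfolding c_def by linarith
   then show ?thesis using p by (simp add: recip_def)
  qed
  have rp: "ennreal r < ennreal p" using 3 by (simp add: ennreal_less_iff)
  obtain C1 where C1: "0 \<le> C1" "\<And>h :: real^'n => real. h \<in> Bm ==> (\<forall>\<xi>. 0 \<le> h \<xi>) ==>
   Lpnorm (ennreal r) (\<lambda>\<xi>. ennreal (h \<xi>)) \<le> ennreal C1 * Lpnorm (ennreal p) (\<lambda>\<xi>. ennreal (h \<xi> * wt c \<xi>))"
   using Lpnorm_Holder[OF 3(2) rp k] by blast
  obtain C2 where C2: "0 \<le> C2" "\<And>u. \<forall>K. dec K u ==> ?I (ennreal p) c (?m u) \<le> ennreal C2 * ?I (ennreal p) (c + growth p) u"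
   using diagonal_bound[OF p, of c] by blast
  obtain C3 where C3: "0 \<le> C3" "\<And>A :: real^'n => real^'n => real. slow Cs A ==>
   (NNI x. enn_pow (fibre (ennreal p) \<delta> A x) p) \<le> ennreal C3 * (NNI x. enn_pow (fibre (ennreal r) \<delta> A x) p)"
   using fibre_embedding[OF 3(2) rp less_imp_le[OF 3(3)], of Cs \<delta>] by blast
  have "?I q 0 (?m u) \<le> ennreal (C1 powr p * C2 * C3) * ?I q \<delta> u" if d: "\<forall>K. dec K u" for u
  proof -
   note u = di[OF d] and mu = modulated_integrable[OF di[OF d]]
   have "fibre q 0 (amp (?m u)) x \<le> ennreal C1 * fibre (ennreal p) c (amp (?m u)) x" for x
    using C1(2)[OF amp_slice_measurable[OF mu], of x 0] by (simp add: fibre_def 3(1))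
   then have "?I q 0 (?m u) \<le> ennreal (C1 powr p) * ?I (ennreal p) c (?m u)"
    using C1(1) p(1) by (intro nn_integral_enn_pow_le) (auto intro: fibre_measurable[OF mu])
   also have "\<dots> \<le> ennreal (C1 powr p) * (ennreal C2 * (ennreal C3 * ?I q \<delta> u))"
    using C2(2)[OF d] C3(2)[OF Cs[OF u]]
    by (intro mult_left_mono order_trans[OF C2(2)[OF d]]) (auto simp: c_def 3(1))
   finally show ?thesis using C2(1) C3(1) by (simp add: ennreal_mult mult.assoc)
  qed
  then show ?thesis using C2(1) C3(1) by (intro exI[of _ "C1 powr p * C2 * C3"]) auto
 qed
qed

text \<open>For \<open>p = top\<close> slow variation turns the mixed norm of the input into a
  pointwise bound of its slices, to which \<open>slice_bounded\<close> applies. What \<delta>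
  exceeds \<open>s n / 2\<close> by, namely \<open>k\<close>, is spent on returning from the
  supremum to the exponent \<open>q\<close>.\<close>

lemma infinite_exponent_bound:
 assumes q: "0 < q" and \<delta>: "s * real CARD('n) / 2 + real CARD('n) * recip q \<le> \<delta>"
   "q \<noteq> top ==> s * real CARD('n) / 2 + real CARD('n) * recip q < \<delta>"
 shows "\<exists>C\<ge>0. \<forall>u. L1 u \<longrightarrow> esssup lborel (fibre q 0 (amp (modulated \<mu> u)))
  \<le> ennreal C * esssup lborel (fibre q \<delta> (amp u))"
proof -
 define k where "k = \<delta> - s * real CARD('n) / 2"
 \<comment> \<open>For \<open>q = top\<close> any finite exponent serves in the slow-variation
   estimate; 1 is taken.\<close>
 define r where "r = (if q = top then 1 else enn2real q)"
 have r: "0 < r" "q \<noteq> top ==> q = ennreal r" using q by (auto simp: r_def enn2real_positive_iff less_top)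
 define l where "l = real CARD('n) + 1"
 have l: "real DIM(real^'n) < l" "0 \<le> l" by (auto simp: l_def)
 define m where "m = wint TYPE(real^'n) l"
 have m: "0 \<le> m" by (simp add: m_def)
 obtain Cs where Cs: "\<And>u. L1 u ==> slow Cs (amp u)" using amp_slow by auto
 obtain D where D: "0 \<le> D" "\<And>A :: real^'n => real^'n => real. slow Cs A ==> (\<forall>x \<xi>. ennreal ((A x \<xi> * wt \<delta> \<xi>) powr r) \<le>
  ennreal D * (NNI y. ewt (- l) (x - y) * (NNI z. ewt (- l) (\<xi> - z) * ennreal ((A y z * wt \<delta> z) powr r))))"
  using slow_power_wt[OF r(1) l(2), of Cs \<delta>] by blast
 define c where "c = (D * (m * max 1 m)) powr (1 / r)"
 have c: "0 \<le> c" by (simp add: c_def)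
 obtain C1 where C1: "0 \<le> C1" "\<And>u D. L1 u ==> 0 \<le> D ==> (\<forall>x \<xi>. norm (slice u \<xi> x) \<le> D * wt (- \<delta>) \<xi>) ==>
  (\<forall>x \<xi>. norm (slice (modulated \<mu> u) \<xi> x) \<le> C1 * D * wt (s * real CARD('n) / 2 - \<delta>) \<xi>)"
  using slice_bounded[of \<delta>] by blast
 have "\<exists>C\<ge>0. \<forall>h :: real^'n => real. h \<in> Bm \<longrightarrow> (\<forall>\<xi>. 0 \<le> h \<xi>) \<longrightarrow>
   Lpnorm q (\<lambda>\<xi>. ennreal (h \<xi>)) \<le> ennreal C * Lpnorm top (\<lambda>\<xi>. ennreal (h \<xi> * wt k \<xi>))"
 proof (cases "q = top")
  case True
  have "0 \<le> k" using \<delta>(1) True by (simp add: k_def recip_def)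
  then have "ennreal (h \<xi>) \<le> ennreal 1 * ennreal (h \<xi> * wt k \<xi>)" if "\<forall>\<xi>. 0 \<le> h \<xi>" for h :: "real^'n => real" and \<xi>
   using mult_left_mono[OF wt_ge_1[of k \<xi>], of "h \<xi>"] that by (simp add: ennreal_leI)
  then show ?thesis unfolding True by (intro exI[of _ 1] conjI allI impI Lpnorm_le_cmult) auto
 next
  case False
  have "real CARD('n) * (1 / r - recip top) < k" using \<delta>(2)[OF False] r False by (simp add: k_def recip_def)
  from Lpnorm_Holder[OF r(1) _ this] show ?thesis using r(2)[OF False] by simp
 qed
 then obtain C2 where C2: "0 \<le> C2" "\<And>h :: real^'n => real. h \<in> Bm ==> (\<forall>\<xi>. 0 \<le> h \<xi>) ==>
   Lpnorm q (\<lambda>\<xi>. ennreal (h \<xi>)) \<le> ennreal C2 * Lpnorm top (\<lambda>\<xi>. ennreal (h \<xi> * wt k \<xi>))" by blast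
 define C where "C = C2 * (C1 * c) + 1"
 have C: "0 < C" using C1(1) C2(1) c by (simp add: C_def add_nonneg_pos)
 show ?thesis
 proof (intro exI[of _ C] conjI allI impI)
  fix u :: "real^'n => complex" assume u: "L1 u"
  note mu = modulated_integrable[OF u]
  have [measurable]: "case_prod (amp u) \<in> Bm2" using u by (intro amp_measurable) auto
  define N where "N = esssup lborel (fibre q \<delta> (amp u))"
  have ae: "AE y in lborel. fibre q \<delta> (amp u) y \<le> N" unfolding N_def by (rule esssup_AE)
  show "esssup lborel (fibre q 0 (amp (modulated \<mu> u))) \<le> ennreal C * N"
  proof (cases N)
   case top
   then show ?thesis using C by (simp add: ennreal_mult_top)
  next
   case (real v)
   \<comment> \<open>For finite \<open>q\<close> the weight is bounded by 1, for
     \<open>q = top\<close> it is integrated and gives \<open>m\<close>; the constant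
     \<open>max 1 m\<close> covers both.\<close>
   have Tb: "(NNI z. ewt (- l) (\<xi> - z) * ennreal ((amp u y z * wt \<delta> z) powr r)) \<le> ennreal (max 1 m * v powr r)"
    if y: "fibre q \<delta> (amp u) y \<le> ennreal v" for y \<xi>
   proof (cases "q = top")
    case True
    have "AE z in lborel. ennreal (amp u y z * wt \<delta> z) \<le> ennreal v"
     using esssup_AE[of "\<lambda>z. ennreal (amp u y z * wt \<delta> z)" lborel] y unfolding fibre_def True Lpnorm_top by auto
    then have "(NNI z. ewt (- l) (\<xi> - z) * ennreal ((amp u y z * wt \<delta> z) powr r)) \<le> (NNI z. ewt (- l) (\<xi> - z) * ennreal v)"
    proof (intro nn_integral_mono_AE, elim eventually_mono)
     fix z assume "ennreal (amp u y z * wt \<delta> z) \<le> ennreal v"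
     then show "ewt (- l) (\<xi> - z) * ennreal ((amp u y z * wt \<delta> z) powr r) \<le> ewt (- l) (\<xi> - z) * ennreal v"
      by (intro mult_left_mono) (simp_all add: r_def True)
    qed
    also have "\<dots> = ennreal (m * v)"
     using real m by (simp add: nn_integral_multc wint_translate(2)[OF l(1)] m_def ennreal_mult)
    also have "\<dots> \<le> ennreal (max 1 m * v powr r)"
     using real by (intro ennreal_leI) (auto simp: r_def True intro!: mult_right_mono)
    finally show ?thesis .
   next
    case False
    have "(NNI z. ewt (- l) (\<xi> - z) * ennreal ((amp u y z * wt \<delta> z) powr r)) \<le> (NNI z. 1 * ennreal ((amp u y z * wt \<delta> z) powr r))"
     using l by (intro nn_integral_mono mult_right_mono) (auto intro: wt_le_1)
    also have "\<dots> = enn_pow (fibre q \<delta> (amp u) y) r" unfolding fibre_def r(2)[OF False] Lpnorm_power[OF r(1)] by simp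
    also have "\<dots> \<le> enn_pow (ennreal v) r" using r y by (intro enn_pow_mono) auto
    also have "\<dots> \<le> ennreal (max 1 m * v powr r)"
     using real mult_right_mono[of 1 "max 1 m" "v powr r"] by (simp add: ennreal_leI)
    finally show ?thesis .
   qed
   \<comment> \<open>The fibre bound holds only for almost every \<open>y\<close>, yet averaging
     over \<open>y\<close> yields a bound at every point, with the full weight of order
     \<open>- \<delta>\<close>.\<close>
   have A: "norm (slice u \<xi> x) \<le> (c * v) * wt (- \<delta>) \<xi>" for x \<xi>
   proof -
    have "ennreal ((amp u x \<xi> * wt \<delta> \<xi>) powr r) \<le> ennreal D * (NNI y. ewt (- l) (x - y) * (NNI z. ewt (- l) (\<xi> - z) * ennreal ((amp u y z * wt \<delta> z) powr r)))"
     using D(2)[OF Cs[OF u]] by blast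
    also have "\<dots> \<le> ennreal D * (NNI y. ewt (- l) (x - y) * ennreal (max 1 m * v powr r))"
    proof (intro mult_left_mono nn_integral_mono_AE)
     show "AE y in lborel. ewt (- l) (x - y) * (NNI z. ewt (- l) (\<xi> - z) * ennreal ((amp u y z * wt \<delta> z) powr r)) \<le> ewt (- l) (x - y) * ennreal (max 1 m * v powr r)"
      using ae unfolding real by eventually_elim (intro mult_left_mono Tb, auto)
    qed simp
    also have "\<dots> = ennreal D * (ennreal m * ennreal (max 1 m * v powr r))"
     by (subst nn_integral_multc) (auto simp: wint_translate(2)[OF l(1)] m_def)
    also have "\<dots> = ennreal ((D * (m * max 1 m)) * v powr r)"
     using D(1) m by (simp add: ennreal_mult3 mult.assoc)
    finally have "(amp u x \<xi> * wt \<delta> \<xi>) powr r \<le> (D * (m * max 1 m)) * v powr r"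
     using D(1) m by (simp add: ennreal_le_iff)
    then have "((amp u x \<xi> * wt \<delta> \<xi>) powr r) powr (1 / r) \<le> ((D * (m * max 1 m)) * v powr r) powr (1 / r)"
     using r by (intro powr_mono2) auto
    also have "\<dots> = c * v" using D(1) m real r by (simp add: c_def powr_mult powr_powr)
    finally have "amp u x \<xi> * wt \<delta> \<xi> \<le> c * v" using r by (simp add: powr_powr)
    then show ?thesis by (simp add: wt_uminus_exp amp_def field_simps)
   qed
   have H: "amp (modulated \<mu> u) x \<xi> * wt k \<xi> \<le> C1 * (c * v)" for x \<xi>
   proof -
    have "norm (slice (modulated \<mu> u) \<xi> x) * wt k \<xi> \<le> (C1 * (c * v) * wt (s * real CARD('n) / 2 - \<delta>) \<xi>) * wt k \<xi>"
     using C1(2)[OF u, of "c * v"] A c real by (intro mult_right_mono) auto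
    also have "\<dots> = C1 * (c * v) * (wt (s * real CARD('n) / 2 - \<delta>) \<xi> * wt k \<xi>)" by (simp only: mult.assoc)
    also have "\<dots> = C1 * (c * v)" unfolding wt_mult by (simp add: k_def)
    finally show ?thesis by (simp add: amp_def)
   qed
   have "fibre q 0 (amp (modulated \<mu> u)) x \<le> ennreal C * N" for x
   proof -
    have am: "(\<lambda>\<xi>. amp (modulated \<mu> u) x \<xi> * wt \<tau> \<xi>) \<in> Bm" for \<tau> by (rule amp_slice_measurable[OF mu])
    have "fibre q 0 (amp (modulated \<mu> u)) x \<le> ennreal C2 * Lpnorm top (\<lambda>\<xi>. ennreal (amp (modulated \<mu> u) x \<xi> * wt k \<xi>))"
     using C2(2)[OF am[of 0]] by (simp add: fibre_def)
    also have "\<dots> \<le> ennreal C2 * ennreal (C1 * (c * v))"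
     unfolding Lpnorm_top by (intro mult_left_mono esssup_I AE_I2 ennreal_leI H) (use am in auto)
    also have "\<dots> = ennreal (C2 * (C1 * c)) * ennreal v" using C1(1) C2(1) c real by (simp add: ennreal_mult[symmetric] mult_ac)
    also have "\<dots> \<le> ennreal C * N" unfolding real by (intro mult_right_mono ennreal_leI) (auto simp: C_def)
    finally show ?thesis .
   qed
   then show ?thesis using fibre_measurable[OF mu q] by (intro esssup_I) auto
  qed
 qed (use C in simp)
qed

end

section \<open>From the amalgam hypothesis to the theorem\<close>

lemma phase_of_inW:
 assumes phi: "schwartz \<phi>" "\<phi> \<noteq> (\<lambda>_. 0)" and mu: "C2 \<mu>" and s: "0 < s" and a: "0 \<le> a"
  and hyp: "\<forall>i j. inW \<phi> \<infinity> 1 a (\<lambda>\<xi>. cor (jb \<xi> powr (- s) * pd i (pd j \<mu>) \<xi>))"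
 shows "phase \<mu> s a"
proof (unfold_locales)
 fix \<psi> :: "real^'a => complex" and R
 assume psi: "dec (4 * (real CARD('a) + 3 + a)) \<psi>" and supp: "\<And>y. R \<le> norm y ==> \<psi> y = 0"
 define g where "g i j \<xi> = cor (jb \<xi> powr (- s) * pd i (pd j \<mu>) \<xi>)" for i j \<xi>
 have "\<exists>C\<ge>0. \<forall>v. NW 0 1 a (\<lambda>y. g i j (y + v) * \<psi> y) \<le> ennreal C" for i j
 proof -
  have h: "\<forall>x. L1 (\<lambda>y. g i j y * cnj (\<phi> (y - x)))" "Wnorm \<phi> top 1 a (g i j) < top"
   using hyp by (auto simp: inW_def g_def[abs_def])
  have W: "Wnorm \<phi> top 1 a (g i j) = esssup lborel (\<lambda>x. NNI \<xi>. ennreal (norm (stft \<phi> (g i j) x \<xi>) * jb \<xi> powr a))"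
   using Lpnorm_real[of 1, where 'a='a] by (simp add: Wnorm_def Lpnorm_top)
  obtain D where D: "Wnorm \<phi> top 1 a (g i j) = ennreal D" using h(2) by (cases "Wnorm \<phi> top 1 a (g i j)") auto
  have "continuous_on UNIV (pd i (pd j \<mu>))" using mu by (auto simp: C2_def)
  then have gc: "continuous_on UNIV (g i j)" unfolding g_def[abs_def] by (intro continuous_intros) auto
  show ?thesis
  proof (rule NW_window_change[OF schwartz_dec[OF phi(1)] phi(2) psi _ a supp gc])
   show "AE w in lborel. (NNI \<xi>. ennreal (norm (stft \<phi> (g i j) w \<xi>) * jb \<xi> powr a)) \<le> ennreal D"
    unfolding D[symmetric] W by (rule esssup_AE)
   show "2 * (real CARD('a) + 1 + a) + real CARD('a) < 4 * (real CARD('a) + 3 + a)" using a by simp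
  qed (use h(1) in auto)
 qed
 then obtain c where c: "\<And>i j. 0 \<le> c i j" "\<And>i j v. NW 0 1 a (\<lambda>y. g i j (y + v) * \<psi> y) \<le> ennreal (c i j)"
  by metis
 show "\<exists>C\<ge>0. \<forall>i j v. NW 0 1 a (\<lambda>y. cor (jb (y + v) powr (- s) * pd i (pd j \<mu>) (y + v)) * \<psi> y) \<le> ennreal C"
 \<comment> \<open>The sum of the finitely many nonnegative constants makes the bound uniform in
   \<open>i\<close> and \<open>j\<close>.\<close>
 proof (intro exI[of _ "\<Sum>i\<in>UNIV. \<Sum>j\<in>UNIV. c i j"] conjI allI)
  fix i j v
  have "c i j \<le> (\<Sum>j\<in>UNIV. c i j)" using c(1) by (intro member_le_sum) auto
  also have "\<dots> \<le> (\<Sum>i\<in>UNIV. \<Sum>j\<in>UNIV. c i j)"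
   using c(1) by (intro member_le_sum[of i UNIV "\<lambda>i. \<Sum>j\<in>UNIV. c i j"]) (auto intro: sum_nonneg)
  finally show "NW 0 1 a (\<lambda>y. cor (jb (y + v) powr (- s) * pd i (pd j \<mu>) (y + v)) * \<psi> y) \<le> ennreal (\<Sum>i\<in>UNIV. \<Sum>j\<in>UNIV. c i j)"
   using c(2)[of i j v] unfolding g_def by (auto intro: order_trans ennreal_leI)
 qed (use c(1) in \<open>auto intro!: sum_nonneg\<close>)
qed (use mu s a in auto)

lemma schwartz_fourier_dec: "schwartz f ==> dec K (fourier f)"
 for f :: "real^'n::finite => complex"
 using dec_mono[OF dec_fourier[OF schwartz_dec, of f "max K (real CARD('n) + 1)"], of K] by auto

lemma ifourier_fourier_schwartz: "schwartz f ==> ifourier (fourier f) = f"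
 for f :: "real^'n::finite => complex"
 using ifourier_fourier[OF schwartz_dec, of f "real CARD('n) + 1"] by auto

theorem theorem5p3:
  fixes \<phi> :: "real^'n::finite \<Rightarrow> complex"
    and \<mu> :: "real^'n \<Rightarrow> real"
    and p q :: ennreal and s \<epsilon> \<delta> :: real
  assumes window: "schwartz \<phi>" "\<phi> \<noteq> (\<lambda>_. 0)"
    and pq: "0 < p" "0 < q"
    and mu: "C2 \<mu>"
    and s_eps: "s > 0" "\<epsilon> > 0"
    and hyp_p_ge1: "p \<ge> 1 \<Longrightarrow> \<forall>i j. inW \<phi> \<infinity> 1 0
                      (\<lambda>\<xi>. complex_of_real (jb \<xi> powr (- s) * pd i (pd j \<mu>) \<xi>))"
    and hyp_p_lt1: "p < 1 \<Longrightarrow> \<forall>i j. inW \<phi> \<infinity> 1 (real CARD('n) * (recip p - 1) + \<epsilon>)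
                      (\<lambda>\<xi>. complex_of_real (jb \<xi> powr (- s) * pd i (pd j \<mu>) \<xi>))"
    and delta: "\<delta> \<ge> s * real CARD('n) * \<bar>recip p - 1/2\<bar> + real CARD('n) * \<bar>recip p - recip q\<bar>"
    and delta_strict: "p \<noteq> q \<Longrightarrow>
                 \<delta> > s * real CARD('n) * \<bar>recip p - 1/2\<bar> + real CARD('n) * \<bar>recip p - recip q\<bar>"
  shows "\<exists>C::real. \<forall>f. schwartz f \<longrightarrow>
           Wnorm \<phi> p q 0 (fmult \<mu> f) \<le> ennreal C * Wnorm \<phi> p q \<delta> f"
proof -
 \<comment> \<open>For \<open>p < 1\<close> the summand \<epsilon> makes \<open>a\<close> strictly
   larger than \<open>n * (1 / p - 1)\<close>, as the integrability of \<open>wt (- lam)\<close> in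
   the slice estimate demands; for \<open>p \<ge> 1\<close> the kernels carry no spatial
   weight.\<close>
 define a where "a = (if p < 1 then real CARD('n) * (recip p - 1) + \<epsilon> else 0)"
 have a1: "1 \<le> recip p" if "p < 1"
 proof -
  have "p \<noteq> top" "enn2real p < 1" using that by (cases p; auto simp: ennreal_less_one_iff)+
  then show ?thesis using pq(1) by (simp add: recip_def enn2real_positive_iff less_top field_simps)
 qed
 have a: "0 \<le> a" using a1 s_eps by (auto simp: a_def intro!: add_nonneg_nonneg mult_nonneg_nonneg)
 interpret phase \<mu> s a
 proof (rule phase_of_inW[OF window mu s_eps(1) a])
  show "\<forall>i j. inW \<phi> \<infinity> 1 a (\<lambda>\<xi>. cor (jb \<xi> powr (- s) * pd i (pd j \<mu>) \<xi>))"
   using hyp_p_ge1 hyp_p_lt1 by (cases "p < 1") (simp_all add: a_def)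
 qed
 interpret window "fourier \<phi>"
 proof
  have "ifourier (\<lambda>_. 0) = (\<lambda>_ :: real^'n. 0)" by (rule ext) (simp add: ifourier_def)
  then show "fourier \<phi> \<noteq> (\<lambda>_. 0)"
   using ifourier_fourier_schwartz[OF window(1)] window(2) by auto
 qed (rule schwartz_fourier_dec[OF window(1)])
 interpret multiplier \<mu> s a "fourier \<phi>" ..
 have "\<exists>C\<ge>0. \<forall>u. (\<forall>K. dec K u) \<longrightarrow> Lpnorm p (fibre q 0 (amp (modulated \<mu> u))) \<le> ennreal C * Lpnorm p (fibre q \<delta> (amp u))"
  using pq(1)
 proof (cases rule: exponent_cases)
  case 1
  have di: "L1 u" if "\<forall>K. dec K u" for u :: "real^'n => complex"
   using that by (intro goodD(2) dec_good[of "real CARD('n) + 1"]) auto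
  \<comment> \<open>With \<open>recip p = 0\<close> the two absolute values in the bound for
    \<delta> are \<open>1 / 2\<close> and \<open>recip q\<close>.\<close>
  have "0 \<le> recip q" by (simp add: recip_def)
  then have "\<exists>C\<ge>0. \<forall>u. L1 u \<longrightarrow> esssup lborel (fibre q 0 (amp (modulated \<mu> u))) \<le> ennreal C * esssup lborel (fibre q \<delta> (amp u))"
   using delta delta_strict 1 by (intro infinite_exponent_bound pq(2)) (auto simp: recip_def)
  then show ?thesis using di unfolding 1 Lpnorm_top by meson
 next
  case (2 r)
  have rp: "recip p = 1 / r" using 2 by (simp add: recip_def)
  have "\<exists>C\<ge>0. \<forall>u. (\<forall>K. dec K u) \<longrightarrow> (NNI x. enn_pow (fibre q 0 (amp (modulated \<mu> u)) x) r)
   \<le> ennreal C * (NNI x. enn_pow (fibre q \<delta> (amp u) x) r)"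
  proof (rule finite_exponent_bound[OF 2(2) _ pq(2)])
   show "real CARD('n) * (1 / r - 1) < a" if "r < 1"
    using that 2 rp s_eps by (simp add: a_def ennreal_less_one_iff)
  qed (use delta delta_strict rp 2 in \<open>auto simp: growth_def\<close>)
  then obtain C where C: "0 \<le> C" "\<And>u. \<forall>K. dec K u ==> (NNI x. enn_pow (fibre q 0 (amp (modulated \<mu> u)) x) r)
   \<le> ennreal C * (NNI x. enn_pow (fibre q \<delta> (amp u) x) r)" by blast
  have "Lpnorm p (fibre q 0 (amp (modulated \<mu> u))) \<le> ennreal (C powr (1 / r)) * Lpnorm p (fibre q \<delta> (amp u))"
   if "\<forall>K. dec K u" for u
   using enn_pow_mono[OF _ C(2)[OF that], of "1 / r"] 2 C(1) by (simp add: Lpnorm_real enn_pow_mult)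
  then show ?thesis by (intro exI[of _ "C powr (1 / r)"]) auto
 qed
 then obtain C where C: "0 \<le> C" "\<And>u. \<forall>K. dec K u ==> Lpnorm p (fibre q 0 (amp (modulated \<mu> u))) \<le> ennreal C * Lpnorm p (fibre q \<delta> (amp u))"
  by blast
 \<comment> \<open>Converts the weight \<open>wt \<delta>\<close> of the slice estimates into
   \<open>jb powr \<delta>\<close>; on the output side the order is 0 and both weights are
   1.\<close>
 define c where "c = 2 powr \<bar>\<delta>\<bar>"
 have c: "0 \<le> c" by (simp add: c_def)
 have stft_amp: "norm (stft \<phi> (ifourier u) x \<xi>) = amp u x \<xi>" if "L1 u" for u x \<xi>
  using stft_ifourier[OF schwartz_dec[OF window(1)] that] by (simp add: norm_mult amp_def slice_def)
 show ?thesis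
 proof (intro exI[of _ "C * c"] allI impI)
  fix f :: "real^'n => complex" assume f: "schwartz f"
  define u where "u = fourier f"
  have d: "\<forall>K. dec K u" using schwartz_fourier_dec[OF f] by (simp add: u_def)
  have u: "L1 u" using d by (intro goodD(2) dec_good[of "real CARD('n) + 1"]) auto
  have fu: "f = ifourier u" unfolding u_def ifourier_fourier_schwartz[OF f] ..
  have "Wnorm \<phi> p q 0 (fmult \<mu> f) = Lpnorm p (fibre q 0 (amp (modulated \<mu> u)))"
   by (simp add: Wnorm_def fmult_def u_def[symmetric] stft_amp[OF modulated_integrable[OF u]] fibre_def[abs_def])
  also have "\<dots> \<le> ennreal C * Lpnorm p (fibre q \<delta> (amp u))" by (rule C(2)[OF d])
  also have "\<dots> \<le> ennreal C * (ennreal c * Wnorm \<phi> p q \<delta> f)"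
   unfolding Wnorm_def fu stft_amp[OF u]
  proof (intro mult_left_mono Lpnorm_le_cmult c pq fibre_measurable[OF u])
   show "(\<lambda>x. Lpnorm q (\<lambda>\<xi>. ennreal (amp u x \<xi> * jb \<xi> powr \<delta>))) \<in> Bm"
    by (rule amp_weighted_measurable[OF u _ pq(2)]) (intro continuous_intros, auto)
   show "fibre q \<delta> (amp u) x \<le> ennreal c * Lpnorm q (\<lambda>\<xi>. ennreal (amp u x \<xi> * jb \<xi> powr \<delta>))" for x
    unfolding fibre_def
   proof (rule Lpnorm_le_cmult[OF _ _ _ c pq(2)])
    have [measurable]: "amp u x \<in> Bm" using amp_slice_measurable[OF u, of x 0] by simp
    show "(\<lambda>\<xi>. ennreal (amp u x \<xi> * wt \<delta> \<xi>)) \<in> Bm" "(\<lambda>\<xi>. ennreal (amp u x \<xi> * jb \<xi> powr \<delta>)) \<in> Bm"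
     by measurable
    fix \<xi>
    have "amp u x \<xi> * wt \<delta> \<xi> \<le> amp u x \<xi> * (c * jb \<xi> powr \<delta>)" unfolding c_def by (intro mult_left_mono wt_le_jb_powr) simp
    then show "ennreal (amp u x \<xi> * wt \<delta> \<xi>) \<le> ennreal c * ennreal (amp u x \<xi> * jb \<xi> powr \<delta>)"
     using c by (simp add: ennreal_mult[symmetric] ennreal_leI mult_ac)
   qed
  qed simp
  also have "\<dots> = ennreal (C * c) * Wnorm \<phi> p q \<delta> f" using C(1) c by (rule ennreal_mult_assoc)
  finally show "Wnorm \<phi> p q 0 (fmult \<mu> f) \<le> ennreal (C * c) * Wnorm \<phi> p q \<delta> f" .
 qed
qed

end
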